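(* Let $X$ be a separable metrizable locally compact space, $\mu$ a Radon measure on $X$ with full support, and $p$ a strictly positive pointwise consistent $\mu$-heat kernel which is regular. Then for every continuous $w:X\to\mathbb{R}$ with $w^-\in\mathscr{M}_p(X,\mu)$ and every $t>0$, $$\mathrm{tr}\big(\mathrm{e}^{-tH_p(w)}\big)=\int_X p(t,x,x)\int_{\Omega(X,t)}\mathrm{e}^{-\int_0^t w(\gamma(s))\,{\rm d}s}\,{\rm d}\mathbb{P}^{x,x}_t(\gamma)\,{\rm d}\mu(x)\in[0,\infty].$$
   Context: A strictly positive pointwise consistent $\mu$-heat kernel is a jointly Borel measurable $p:(0,\infty)\times X\times X\to(0,\infty)$ such that for all $t,s>0$, $x,y\in X$: $p(t+s,x,y)=\int p(t,x,z)p(s,z,y)\,{\rm d}\mu(z)$, $p(t,x,y)=p(t,y,x)$, $\int p(t,x,z)\,{\rm d}\mu(z)\le 1$, and, with $P_tf(x):=\int p(t,x,y)f(y)\,{\rm d}\mu(y)$, $\|P_tf-f\|_{L^2(X,\mu)}\to0$ as $t\to0+$ for all $f\in L^2(X,\mu)$. $H_p\ge0$ is the self-adjoint generator of the semigroup $(P_t)$ on $L^2(X,\mu)$ and $Q_p$ its closed form. $p$ is regular if $C_c(X)\cap\mathrm{Dom}(Q_p)$ is dense in $C_c(X)$ for the uniform norm and dense in $\mathrm{Dom}(Q_p)$ for the norm $(Q_p(f,f)+\int|f|^2{\rm d}\mu)^{1/2}$. For $t>0$, $\Omega(X,t)$ is the space of càdlàg paths $[0,t]\to X$, $\mathscr{F}_s(X,t)$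 is generated by coordinate maps at times $\le s$, and $\mathscr{F}^-_t(X,t)$ is the $\sigma$-algebra generated by $\bigcup_{u<t}\mathscr{F}_u(X,t)$. The Wiener measure $\mathbb{P}^{x_0}_t$ is the unique sub-probability measure on $\mathscr{F}_t(X,t)$ whose finite-dimensional distributions are $\mathbb{P}^{x_0}_t\{\gamma(t_1)\in A_1,\dots,\gamma(t_n)\in A_n\}=\int_{A_1}\cdots\int_{A_n}\prod_{j=1}^n p(t_j-t_{j-1},x_{j-1},x_j)\,{\rm d}\mu(x_1)\cdots{\rm d}\mu(x_n)$ ($0=t_0<\dots<t_n=t$); the pinned Wiener measure $\mathbb{P}^{x_0,y_0}_t$ is the unique probability measure on $\mathscr{F}^-_t(X,t)$ with $\mathbb{P}^{x_0,y_0}_t(A)=p(t,x_0,y_0)^{-1}\int_A p(t-s,\gamma(s),y_0)\,{\rm d}\mathbb{P}^{x_0}_t(\gamma)$ for all $0\le s<t$ and $A\in\mathscr{F}_s(X,t)$. $w\in\mathscr{M}_p(X,\mu)$ means: for every $\epsilon>0$ there is $C_\epsilon$ with $\int|w||f|^2{\rm d}\mu\le\epsilon Q_p(f,f)+C_\epsilon\int|f|^2{\rm d}\mu<\infty$ for all $f\in\mathrm{Dom}(Q_p)$; $w^-=\max(-w,0)$. $H_p(w)$ is the semibounded self-adjoint operator associated with the closed form $Q_p(f_1,f_2)+\int w\overline{f_1}f_2\,{\rm d}\mu$ on $\{f\in\mathrm{Dom}(Q_p):\int|w||f|^2{\rm d}\mu<\infty\}$.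
   Formalization: The Wiener and pinned Wiener measures are assumed to exist for every x as defined; since the pinned measure must have mass 1, this forces the heat kernel to be stochastically complete (∫p(s,y,z)dμ(z)=1 a.e. for s<t), and otherwise the pinned measure as defined does not exist. *)

theory Defs
  imports "HOL-Analysis.Analysis"
begin

definition radon_full_support :: "'a::topological_space measure \<Rightarrow> bool" where
  "radon_full_support M \<longleftrightarrow>
     sets M = sets borel \<and>
     (\<forall>K. compact K \<longrightarrow> emeasure M K < \<infinity>) \<and>
     (\<forall>A\<in>sets borel. emeasure M A = (INF U\<in>{U. open U \<and> A \<subseteq> U}. emeasure M U)) \<and>
     (\<forall>U. open U \<longrightarrow> emeasure M U = (SUP K\<in>{K. compact K \<and> K \<subseteq> U}. emeasure M K)) \<and>
     (\<forall>U. open U \<and> U \<noteq> {} \<longrightarrow> emeasure M U > 0)"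

definition L2 :: "'a measure \<Rightarrow> ('a \<Rightarrow> complex) set" where
  "L2 M = {f. f \<in> borel_measurable M \<and> integrable M (\<lambda>x. (cmod (f x))\<^sup>2)}"

definition L2_inner :: "'a measure \<Rightarrow> ('a \<Rightarrow> complex) \<Rightarrow> ('a \<Rightarrow> complex) \<Rightarrow> complex" where
  "L2_inner M f g = (\<integral>x. cnj (f x) * g x \<partial>M)"

definition L2_sqnorm :: "'a measure \<Rightarrow> ('a \<Rightarrow> complex) \<Rightarrow> real" where
  "L2_sqnorm M f = (\<integral>x. (cmod (f x))\<^sup>2 \<partial>M)"

definition orthonormal_L2 :: "'a measure \<Rightarrow> ('a \<Rightarrow> complex) set \<Rightarrow> bool" where
  "orthonormal_L2 M F \<longleftrightarrow> F \<subseteq> L2 M \<and>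
     (\<forall>f\<in>F. \<forall>g\<in>F. L2_inner M f g = (if f = g then 1 else 0))"

definition pos_trace :: "'a measure \<Rightarrow> (('a \<Rightarrow> complex) \<Rightarrow> ('a \<Rightarrow> complex)) \<Rightarrow> ennreal" where
  "pos_trace M T = (SUP F\<in>{F. finite F \<and> orthonormal_L2 M F}.
        ennreal (\<Sum>f\<in>F. Re (L2_inner M f (T f))))"

definition heat_op :: "'a measure \<Rightarrow> (real \<Rightarrow> 'a \<Rightarrow> 'a \<Rightarrow> real) \<Rightarrow> real
    \<Rightarrow> ('a \<Rightarrow> complex) \<Rightarrow> ('a \<Rightarrow> complex)" where
  "heat_op M p t f = (\<lambda>x. \<integral>y. complex_of_real (p t x y) * f y \<partial>M)"

definition pos_heat_kernel :: "'a::topological_space measure \<Rightarrow> (real \<Rightarrow> 'a \<Rightarrow> 'a \<Rightarrow> real) \<Rightarrow> bool" where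
  "pos_heat_kernel M p \<longleftrightarrow>
     (\<lambda>z. p (fst z) (fst (snd z)) (snd (snd z)))
        \<in> borel_measurable (restrict_space (borel :: (real \<times> 'a \<times> 'a) measure) ({0<..} \<times> UNIV)) \<and>
     (\<forall>t>0. \<forall>x y. p t x y > 0) \<and>
     (\<forall>t>0. \<forall>s>0. \<forall>x y. ennreal (p (t + s) x y) = (\<integral>\<^sup>+ z. ennreal (p t x z * p s z y) \<partial>M)) \<and>
     (\<forall>t>0. \<forall>x y. p t x y = p t y x) \<and>
     (\<forall>t>0. \<forall>x. (\<integral>\<^sup>+ z. ennreal (p t x z) \<partial>M) \<le> 1) \<and>
     (\<forall>f\<in>L2 M. ((\<lambda>t. \<integral>\<^sup>+ x. ennreal ((cmod (heat_op M p t f x - f x))\<^sup>2) \<partial>M) \<longlongrightarrow> 0) (at_right 0))"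

text \<open>For a strongly continuous self-adjoint semigroup e^{-tH} with H self-adjoint and
  semibounded, the closed form of H is f \<mapsto> lim_{t\<rightarrow>0+} t^{-1} Re<f - e^{-tH} f, f>, the
  limit being monotone (a supremum); its domain is where this is finite.\<close>
definition semigroup_form :: "'a measure \<Rightarrow> (real \<Rightarrow> ('a \<Rightarrow> complex) \<Rightarrow> ('a \<Rightarrow> complex))
    \<Rightarrow> ('a \<Rightarrow> complex) \<Rightarrow> ereal" where
  "semigroup_form M T f = (SUP t\<in>{0<..}. ereal ((1 / t) * Re (L2_inner M (\<lambda>x. f x - T t f x) f)))"

definition Qp :: "'a measure \<Rightarrow> (real \<Rightarrow> 'a \<Rightarrow> 'a \<Rightarrow> real) \<Rightarrow> ('a \<Rightarrow> complex) \<Rightarrow> real" where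
  "Qp M p f = real_of_ereal (semigroup_form M (heat_op M p) f)"

definition DomQp :: "'a measure \<Rightarrow> (real \<Rightarrow> 'a \<Rightarrow> 'a \<Rightarrow> real) \<Rightarrow> ('a \<Rightarrow> complex) set" where
  "DomQp M p = {f \<in> L2 M. semigroup_form M (heat_op M p) f < \<infinity>}"

definition regular_kernel :: "'a::topological_space measure \<Rightarrow> (real \<Rightarrow> 'a \<Rightarrow> 'a \<Rightarrow> real) \<Rightarrow> bool" where
  "regular_kernel M p \<longleftrightarrow>
     (\<forall>g. continuous_on UNIV g \<and> compact (closure {x. g x \<noteq> 0}) \<longrightarrow>
        (\<forall>e>0. \<exists>f\<in>DomQp M p. continuous_on UNIV f \<and> compact (closure {x. f x \<noteq> 0}) \<and>
                (\<forall>x. cmod (f x - g x) < e))) \<and>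
     (\<forall>g\<in>DomQp M p. \<forall>e>0. \<exists>f\<in>DomQp M p. continuous_on UNIV f \<and> compact (closure {x. f x \<noteq> 0}) \<and>
                Qp M p (\<lambda>x. f x - g x) + L2_sqnorm M (\<lambda>x. f x - g x) < e)"

definition in_Mp :: "'a measure \<Rightarrow> (real \<Rightarrow> 'a \<Rightarrow> 'a \<Rightarrow> real) \<Rightarrow> ('a \<Rightarrow> real) \<Rightarrow> bool" where
  "in_Mp M p v \<longleftrightarrow> (\<forall>e>0. \<exists>C. \<forall>f\<in>DomQp M p.
      (\<integral>\<^sup>+ x. ennreal (\<bar>v x\<bar> * (cmod (f x))\<^sup>2) \<partial>M) < \<infinity> \<and>
      enn2real (\<integral>\<^sup>+ x. ennreal (\<bar>v x\<bar> * (cmod (f x))\<^sup>2) \<partial>M) \<le> e * Qp M p f + C * L2_sqnorm M f)"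

definition DomQw :: "'a measure \<Rightarrow> (real \<Rightarrow> 'a \<Rightarrow> 'a \<Rightarrow> real) \<Rightarrow> ('a \<Rightarrow> real) \<Rightarrow> ('a \<Rightarrow> complex) set" where
  "DomQw M p w = {f \<in> DomQp M p. (\<integral>\<^sup>+ x. ennreal (\<bar>w x\<bar> * (cmod (f x))\<^sup>2) \<partial>M) < \<infinity>}"

definition Qw :: "'a measure \<Rightarrow> (real \<Rightarrow> 'a \<Rightarrow> 'a \<Rightarrow> real) \<Rightarrow> ('a \<Rightarrow> real) \<Rightarrow> ('a \<Rightarrow> complex) \<Rightarrow> real" where
  "Qw M p w f = Qp M p f + (\<integral>x. w x * (cmod (f x))\<^sup>2 \<partial>M)"

text \<open>T is (a representative of) the semigroup (e^{-tH})_{t>0} where H is the semibounded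
  self-adjoint operator associated with the closed form q with domain D: T is a strongly
  continuous semigroup of bounded linear self-adjoint operators on L^2 whose closed form
  (computed as in semigroup_form) is q on D (and infinite off D).\<close>
definition form_semigroup :: "'a measure \<Rightarrow> ('a \<Rightarrow> complex) set \<Rightarrow> (('a \<Rightarrow> complex) \<Rightarrow> real)
    \<Rightarrow> (real \<Rightarrow> ('a \<Rightarrow> complex) \<Rightarrow> ('a \<Rightarrow> complex)) \<Rightarrow> bool" where
  "form_semigroup M D q T \<longleftrightarrow>
     (\<forall>t>0. \<forall>f\<in>L2 M. T t f \<in> L2 M) \<and>
     (\<forall>t>0. \<forall>f\<in>L2 M. \<forall>g\<in>L2 M. \<forall>a b.
         AE x in M. T t (\<lambda>y. a * f y + b * g y) x = a * T t f x + b * T t g x) \<and>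
     (\<forall>t>0. \<forall>f\<in>L2 M. \<forall>g\<in>L2 M. (AE x in M. f x = g x) \<longrightarrow> (AE x in M. T t f x = T t g x)) \<and>
     (\<forall>t>0. \<exists>C. \<forall>f\<in>L2 M. L2_sqnorm M (T t f) \<le> C * L2_sqnorm M f) \<and>
     (\<forall>t>0. \<forall>f\<in>L2 M. \<forall>g\<in>L2 M. L2_inner M f (T t g) = L2_inner M (T t f) g) \<and>
     (\<forall>t>0. \<forall>s>0. \<forall>f\<in>L2 M. AE x in M. T (t + s) f x = T t (T s f) x) \<and>
     (\<forall>f\<in>L2 M. ((\<lambda>t. L2_sqnorm M (\<lambda>x. T t f x - f x)) \<longlongrightarrow> 0) (at_right 0)) \<and>
     (\<forall>f\<in>L2 M. semigroup_form M T f = (if f \<in> D then ereal (q f) else \<infinity>))"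

definition cadlag_paths :: "real \<Rightarrow> (real \<Rightarrow> 'a::topological_space) set" where
  "cadlag_paths t = {\<gamma>. (\<forall>s. s \<notin> {0..t} \<longrightarrow> \<gamma> s = undefined) \<and>
      (\<forall>s\<in>{0..<t}. (\<gamma> \<longlongrightarrow> \<gamma> s) (at_right s)) \<and>
      (\<forall>s\<in>{0<..t}. \<exists>l. (\<gamma> \<longlongrightarrow> l) (at_left s))}"

definition path_filtration :: "real \<Rightarrow> real \<Rightarrow> (real \<Rightarrow> 'a::topological_space) measure" where
  "path_filtration t s = sigma (cadlag_paths t)
      {{\<gamma> \<in> cadlag_paths t. \<gamma> u \<in> A} | u A. 0 \<le> u \<and> u \<le> s \<and> A \<in> sets borel}"

definition path_filtration_minus :: "real \<Rightarrow> (real \<Rightarrow> 'a::topological_space) measure" where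
  "path_filtration_minus t = sigma (cadlag_paths t) (\<Union>u\<in>{0..<t}. sets (path_filtration t u))"

text \<open>Iterated integral giving the finite-dimensional distributions:
  fidi M p s x [(t1,A1),...,(tn,An)] =
  \<integral>_{A1}...\<integral>_{An} \<Prod>_j p(t_j - t_{j-1}, x_{j-1}, x_j) dmu(x_1)...dmu(x_n), with t_0 = s, x_0 = x.\<close>
fun fidi :: "'a measure \<Rightarrow> (real \<Rightarrow> 'a \<Rightarrow> 'a \<Rightarrow> real) \<Rightarrow> real \<Rightarrow> 'a \<Rightarrow> (real \<times> 'a set) list \<Rightarrow> ennreal" where
  "fidi M p s x [] = 1"
| "fidi M p s x ((u, A) # L) =
     (\<integral>\<^sup>+ y. indicator A y * ennreal (p (u - s) x y) * fidi M p u y L \<partial>M)"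

definition wiener_measure :: "'a::topological_space measure \<Rightarrow> (real \<Rightarrow> 'a \<Rightarrow> 'a \<Rightarrow> real)
    \<Rightarrow> real \<Rightarrow> 'a \<Rightarrow> (real \<Rightarrow> 'a) measure \<Rightarrow> bool" where
  "wiener_measure M p t x0 P \<longleftrightarrow>
     sets P = sets (path_filtration t t) \<and>
     emeasure P (space P) \<le> 1 \<and>
     (\<forall>ts As. length ts \<ge> 1 \<and> length As = length ts \<and> sorted_wrt (<) ts \<and>
        hd ts > 0 \<and> last ts = t \<and> (\<forall>A\<in>set As. A \<in> sets borel) \<longrightarrow>
        emeasure P {\<gamma> \<in> cadlag_paths t. \<forall>i<length ts. \<gamma> (ts ! i) \<in> As ! i}
          = fidi M p 0 x0 (zip ts As))"

definition pinned_wiener_measure :: "'a::topological_space measure \<Rightarrow> (real \<Rightarrow> 'a \<Rightarrow> 'a \<Rightarrow> real)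
    \<Rightarrow> real \<Rightarrow> 'a \<Rightarrow> 'a \<Rightarrow> (real \<Rightarrow> 'a) measure \<Rightarrow> (real \<Rightarrow> 'a) measure \<Rightarrow> bool" where
  "pinned_wiener_measure M p t x0 y0 W P \<longleftrightarrow>
     sets P = sets (path_filtration_minus t) \<and>
     emeasure P (space P) = 1 \<and>
     (\<forall>s\<in>{0..<t}. \<forall>A\<in>sets (path_filtration t s).
        emeasure P A = ennreal (1 / p t x0 y0) * (\<integral>\<^sup>+ \<gamma>\<in>A. ennreal (p (t - s) (\<gamma> s) y0) \<partial>W))"

end

theory Submission
  imports Defs
begin

text \<open>For a potential \<open>v\<close> bounded from both sides, the semigroup of the form sum has an integral kernel,
  the Dyson series around the heat kernel \<open>p\<close>; its diagonal is \<open>p t x x\<close> times the pinned expectation of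
  \<open>exp (- \<integral> v)\<close>, by comparing the series with the moments of the additive functional \<open>\<integral> v\<close>. The given \<open>w\<close> is
  truncated to \<open>min (max w (- m)) n\<close>: as \<open>n \<rightarrow> \<infinity>\<close> the kernels decrease, as \<open>m \<rightarrow> \<infinity>\<close> they increase, and
  the assumption on the negative part keeps the operator norms bounded. Monotone limits of forms and the
  fact that a symmetric semigroup is determined by its form identify the limit kernel \<open>k\<close> with the given
  semigroup, while pathwise convergence gives the diagonal of \<open>k\<close>. Finally
  \<open>tr T t = \<Sum> \<parallel>T (t/2) f\<parallel>\<^sup>2 = \<integral>\<integral> k (t/2) x y ^ 2 = \<integral> k t x x\<close>, where the Hilbert-Schmidt identity holds in
  \<open>[0, \<infinity>]\<close>: one inequality is Bessel's, the other one follows by testing with the normalised indicators of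
  a refining sequence of finite partitions generating the topology.\<close>

section \<open>Symmetric semigroups and their forms\<close>

text \<open>The semigroup \<open>T\<close> is known only through its form, and no spectral calculus
  enters. Everything rests on the quotients \<open>dq T e f f = (B f f - B (T e f) f) / e\<close>:
  since \<open>B (T s f) f\<close> is a squared norm at half time, it is midpoint convex in
  \<open>s\<close>, and the quotients increase along \<open>e = t/2^n\<close>. Two semigroups with
  the same form are compared by telescoping \<open>B (T (j e) f) (S ((2^n - j) e) g)\<close>; the
  obstacle is to make the \<open>2^n\<close> differences small uniformly in \<open>j\<close>, which
  needs control of the form along whole orbits.

  The order of the two truncations matters. With the lower cut-off \<open>m\<close> fixed, all
  kernels stay below \<open>exp (m t) P\<close>, which justifies the decreasing limit in
  \<open>n\<close>. That majorant is lost as \<open>m\<close> grows; from there on the lower bound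
  \<open>- C0\<close>, common to all truncated forms, gives growth constants free of
  \<open>m\<close> and \<open>n\<close>. Strong continuity of the limits does not follow from
  convergence of the kernels. It comes from a dense set of vectors with finite form, and the given
  \<open>T\<close> itself provides these vectors.\<close>

locale semi_inner =
  fixes V :: "'b set" and B :: "'b \<Rightarrow> 'b \<Rightarrow> real"
    and lc :: "real \<Rightarrow> 'b \<Rightarrow> real \<Rightarrow> 'b \<Rightarrow> 'b"
  assumes lc_in: "f \<in> V \<Longrightarrow> g \<in> V \<Longrightarrow> lc a f b g \<in> V"
    and B_lc: "f \<in> V \<Longrightarrow> g \<in> V \<Longrightarrow> h \<in> V \<Longrightarrow> B (lc a f b g) h = a * B f h + b * B g h"
    and B_sym: "f \<in> V \<Longrightarrow> g \<in> V \<Longrightarrow> B f g = B g f"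
    and B_nonneg: "f \<in> V \<Longrightarrow> 0 \<le> B f f"
begin

lemma B_lc_right: "f \<in> V \<Longrightarrow> g \<in> V \<Longrightarrow> h \<in> V \<Longrightarrow> B h (lc a f b g) = a * B h f + b * B h g"
  by (metis B_lc B_sym lc_in)

text \<open>Discriminant argument for an arbitrary positive form \<open>c\<close> in place of
  \<open>B\<close>: it is applied below to differences of difference quotients, which are not the
  inner product of the locale.\<close>

lemma form_Cauchy_Schwarz:
  assumes lin: "\<And>a b f g h. f \<in> V \<Longrightarrow> g \<in> V \<Longrightarrow> h \<in> V \<Longrightarrow> c (lc a f b g) h = a * c f h + b * c g h"
    and sym: "\<And>f g. f \<in> V \<Longrightarrow> g \<in> V \<Longrightarrow> c f g = c g f"
    and pos: "\<And>f. f \<in> V \<Longrightarrow> (0::real) \<le> c f f"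
    and f: "f \<in> V" and g: "g \<in> V"
  shows "(c f g)\<^sup>2 \<le> c f f * c g g"
proof -
  have ex: "c (lc a f b g) (lc a f b g) = a\<^sup>2 * c f f + 2 * a * b * c f g + b\<^sup>2 * c g g" for a b
  proof -
    have "c (lc a f b g) (lc a f b g) = a * c (lc a f b g) f + b * c (lc a f b g) g"
      using lin[OF f g lc_in[OF f g]] sym f g lc_in[OF f g] by metis
    then show ?thesis using lin f g sym[OF f g] by (simp add: power2_eq_square algebra_simps)
  qed
  show ?thesis
  proof (cases "c g g = 0")
    case True
    have "c f g = 0"
    proof (rule ccontr)
      assume nz: "c f g \<noteq> 0"
      \<comment> \<open>For \<open>c g g = 0\<close> the quadratic polynomial in \<open>x\<close>
        degenerates to an affine one; at this \<open>x\<close> it takes the value -1.\<close>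
      define x where "x = - (c f f + 1) / (2 * c f g)"
      have "0 \<le> c f f + 2 * x * c f g"
        using pos[OF lc_in[OF f g, of 1 x]] ex[of 1 x] True by simp
      moreover have "2 * x * c f g = - (c f f + 1)" using nz by (simp add: x_def field_simps)
      ultimately show False by simp
    qed
    then show ?thesis using True by simp
  next
    case False
    then have G: "c g g > 0" using pos[OF g] by simp
    have "0 \<le> c g g * (c f f * c g g - (c f g)\<^sup>2)"
      using pos[OF lc_in[OF f g, of "c g g" "- c f g"]] ex[of "c g g" "- c f g"]
      by (simp add: power2_eq_square algebra_simps)
    then show ?thesis using G by (simp add: zero_le_mult_iff)
  qed
qed

lemma Cauchy_Schwarz: "f \<in> V \<Longrightarrow> g \<in> V \<Longrightarrow> (B f g)\<^sup>2 \<le> B f f * B g g"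
  by (rule form_Cauchy_Schwarz) (auto simp: B_lc B_nonneg intro: B_sym)

text \<open>The squared seminorm of \<open>f - g\<close>, already expanded, so that it makes sense
  without a vector that represents the difference.\<close>

definition nd :: "'b \<Rightarrow> 'b \<Rightarrow> real" where "nd f g = B f f - 2 * B f g + B g g"

lemma nd_eq: "f \<in> V \<Longrightarrow> g \<in> V \<Longrightarrow> nd f g = B (lc 1 f (-1) g) (lc 1 f (-1) g)"
  unfolding nd_def using B_sym[of f g] by (simp add: B_lc B_lc_right lc_in)

lemma nd_nonneg: "f \<in> V \<Longrightarrow> g \<in> V \<Longrightarrow> 0 \<le> nd f g"
  by (simp add: nd_eq B_nonneg lc_in)

lemma nd_commute: "f \<in> V \<Longrightarrow> g \<in> V \<Longrightarrow> nd f g = nd g f"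
  unfolding nd_def using B_sym[of f g] by simp

text \<open>\<open>nd\<close> is a squared distance, hence the factor 2 from
  \<open>(a + b)^2 \<le> 2 a^2 + 2 b^2\<close>.\<close>

lemma nd_triangle:
  assumes "f \<in> V" "g \<in> V" "h \<in> V" shows "nd f h \<le> 2 * nd f g + 2 * nd g h"
proof -
  define u where "u = lc 1 f (-1) g" define v where "v = lc 1 g (-1) h"
  have V: "u \<in> V" "v \<in> V" using assms by (auto simp: u_def v_def lc_in)
  have e: "nd f g = B u u" "nd g h = B v v" "nd f h = B (lc 1 u 1 v) (lc 1 u 1 v)"
    unfolding nd_def u_def v_def using assms B_sym by (simp_all add: B_lc B_lc_right lc_in)
  have "0 \<le> nd u v" using V nd_nonneg by blast
  then have "2 * B u v \<le> B u u + B v v" by (simp add: nd_def)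
  then show ?thesis using V unfolding e by (simp add: B_lc B_lc_right lc_in B_sym[of v u])
qed

lemma abs_B_diff_le:
  assumes "f \<in> V" "f' \<in> V" "g \<in> V"
  shows "\<bar>B f g - B f' g\<bar> \<le> sqrt (nd f f' * B g g)"
proof -
  have "(B f g - B f' g)\<^sup>2 \<le> nd f f' * B g g"
    using Cauchy_Schwarz[of "lc 1 f (-1) f'" g] assms by (simp add: nd_eq lc_in B_lc)
  then show ?thesis using real_le_rsqrt[of "\<bar>B f g - B f' g\<bar>"] by simp
qed

lemma tendsto_B:
  assumes "((\<lambda>k. nd (F k) f) \<longlongrightarrow> 0) L" "((\<lambda>k. nd (G k) g) \<longlongrightarrow> 0) L"
    and V: "\<forall>\<^sub>F k in L. F k \<in> V" "f \<in> V" "\<forall>\<^sub>F k in L. G k \<in> V" "g \<in> V"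
  shows "((\<lambda>k. B (F k) (G k)) \<longlongrightarrow> B f g) L"
proof -
  have "((\<lambda>k. sqrt (nd (F k) f * nd (G k) g) + sqrt (nd (F k) f * B g g) + sqrt (nd (G k) g * B f f)) \<longlongrightarrow>
      sqrt (0 * 0) + sqrt (0 * B g g) + sqrt (0 * B f f)) L"
    by (intro tendsto_intros assms)
  then have lim: "((\<lambda>k. sqrt (nd (F k) f * nd (G k) g) + sqrt (nd (F k) f * B g g) + sqrt (nd (G k) g * B f f)) \<longlongrightarrow> 0) L"
    by simp
  have "\<forall>\<^sub>F k in L. norm (B (F k) (G k) - B f g) \<le>
      sqrt (nd (F k) f * nd (G k) g) + sqrt (nd (F k) f * B g g) + sqrt (nd (G k) g * B f f)"
    using V(1,3)
  proof eventually_elim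
    case (elim k)
    let ?u = "lc 1 (G k) (-1) g"
    have u: "?u \<in> V" using elim V by (simp add: lc_in)
    have "\<bar>B (F k) ?u - B f ?u\<bar> \<le> sqrt (nd (F k) f * nd (G k) g)"
      using abs_B_diff_le[OF elim(1) V(2) u] elim V by (simp add: nd_eq)
    moreover have "B (F k) ?u - B f ?u = B (F k) (G k) - B (F k) g - B f (G k) + B f g"
      using elim V by (simp add: B_lc_right)
    moreover have "\<bar>B (F k) g - B f g\<bar> \<le> sqrt (nd (F k) f * B g g)"
      by (rule abs_B_diff_le) (use elim V in auto)
    moreover have "\<bar>B (G k) f - B g f\<bar> \<le> sqrt (nd (G k) g * B f f)"
      by (rule abs_B_diff_le) (use elim V in auto)
    moreover have "B (G k) f = B f (G k)" "B g f = B f g" using elim V B_sym by auto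
    ultimately show ?case unfolding real_norm_def by linarith
  qed
  then have "((\<lambda>k. B (F k) (G k) - B f g) \<longlongrightarrow> 0) L"
    by (rule Lim_null_comparison[OF _ lim])
  then show ?thesis by (simp add: LIM_zero_iff)
qed

lemma nd_refl: "nd f f = 0" by (simp add: nd_def)

lemma tendsto_B_left:
  assumes "((\<lambda>k. nd (F k) f) \<longlongrightarrow> 0) L" "\<forall>\<^sub>F k in L. F k \<in> V" "f \<in> V" "g \<in> V"
  shows "((\<lambda>k. B (F k) g) \<longlongrightarrow> B f g) L"
  by (rule tendsto_B[where G="\<lambda>_. g"]) (use assms in \<open>auto simp: nd_refl\<close>)

text \<open>\<open>A\<close> is not assumed to be linear. Symmetry alone shows that \<open>A\<close>
  of a difference and the difference of the images have the same inner product with every vector,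
  and the norms depend on nothing else.\<close>

lemma nd_sym_le:
  assumes A: "\<And>f. f \<in> V \<Longrightarrow> A f \<in> V" "\<And>f g. f \<in> V \<Longrightarrow> g \<in> V \<Longrightarrow> B f (A g) = B (A f) g"
    and C: "\<And>g. g \<in> V \<Longrightarrow> B (A g) (A g) \<le> C * B g g" and V: "g \<in> V" "f \<in> V"
  shows "nd (A g) (A f) \<le> C * nd g f"
proof -
  let ?u = "lc 1 g (-1) f"
  have u: "?u \<in> V" using V by (simp add: lc_in)
  define U where "U = A ?u"
  have W: "U \<in> V" "A g \<in> V" "A f \<in> V" unfolding U_def using V u A(1) by auto
  have U: "B U h = B (A g) h - B (A f) h" if "h \<in> V" for h
    unfolding U_def using A(2)[OF u that] A(2)[OF V(1) that] A(2)[OF V(2) that] B_lc[OF V A(1)[OF that], of 1 "-1"]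
    by simp
  have "nd (A g) (A f) = B U U"
    using U[OF W(1)] U[OF W(2)] U[OF W(3)] B_sym[OF W(1,2)] B_sym[OF W(1,3)] B_sym[OF W(2,3)]
    by (simp add: nd_def)
  also have "\<dots> \<le> C * nd g f" using C[OF u] V by (simp add: nd_eq U_def)
  finally show ?thesis .
qed

text \<open>Identities between vectors are only required against test vectors: in the application \<open>V\<close> consists
  of functions rather than of their classes modulo null vectors.\<close>
definition sg :: "(real \<Rightarrow> 'b \<Rightarrow> 'b) \<Rightarrow> bool" where
  "sg T \<longleftrightarrow> (\<forall>f\<in>V. T 0 f = f) \<and> (\<forall>t\<ge>0. \<forall>f\<in>V. T t f \<in> V) \<and>
     (\<forall>t\<ge>0. \<exists>C. \<forall>f\<in>V. B (T t f) (T t f) \<le> C * B f f) \<and>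
     (\<forall>t\<ge>0. \<forall>f\<in>V. \<forall>g\<in>V. B f (T t g) = B (T t f) g) \<and>
     (\<forall>t\<ge>0. \<forall>s\<ge>0. \<forall>f\<in>V. \<forall>g\<in>V. B (T (t + s) f) g = B (T t (T s f)) g) \<and>
     (\<forall>f\<in>V. ((\<lambda>t. nd (T t f) f) \<longlongrightarrow> 0) (at_right 0))"

text \<open>For \<open>T e = exp (- e H)\<close> this is the form of the bounded operator
  \<open>(1 - exp (- e H)) / e\<close>, which increases to the form of \<open>H\<close> as
  \<open>e\<close> decreases to 0.\<close>

definition dq :: "(real \<Rightarrow> 'b \<Rightarrow> 'b) \<Rightarrow> real \<Rightarrow> 'b \<Rightarrow> 'b \<Rightarrow> real" where
  "dq T e f g = (B f g - B (T e f) g) / e"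

definition frm :: "(real \<Rightarrow> 'b \<Rightarrow> 'b) \<Rightarrow> 'b \<Rightarrow> ereal" where
  "frm T f = (SUP e\<in>{0<..}. ereal (dq T e f f))"

lemma dq_le_frm: "0 < e \<Longrightarrow> ereal (dq T e f f) \<le> frm T f"
  unfolding frm_def by (intro SUP_upper) auto

lemma frm_ne_minus_inf: "frm T f \<noteq> - \<infinity>"
  using dq_le_frm[of 1 T f] by auto

context
  fixes T assumes sg: "sg T"
begin

lemma sg_0: "f \<in> V \<Longrightarrow> T 0 f = f"
  and sg_in: "0 \<le> t \<Longrightarrow> f \<in> V \<Longrightarrow> T t f \<in> V"
  and sg_bdd: "0 \<le> t \<Longrightarrow> \<exists>C. \<forall>f\<in>V. B (T t f) (T t f) \<le> C * B f f"
  and sg_sym: "0 \<le> t \<Longrightarrow> f \<in> V \<Longrightarrow> g \<in> V \<Longrightarrow> B f (T t g) = B (T t f) g"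
  and sg_add: "0 \<le> t \<Longrightarrow> 0 \<le> s \<Longrightarrow> f \<in> V \<Longrightarrow> g \<in> V \<Longrightarrow> B (T (t + s) f) g = B (T t (T s f)) g"
  and sg_cont: "f \<in> V \<Longrightarrow> ((\<lambda>t. nd (T t f) f) \<longlongrightarrow> 0) (at_right 0)"
  using sg unfolding sg_def by blast+

lemma sg_mult:
  assumes "0 \<le> s" "0 \<le> r" "f \<in> V" "g \<in> V"
  shows "B (T s f) (T r g) = B (T (s + r) f) g"
  using assms sg_sym[of r "T s f" g] sg_add[of r s f g] by (simp add: sg_in add.commute)

lemma sg_lc:
  assumes "0 \<le> s" "f \<in> V" "g \<in> V" "h \<in> V"
  shows "B (T s (lc a f b g)) h = a * B (T s f) h + b * B (T s g) h"
proof -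
  have "B (T s (lc a f b g)) h = B (lc a f b g) (T s h)"
    using assms by (simp add: sg_sym lc_in)
  also have "\<dots> = a * B f (T s h) + b * B g (T s h)" using assms by (simp add: B_lc sg_in)
  finally show ?thesis using assms by (simp add: sg_sym)
qed

lemma sg_diag: "0 \<le> s \<Longrightarrow> f \<in> V \<Longrightarrow> B (T s f) f = B (T (s/2) f) (T (s/2) f)"
  by (simp add: sg_mult)

lemma sg_diag_nonneg: "0 \<le> s \<Longrightarrow> f \<in> V \<Longrightarrow> 0 \<le> B (T s f) f"
  by (simp add: sg_diag B_nonneg sg_in)

text \<open>\<open>B (T s f) f\<close> is the squared norm of \<open>T (s/2) f\<close>, so midpoint
  convexity in \<open>s\<close> is nothing but the nonnegativity of the squared distance between
  \<open>T (s/2) f\<close> and \<open>T (s/2 + h) f\<close>.\<close>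

lemma sg_midpoint:
  assumes "0 \<le> s" "0 \<le> h" "f \<in> V"
  shows "2 * B (T (s + h) f) f \<le> B (T s f) f + B (T (s + 2 * h) f) f"
proof -
  have "0 \<le> nd (T (s/2) f) (T (s/2 + h) f)" using assms by (intro nd_nonneg sg_in) auto
  moreover have "B (T (s/2) f) (T (s/2) f) = B (T s f) f" using assms by (simp add: sg_mult)
  moreover have "B (T (s/2) f) (T (s/2 + h) f) = B (T (s/2 + (s/2 + h)) f) f"
    by (rule sg_mult) (use assms in auto)
  moreover have "B (T (s/2 + h) f) (T (s/2 + h) f) = B (T (s/2 + h + (s/2 + h)) f) f"
    by (rule sg_mult) (use assms in auto)
  moreover have "s/2 + (s/2 + h) = s + h" "s/2 + h + (s/2 + h) = s + 2 * h" by auto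
  ultimately show ?thesis by (simp add: nd_def)
qed

lemma sg_rcont:
  assumes "0 \<le> s" "f \<in> V" "g \<in> V"
  shows "((\<lambda>h. B (T (s + h) f) g) \<longlongrightarrow> B (T s f) g) (at_right 0)"
proof -
  have "((\<lambda>h. B (T h f) (T s g)) \<longlongrightarrow> B f (T s g)) (at_right 0)"
    using assms by (intro tendsto_B_left sg_cont)
      (auto simp: sg_in eventually_at_right_less intro!: eventually_at_rightI[of 0 1])
  moreover have "\<forall>\<^sub>F h in at_right 0. B (T h f) (T s g) = B (T (s + h) f) g"
    using assms by (intro eventually_at_rightI[of 0 1]) (auto simp: sg_mult add.commute)
  ultimately show ?thesis using assms by (simp add: sg_sym tendsto_cong)
qed

end

text \<open>The decrements of a convex sequence decrease. Hence the total decrement over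
  \<open>n\<close> steps is at most \<open>n\<close> times the first one and at least
  \<open>n\<close> times the one that follows.\<close>

lemma convex_seq:
  fixes u :: "nat \<Rightarrow> real"
  assumes "\<And>j. 2 * u (Suc j) \<le> u j + u (Suc (Suc j))"
  shows "u 0 - u n \<le> n * (u 0 - u 1)" "n * (u n - u (Suc n)) \<le> u 0 - u n"
proof -
  have d: "u (i + k) - u (Suc (i + k)) \<le> u i - u (Suc i)" for i k
  proof (induction k)
    case (Suc k) then show ?case using assms[of "i + k"] by simp
  qed simp
  show "u 0 - u n \<le> n * (u 0 - u 1)"
  proof (induction n)
    case (Suc n)
    then show ?case using d[of 0 n] by (simp add: algebra_simps)
  qed simp
  show "n * (u n - u (Suc n)) \<le> u 0 - u n"
  proof (induction n)
    case (Suc n)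
    have "real (Suc n) * (u (Suc n) - u (Suc (Suc n))) \<le> real (Suc n) * (u n - u (Suc n))"
      using d[of n 1] by (intro mult_left_mono) auto
    then show ?case using Suc by (simp add: algebra_simps)
  qed simp
qed

section \<open>Difference quotients and the form of a symmetric semigroup\<close>

context
  fixes T assumes sg: "sg T"
begin

lemma sg_convex_seq:
  assumes "0 \<le> e" "f \<in> V"
  shows "2 * B (T (real (Suc j) * e) f) f \<le> B (T (real j * e) f) f + B (T (real (Suc (Suc j)) * e) f) f"
  using sg_midpoint[OF sg, of "real j * e" e f] assms by (simp add: algebra_simps)

lemma dq_mult_le:
  assumes "0 < e" "f \<in> V" "0 < n"
  shows "dq T (real n * e) f f \<le> dq T e f f"
proof -
  have "B f f - B (T (real n * e) f) f \<le> n * (B f f - B (T e f) f)"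
    using convex_seq(1)[of "\<lambda>j. B (T (real j * e) f) f" n] sg_convex_seq[of e f] assms sg_0[OF sg] by simp
  then have "dq T (real n * e) f f \<le> n * (B f f - B (T e f) f) / (real n * e)"
    unfolding dq_def using assms by (intro divide_right_mono) auto
  then show ?thesis using assms by (simp add: dq_def)
qed

lemma dq_dyadic_mono:
  assumes "0 < t" "f \<in> V" "n \<le> k"
  shows "dq T (t/2^n) f f \<le> dq T (t/2^k) f f"
proof -
  have "t/2^n = real (2^(k-n)) * (t/2^k)"
    unfolding of_nat_power of_nat_numeral using assms by (simp add: power_diff)
  then show ?thesis using dq_mult_le[of "t/2^k" f "2^(k-n)"] assms by simp
qed

text \<open>Multiples of \<open>t/2^n\<close> approximate \<open>s\<close>, and the quotient at a
  multiple is at most the quotient at the unit. So the dyadic quotients alone determine the supremum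
  \<open>frm\<close>.\<close>

lemma dq_le_if_dyadic:
  assumes t: "0 < t" and s: "0 < s" and f: "f \<in> V" and c: "\<And>n. dq T (t/2^n) f f \<le> c"
  shows "dq T s f f \<le> c"
proof -
  \<comment> \<open>The summand 1 keeps the grid points strictly above \<open>s\<close>, because
    only continuity from the right has been established.\<close>
  define k where "k n = nat \<lfloor>s * 2^n / t\<rfloor> + 1" for n :: nat
  define h where "h n = real (k n) * (t/2^n) - s" for n
  have fl: "real (nat \<lfloor>s * 2^n / t\<rfloor>) = of_int \<lfloor>s * 2^n / t\<rfloor>" for n
    using s t by simp
  have h: "0 < h n" "h n \<le> t/2^n" for n
  proof -
    have "s * 2^n / t < real (k n)" "real (k n) \<le> s * 2^n / t + 1"
      unfolding k_def using fl[of n] by linarith+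
    then have "s * 2^n < real (k n) * t" "real (k n) * t \<le> s * 2^n + t"
      using t by (simp_all add: pos_divide_less_eq field_simps)
    moreover have "h n = (real (k n) * t - s * 2^n) / 2^n" by (simp add: h_def diff_divide_distrib)
    ultimately show "0 < h n" "h n \<le> t/2^n" by (simp_all add: divide_right_mono)
  qed
  have "h \<longlonglongrightarrow> 0"
  proof (rule tendsto_sandwich[where f="\<lambda>_. 0" and h="\<lambda>n. t * (1/2)^n"])
    show "(\<lambda>n. t * (1/2)^n) \<longlonglongrightarrow> 0" by (auto intro!: tendsto_mult_right_zero LIMSEQ_power_zero)
  qed (use h in \<open>auto simp: power_divide less_imp_le\<close>)
  then have "filterlim h (at_right 0) sequentially"
    unfolding filterlim_at using h(1) by (auto intro!: always_eventually simp: less_imp_neq[symmetric])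
  then have "(\<lambda>n. B (T (s + h n) f) f) \<longlonglongrightarrow> B (T s f) f"
    using filterlim_compose[OF sg_rcont[OF sg, of s f f]] s f by (simp add: less_imp_le)
  then have "(\<lambda>n. dq T (s + h n) f f) \<longlonglongrightarrow> dq T s f f"
    unfolding dq_def using \<open>h \<longlonglongrightarrow> 0\<close> s tendsto_add[OF tendsto_const[of s] \<open>h \<longlonglongrightarrow> 0\<close>]
    by (intro tendsto_divide tendsto_diff tendsto_const) auto
  moreover have "dq T (s + h n) f f \<le> c" for n
  proof -
    have "s + h n = real (k n) * (t/2^n)" by (simp add: h_def)
    then have "dq T (s + h n) f f \<le> dq T (t/2^n) f f"
      using dq_mult_le[of "t/2^n" f "k n"] t f by (simp add: k_def)
    then show ?thesis using c[of n] by simp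
  qed
  ultimately show ?thesis by (meson LIMSEQ_le_const2)
qed

lemma frm_le_if_dyadic:
  assumes "0 < t" "f \<in> V" "\<And>n. dq T (t/2^n) f f \<le> c"
  shows "frm T f \<le> ereal c"
  unfolding frm_def
proof (rule SUP_least)
  fix e :: real assume "e \<in> {0<..}"
  then have "dq T e f f \<le> c" using dq_le_if_dyadic[OF assms(1) _ assms(2,3)] by simp
  then show "ereal (dq T e f f) \<le> ereal c" by simp
qed

lemma dq_dyadic_tendsto:
  assumes "0 < t" "f \<in> V" "frm T f = ereal r"
  shows "(\<lambda>n. dq T (t/2^n) f f) \<longlonglongrightarrow> r"
proof -
  have up: "dq T (t/2^n) f f \<le> r" for n
    using dq_le_frm[of "t/2^n" T f] assms by simp
  have "incseq (\<lambda>n. dq T (t/2^n) f f)" using assms dq_dyadic_mono by (auto simp: incseq_def)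
  then obtain L where L: "(\<lambda>n. dq T (t/2^n) f f) \<longlonglongrightarrow> L" "\<And>n. dq T (t/2^n) f f \<le> L"
    using incseq_convergent[of "\<lambda>n. dq T (t/2^n) f f" r] up by blast
  have "L \<le> r" using L(1) up LIMSEQ_le_const2 by blast
  moreover have "frm T f \<le> ereal L" using frm_le_if_dyadic[OF assms(1,2) L(2)] .
  ultimately show ?thesis using L assms by simp
qed

text \<open>Along a convex function the slope beyond \<open>2 s\<close> is at most the mean slope on
  \<open>[0, 2 s]\<close>; this replaces the spectral inequality
  \<open>x exp (- 2 s x) \<le> (1 - exp (- 2 s x)) / (2 s)\<close>. In particular the semigroup maps
  every vector into the form domain.\<close>

lemma frm_sg_le:
  assumes "0 < s" "f \<in> V"
  shows "frm T (T s f) \<le> ereal (dq T (2 * s) f f)"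
proof (rule frm_le_if_dyadic[of "2 * s"])
  fix n :: nat
  define e where "e = 2 * s/2^n"
  have e: "0 < e" "real (2^n) * e = 2 * s" using assms by (auto simp: e_def)
  define X where "X = B (T (2 * s) f) f - B (T (2 * s + e) f) f"
  have X: "real (2^n) * X \<le> B f f - B (T (2 * s) f) f"
    using convex_seq(2)[of "\<lambda>j. B (T (real j * e) f) f" "2^n"] sg_convex_seq[of e f] assms e sg_0[OF sg]
    by (simp add: algebra_simps X_def)
  have "B (T e (T s f)) (T s f) = B (T (2 * s + e) f) f"
    using assms e sg_mult[OF sg, of "e + s" s f f] sg_add[OF sg, of e s f "T s f"]
    by (simp add: sg_in[OF sg] algebra_simps)
  moreover have "B (T s f) (T s f) = B (T (2 * s) f) f"
    using assms sg_mult[OF sg, of s s f f] by simp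
  ultimately have "dq T e (T s f) (T s f) * e = X" using e by (simp add: dq_def X_def)
  then have "dq T e (T s f) (T s f) * (2 * s) = real (2^n) * X" unfolding e(2)[symmetric] by simp
  then have "dq T e (T s f) (T s f) \<le> dq T (2 * s) f f"
    unfolding dq_def[of T "2 * s" f f] using X assms by (simp add: pos_le_divide_eq)
  then show "dq T (2 * s/2^n) (T s f) (T s f) \<le> dq T (2 * s) f f" by (simp add: e_def)
qed (use assms sg_in[OF sg] in auto)

lemma sg_nd_le:
  assumes "0 \<le> e" "\<And>g. g \<in> V \<Longrightarrow> B (T e g) (T e g) \<le> C * B g g" "g \<in> V" "f \<in> V"
  shows "nd (T e g) (T e f) \<le> C * nd g f"
  by (rule nd_sym_le) (use assms sg_in[OF sg] sg_sym[OF sg] in auto)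

lemma dq_tendsto:
  assumes "((\<lambda>k. nd (F k) f) \<longlongrightarrow> 0) L" "\<forall>\<^sub>F k in L. F k \<in> V" "f \<in> V" "0 < e"
  shows "((\<lambda>k. dq T e (F k) (F k)) \<longlongrightarrow> dq T e f f) L"
proof -
  obtain C where C: "\<And>g. g \<in> V \<Longrightarrow> B (T e g) (T e g) \<le> C * B g g"
    using sg_bdd[OF sg, of e] assms by auto
  have "((\<lambda>k. nd (T e (F k)) (T e f)) \<longlongrightarrow> 0) L"
  proof (rule tendsto_0_le[OF assms(1), of _ C])
    show "\<forall>\<^sub>F k in L. norm (nd (T e (F k)) (T e f)) \<le> norm (nd (F k) f) * C"
      using assms(2)
    proof eventually_elim
      case (elim k)
      show ?case using sg_nd_le[OF _ C elim assms(3)] nd_nonneg elim assms sg_in[OF sg]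
        by (simp add: mult.commute)
    qed
  qed
  then have "((\<lambda>k. B (T e (F k)) (F k)) \<longlongrightarrow> B (T e f) f) L"
    by (rule tendsto_B) (use assms sg_in[OF sg] in \<open>auto elim: eventually_mono\<close>)
  moreover have "((\<lambda>k. B (F k) (F k)) \<longlongrightarrow> B f f) L"
    by (rule tendsto_B) (use assms in auto)
  ultimately show ?thesis unfolding dq_def using assms(4) by (intro tendsto_intros) auto
qed

text \<open>A supremum of the functionals \<open>dq T e\<close>, each of which is continuous, is
  lower semicontinuous. The bounds \<open>b k\<close> may vary with \<open>k\<close>, since
  smoothing estimates give moving bounds.\<close>

lemma frm_lsc:
  assumes "((\<lambda>k. nd (F k) f) \<longlongrightarrow> 0) L" "\<forall>\<^sub>F k in L. F k \<in> V" "f \<in> V" "L \<noteq> bot"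
    and "\<forall>\<^sub>F k in L. frm T (F k) \<le> ereal (b k)" "(b \<longlongrightarrow> c) L"
  shows "frm T f \<le> ereal c"
  unfolding frm_def
proof (rule SUP_least)
  fix e :: real assume e: "e \<in> {0<..}"
  have "\<forall>\<^sub>F k in L. dq T e (F k) (F k) \<le> b k"
    using assms(5) by eventually_elim (use e dq_le_frm[of e T] in \<open>force dest: order_trans\<close>)
  then have "dq T e f f \<le> c"
    using tendsto_le[OF assms(4,6) dq_tendsto[OF assms(1-3)]] e by simp
  then show "ereal (dq T e f f) \<le> ereal c" by simp
qed

text \<open>The lower bound is inserted at \<open>T r f\<close>, where \<open>frm_sg_le\<close>
  bounds the form above by \<open>(B f f - B (T r f) (T r f)) / (2 r)\<close>. The factor
  \<open>1 - 2 r C\<close> stands in for \<open>exp (- 2 r C)\<close> and is useful for small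
  \<open>r\<close> only.\<close>

lemma sg_bound_if_frm_ge:
  assumes lb: "\<And>f. f \<in> V \<Longrightarrow> ereal (- C * B f f) \<le> frm T f" and "0 \<le> r" "f \<in> V"
  shows "B (T r f) (T r f) * (1 - 2 * r * C) \<le> B f f"
proof (cases "r = 0")
  case False
  then have r: "0 < r" using assms by simp
  have "- C * B (T r f) (T r f) \<le> dq T (2 * r) f f"
    using order_trans[OF lb[of "T r f"] frm_sg_le[OF r, of f]] assms sg_in[OF sg] by simp
  moreover have "B (T (2 * r) f) f = B (T r f) (T r f)" using sg_diag[OF sg, of "2 * r" f] assms by simp
  ultimately show ?thesis using r by (simp add: dq_def field_simps)
qed (use assms sg_0[OF sg] in simp)

end

text \<open>The form of a limit may jump, so \<open>f\<close> is first smoothed: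
  \<open>frm T (Sk k s f) \<le> dq (Sk k) (2 s) f f\<close> by \<open>frm_sg_le\<close>, and the
  right-hand side converges to a quotient of \<open>S\<close>. Lower semicontinuity is then used
  twice, for the limit in \<open>k\<close> and for \<open>s\<close> tending to 0.\<close>

lemma frm_le_limit:
  assumes S: "sg S" and Sk: "\<And>k. sg (Sk k)" and T: "sg T"
    and conv: "\<And>s f. 0 < s \<Longrightarrow> f \<in> V \<Longrightarrow> (\<lambda>k. nd (Sk k s f) (S s f)) \<longlonglongrightarrow> 0"
    and le: "\<forall>\<^sub>F k in sequentially. \<forall>f\<in>V. frm T f \<le> frm (Sk k) f"
    and f: "f \<in> V"
  shows "frm T f \<le> frm S f"
proof (cases "frm S f")
  case (real r)
  have *: "frm T (S s f) \<le> ereal r" if s: "0 < s" for s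
  proof -
    have "frm T (S s f) \<le> ereal (dq S (2 * s) f f)"
    proof (rule frm_lsc[OF T conv[OF s f]])
      show "\<forall>\<^sub>F k in sequentially. frm T (Sk k s f) \<le> ereal (dq (Sk k) (2 * s) f f)"
        using le
      proof eventually_elim
        case (elim k)
        then show ?case using frm_sg_le[OF Sk s f, of k] sg_in[OF Sk, of s f k] s f
          by (meson less_imp_le order_trans)
      qed
      show "(\<lambda>k. dq (Sk k) (2 * s) f f) \<longlonglongrightarrow> dq S (2 * s) f f"
        unfolding dq_def using s f conv[of "2 * s" f] sg_in[OF S] sg_in[OF Sk]
        by (intro tendsto_intros tendsto_B_left) auto
    qed (use sg_in[OF S] sg_in[OF Sk] s f in auto)
    also have "\<dots> \<le> ereal r" using dq_le_frm[of "2 * s" S f] s real by simp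
    finally show ?thesis .
  qed
  have "frm T f \<le> ereal r"
  proof (rule frm_lsc[OF T sg_cont[OF S f]])
    show "\<forall>\<^sub>F k in at_right 0. frm T (S k f) \<le> ereal r"
      using * by (intro eventually_at_rightI[of 0 1]) auto
    show "\<forall>\<^sub>F k in at_right 0. S k f \<in> V"
      using sg_in[OF S _ f] by (intro eventually_at_rightI[of 0 1]) auto
  qed (use f in auto)
  then show ?thesis using real by simp
qed (use frm_ne_minus_inf in auto)

lemma frm_limit_le:
  assumes S: "\<And>s. 0 < s \<Longrightarrow> S s f \<in> V" and Sk: "\<And>k s. 0 < s \<Longrightarrow> Sk k s f \<in> V"
    and conv: "\<And>s. 0 < s \<Longrightarrow> (\<lambda>k. nd (Sk k s f) (S s f)) \<longlonglongrightarrow> 0"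
    and le: "\<forall>\<^sub>F k in sequentially. frm (Sk k) f \<le> ereal (b k)" "b \<longlonglongrightarrow> c"
    and f: "f \<in> V"
  shows "frm S f \<le> ereal c"
  unfolding frm_def
proof (rule SUP_least)
  fix e :: real assume e: "e \<in> {0<..}"
  have "\<forall>\<^sub>F k in sequentially. dq (Sk k) e f f \<le> b k"
    using le(1) by eventually_elim (use e dq_le_frm[of e] in \<open>force dest: order_trans\<close>)
  moreover have "(\<lambda>k. dq (Sk k) e f f) \<longlonglongrightarrow> dq S e f f"
    unfolding dq_def using e f conv[of e] S Sk
    by (intro tendsto_intros tendsto_B_left) auto
  ultimately have "dq S e f f \<le> c"
    using tendsto_le[OF _ le(2), of "\<lambda>k. dq (Sk k) e f f"] by simp
  then show "ereal (dq S e f f) \<le> ereal c" by simp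
qed

lemma B_eq_if_weak_eq:
  assumes "x \<in> V" "y \<in> V" "\<And>h. h \<in> V \<Longrightarrow> B x h = B y h"
  shows "B x x = B y y"
  using assms(3)[OF assms(1)] assms(3)[OF assms(2)] B_sym[OF assms(1,2)] by simp

section \<open>Growth of orbits and of their energies\<close>

context
  fixes T assumes sg: "sg T"
begin

lemma sg_pow_bound:
  assumes s: "0 \<le> s" and G: "\<And>f. f \<in> V \<Longrightarrow> B (T s f) (T s f) \<le> G * B f f" "0 \<le> G"
    and f: "f \<in> V"
  shows "B (T (real j * s) f) (T (real j * s) f) \<le> G ^ j * B f f"
proof (induction j)
  case 0 then show ?case using f sg_0[OF sg] by simp
next
  case (Suc j)
  let ?u = "T (real j * s) f"
  have u: "?u \<in> V" using s f sg_in[OF sg] by simp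
  have "B (T (real (Suc j) * s) f) (T (real (Suc j) * s) f) = B (T s ?u) (T s ?u)"
    by (rule B_eq_if_weak_eq) (use s f u sg_in[OF sg] sg_add[OF sg, of s "real j * s" f] in \<open>auto simp: algebra_simps\<close>)
  also have "\<dots> \<le> G * B ?u ?u" using G u by simp
  also have "\<dots> \<le> G * (G ^ j * B f f)" using Suc G by (intro mult_left_mono) auto
  finally show ?case by simp
qed

text \<open>The axioms give a bound at each single time, without uniformity. Halving the time takes
  the square root of the constant, because \<open>B (T (s/2) f) (T (s/2) f) = B (T s f) f\<close>,
  so that \<open>2^n\<close> steps of length \<open>t/2^n\<close> together cost no more than
  \<open>G\<close>.\<close>

lemma sg_dyadic_bound:
  assumes t: "0 < t"
  obtains G where "1 \<le> G"
    "\<And>n j f. f \<in> V \<Longrightarrow> j \<le> 2^n \<Longrightarrow> B (T (real j * (t/2^n)) f) (T (real j * (t/2^n)) f) \<le> G * B f f"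
proof -
  obtain C where C: "\<And>f. f \<in> V \<Longrightarrow> B (T t f) (T t f) \<le> C * B f f"
    using sg_bdd[OF sg, of t] t by auto
  define G where "G = max 1 C"
  define K where "K n = G powr (1/2^n)" for n :: nat
  have G1: "1 \<le> G" by (simp add: G_def)
  have K1: "1 \<le> K n" for n unfolding K_def using G1 by (simp add: ge_one_powr_ge_zero)
  have step: "B (T (t/2^n) f) (T (t/2^n) f) \<le> K n * B f f" if f: "f \<in> V" for n f
    using f
  proof (induction n arbitrary: f)
    case 0
    have "C * B f f \<le> G * B f f" using B_nonneg[OF 0] by (intro mult_right_mono) (auto simp: G_def)
    then show ?case using C[OF 0] G1 by (simp add: K_def)
  next
    case (Suc n)
    let ?s = "t/2^n"
    have "B (T (?s/2) f) (T (?s/2) f) = B (T ?s f) f"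
      using sg_diag[OF sg, of ?s f] t Suc by simp
    moreover have "(B (T ?s f) f)\<^sup>2 \<le> B (T ?s f) (T ?s f) * B f f"
      using t Suc by (intro Cauchy_Schwarz sg_in[OF sg]) auto
    moreover have "\<dots> \<le> (K n * B f f) * B f f"
      using Suc B_nonneg by (intro mult_right_mono) auto
    moreover have "(K n * B f f) * B f f = (K (Suc n) * B f f)\<^sup>2"
      using G1 by (simp add: K_def power2_eq_square powr_add[symmetric])
    ultimately have "(B (T (?s/2) f) (T (?s/2) f))\<^sup>2 \<le> (K (Suc n) * B f f)\<^sup>2" by simp
    then have "B (T (?s/2) f) (T (?s/2) f) \<le> K (Suc n) * B f f"
      by (rule power2_le_imp_le) (intro mult_nonneg_nonneg order_trans[OF zero_le_one K1] B_nonneg Suc.prems)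
    then show ?case by (simp add: mult.commute)
  qed
  have "B (T (real j * (t/2^n)) f) (T (real j * (t/2^n)) f) \<le> G * B f f"
    if f: "f \<in> V" and j: "j \<le> 2^n" for n j f
  proof -
    have "B (T (real j * (t/2^n)) f) (T (real j * (t/2^n)) f) \<le> K n ^ j * B f f"
      using step K1[of n] t f by (intro sg_pow_bound) auto
    also have "\<dots> \<le> K n ^ (2^n) * B f f"
      using K1[of n] j B_nonneg[OF f] by (intro mult_right_mono power_increasing) auto
    also have "K n ^ (2^n) = K n powr real (2^n)" using K1[of n] by (intro powr_realpow[symmetric]) auto
    also have "\<dots> = G powr (1/2^n * real (2^n))" unfolding K_def by (rule powr_powr)
    also have "1/2^n * real (2^n) = (1::real)" by simp
    also have "G powr 1 = G" using G1 by simp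
    finally show ?thesis .
  qed
  then show thesis using that G1 by blast
qed

lemma dq_lc:
  assumes "0 < e" "f \<in> V" "g \<in> V" "h \<in> V"
  shows "dq T e (lc a f b g) h = a * dq T e f h + b * dq T e g h"
  using assms by (simp add: dq_def B_lc sg_lc[OF sg] diff_divide_distrib add_divide_distrib algebra_simps)

lemma dq_sym: "0 < e \<Longrightarrow> f \<in> V \<Longrightarrow> g \<in> V \<Longrightarrow> dq T e f g = dq T e g f"
  using B_sym[of f g] sg_sym[OF sg, of e f g] B_sym[of f "T e g"] sg_in[OF sg, of e g]
  by (simp add: dq_def)

lemma dq_le_norm: "0 < e \<Longrightarrow> f \<in> V \<Longrightarrow> dq T e f f \<le> B f f / e"
  using sg_diag_nonneg[OF sg, of e f] by (auto simp: dq_def intro!: divide_right_mono)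

lemma minus_dq_le_norm:
  assumes "0 < e" "f \<in> V" "B (T e f) (T e f) \<le> G * B f f"
  shows "- dq T e f f \<le> (G + 1) * B f f / e"
proof -
  have "0 \<le> nd (T e f) f" using assms sg_in[OF sg] by (intro nd_nonneg) auto
  then have "2 * B (T e f) f \<le> (G + 1) * B f f"
    using assms(3) by (simp add: nd_def algebra_simps)
  moreover have "0 \<le> B (T e f) f" using sg_diag_nonneg[OF sg] assms by simp
  ultimately have "B (T e f) f - B f f \<le> (G + 1) * B f f" using B_nonneg[OF assms(2)] by linarith
  then have "(B (T e f) f - B f f) / e \<le> (G + 1) * B f f / e"
    using assms by (intro divide_right_mono) auto
  then show ?thesis by (simp add: dq_def minus_divide_left)
qed

lemma dq_sg:
  assumes "0 < e" "0 \<le> s" "f \<in> V" "g \<in> V"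
  shows "dq T e (T s f) (T s g) = dq T e (T (2 * s) f) g"
proof -
  have "B (T e (T s f)) (T s g) = B (T (e + s) f) (T s g)"
    using sg_add[OF sg, of e s f "T s g"] assms sg_in[OF sg] by simp
  also have "\<dots> = B (T (e + s + s) f) g" using assms by (intro sg_mult[OF sg]) auto
  also have "e + s + s = e + 2 * s" by simp
  also have "B (T (e + 2 * s) f) g = B (T e (T (2 * s) f)) g"
    using assms by (intro sg_add[OF sg]) auto
  finally show ?thesis using sg_mult[OF sg, of s s f g] assms by (simp add: dq_def)
qed

text \<open>The difference of two dyadic quotients is a nonnegative symmetric form by monotonicity
  in the scale, so the Cauchy-Schwarz inequality applies to it.\<close>

lemma dq_diff_Cauchy_Schwarz:
  assumes "0 < t" "n \<le> k" "f \<in> V" "g \<in> V"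
  shows "(dq T (t/2^k) f g - dq T (t/2^n) f g)\<^sup>2 \<le>
    (dq T (t/2^k) f f - dq T (t/2^n) f f) * (dq T (t/2^k) g g - dq T (t/2^n) g g)"
  using assms
  by (intro form_Cauchy_Schwarz[where c="\<lambda>f g. dq T (t/2^k) f g - dq T (t/2^n) f g"])
    (auto simp: dq_lc algebra_simps dq_sym intro: dq_dyadic_mono[OF sg])

text \<open>The form \<open>c\<close> below is nonnegative and \<open>T s\<close> is symmetric for it, so \<open>c (T s f) (T s f)\<close> is
  log-convex along \<open>s, 2s, 4s, \<dots>\<close>; a contraction constant for \<open>B\<close> is thus one for \<open>c\<close>.\<close>
lemma dq_diff_sg_le:
  assumes t: "0 < t" and nk: "n \<le> k" and s: "0 \<le> s" and f: "f \<in> V"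
    and G: "\<And>f. f \<in> V \<Longrightarrow> B (T s f) (T s f) \<le> G * B f f" "1 \<le> G"
  shows "dq T (t/2^k) (T s f) (T s f) - dq T (t/2^n) (T s f) (T s f) \<le>
     G * (dq T (t/2^k) f f - dq T (t/2^n) f f)"
proof -
  define c where "c f g = dq T (t/2^k) f g - dq T (t/2^n) f g" for f g
  have pos: "0 \<le> c g g" if "g \<in> V" for g using dq_dyadic_mono[OF sg t that nk] by (simp add: c_def)
  define x where "x i = c (T (2^i * s) f) (T (2^i * s) f)" for i :: nat
  have in_V: "T (2^i * s) f \<in> V" for i using s f sg_in[OF sg] by simp
  have log: "(x i)\<^sup>2 \<le> x (Suc i) * c f f" for i
  proof -
    have "x i = c (T (2^Suc i * s) f) f"
      using dq_sg[of "t/2^k" "2^i * s" f f] dq_sg[of "t/2^n" "2^i * s" f f] t s f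
      by (simp add: x_def c_def mult.assoc)
    then show ?thesis
      using dq_diff_Cauchy_Schwarz[OF t nk in_V[of "Suc i"] f] by (simp add: c_def x_def)
  qed
  have x0: "x 0 = c (T s f) (T s f)" by (simp add: x_def)
  obtain C where C: "\<And>f. f \<in> V \<Longrightarrow> B (T (t/2^n) f) (T (t/2^n) f) \<le> C * B f f"
    using sg_bdd[OF sg, of "t/2^n"] t by auto
  define K where "K = 1 / (t/2^k) + (C + 1) / (t/2^n)"
  have K: "c g g \<le> K * B g g" if "g \<in> V" for g
  proof -
    define a b where "a = t/2^k" and "b = t/2^n"
    have "dq T a g g \<le> B g g / a" using dq_le_norm[of a g] that t by (simp add: a_def)
    moreover have "- dq T b g g \<le> (C + 1) * B g g / b"
      using minus_dq_le_norm[of b g C] C[OF that] that t by (simp add: b_def)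
    moreover have "K * B g g = B g g / a + (C + 1) * B g g / b"
      unfolding K_def a_def[symmetric] b_def[symmetric] by (simp add: distrib_right)
    ultimately show ?thesis by (simp add: c_def a_def b_def)
  qed
  have up: "x i \<le> K * B (T (2^i * s) f) (T (2^i * s) f)" for i
    unfolding x_def by (intro K in_V)
  have grow: "B (T (2^i * s) f) (T (2^i * s) f) \<le> G ^ (2^i) * B f f" for i
    using sg_pow_bound[OF s G(1) _ f, of "2^i"] G(2) by simp
  show ?thesis
  \<comment> \<open>If the ratio \<open>r\<close> exceeded 1, repeated squaring would force growth
    like \<open>(G r)^(2^i)\<close>, while the crude bound \<open>K\<close> of \<open>c\<close> by
    \<open>B\<close> allows no more than a fixed multiple of \<open>G^(2^i)\<close>.\<close>
  proof (rule ccontr)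
    assume "\<not> ?thesis"
    then have neg: "G * c f f < x 0" by (simp add: c_def x0)
    have c0: "0 < c f f"
    proof (rule ccontr)
      assume "\<not> 0 < c f f"
      then have "c f f = 0" using pos[OF f] by simp
      then show False using log[of 0] neg by simp
    qed
    define r where "r = x 0 / (G * c f f)"
    have r: "1 < r" using neg c0 G(2) by (simp add: r_def)
    have low: "c f f * (G * r) ^ (2^i) \<le> x i" for i
    proof (induction i)
      case 0 then show ?case using c0 G(2) by (simp add: r_def)
    next
      case (Suc i)
      have "c f f * (c f f * (G * r) ^ (2^Suc i)) = (c f f * (G * r) ^ (2^i))\<^sup>2"
        unfolding power_Suc power_even_eq by (simp add: power2_eq_square)
      also have "\<dots> \<le> (x i)\<^sup>2" using Suc c0 G(2) r by (intro power_mono) auto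
      also have "\<dots> \<le> c f f * x (Suc i)" using log[of i] by (simp add: mult.commute)
      finally show ?case using c0 by simp
    qed
    have K0: "0 \<le> K * B f f" using K[OF f] pos[OF f] by simp
    have "c f f * r ^ (2^i) \<le> \<bar>K\<bar> * B f f" for i
    proof -
      have "c f f * r ^ (2^i) * G ^ (2^i) \<le> x i" using low[of i] by (simp add: power_mult_distrib mult_ac)
      also have "\<dots> \<le> \<bar>K\<bar> * (G ^ (2^i) * B f f)"
        using up[of i] grow[of i] B_nonneg[OF in_V[of i]]
        by (meson abs_ge_self abs_ge_zero mult_mono order_trans)
      finally show ?thesis using G(2) by (simp add: mult_ac)
    qed
    moreover have "r ^ i \<le> r ^ (2^i)" for i
      using r by (intro power_increasing) (auto intro: less_imp_le[OF less_exp])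
    ultimately have bd: "r ^ i \<le> \<bar>K\<bar> * B f f / c f f" for i
      using c0 by (smt (verit) mult.commute pos_le_divide_eq)
    then show False using real_arch_pow[OF r, of "\<bar>K\<bar> * B f f / c f f"] by (meson not_le)
  qed
qed

text \<open>\<open>dq_diff_sg_le\<close> for all \<open>k \<ge> n\<close> says that the excess of
  the form over its \<open>n\<close>-th quotient grows along the orbit at most by the factor
  \<open>G\<close>. Smallness of this excess at \<open>f\<close> thus holds for the whole orbit,
  which is the uniformity needed in the telescoping sum.\<close>

lemma frm_sg_finite:
  assumes t: "0 < t" and s: "0 \<le> s" and f: "f \<in> V"
    and G: "\<And>f. f \<in> V \<Longrightarrow> B (T s f) (T s f) \<le> G * B f f" "1 \<le> G"
    and q: "frm T f = ereal q"
  shows "frm T (T s f) \<le> ereal (dq T (t/2^n) (T s f) (T s f) + G * (q - dq T (t/2^n) f f))"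
proof (rule frm_le_if_dyadic[OF sg t sg_in[OF sg s f]])
  fix k
  show "dq T (t/2^k) (T s f) (T s f) \<le> dq T (t/2^n) (T s f) (T s f) + G * (q - dq T (t/2^n) f f)"
  proof (cases "n \<le> k")
    case True
    have "G * (dq T (t/2^k) f f - dq T (t/2^n) f f) \<le> G * (q - dq T (t/2^n) f f)"
      using dq_le_frm[of "t/2^k" T f] q t G(2) by (intro mult_left_mono) auto
    then show ?thesis using dq_diff_sg_le[OF t True s f G] by linarith
  next
    case False
    have "0 \<le> G * (q - dq T (t/2^n) f f)"
      using dq_le_frm[of "t/2^n" T f] q t G(2) by (intro mult_nonneg_nonneg) auto
    then show ?thesis using dq_dyadic_mono[OF sg t sg_in[OF sg s f], of k n] False by simp
  qed
qed

end

section \<open>Uniqueness of the semigroup belonging to a form\<close>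

context
  fixes T S assumes T: "sg T" and S: "sg S" and eq: "\<And>f. f \<in> V \<Longrightarrow> frm T f = frm S f"
begin

text \<open>By polarisation a mixed quotient is a combination of the quotients at
  \<open>u + z\<close>, \<open>u\<close> and \<open>z\<close>, and these converge to form values
  that \<open>T\<close> and \<open>S\<close> share.\<close>

lemma dq_polar_tendsto:
  assumes t: "0 < t" and V: "u \<in> V" "z \<in> V" and fin: "frm T u = ereal qu" "frm T z = ereal qz"
  shows "(\<lambda>k. dq T (t/2^k) u z - dq S (t/2^k) u z) \<longlonglongrightarrow> 0"
proof -
  define p where "p = lc 1 u 1 z" define m where "m = lc 1 u (-1) z"
  have pm: "p \<in> V" "m \<in> V" using V by (auto simp: p_def m_def lc_in)
  have exp: "dq R e p p = dq R e u u + 2 * dq R e u z + dq R e z z"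
       "dq R e m m = dq R e u u - 2 * dq R e u z + dq R e z z" if R: "sg R" "0 < e" for R e
  proof -
    have *: "dq R e h (lc 1 u b z) = dq R e h u + b * dq R e h z" if "h \<in> V" for h b
      using dq_lc[OF R V that, of 1 b] dq_sym[OF R that V(1)] dq_sym[OF R that V(2)]
        dq_sym[OF R that lc_in[OF V, of 1 b]] by simp
    show "dq R e p p = dq R e u u + 2 * dq R e u z + dq R e z z"
       "dq R e m m = dq R e u u - 2 * dq R e u z + dq R e z z"
      using dq_lc[OF R V, of _ 1] *[of u] *[of z] dq_sym[OF R V] pm V
      unfolding p_def m_def by (simp_all add: lc_in *)
  qed
  \<comment> \<open>Finiteness of the form at the sum comes from the parallelogram identity; the
    quotients at \<open>m = u - z\<close> are bounded below by the one at the coarsest scale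
    \<open>t\<close>.\<close>
  have "frm T p \<le> ereal (2 * qu + 2 * qz - dq T t m m)"
  proof (rule frm_le_if_dyadic[OF T t pm(1)])
    fix n
    have "dq T (t/2^n) u u \<le> qu" "dq T (t/2^n) z z \<le> qz"
      using dq_le_frm[of "t/2^n" T u] dq_le_frm[of "t/2^n" T z] fin t by auto
    moreover have "dq T t m m \<le> dq T (t/2^n) m m"
      using dq_dyadic_mono[OF T t pm(2), of 0 n] by simp
    moreover have "0 < t/2^n" using t by simp
    ultimately show "dq T (t/2^n) p p \<le> 2 * qu + 2 * qz - dq T t m m"
      using exp[OF T, of "t/2^n"] by linarith
  qed
  then obtain qp where qp: "frm T p = ereal qp" using frm_ne_minus_inf[of T p] by (cases "frm T p") auto
  have l: "(\<lambda>k. dq R (t/2^k) u z) \<longlonglongrightarrow> (qp - qu - qz) / 2" if R: "sg R"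
    "frm R p = ereal qp" "frm R u = ereal qu" "frm R z = ereal qz" for R
  proof -
    have "(\<lambda>k. (dq R (t/2^k) p p - dq R (t/2^k) u u - dq R (t/2^k) z z) / 2) \<longlonglongrightarrow> (qp - qu - qz) / 2"
      using R pm V by (intro tendsto_intros dq_dyadic_tendsto[OF _ t]) auto
    then show ?thesis using exp[OF R(1)] t by simp
  qed
  have "(\<lambda>k. dq T (t/2^k) u z - dq S (t/2^k) u z) \<longlonglongrightarrow> (qp - qu - qz) / 2 - (qp - qu - qz) / 2"
    by (intro tendsto_diff l) (use T S qp fin eq pm V in auto)
  then show ?thesis by simp
qed

text \<open>Both quotients are pushed from scale \<open>n\<close> to a finer scale \<open>k\<close>,
  at a cost given by the Cauchy-Schwarz inequality for the difference form. In the limit of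
  \<open>k\<close> the two semigroups agree.\<close>

lemma dq_diff_le:
  assumes t: "0 < t" and V: "u \<in> V" "z \<in> V" and fin: "frm T u = ereal qu" "frm T z = ereal qz"
  shows "\<bar>dq T (t/2^n) u z - dq S (t/2^n) u z\<bar> \<le>
     sqrt ((qu - dq T (t/2^n) u u) * (qz - dq T (t/2^n) z z)) +
     sqrt ((qu - dq S (t/2^n) u u) * (qz - dq S (t/2^n) z z))"
proof -
  have one: "\<bar>dq R (t/2^k) u z - dq R (t/2^n) u z\<bar> \<le>
      sqrt ((qu - dq R (t/2^n) u u) * (qz - dq R (t/2^n) z z))"
    if R: "sg R" "frm R u = ereal qu" "frm R z = ereal qz" "n \<le> k" for R k
  proof -
    have "(dq R (t/2^k) u z - dq R (t/2^n) u z)\<^sup>2 \<le>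
       (dq R (t/2^k) u u - dq R (t/2^n) u u) * (dq R (t/2^k) z z - dq R (t/2^n) z z)"
      by (rule dq_diff_Cauchy_Schwarz[OF R(1) t R(4) V])
    also have "\<dots> \<le> (qu - dq R (t/2^n) u u) * (qz - dq R (t/2^n) z z)"
      using dq_le_frm[of "t/2^k" R u] dq_le_frm[of "t/2^n" R u] dq_le_frm[of "t/2^k" R z]
        dq_dyadic_mono[OF R(1) t V(1) R(4)] dq_dyadic_mono[OF R(1) t V(2) R(4)] R(2,3) t
      by (intro mult_mono) auto
    finally show ?thesis using real_le_rsqrt[of "\<bar>dq R (t/2^k) u z - dq R (t/2^n) u z\<bar>"] by simp
  qed
  define c where "c = sqrt ((qu - dq T (t/2^n) u u) * (qz - dq T (t/2^n) z z)) +
     sqrt ((qu - dq S (t/2^n) u u) * (qz - dq S (t/2^n) z z))"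
  have "\<bar>dq T (t/2^n) u z - dq S (t/2^n) u z\<bar> \<le> c + \<bar>dq T (t/2^k) u z - dq S (t/2^k) u z\<bar>" if "n \<le> k" for k
    using one[OF T fin that] one[OF S _ _ that] fin eq V unfolding c_def by fastforce
  moreover have "(\<lambda>k. c + \<bar>dq T (t/2^k) u z - dq S (t/2^k) u z\<bar>) \<longlonglongrightarrow> c + \<bar>0\<bar>"
    by (intro tendsto_intros dq_polar_tendsto[OF t V fin])
  ultimately have "\<bar>dq T (t/2^n) u z - dq S (t/2^n) u z\<bar> \<le> c"
    using LIMSEQ_le_const[of "\<lambda>k. c + \<bar>dq T (t/2^k) u z - dq S (t/2^k) u z\<bar>" c] by auto
  then show ?thesis by (simp add: c_def)
qed

end

text \<open>The orbit of \<open>T\<close> is measured against the quotients of the other semigroup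
  \<open>S\<close>. Nothing makes this excess small, but a bound uniform in \<open>n\<close> and
  \<open>j\<close> suffices, since it is always multiplied by an excess that does become
  small.\<close>

lemma sg_energy_bound:
  assumes T: "sg T" and S: "sg S" and t: "0 < t" and f: "f \<in> V" and q: "frm T f = ereal q"
  obtains Z where "\<And>n j. j \<le> 2^n \<Longrightarrow> \<exists>q'. frm T (T (real j * (t/2^n)) f) = ereal q' \<and>
     q' - dq S (t/2^n) (T (real j * (t/2^n)) f) (T (real j * (t/2^n)) f) \<le> Z"
proof -
  obtain G where G: "1 \<le> G"
    "\<And>n j f. f \<in> V \<Longrightarrow> j \<le> 2^n \<Longrightarrow> B (T (real j * (t/2^n)) f) (T (real j * (t/2^n)) f) \<le> G * B f f"
    using sg_dyadic_bound[OF T t] by blast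
  obtain H where H: "\<And>f. f \<in> V \<Longrightarrow> B (S t f) (S t f) \<le> H * B f f"
    using sg_bdd[OF S, of t] t by auto
  define Z where "Z = G * B f f / t + G * (q - dq T t f f) + (\<bar>H\<bar> + 1) * (G * B f f) / t"
  show thesis
  proof (rule that[of Z])
    fix n j assume j: "j \<le> (2::nat)^n"
    define u where "u = T (real j * (t/2^n)) f"
    have u: "u \<in> V" unfolding u_def using t f sg_in[OF T] by simp
    have Bu: "B u u \<le> G * B f f" unfolding u_def using G(2)[OF f j] .
    have fr: "frm T u \<le> ereal (dq T t u u + G * (q - dq T t f f))"
      unfolding u_def using frm_sg_finite[OF T t _ f _ G(1) q, of "real j * (t/2^n)" 0] G(2) j t by simp
    then obtain q' where q': "frm T u = ereal q'" using frm_ne_minus_inf[of T u] by (cases "frm T u") auto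
    have "q' \<le> dq T t u u + G * (q - dq T t f f)" using fr q' by simp
    moreover have "dq T t u u \<le> G * B f f / t"
      using dq_le_norm[OF T t u] Bu t by (meson divide_right_mono less_imp_le order_trans)
    moreover have "- dq S (t/2^n) u u \<le> - dq S t u u" using dq_dyadic_mono[OF S t u, of 0 n] by simp
    moreover have "- dq S t u u \<le> (\<bar>H\<bar> + 1) * B u u / t"
      using minus_dq_le_norm[OF S t u, of "\<bar>H\<bar>"] H[OF u] B_nonneg[OF u]
      by (meson abs_ge_self mult_right_mono order_trans)
    moreover have "(\<bar>H\<bar> + 1) * B u u / t \<le> (\<bar>H\<bar> + 1) * (G * B f f) / t"
      using Bu t by (intro divide_right_mono mult_left_mono) auto
    ultimately have "q' - dq S (t/2^n) u u \<le> Z" by (simp add: Z_def)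
    then show "\<exists>q'. frm T (T (real j * (t/2^n)) f) = ereal q' \<and>
     q' - dq S (t/2^n) (T (real j * (t/2^n)) f) (T (real j * (t/2^n)) f) \<le> Z"
      using q' unfolding u_def by blast
  qed
qed

text \<open>\<open>B (T t f) g - B f (S t g)\<close> telescopes over the products
  \<open>T (j e) S ((2^n - j) e)\<close> with \<open>e = t/2^n\<close>. Each of the
  \<open>2^n\<close> steps equals \<open>e\<close> times a difference of mixed quotients, and
  \<open>dq_diff_le\<close> makes that difference small uniformly in \<open>j\<close>.\<close>

lemma sg_unique_weak:
  assumes T: "sg T" and S: "sg S" and eq: "\<And>f. f \<in> V \<Longrightarrow> frm T f = frm S f" and t: "0 < t"
    and f: "f \<in> V" "frm T f = ereal qf" and g: "g \<in> V" "frm T g = ereal qg"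
  shows "B (T t f) g = B (S t f) g"
proof -
  obtain G where G: "1 \<le> G"
    "\<And>n j f. f \<in> V \<Longrightarrow> j \<le> 2^n \<Longrightarrow> B (T (real j * (t/2^n)) f) (T (real j * (t/2^n)) f) \<le> G * B f f"
    using sg_dyadic_bound[OF T t] by blast
  obtain H where H: "1 \<le> H"
    "\<And>n j f. f \<in> V \<Longrightarrow> j \<le> 2^n \<Longrightarrow> B (S (real j * (t/2^n)) f) (S (real j * (t/2^n)) f) \<le> H * B f f"
    using sg_dyadic_bound[OF S t] by blast
  have gS: "frm S g = ereal qg" using g eq by simp
  obtain U where U: "\<And>n j. j \<le> 2^n \<Longrightarrow> \<exists>q'. frm T (T (real j * (t/2^n)) f) = ereal q' \<and>
     q' - dq S (t/2^n) (T (real j * (t/2^n)) f) (T (real j * (t/2^n)) f) \<le> U"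
    using sg_energy_bound[OF T S t f] by blast
  obtain Z where Z: "\<And>n j. j \<le> 2^n \<Longrightarrow> \<exists>q'. frm S (S (real j * (t/2^n)) g) = ereal q' \<and>
     q' - dq T (t/2^n) (S (real j * (t/2^n)) g) (S (real j * (t/2^n)) g) \<le> Z"
    using sg_energy_bound[OF S T t g(1) gS] by blast
  \<comment> \<open>Bounds for the excess along the two orbits, each relative to its own semigroup;
    they tend to 0 with \<open>n\<close>, because the dyadic quotients converge to the form values.
    The bounds \<open>U\<close> and \<open>Z\<close> for the mixed excesses stay fixed.\<close>
  define a where "a n = G * (qf - dq T (t/2^n) f f)" for n
  define b where "b n = H * (qg - dq S (t/2^n) g g)" for n
  have bound: "\<bar>B (T t f) g - B f (S t g)\<bar> \<le> t * (sqrt (a n * Z) + sqrt (U * b n))" for n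
  proof -
    define e where "e = t/2^n"
    have e: "0 < e" "2^n * e = t" using t by (auto simp: e_def)
    define h where "h j = B (T (real j * e) f) (S (real (2^n - j) * e) g)" for j
    have step: "\<bar>h (Suc j) - h j\<bar> \<le> e * (sqrt (a n * Z) + sqrt (U * b n))" if j: "j < 2^n" for j
    proof -
      define i where "i = 2^n - Suc j"
      have i: "2^n - j = Suc i" "i \<le> 2^n" "j \<le> 2^n" using j by (auto simp: i_def)
      define u where "u = T (real j * e) f" define z where "z = S (real i * e) g"
      have uz: "u \<in> V" "z \<in> V" using e f g sg_in[OF T] sg_in[OF S] by (auto simp: u_def z_def)
      have "h (Suc j) = B (T e u) z"
        using sg_add[OF T, of e "real j * e" f z] e f uz
        by (simp add: h_def u_def z_def i_def algebra_simps)
      moreover have "h j = B u (S e z)"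
      proof -
        have eqt: "real (2^n - j) * e = e + real i * e" unfolding i(1) by (simp add: algebra_simps)
        have W: "S (e + real i * e) g \<in> V" "S e z \<in> V" using e g uz sg_in[OF S] by auto
        have "h j = B u (S (e + real i * e) g)" unfolding h_def eqt u_def ..
        also have "\<dots> = B (S (e + real i * e) g) u" by (rule B_sym[OF uz(1) W(1)])
        also have "\<dots> = B (S e z) u" unfolding z_def by (rule sg_add[OF S]) (use e g uz in auto)
        also have "\<dots> = B u (S e z)" by (rule B_sym[OF W(2) uz(1)])
        finally show ?thesis .
      qed
      moreover have "B u (S e z) = B (S e u) z" using sg_sym[OF S] uz e by simp
      ultimately have "h (Suc j) - h j = e * (dq S e u z - dq T e u z)"
        using e by (simp add: dq_def right_diff_distrib diff_divide_distrib)
      then have hd: "\<bar>h (Suc j) - h j\<bar> = e * \<bar>dq T e u z - dq S e u z\<bar>"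
        using e by (simp add: abs_mult abs_minus_commute)
      obtain qu where qu: "frm T u = ereal qu" "qu - dq S e u u \<le> U"
        using U[OF i(3)] unfolding u_def e_def by blast
      obtain qz where qz: "frm S z = ereal qz" "qz - dq T e z z \<le> Z"
        using Z[OF i(2)] unfolding z_def e_def by blast
      have qzT: "frm T z = ereal qz" using eq uz qz by simp
      have quS: "frm S u = ereal qu" using eq uz qu by simp
      have "frm T u \<le> ereal (dq T e u u + a n)"
        unfolding u_def a_def e_def using frm_sg_finite[OF T t _ f(1) _ G(1) f(2)] G(2)[OF _ i(3)] t by simp
      then have au: "qu - dq T e u u \<le> a n" using qu by simp
      have "frm S z \<le> ereal (dq S e z z + b n)"
        unfolding z_def b_def e_def using frm_sg_finite[OF S t _ g(1) _ H(1) gS] H(2)[OF _ i(2)] t by simp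
      then have bz: "qz - dq S e z z \<le> b n" using qz by simp
      have nn: "0 \<le> qu - dq T e u u" "0 \<le> qu - dq S e u u" "0 \<le> qz - dq T e z z" "0 \<le> qz - dq S e z z"
        using dq_le_frm[OF e(1), of T u] dq_le_frm[OF e(1), of S u] dq_le_frm[OF e(1), of T z]
          dq_le_frm[OF e(1), of S z] qu quS qz qzT by auto
      have "\<bar>dq T e u z - dq S e u z\<bar> \<le>
         sqrt ((qu - dq T e u u) * (qz - dq T e z z)) + sqrt ((qu - dq S e u u) * (qz - dq S e z z))"
        using dq_diff_le[OF T S eq t uz qu(1) qzT, of n] by (simp add: e_def)
      also have "\<dots> \<le> sqrt (a n * Z) + sqrt (U * b n)"
        using au bz qu(2) qz(2) nn by (intro add_mono real_sqrt_le_mono mult_mono) auto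
      finally show ?thesis unfolding hd using e by (intro mult_left_mono) auto
    qed
    have "B (T t f) g - B f (S t g) = h (2^n) - h 0"
      using e f g by (simp add: h_def sg_0[OF T] sg_0[OF S])
    also have "\<dots> = (\<Sum>j<2^n. h (Suc j) - h j)" by (simp add: sum_lessThan_telescope)
    finally have tele: "B (T t f) g - B f (S t g) = (\<Sum>j<2^n. h (Suc j) - h j)" .
    have "\<bar>B (T t f) g - B f (S t g)\<bar> \<le> (\<Sum>j<2^n. \<bar>h (Suc j) - h j\<bar>)"
      unfolding tele by (rule sum_abs)
    also have "\<dots> \<le> (\<Sum>j<(2::nat)^n. e * (sqrt (a n * Z) + sqrt (U * b n)))"
      using step by (intro sum_mono) auto
    also have "\<dots> = t * (sqrt (a n * Z) + sqrt (U * b n))" using e by (simp flip: mult.assoc)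
    finally show ?thesis .
  qed
  have "a \<longlonglongrightarrow> G * (qf - qf)" unfolding a_def by (intro tendsto_intros dq_dyadic_tendsto[OF T t f])
  moreover have "b \<longlonglongrightarrow> H * (qg - qg)" unfolding b_def by (intro tendsto_intros dq_dyadic_tendsto[OF S t g(1) gS])
  ultimately have "(\<lambda>n. t * (sqrt (a n * Z) + sqrt (U * b n))) \<longlonglongrightarrow>
     t * (sqrt (G * (qf - qf) * Z) + sqrt (U * (H * (qg - qg))))"
    by (intro tendsto_intros)
  then have "(\<lambda>n. t * (sqrt (a n * Z) + sqrt (U * b n))) \<longlonglongrightarrow> 0" by simp
  then have "\<bar>B (T t f) g - B f (S t g)\<bar> \<le> 0" using bound LIMSEQ_le_const by blast
  then show ?thesis using sg_sym[OF S, of t f g] f g t by simp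
qed

text \<open>Along \<open>1/2^n\<close> both sequences of quotients are monotone, so a limit of their
  difference transfers finiteness of the form in either direction as well as its value.\<close>

lemma frm_add:
  assumes S: "sg S" and R: "sg R" and f: "f \<in> V"
    and lim: "((\<lambda>e. dq S e f f - dq R e f f) \<longlongrightarrow> c) (at_right 0)"
  shows "frm S f = frm R f + ereal c"
proof -
  have "filterlim (\<lambda>n. 1/2^n :: real) (at_right 0) sequentially"
    unfolding filterlim_at using LIMSEQ_power_zero[of "1/2 :: real"]
    by (auto simp: power_divide intro!: always_eventually)
  then have d: "(\<lambda>n. dq S (1/2^n) f f - dq R (1/2^n) f f) \<longlonglongrightarrow> c"
    by (rule filterlim_compose[OF lim])
  have fin: "frm Y f \<le> ereal (r + c')"
    if X: "sg X" and Y: "sg Y" and d: "(\<lambda>n. dq Y (1/2^n) f f - dq X (1/2^n) f f) \<longlonglongrightarrow> c'" and r: "frm X f = ereal r"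
    for X Y c' r
  proof (rule frm_le_if_dyadic[OF Y zero_less_one f])
    have "(\<lambda>n. dq X (1/2^n) f f + (dq Y (1/2^n) f f - dq X (1/2^n) f f)) \<longlonglongrightarrow> r + c'"
      by (intro tendsto_add dq_dyadic_tendsto[OF X zero_less_one f r] d)
    then have l: "(\<lambda>n. dq Y (1/2^n) f f) \<longlonglongrightarrow> r + c'" by simp
    show "dq Y (1/2^n) f f \<le> r + c'" for n
      by (rule incseq_le[OF _ l]) (use dq_dyadic_mono[OF Y zero_less_one f] in \<open>auto simp: incseq_def\<close>)
  qed
  have d': "(\<lambda>n. dq R (1/2^n) f f - dq S (1/2^n) f f) \<longlonglongrightarrow> - c"
    using tendsto_minus[OF d] by simp
  show ?thesis
  proof (cases "frm R f")
    case (real r)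
    then have "frm S f \<le> ereal (r + c)" by (rule fin[OF R S d])
    then obtain q where q: "frm S f = ereal q" "q \<le> r + c" using frm_ne_minus_inf[of S f] by (cases "frm S f") auto
    have "r \<le> q - c" using fin[OF S R d' q(1)] real by simp
    then show ?thesis using real q by simp
  next
    case PInf
    have "frm S f = \<infinity>"
    proof (cases "frm S f")
      case (real q) then show ?thesis using fin[OF S R d' real] PInf by simp
    qed (use frm_ne_minus_inf in auto)
    then show ?thesis using PInf by simp
  qed (use frm_ne_minus_inf in auto)
qed

text \<open>Time \<open>r\<close> is cut into \<open>N\<close> steps so short that the factor
  \<open>1 - 2 (r/N) C\<close> is at least \<open>1/2\<close>; every step then costs at most a
  factor 2.\<close>

lemma sg_growth:
  assumes T: "sg T" and lb: "\<And>s f. 0 \<le> s \<Longrightarrow> f \<in> V \<Longrightarrow> B (T s f) (T s f) * (1 - 2 * s * C) \<le> B f f"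
    and N: "0 < N" "4 * r * C \<le> real N" and r: "0 \<le> r" and f: "f \<in> V"
  shows "B (T r f) (T r f) \<le> 2^N * B f f"
proof -
  have "B (T (r/N) g) (T (r/N) g) \<le> 2 * B g g" if g: "g \<in> V" for g
  proof -
    have "1/2 \<le> 1 - 2 * (r/N) * C" using N by (simp add: field_simps)
    then have "B (T (r/N) g) (T (r/N) g) * (1/2) \<le> B (T (r/N) g) (T (r/N) g) * (1 - 2 * (r/N) * C)"
      using B_nonneg[OF sg_in[OF T _ g]] r by (intro mult_left_mono) auto
    moreover have "0 \<le> r/N" using r by simp
    ultimately show ?thesis using lb[of "r/N" g, OF _ g] by linarith
  qed
  then show ?thesis using sg_pow_bound[OF T _ _ _ f, of "r/N" 2 N] N r by simp
qed

text \<open>All algebraic axioms pass to the limit at fixed times; strong continuity at 0 does not.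
  For \<open>g\<close> with finite form, \<open>nd (S s g) g\<close> is controlled by
  \<open>s\<close> times the form value plus the growth of the norm, and density together with
  uniform boundedness does the rest.\<close>

lemma sg_limitI:
  assumes Sk: "\<And>k. sg (Sk k)" and S0: "\<And>f. f \<in> V \<Longrightarrow> S 0 f = f"
    and Sin: "\<And>t f. 0 < t \<Longrightarrow> f \<in> V \<Longrightarrow> S t f \<in> V"
    and conv: "\<And>t f. 0 < t \<Longrightarrow> f \<in> V \<Longrightarrow> (\<lambda>k. nd (Sk k t f) (S t f)) \<longlonglongrightarrow> 0"
    and lb: "\<And>k s f. 0 \<le> s \<Longrightarrow> f \<in> V \<Longrightarrow> B (Sk k s f) (Sk k s f) * (1 - 2 * s * C) \<le> B f f" and C: "0 \<le> C"
    and dense: "\<And>f e. f \<in> V \<Longrightarrow> 0 < e \<Longrightarrow> \<exists>g\<in>V. nd g f < e \<and> frm S g < \<infinity>"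
  shows "sg S" and "\<And>s f. 0 \<le> s \<Longrightarrow> f \<in> V \<Longrightarrow> B (S s f) (S s f) * (1 - 2 * s * C) \<le> B f f"
proof -
  have Sin': "S t f \<in> V" if "0 \<le> t" "f \<in> V" for t f using Sin S0 that by (cases "t = 0") auto
  have Skin: "Sk k t f \<in> V" if "0 \<le> t" "f \<in> V" for k t f by (rule sg_in[OF Sk that])
  have conv': "(\<lambda>k. nd (Sk k t f) (S t f)) \<longlonglongrightarrow> 0" if "0 \<le> t" "f \<in> V" for t f
    using conv[of t f] that S0[OF that(2)] sg_0[OF Sk that(2)] by (cases "t = 0") (auto simp: nd_refl)
  have BB: "(\<lambda>k. B (Sk k t f) (Sk k s g)) \<longlonglongrightarrow> B (S t f) (S s g)"
    if "0 \<le> t" "0 \<le> s" "f \<in> V" "g \<in> V" for t s f g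
    using that by (intro tendsto_B conv' always_eventually allI Skin Sin')
  have Bl: "(\<lambda>k. B (Sk k t f) g) \<longlonglongrightarrow> B (S t f) g" if "0 \<le> t" "f \<in> V" "g \<in> V" for t f g
    using that by (intro tendsto_B_left conv' always_eventually allI Skin Sin')
  show lbS: "B (S s f) (S s f) * (1 - 2 * s * C) \<le> B f f" if "0 \<le> s" "f \<in> V" for s f
    by (rule LIMSEQ_le_const2[OF tendsto_mult_right[OF BB]]) (use that lb in auto)
  have sym: "B f (S t g) = B (S t f) g" if "0 \<le> t" "f \<in> V" "g \<in> V" for t f g
  proof -
    have "(\<lambda>k. B (Sk k t g) f) \<longlonglongrightarrow> B (S t g) f" using that by (intro Bl)
    moreover have "B (Sk k t g) f = B (Sk k t f) g" for k
      using sg_sym[OF Sk that, of k] B_sym[OF that(2) Skin[OF that(1,3), of k]] by simp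
    ultimately have "(\<lambda>k. B (Sk k t f) g) \<longlonglongrightarrow> B (S t g) f" by simp
    then have "B (S t g) f = B (S t f) g" using LIMSEQ_unique Bl[OF that] by blast
    then show ?thesis using B_sym[OF that(2) Sin'[OF that(1,3)]] by simp
  qed
  have add: "B (S (t + s) f) g = B (S t (S s f)) g" if "0 \<le> t" "0 \<le> s" "f \<in> V" "g \<in> V" for t s f g
  proof -
    have "(\<lambda>k. B (Sk k s f) (Sk k t g)) \<longlonglongrightarrow> B (S s f) (S t g)" using that by (intro BB)
    moreover have "B (Sk k s f) (Sk k t g) = B (Sk k (t + s) f) g" for k
      using sg_mult[OF Sk that(2,1,3,4)] by (simp add: add.commute)
    ultimately have "(\<lambda>k. B (Sk k (t + s) f) g) \<longlonglongrightarrow> B (S s f) (S t g)" by simp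
    moreover have "(\<lambda>k. B (Sk k (t + s) f) g) \<longlonglongrightarrow> B (S (t + s) f) g" using that by (intro Bl) auto
    ultimately have "B (S (t + s) f) g = B (S s f) (S t g)" using LIMSEQ_unique by blast
    then show ?thesis using sym[OF that(1) Sin'[OF that(2,3)] that(4)] by simp
  qed
  have bdd: "\<exists>K. \<forall>f\<in>V. B (S t f) (S t f) \<le> K * B f f" if t: "0 \<le> t" for t
  proof (intro exI ballI)
    define N where "N = nat \<lceil>4 * t * C\<rceil> + 1"
    have N: "0 < N" "4 * t * C \<le> real N" unfolding N_def by linarith+
    fix f assume f: "f \<in> V"
    show "B (S t f) (S t f) \<le> 2^N * B f f"
      by (rule LIMSEQ_le_const2[OF BB[OF t t f f]]) (use sg_growth[OF Sk lb N t f] in auto)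
  qed
  have cont: "((\<lambda>t. nd (S t f) f) \<longlongrightarrow> 0) (at_right 0)" if f: "f \<in> V" for f
  proof (rule tendstoI)
    \<comment> \<open>Two applications of \<open>nd_triangle\<close> and the bound 2 for short times
      give three terms with weight 4, each below \<open>e/16\<close>.\<close>
    fix e :: real assume e: "0 < e"
    obtain g where g: "g \<in> V" "nd g f < e/16" "frm S g < \<infinity>" using dense[OF f, of "e/16"] e by auto
    obtain q where q: "frm S g = ereal q" using g(3) frm_ne_minus_inf[of S g] by (cases "frm S g") auto
    \<comment> \<open>The first summand is the possible growth of the norm; the second one is
      \<open>2 (B g g - B (S s g) g)\<close>, estimated by the form value \<open>q\<close>.\<close>
    define h where "h s = (1 / (1 - 2 * s * C) - 1) * B g g + 2 * s * q" for s
    have "(h \<longlongrightarrow> (1 / (1 - 2 * 0 * C) - 1) * B g g + 2 * 0 * q) (at_right 0)"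
      unfolding h_def by (intro tendsto_intros) auto
    then have "(h \<longlongrightarrow> 0) (at_right 0)" by simp
    then have "\<forall>\<^sub>F s in at_right 0. h s < e/16" by (rule order_tendstoD) (use e in auto)
    moreover have "((\<lambda>s. 2 * s * C) \<longlongrightarrow> 2 * 0 * C) (at_right 0)" by (intro tendsto_intros)
    then have "\<forall>\<^sub>F s in at_right 0. 2 * s * C < 1/2" by (rule order_tendstoD) auto
    moreover have "\<forall>\<^sub>F s in at_right (0::real). 0 < s" by (simp add: eventually_at_right_less)
    ultimately show "\<forall>\<^sub>F s in at_right 0. dist (nd (S s f) f) 0 < e"
    proof eventually_elim
      case (elim s)
      have s: "0 \<le> s" using elim by simp
      note V = Sin'[OF s f] Sin'[OF s g(1)]
      have b2: "B (S s u) (S s u) \<le> 2 * B u u" if u: "u \<in> V" for u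
      proof -
        have "B (S s u) (S s u) * (1/2) \<le> B (S s u) (S s u) * (1 - 2 * s * C)"
          using elim B_nonneg[OF Sin'[OF s u]] by (intro mult_left_mono) auto
        then show ?thesis using lbS[OF s u] by simp
      qed
      have "nd (S s f) (S s g) \<le> 2 * nd f g"
        by (rule nd_sym_le) (use s f g Sin' sym b2 in auto)
      moreover have "nd (S s g) g \<le> h s"
      proof -
        have "B (S s g) (S s g) \<le> B g g / (1 - 2 * s * C)"
          using lbS[OF s g(1)] elim by (simp add: pos_le_divide_eq)
        moreover have "dq S s g g \<le> q" using dq_le_frm[of s S g] elim q by simp
        then have "B g g - B (S s g) g \<le> s * q" using elim by (simp add: dq_def pos_divide_le_eq mult.commute)
        ultimately show ?thesis by (simp add: nd_def h_def left_diff_distrib)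
      qed
      moreover have "nd (S s f) f \<le> 2 * nd (S s f) (S s g) + 2 * nd (S s g) f"
        by (rule nd_triangle) (use V f g in auto)
      moreover have "nd (S s g) f \<le> 2 * nd (S s g) g + 2 * nd g f"
        by (rule nd_triangle) (use V f g in auto)
      moreover have "nd f g = nd g f" by (rule nd_commute) (use f g in auto)
      ultimately have "nd (S s f) f < e" using elim g(2) e by linarith
      then show ?case using nd_nonneg[OF V(1) f] by simp
    qed
  qed
  show "sg S" unfolding sg_def by (intro conjI allI ballI impI S0 Sin' sym add bdd cont)
qed

text \<open>\<open>sg_unique_weak\<close> requires finite forms. By \<open>frm_sg_le\<close> every
  \<open>T s f\<close> with \<open>0 < s\<close> has finite form, so both arguments are smoothed by
  \<open>T s\<close> and then \<open>s\<close> tends to 0.\<close>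

theorem sg_unique:
  assumes T: "sg T" and S: "sg S" and eq: "\<And>f. f \<in> V \<Longrightarrow> frm T f = frm S f" and t: "0 < t"
    and f: "f \<in> V"
  shows "nd (T t f) (S t f) = 0"
proof -
  have weak: "B (T t f) g = B (S t f) g" if g: "g \<in> V" for g
  proof -
    have fin: "\<exists>q. frm T (T s h) = ereal q" if "0 < s" "h \<in> V" for s h
      using frm_sg_le[OF T that] frm_ne_minus_inf[of T "T s h"] by (cases "frm T (T s h)") auto
    have ev: "\<forall>\<^sub>F s in at_right 0. T s h \<in> V" if "h \<in> V" for h
      using sg_in[OF T _ that] by (intro eventually_at_rightI[of 0 1]) auto
    have lim: "((\<lambda>s. B (R t (T s f)) (T s g)) \<longlongrightarrow> B (R t f) g) (at_right 0)" if R: "sg R" for R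
    proof -
      obtain C where C: "\<And>g. g \<in> V \<Longrightarrow> B (R t g) (R t g) \<le> C * B g g"
        using sg_bdd[OF R, of t] t by auto
      have "((\<lambda>s. nd (R t (T s f)) (R t f)) \<longlongrightarrow> 0) (at_right 0)"
      proof (rule tendsto_0_le[OF sg_cont[OF T f], of _ C])
        show "\<forall>\<^sub>F s in at_right 0. norm (nd (R t (T s f)) (R t f)) \<le> norm (nd (T s f) f) * C"
          using ev[OF f]
        proof eventually_elim
          case (elim s)
          show ?case using sg_nd_le[OF R _ C elim f] nd_nonneg elim f sg_in[OF R] t by (simp add: mult.commute)
        qed
      qed
      then show ?thesis
      proof (rule tendsto_B[OF _ sg_cont[OF T g]])
        show "\<forall>\<^sub>F s in at_right 0. R t (T s f) \<in> V"
          using ev[OF f] by eventually_elim (use sg_in[OF R] t in auto)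
        show "R t f \<in> V" using sg_in[OF R] t f by simp
        show "\<forall>\<^sub>F s in at_right 0. T s g \<in> V" by (rule ev[OF g])
        show "g \<in> V" by (rule g)
      qed
    qed
    have "\<forall>\<^sub>F s in at_right 0. B (T t (T s f)) (T s g) = B (S t (T s f)) (T s g)"
    proof (rule eventually_at_rightI[of 0 1])
      fix s :: real assume "s \<in> {0<..<1}"
      then have s: "0 < s" by simp
      show "B (T t (T s f)) (T s g) = B (S t (T s f)) (T s g)"
        using fin[OF s f] fin[OF s g] sg_unique_weak[OF T S eq t] sg_in[OF T] s f g by (metis less_imp_le)
    qed simp
    then have "((\<lambda>s. B (S t (T s f)) (T s g)) \<longlongrightarrow> B (T t f) g) (at_right 0)"
      using lim[OF T] by (simp add: tendsto_cong)
    then show ?thesis using lim[OF S] tendsto_unique by (meson trivial_limit_at_right_real)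
  qed
  have V: "T t f \<in> V" "S t f \<in> V" using sg_in[OF T] sg_in[OF S] t f by auto
  show ?thesis using weak[OF V(1)] weak[OF V(2)] B_sym[OF V] by (simp add: nd_def)
qed

end

section \<open>Perturbation series of a heat kernel\<close>

text \<open>No convergence is assumed: sums of extended nonnegative reals can be rearranged
  freely.\<close>

lemma ennreal_Cauchy_product:
  fixes a b :: "nat \<Rightarrow> ennreal"
  shows "(\<Sum>i. a i) * (\<Sum>j. b j) = (\<Sum>k. \<Sum>i\<le>k. a i * b (k - i))"
proof -
  define c where "c i k = (if i \<le> k then a i * b (k - i) else 0)" for i k
  have "(\<Sum>k. \<Sum>i\<le>k. a i * b (k - i)) = (\<Sum>k. \<Sum>i. c i k)"
  proof (rule suminf_cong)
    fix k
    have "(\<Sum>i. c i k) = (\<Sum>i\<in>{..k}. c i k)" by (rule suminf_finite) (auto simp: c_def)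
    then show "(\<Sum>i\<le>k. a i * b (k - i)) = (\<Sum>i. c i k)" by (simp add: c_def)
  qed
  also have "\<dots> = (\<Sum>i. \<Sum>k. c i k)"
    using nn_integral_suminf[of "\<lambda>i k. c i k" "count_space UNIV"]
    by (simp add: nn_integral_count_space_nat)
  also have "\<dots> = (\<Sum>i. a i * (\<Sum>j. b j))"
  proof (rule suminf_cong)
    fix i
    have "(\<Sum>k. c i k) = (\<Sum>k. c i (k + i)) + (\<Sum>k<i. c i k)"
      by (rule suminf_offset) auto
    also have "(\<Sum>k<i. c i k) = 0" by (simp add: c_def)
    finally show "(\<Sum>k. c i k) = a i * (\<Sum>j. b j)" by (simp add: c_def)
  qed
  finally show ?thesis by simp
qed

text \<open>For \<open>0 \<le> s\<close> the volume of the simplex of \<open>j\<close> ordered times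
  in \<open>[0, s]\<close>, that is, the contribution of \<open>j\<close> insertions of the constant
  1.\<close>

definition tau :: "nat \<Rightarrow> real \<Rightarrow> ennreal" where "tau j s = ennreal (s^j / fact j)"

lemma tau_measurable [measurable]: "tau j \<in> borel_measurable borel"
  unfolding tau_def by measurable

text \<open>Written as a sum, since differences of extended nonnegative reals are truncated at
  0.\<close>

lemma nn_integral_tau:
  assumes "0 \<le> r" "r \<le> t"
  shows "tau (Suc j) r + (\<integral>\<^sup>+ s. tau j s * indicator {r<..<t} s \<partial>lborel) = tau (Suc j) t"
proof -
  have "(\<integral>\<^sup>+ s. tau j s * indicator {r<..<t} s \<partial>lborel) =
      (\<integral>\<^sup>+ s. ennreal (s^j / fact j) * indicator {r..t} s \<partial>lborel)"
    by (rule nn_integral_cong_AE)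
      (use AE_lborel_singleton[of r] AE_lborel_singleton[of t] in
        \<open>eventually_elim, auto simp: indicator_def tau_def\<close>)
  also have "\<dots> = ennreal (t^Suc j / fact (Suc j) - r^Suc j / fact (Suc j))"
  proof (rule nn_integral_FTC_Icc)
    fix x assume "x \<in> {r..t}"
    show "((\<lambda>x. x^Suc j / fact (Suc j)) has_real_derivative x^j / fact j) (at x)"
      by (auto intro!: derivative_eq_intros simp del: power_Suc)
  qed (use assms in auto)
  finally have I: "(\<integral>\<^sup>+ s. tau j s * indicator {r<..<t} s \<partial>lborel) =
      ennreal (t^Suc j / fact (Suc j) - r^Suc j / fact (Suc j))" .
  define a b where "a = r^Suc j / fact (Suc j)" and "b = t^Suc j / fact (Suc j)"
  have "0 \<le> a" "a \<le> b" unfolding a_def b_def using assms by (auto intro!: divide_right_mono power_mono simp del: power_Suc)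
  then have "ennreal a + ennreal (b - a) = ennreal b" by (simp flip: ennreal_plus)
  then show ?thesis unfolding I by (simp only: tau_def a_def b_def)
qed

text \<open>Setting the kernel to 0 at nonpositive times turns integrals over time simplices into
  integrals over the whole line, so that translations, reflections and Fubini's theorem need no
  bookkeeping of bounds. Values in \<open>[0, \<infinity>]\<close> make every integral
  meaningful.\<close>

locale heat_kernel = sigma_finite_measure M for M :: "'a measure" +
  fixes P :: "real \<Rightarrow> 'a \<Rightarrow> 'a \<Rightarrow> ennreal"
  assumes space_M: "space M = UNIV"
    and P_measurable: "(\<lambda>(t, x, y). P t x y) \<in> borel_measurable (borel \<Otimes>\<^sub>M M \<Otimes>\<^sub>M M)"
    and P_nonpos: "t \<le> 0 \<Longrightarrow> P t x y = 0"
    and P_CK: "0 < t \<Longrightarrow> 0 < s \<Longrightarrow> (\<integral>\<^sup>+ z. P t x z * P s z y \<partial>M) = P (t + s) x y"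
    and P_sym: "P t x y = P t y x"
    and P_sub: "(\<integral>\<^sup>+ y. P t x y \<partial>M) \<le> 1"
    and P_finite: "P t x y < \<infinity>"
begin

definition mk :: "(real \<Rightarrow> 'a \<Rightarrow> 'a \<Rightarrow> ennreal) \<Rightarrow> bool" where
  "mk f \<longleftrightarrow> (\<lambda>(t, x, y). f t x y) \<in> borel_measurable (borel \<Otimes>\<^sub>M M \<Otimes>\<^sub>M M)"

lemma mkD:
  assumes "mk f" "a \<in> measurable N borel" "b \<in> measurable N M" "c \<in> measurable N M"
  shows "(\<lambda>w. f (a w) (b w) (c w)) \<in> borel_measurable N"
proof -
  have "(\<lambda>w. (a w, b w, c w)) \<in> measurable N (borel \<Otimes>\<^sub>M M \<Otimes>\<^sub>M M)" using assms by measurable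
  from measurable_compose[OF this assms(1)[unfolded mk_def]] show ?thesis by simp
qed

lemma mk_P: "mk P" using P_measurable by (simp add: mk_def)

lemma const_measurable_M [measurable]: "(\<lambda>_. x) \<in> measurable N M"
  by (simp add: space_M)

lemmas P_meas [measurable (raw)] = mkD[OF mk_P]

sublocale lb: pair_sigma_finite "lborel :: real measure" M ..
sublocale MM: pair_sigma_finite M M ..
sublocale NN: pair_sigma_finite "(lborel :: real measure) \<Otimes>\<^sub>M M" "(lborel :: real measure) \<Otimes>\<^sub>M M"
  by (intro pair_sigma_finite.intro sigma_finite_pair_measure sigma_finite_measure_axioms
      sigma_finite_lborel)

lemma swap_MM:
  assumes "(\<lambda>(u, z). F u z) \<in> borel_measurable (M \<Otimes>\<^sub>M M)"
  shows "(\<integral>\<^sup>+ u. \<integral>\<^sup>+ z. F u z \<partial>M \<partial>M) = (\<integral>\<^sup>+ z. \<integral>\<^sup>+ u. F u z \<partial>M \<partial>M)"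
  using MM.Fubini'[OF assms] by simp

lemma swap_lM:
  fixes F :: "real \<Rightarrow> 'a \<Rightarrow> ennreal"
  assumes "(\<lambda>(s, z). F s z) \<in> borel_measurable (lborel \<Otimes>\<^sub>M M)"
  shows "(\<integral>\<^sup>+ s. \<integral>\<^sup>+ z. F s z \<partial>M \<partial>lborel) = (\<integral>\<^sup>+ z. \<integral>\<^sup>+ s. F s z \<partial>lborel \<partial>M)"
  using lb.Fubini'[OF assms] by simp

lemma swap_NN:
  fixes F :: "real \<Rightarrow> 'a \<Rightarrow> real \<Rightarrow> 'a \<Rightarrow> ennreal"
  assumes F: "(\<lambda>((s, u), (r, z)). F s u r z) \<in> borel_measurable ((lborel \<Otimes>\<^sub>M M) \<Otimes>\<^sub>M (lborel \<Otimes>\<^sub>M M))"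
  shows "(\<integral>\<^sup>+ s. \<integral>\<^sup>+ u. \<integral>\<^sup>+ r. \<integral>\<^sup>+ z. F s u r z \<partial>M \<partial>lborel \<partial>M \<partial>lborel) =
         (\<integral>\<^sup>+ r. \<integral>\<^sup>+ z. \<integral>\<^sup>+ s. \<integral>\<^sup>+ u. F s u r z \<partial>M \<partial>lborel \<partial>M \<partial>lborel)"
proof -
  define G :: "real \<times> 'a \<Rightarrow> real \<times> 'a \<Rightarrow> ennreal" where "G p q = F (fst p) (snd p) (fst q) (snd q)" for p q
  have G[measurable]: "(\<lambda>(p, q). G p q) \<in> borel_measurable ((lborel \<Otimes>\<^sub>M M) \<Otimes>\<^sub>M (lborel \<Otimes>\<^sub>M M))"
    using F by (simp add: G_def case_prod_beta')
  have Gp: "(\<lambda>q. G p q) \<in> borel_measurable (lborel \<Otimes>\<^sub>M M)"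
     "(\<lambda>q. G q p) \<in> borel_measurable (lborel \<Otimes>\<^sub>M M)" for p
    using measurable_Pair2[OF G, of p] measurable_Pair1[OF G, of p] space_M
    by (auto simp: space_pair_measure)
  have i1: "(\<integral>\<^sup>+ r. \<integral>\<^sup>+ z. H (r, z) \<partial>M \<partial>lborel) = integral\<^sup>N (lborel \<Otimes>\<^sub>M M) H"
    if "H \<in> borel_measurable (lborel \<Otimes>\<^sub>M M)" for H :: "real \<times> 'a \<Rightarrow> ennreal"
    using nn_integral_fst[OF that] by simp
  have e1: "(\<integral>\<^sup>+ r. \<integral>\<^sup>+ z. F s u r z \<partial>M \<partial>lborel) = (\<integral>\<^sup>+ q. G (s, u) q \<partial>(lborel \<Otimes>\<^sub>M M))" for s u
    using i1[OF Gp(1)[of "(s, u)"]] by (simp add: G_def)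
  have e2: "(\<integral>\<^sup>+ s. \<integral>\<^sup>+ u. F s u r z \<partial>M \<partial>lborel) = (\<integral>\<^sup>+ p. G p (r, z) \<partial>(lborel \<Otimes>\<^sub>M M))" for r z
    using i1[OF Gp(2)[of "(r, z)"]] by (simp add: G_def)
  have "(\<integral>\<^sup>+ s. \<integral>\<^sup>+ u. \<integral>\<^sup>+ r. \<integral>\<^sup>+ z. F s u r z \<partial>M \<partial>lborel \<partial>M \<partial>lborel) =
     (\<integral>\<^sup>+ s. \<integral>\<^sup>+ u. (\<integral>\<^sup>+ q. G (s, u) q \<partial>(lborel \<Otimes>\<^sub>M M)) \<partial>M \<partial>lborel)"
    unfolding e1 ..
  also have "\<dots> = (\<integral>\<^sup>+ p. \<integral>\<^sup>+ q. G p q \<partial>(lborel \<Otimes>\<^sub>M M) \<partial>(lborel \<Otimes>\<^sub>M M))"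
    by (rule i1[where H="\<lambda>p. \<integral>\<^sup>+ q. G p q \<partial>(lborel \<Otimes>\<^sub>M M)"]) measurable
  also have "\<dots> = (\<integral>\<^sup>+ q. \<integral>\<^sup>+ p. G p q \<partial>(lborel \<Otimes>\<^sub>M M) \<partial>(lborel \<Otimes>\<^sub>M M))"
    using NN.Fubini'[OF G] by simp
  also have "\<dots> = (\<integral>\<^sup>+ r. \<integral>\<^sup>+ z. (\<integral>\<^sup>+ p. G p (r, z) \<partial>(lborel \<Otimes>\<^sub>M M)) \<partial>M \<partial>lborel)"
    by (rule i1[where H="\<lambda>q. \<integral>\<^sup>+ p. G p q \<partial>(lborel \<Otimes>\<^sub>M M)", symmetric]) measurable
  also have "\<dots> = (\<integral>\<^sup>+ r. \<integral>\<^sup>+ z. \<integral>\<^sup>+ s. \<integral>\<^sup>+ u. F s u r z \<partial>M \<partial>lborel \<partial>M \<partial>lborel)"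
    unfolding e2 ..
  finally show ?thesis .
qed

text \<open>The Duhamel integral with one insertion of \<open>v\<close>. It extends over all
  \<open>s\<close>, but for kernels that vanish at nonpositive times only \<open>0 < s < t\<close>
  contributes; \<open>s\<close> is the time that remains after the insertion.\<close>

definition conv :: "('a \<Rightarrow> ennreal) \<Rightarrow> (real \<Rightarrow> 'a \<Rightarrow> 'a \<Rightarrow> ennreal) \<Rightarrow> (real \<Rightarrow> 'a \<Rightarrow> 'a \<Rightarrow> ennreal)
    \<Rightarrow> real \<Rightarrow> 'a \<Rightarrow> 'a \<Rightarrow> ennreal" where
  "conv v f g t x y = (\<integral>\<^sup>+ s. \<integral>\<^sup>+ z. f (t - s) x z * v z * g s z y \<partial>M \<partial>lborel)"

lemma mk_conv:
  assumes f: "mk f" and g: "mk g" and [measurable]: "v \<in> borel_measurable M"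
  shows "mk (conv v f g)"
proof -
  note mkD[OF f, measurable (raw)] mkD[OF g, measurable (raw)]
  show ?thesis unfolding mk_def conv_def by measurable
qed

lemma conv_assoc:
  assumes f: "mk f" and g: "mk g" and h: "mk h" and [measurable]: "v \<in> borel_measurable M" "u \<in> borel_measurable M"
  shows "conv v (conv u f g) h = conv u f (conv v g h)"
proof (intro ext)
  fix t x y
  note mkD[OF f, measurable (raw)] mkD[OF g, measurable (raw)] mkD[OF h, measurable (raw)]
  have "conv v (conv u f g) h t x y =
     (\<integral>\<^sup>+ s. \<integral>\<^sup>+ z. \<integral>\<^sup>+ r. \<integral>\<^sup>+ a. f (t - s - r) x a * u a * g r a z * (v z * h s z y) \<partial>M \<partial>lborel \<partial>M \<partial>lborel)"
    unfolding conv_def by (simp add: nn_integral_multc[symmetric] mult.assoc)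
  also have "\<dots> = (\<integral>\<^sup>+ s. \<integral>\<^sup>+ z. \<integral>\<^sup>+ r. \<integral>\<^sup>+ a. f (t - r) x a * u a * g (r - s) a z * (v z * h s z y) \<partial>M \<partial>lborel \<partial>M \<partial>lborel)"
  proof (rule nn_integral_cong, rule nn_integral_cong)
    fix s z
    show "(\<integral>\<^sup>+ r. \<integral>\<^sup>+ a. f (t - s - r) x a * u a * g r a z * (v z * h s z y) \<partial>M \<partial>lborel) =
       (\<integral>\<^sup>+ r. \<integral>\<^sup>+ a. f (t - r) x a * u a * g (r - s) a z * (v z * h s z y) \<partial>M \<partial>lborel)"
      by (subst nn_integral_real_affine[where c=1 and t="- s"])
        (auto simp: space_M algebra_simps)
  qed
  also have "\<dots> = (\<integral>\<^sup>+ r. \<integral>\<^sup>+ a. \<integral>\<^sup>+ s. \<integral>\<^sup>+ z. f (t - r) x a * u a * g (r - s) a z * (v z * h s z y) \<partial>M \<partial>lborel \<partial>M \<partial>lborel)"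
    by (rule swap_NN[where F="\<lambda>s z r a. f (t - r) x a * u a * g (r - s) a z * (v z * h s z y)"])
      (simp add: space_M case_prod_beta')
  also have "\<dots> = conv u f (conv v g h) t x y"
    unfolding conv_def by (simp add: nn_integral_cmult[symmetric] mult.assoc space_M)
  finally show "conv v (conv u f g) h t x y = conv u f (conv v g h) t x y" .
qed

lemma conv_transpose:
  assumes f: "mk f" and g: "mk g" and [measurable]: "v \<in> borel_measurable M"
  shows "conv v f g t y x = conv v (\<lambda>t x y. g t y x) (\<lambda>t x y. f t y x) t x y"
proof -
  note mkD[OF f, measurable (raw)] mkD[OF g, measurable (raw)]
  show ?thesis unfolding conv_def
    by (subst nn_integral_real_affine[where c="-1" and t=t])
      (auto simp: space_M mult_ac)
qed

text \<open>The \<open>k\<close>-th term of the Dyson series of the kernel of \<open>exp (-t (H - v))\<close>.\<close>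
primrec D :: "('a \<Rightarrow> ennreal) \<Rightarrow> nat \<Rightarrow> real \<Rightarrow> 'a \<Rightarrow> 'a \<Rightarrow> ennreal" where
  "D v 0 = P"
| "D v (Suc k) = conv v P (D v k)"

lemma conv_nonpos:
  assumes "\<And>t x y. t \<le> 0 \<Longrightarrow> f t x y = 0" "\<And>t x y. t \<le> 0 \<Longrightarrow> g t x y = 0" "t \<le> 0"
  shows "conv v f g t x y = 0"
proof -
  have z: "f (t - s) x z * v z * g s z y = 0" for s z
    using assms by (cases "s \<le> 0") auto
  show ?thesis unfolding conv_def z by simp
qed

lemma D_nonpos: "t \<le> 0 \<Longrightarrow> D v k t x y = 0"
  by (induction k arbitrary: t x y) (auto simp: P_nonpos intro: conv_nonpos)

lemma D_mono: "(\<And>x. v x \<le> v' x) \<Longrightarrow> D v k t x y \<le> D v' k t x y"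
  by (induction k arbitrary: t x y) (auto simp: conv_def intro!: nn_integral_mono mult_mono)

text \<open>By Chapman-Kolmogorov the intermediate point integrates out, and only its time, confined
  to \<open>(r, t)\<close> by the vanishing of \<open>P\<close>, remains.\<close>

lemma conv_one_comp:
  assumes [measurable]: "h \<in> borel_measurable borel"
  shows "(\<integral>\<^sup>+ s. \<integral>\<^sup>+ u. h s * (P (t - s) x u * P (s - r) u z) \<partial>M \<partial>lborel) =
     (\<integral>\<^sup>+ s. h s * indicator {r<..<t} s \<partial>lborel) * P (t - r) x z"
proof -
  have "(\<integral>\<^sup>+ u. h s * (P (t - s) x u * P (s - r) u z) \<partial>M) = h s * indicator {r<..<t} s * P (t - r) x z" for s
  proof (cases "r < s \<and> s < t")
    case True
    then show ?thesis using P_CK[of "t - s" "s - r" x z] by (simp add: nn_integral_cmult space_M)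
  next
    case False
    then have z: "P (t - s) x u * P (s - r) u z = 0" for u
      using P_nonpos[of "t - s"] P_nonpos[of "s - r"] by (cases "r < s") auto
    show ?thesis unfolding z using False by (auto simp: indicator_def)
  qed
  then show ?thesis by (simp add: nn_integral_multc)
qed

lemma conv_one_tau_P: "conv (\<lambda>_. 1) P (\<lambda>t x y. tau j t * P t x y) t x y = tau (Suc j) t * P t x y"
proof (cases "0 < t")
  case True
  have "conv (\<lambda>_. 1) P (\<lambda>t x y. tau j t * P t x y) t x y =
     (\<integral>\<^sup>+ s. tau j s * indicator {0<..<t} s \<partial>lborel) * P (t - 0) x y"
    using conv_one_comp[of "tau j" t x 0 y] by (simp add: conv_def mult_ac)
  then show ?thesis using nn_integral_tau[of 0 t j] True by (simp add: tau_def)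
next
  case False
  then show ?thesis using conv_nonpos[of P "\<lambda>t x y. tau j t * P t x y" t] by (simp add: P_nonpos)
qed

section \<open>Symmetry, composition and shift of the perturbation series\<close>

context
  fixes v :: "'a \<Rightarrow> ennreal" assumes v [measurable]: "v \<in> borel_measurable M"
begin

lemma mk_D: "mk (D v k)"
  by (induction k) (auto intro: mk_P mk_conv)

lemmas D_meas [measurable (raw)] = mkD[OF mk_D]

lemma D_right: "D v (Suc k) = conv v (D v k) P"
proof (induction k)
  case (Suc k)
  have "D v (Suc (Suc k)) = conv v P (conv v (D v k) P)" using Suc by simp
  also have "\<dots> = conv v (D v (Suc k)) P"
    by (simp add: conv_assoc mk_P mk_D)
  finally show ?case .
qed simp

lemma D_sym: "D v k t x y = D v k t y x"
proof (induction k arbitrary: t x y)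
  case (Suc k)
  have "D v (Suc k) t x y = conv v (\<lambda>t x y. D v k t y x) (\<lambda>t x y. P t y x) t y x"
    by (simp add: conv_transpose[OF mk_P mk_D])
  also have "\<dots> = D v (Suc k) t y x" using Suc P_sym by (simp only: D_right)
  finally show ?case .
qed (simp add: P_sym)

text \<open>The \<open>k\<close> insertions are sorted by how many of them lie before the
  intermediate point. The induction removes the first insertion and distinguishes whether the time
  \<open>r\<close> remaining after it is below or above \<open>s\<close>; equality is a null
  event.\<close>

lemma D_CK:
  assumes s: "0 < s"
  shows "0 < t \<Longrightarrow> D v k (t + s) x y = (\<Sum>i\<le>k. \<integral>\<^sup>+ u. D v i t x u * D v (k - i) s u y \<partial>M)"
proof (induction k arbitrary: t x y)
  case 0
  then show ?case using s by (simp add: P_CK)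
next
  case (Suc k)
  define F where "F r = (\<integral>\<^sup>+ z. P (t + s - r) x z * v z * D v k r z y \<partial>M)" for r
  have [measurable]: "F \<in> borel_measurable borel" unfolding F_def by measurable
  have "D v (Suc k) (t + s) x y = (\<integral>\<^sup>+ r. F r \<partial>lborel)" by (simp add: conv_def F_def)
  also have "\<dots> = (\<integral>\<^sup>+ r. F r * indicator {..<s} r + F r * indicator {s<..} r \<partial>lborel)"
    by (rule nn_integral_cong_AE) (use AE_lborel_singleton[of s] in \<open>eventually_elim, auto simp: indicator_def\<close>)
  also have "\<dots> = (\<integral>\<^sup>+ r. F r * indicator {..<s} r \<partial>lborel) + (\<integral>\<^sup>+ r. F r * indicator {s<..} r \<partial>lborel)"
    by (rule nn_integral_add) auto
  \<comment> \<open>Here even the first insertion comes after the intermediate point, so the free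
    kernel leading to it is split; this is the term \<open>i = 0\<close>.\<close>
  also have "(\<integral>\<^sup>+ r. F r * indicator {..<s} r \<partial>lborel) = (\<integral>\<^sup>+ u. D v 0 t x u * D v (Suc k) s u y \<partial>M)"
  proof -
    have "F r * indicator {..<s} r = (\<integral>\<^sup>+ u. P t x u * (\<integral>\<^sup>+ z. P (s - r) u z * v z * D v k r z y \<partial>M) \<partial>M)" for r
    proof (cases "r < s")
      case True
      have "F r = (\<integral>\<^sup>+ z. (\<integral>\<^sup>+ u. P t x u * (P (s - r) u z * v z * D v k r z y) \<partial>M) \<partial>M)"
        unfolding F_def
      proof (rule nn_integral_cong)
        fix z
        have "P (t + s - r) x z = (\<integral>\<^sup>+ u. P t x u * P (s - r) u z \<partial>M)"
          using P_CK[OF Suc.prems, of "s - r" x z] True by (simp add: algebra_simps)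
        then show "P (t + s - r) x z * v z * D v k r z y =
            (\<integral>\<^sup>+ u. P t x u * (P (s - r) u z * v z * D v k r z y) \<partial>M)"
          by (simp add: nn_integral_multc[symmetric] mult.assoc space_M)
      qed
      also have "\<dots> = (\<integral>\<^sup>+ u. (\<integral>\<^sup>+ z. P t x u * (P (s - r) u z * v z * D v k r z y) \<partial>M) \<partial>M)"
        by (rule swap_MM) measurable
      finally show ?thesis using True by (simp add: nn_integral_cmult space_M)
    next
      case False
      then show ?thesis by (simp add: P_nonpos)
    qed
    then have "(\<integral>\<^sup>+ r. F r * indicator {..<s} r \<partial>lborel) =
        (\<integral>\<^sup>+ r. \<integral>\<^sup>+ u. P t x u * (\<integral>\<^sup>+ z. P (s - r) u z * v z * D v k r z y \<partial>M) \<partial>M \<partial>lborel)" by simp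
    also have "\<dots> = (\<integral>\<^sup>+ u. \<integral>\<^sup>+ r. P t x u * (\<integral>\<^sup>+ z. P (s - r) u z * v z * D v k r z y \<partial>M) \<partial>lborel \<partial>M)"
      by (rule swap_lM) measurable
    also have "\<dots> = (\<integral>\<^sup>+ u. D v 0 t x u * D v (Suc k) s u y \<partial>M)"
      by (simp add: nn_integral_cmult conv_def space_M)
    finally show ?thesis .
  qed
  \<comment> \<open>Now the first insertion precedes the intermediate point, and the remaining chain
    of duration \<open>r > s\<close> is split by the induction hypothesis.\<close>
  also have "(\<integral>\<^sup>+ r. F r * indicator {s<..} r \<partial>lborel) =
     (\<Sum>i\<le>k. \<integral>\<^sup>+ u. D v (Suc i) t x u * D v (k - i) s u y \<partial>M)"
  proof -
    have "(\<integral>\<^sup>+ r. F r * indicator {s<..} r \<partial>lborel) = (\<integral>\<^sup>+ r. F (s + r) * indicator {0<..} r \<partial>lborel)"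
      by (subst nn_integral_real_affine[where c=1 and t=s]) (auto simp: indicator_def)
    also have "\<dots> = (\<integral>\<^sup>+ r. (\<Sum>i\<le>k. \<integral>\<^sup>+ u. (\<integral>\<^sup>+ z. P (t - r) x z * v z * D v i r z u \<partial>M) * D v (k - i) s u y \<partial>M) \<partial>lborel)"
    proof (rule nn_integral_cong)
      fix r
      show "F (s + r) * indicator {0<..} r =
         (\<Sum>i\<le>k. \<integral>\<^sup>+ u. (\<integral>\<^sup>+ z. P (t - r) x z * v z * D v i r z u \<partial>M) * D v (k - i) s u y \<partial>M)"
      proof (cases "0 < r")
        case True
        have "F (s + r) = (\<integral>\<^sup>+ z. (\<Sum>i\<le>k. \<integral>\<^sup>+ u. P (t - r) x z * v z * D v i r z u * D v (k - i) s u y \<partial>M) \<partial>M)"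
          unfolding F_def
        proof (rule nn_integral_cong)
          fix z
          have "D v k (s + r) z y = (\<Sum>i\<le>k. \<integral>\<^sup>+ u. D v i r z u * D v (k - i) s u y \<partial>M)"
            using Suc.IH[OF True, of z y] by (simp add: add.commute)
          then show "P (t + s - (s + r)) x z * v z * D v k (s + r) z y =
             (\<Sum>i\<le>k. \<integral>\<^sup>+ u. P (t - r) x z * v z * D v i r z u * D v (k - i) s u y \<partial>M)"
            by (simp add: sum_distrib_left nn_integral_cmult[symmetric] mult.assoc space_M)
        qed
        also have "\<dots> = (\<Sum>i\<le>k. \<integral>\<^sup>+ z. \<integral>\<^sup>+ u. P (t - r) x z * v z * D v i r z u * D v (k - i) s u y \<partial>M \<partial>M)"
          by (rule nn_integral_sum) measurable
        also have "\<dots> = (\<Sum>i\<le>k. \<integral>\<^sup>+ u. \<integral>\<^sup>+ z. P (t - r) x z * v z * D v i r z u * D v (k - i) s u y \<partial>M \<partial>M)"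
          by (intro sum.cong refl swap_MM) measurable
        finally show ?thesis using True by (simp add: nn_integral_multc space_M)
      qed (simp add: D_nonpos)
    qed
    also have "\<dots> = (\<Sum>i\<le>k. \<integral>\<^sup>+ r. \<integral>\<^sup>+ u. (\<integral>\<^sup>+ z. P (t - r) x z * v z * D v i r z u \<partial>M) * D v (k - i) s u y \<partial>M \<partial>lborel)"
      by (rule nn_integral_sum) measurable
    also have "\<dots> = (\<Sum>i\<le>k. \<integral>\<^sup>+ u. \<integral>\<^sup>+ r. (\<integral>\<^sup>+ z. P (t - r) x z * v z * D v i r z u \<partial>M) * D v (k - i) s u y \<partial>lborel \<partial>M)"
      by (intro sum.cong refl swap_lM) measurable
    finally show ?thesis by (simp add: nn_integral_multc conv_def space_M)
  qed
  also have "(\<integral>\<^sup>+ u. D v 0 t x u * D v (Suc k) s u y \<partial>M) + (\<Sum>i\<le>k. \<integral>\<^sup>+ u. D v (Suc i) t x u * D v (k - i) s u y \<partial>M)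
      = (\<Sum>i\<le>Suc k. \<integral>\<^sup>+ u. D v i t x u * D v (Suc k - i) s u y \<partial>M)"
    by (simp only: sum.atMost_Suc_shift diff_Suc_Suc diff_zero)
  finally show ?case .
qed

lemma D_le:
  assumes "\<And>x. v x \<le> ennreal c" "0 \<le> c"
  shows "D v k t x y \<le> ennreal (c^k) * tau k t * P t x y"
proof (induction k arbitrary: t x y)
  case 0 then show ?case by (simp add: tau_def)
next
  case (Suc k)
  have "D v (Suc k) t x y \<le> (\<integral>\<^sup>+ s. \<integral>\<^sup>+ z. ennreal (c^Suc k) * (P (t - s) x z * 1 * (tau k s * P s z y)) \<partial>M \<partial>lborel)"
    unfolding D.simps conv_def
  proof (intro nn_integral_mono)
    fix s z
    have "P (t - s) x z * v z * D v k s z y \<le> P (t - s) x z * ennreal c * (ennreal (c^k) * tau k s * P s z y)"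
      using assms Suc by (intro mult_mono) auto
    also have "\<dots> = ennreal (c^Suc k) * (P (t - s) x z * 1 * (tau k s * P s z y))"
      using assms by (simp add: ennreal_mult mult_ac)
    finally show "P (t - s) x z * v z * D v k s z y \<le> ennreal (c^Suc k) * (P (t - s) x z * 1 * (tau k s * P s z y))" .
  qed
  also have "\<dots> = ennreal (c^Suc k) * conv (\<lambda>_. 1) P (\<lambda>t x y. tau k t * P t x y) t x y"
    unfolding conv_def by (simp add: nn_integral_cmult)
  finally show ?case by (simp add: conv_one_tau_P mult.assoc)
qed

text \<open>Integrating out the leading insertion of the constant 1 yields
  \<open>tau (Suc j) t - tau (Suc j) r\<close>, where \<open>r\<close> is the time remaining after
  the first insertion of \<open>v\<close>. The second summand supplies exactly the missing
  \<open>tau (Suc j) r\<close>.\<close>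

lemma tau_D_shift:
  "conv (\<lambda>_. 1) P (\<lambda>t x y. tau j t * D v (Suc i) t x y) t x y + conv v P (\<lambda>t x y. tau (Suc j) t * D v i t x y) t x y
    = tau (Suc j) t * D v (Suc i) t x y"
proof -
  define J where "J r = (\<integral>\<^sup>+ s. tau j s * indicator {r<..<t} s \<partial>lborel)" for r
  have [measurable]: "J \<in> borel_measurable borel"
  proof -
    have "J = (\<lambda>r. \<integral>\<^sup>+ s. tau j s * (if r < s \<and> s < t then 1 else 0) \<partial>lborel)"
      unfolding J_def by (intro ext nn_integral_cong) (simp add: indicator_def)
    then show ?thesis by simp
  qed
  have "conv (\<lambda>_. 1) P (\<lambda>t x y. tau j t * D v (Suc i) t x y) t x y =
      (\<integral>\<^sup>+ s. \<integral>\<^sup>+ u. \<integral>\<^sup>+ r. \<integral>\<^sup>+ z. tau j s * (P (t - s) x u * P (s - r) u z) * (v z * D v i r z y) \<partial>M \<partial>lborel \<partial>M \<partial>lborel)"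
    unfolding D.simps conv_def by (simp add: nn_integral_cmult[symmetric] mult_ac space_M)
  also have "\<dots> = (\<integral>\<^sup>+ r. \<integral>\<^sup>+ z. \<integral>\<^sup>+ s. \<integral>\<^sup>+ u. tau j s * (P (t - s) x u * P (s - r) u z) * (v z * D v i r z y) \<partial>M \<partial>lborel \<partial>M \<partial>lborel)"
    by (rule swap_NN[where F="\<lambda>s u r z. tau j s * (P (t - s) x u * P (s - r) u z) * (v z * D v i r z y)"])
      (simp add: space_M case_prod_beta')
  also have "\<dots> = (\<integral>\<^sup>+ r. \<integral>\<^sup>+ z. J r * (P (t - r) x z * (v z * D v i r z y)) \<partial>M \<partial>lborel)"
  proof (rule nn_integral_cong, rule nn_integral_cong)
    fix r z
    have "(\<integral>\<^sup>+ s. \<integral>\<^sup>+ u. tau j s * (P (t - s) x u * P (s - r) u z) * (v z * D v i r z y) \<partial>M \<partial>lborel) =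
      (\<integral>\<^sup>+ s. \<integral>\<^sup>+ u. tau j s * (P (t - s) x u * P (s - r) u z) \<partial>M \<partial>lborel) * (v z * D v i r z y)"
      by (simp add: nn_integral_multc)
    then show "(\<integral>\<^sup>+ s. \<integral>\<^sup>+ u. tau j s * (P (t - s) x u * P (s - r) u z) * (v z * D v i r z y) \<partial>M \<partial>lborel) =
      J r * (P (t - r) x z * (v z * D v i r z y))"
      by (simp add: conv_one_comp mult.assoc J_def)
  qed
  finally have 1: "conv (\<lambda>_. 1) P (\<lambda>t x y. tau j t * D v (Suc i) t x y) t x y = \<dots>" .
  have "conv (\<lambda>_. 1) P (\<lambda>t x y. tau j t * D v (Suc i) t x y) t x y + conv v P (\<lambda>t x y. tau (Suc j) t * D v i t x y) t x y
     = (\<integral>\<^sup>+ r. (\<integral>\<^sup>+ z. J r * (P (t - r) x z * (v z * D v i r z y)) \<partial>M)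
          + (\<integral>\<^sup>+ z. P (t - r) x z * v z * (tau (Suc j) r * D v i r z y) \<partial>M) \<partial>lborel)"
  proof -
    have m1: "(\<lambda>r. \<integral>\<^sup>+ z. J r * (P (t - r) x z * (v z * D v i r z y)) \<partial>M) \<in> borel_measurable lborel"
      by measurable
    have m2: "(\<lambda>r. \<integral>\<^sup>+ z. P (t - r) x z * v z * (tau (Suc j) r * D v i r z y) \<partial>M) \<in> borel_measurable lborel"
      by measurable
    show ?thesis using nn_integral_add[OF m1 m2] 1 by (simp only: conv_def[of v])
  qed
  also have "\<dots> = (\<integral>\<^sup>+ r. \<integral>\<^sup>+ z. J r * (P (t - r) x z * (v z * D v i r z y))
          + P (t - r) x z * v z * (tau (Suc j) r * D v i r z y) \<partial>M \<partial>lborel)"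
    by (intro nn_integral_cong nn_integral_add[symmetric]) measurable
  also have "\<dots> = (\<integral>\<^sup>+ r. \<integral>\<^sup>+ z. tau (Suc j) t * (P (t - r) x z * v z * D v i r z y) \<partial>M \<partial>lborel)"
  proof (rule nn_integral_cong, rule nn_integral_cong)
    fix r z
    let ?I = "J r"
    show "?I * (P (t - r) x z * (v z * D v i r z y)) + P (t - r) x z * v z * (tau (Suc j) r * D v i r z y)
       = tau (Suc j) t * (P (t - r) x z * v z * D v i r z y)"
    proof (cases "0 \<le> r \<and> r \<le> t")
      case True
      then have "(?I + tau (Suc j) r) = tau (Suc j) t" using nn_integral_tau[of r t j] by (simp add: add.commute J_def)
      moreover have "?I * (P (t - r) x z * (v z * D v i r z y)) + P (t - r) x z * v z * (tau (Suc j) r * D v i r z y)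
         = (?I + tau (Suc j) r) * (P (t - r) x z * v z * D v i r z y)"
        unfolding distrib_right by (simp only: mult_ac)
      ultimately show ?thesis by simp
    next
      case False
      then show ?thesis using P_nonpos[of "t - r"] D_nonpos[of r] by (cases "r < 0") auto
    qed
  qed
  also have "\<dots> = tau (Suc j) t * D v (Suc i) t x y"
    by (simp add: nn_integral_cmult conv_def space_M)
  finally show ?thesis .
qed

text \<open>Every insertion is either \<open>v\<close> or \<open>d\<close>. Summed over all
  positions, the constant insertions contribute only their simplex volume \<open>tau j t\<close>;
  the induction is a Pascal rule according to the kind of the first insertion.\<close>

lemma D_shift:
  "D (\<lambda>x. v x + d) k t x y = (\<Sum>j\<le>k. d^j * (tau j t * D v (k - j) t x y))"
proof (induction k arbitrary: t x y)
  case 0 then show ?case by (simp add: tau_def)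
next
  case (Suc k)
  define T where "T j i = d^j * (tau j t * D v i t x y)" for j i
  \<comment> \<open>\<open>A\<close> collects the terms whose first insertion is \<open>v\<close>,
    \<open>C\<close> those whose first insertion is the constant; \<open>tau_D_shift\<close> merges
    them.\<close>
  define A where "A j i = d^j * conv v P (\<lambda>t x y. tau j t * D v i t x y) t x y" for j i
  define C where "C j i = d^Suc j * conv (\<lambda>_. 1) P (\<lambda>t x y. tau j t * D v i t x y) t x y" for j i
  have "D (\<lambda>x. v x + d) (Suc k) t x y =
     (\<integral>\<^sup>+ s. \<integral>\<^sup>+ z. (\<Sum>j\<le>k. d^j * (P (t - s) x z * v z * (tau j s * D v (k - j) s z y))
         + d^Suc j * (P (t - s) x z * 1 * (tau j s * D v (k - j) s z y))) \<partial>M \<partial>lborel)"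
    unfolding D.simps conv_def Suc
    by (simp add: sum_distrib_left distrib_left distrib_right mult_ac)
  also have "\<dots> = (\<Sum>j\<le>k. A j (k - j) + C j (k - j))"
    unfolding A_def C_def conv_def
    by (simp add: nn_integral_sum nn_integral_add nn_integral_cmult space_M)
  also have "\<dots> = (\<Sum>j\<le>k. A j (k - j)) + (\<Sum>j\<le>k. C j (k - j))" by (rule sum.distrib)
  also have "(\<Sum>j\<le>k. A j (k - j)) = A 0 k + (\<Sum>j<k. A (Suc j) (k - Suc j))"
    by (simp add: lessThan_Suc_atMost[symmetric] sum.lessThan_Suc_shift del: sum.lessThan_Suc)
  also have "(\<Sum>j\<le>k. C j (k - j)) = (\<Sum>j<k. C j (k - j)) + C k 0"
    by (simp add: lessThan_Suc_atMost[symmetric])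
  also have "A 0 k = T 0 (Suc k)" by (simp add: A_def T_def tau_def)
  also have "C k 0 = T (Suc k) 0" by (simp add: C_def T_def conv_one_tau_P)
  also have "T 0 (Suc k) + (\<Sum>j<k. A (Suc j) (k - Suc j)) + ((\<Sum>j<k. C j (k - j)) + T (Suc k) 0) =
     T 0 (Suc k) + (\<Sum>j<k. C j (k - j) + A (Suc j) (k - Suc j)) + T (Suc k) 0"
    by (simp add: sum.distrib add_ac)
  also have "(\<Sum>j<k. C j (k - j) + A (Suc j) (k - Suc j)) = (\<Sum>j<k. T (Suc j) (k - j))"
  proof (rule sum.cong)
    fix j assume "j \<in> {..<k}"
    then have k: "k - j = Suc (k - Suc j)" by auto
    show "C j (k - j) + A (Suc j) (k - Suc j) = T (Suc j) (k - j)"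
      unfolding C_def A_def T_def k by (simp only: distrib_left[symmetric] tau_D_shift)
  qed simp
  also have "T 0 (Suc k) + (\<Sum>j<k. T (Suc j) (k - j)) + T (Suc k) 0 = (\<Sum>j\<le>Suc k. T j (Suc k - j))"
  proof -
    have "(\<Sum>j\<le>Suc k. T j (Suc k - j)) = T 0 (Suc k) + (\<Sum>j\<le>k. T (Suc j) (k - j))"
      by (simp only: sum.atMost_Suc_shift diff_Suc_Suc diff_zero)
    also have "(\<Sum>j\<le>k. T (Suc j) (k - j)) = (\<Sum>j<k. T (Suc j) (k - j)) + T (Suc k) 0"
      by (simp add: lessThan_Suc_atMost[symmetric])
    finally show ?thesis by (simp only: add.assoc)
  qed
  finally show ?case by (simp add: T_def)
qed

definition K :: "real \<Rightarrow> 'a \<Rightarrow> 'a \<Rightarrow> ennreal" where "K t x y = (\<Sum>k. D v k t x y)"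

lemma mk_K: "mk K"
  unfolding mk_def K_def by measurable

lemma K_sym: "K t x y = K t y x"
  unfolding K_def using D_sym by simp

lemma K_CK:
  assumes "0 < t" "0 < s"
  shows "(\<integral>\<^sup>+ z. K t x z * K s z y \<partial>M) = K (t + s) x y"
  unfolding K_def ennreal_Cauchy_product
  by (simp add: nn_integral_suminf nn_integral_sum D_CK[OF assms(2,1)] space_M)

lemma K_le:
  assumes "\<And>x. v x \<le> ennreal c" "0 \<le> c"
  shows "K t x y \<le> ennreal (exp (c * t)) * P t x y"
proof (cases "0 < t")
  case True
  have "K t x y \<le> (\<Sum>k. ennreal ((c * t)^k /\<^sub>R fact k) * P t x y)"
    unfolding K_def
  proof (intro suminf_le allI)
    fix k
    have "ennreal (c^k) * tau k t = ennreal ((c * t)^k /\<^sub>R fact k)"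
      unfolding tau_def using assms(2) True
      by (simp add: ennreal_mult[symmetric] power_mult_distrib divide_inverse mult_ac)
    then show "D v k t x y \<le> ennreal ((c * t)^k /\<^sub>R fact k) * P t x y" using D_le[OF assms, of k t x y] by simp
  qed auto
  also have "\<dots> = (\<Sum>k. ennreal ((c * t)^k /\<^sub>R fact k)) * P t x y" by simp
  also have "(\<Sum>k. ennreal ((c * t)^k /\<^sub>R fact k)) = ennreal (exp (c * t))"
    unfolding exp_def using summable_exp_generic[of "c * t"] assms True
    by (intro suminf_ennreal_eq summable_sums) auto
  finally show ?thesis .
qed (simp add: K_def D_nonpos)

end

lemma K_mono:
  assumes "\<And>x. v x \<le> v' x" "v \<in> borel_measurable M" "v' \<in> borel_measurable M"
  shows "K v t x y \<le> K v' t x y"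
  unfolding K_def[OF assms(2)] K_def[OF assms(3)] using assms(1) by (intro suminf_le D_mono) auto

text \<open>The sum in \<open>D_shift\<close> is a Cauchy product with the exponential series. This
  is what makes the kernel of a bounded potential independent of the constant added to make it
  nonnegative.\<close>

lemma K_shift:
  assumes v: "v \<in> borel_measurable M" and d: "0 \<le> d" and t: "0 \<le> t"
  shows "K (\<lambda>x. v x + ennreal d) t x y = ennreal (exp (d * t)) * K v t x y"
proof -
  have e: "ennreal (exp (d * t)) = (\<Sum>j. ennreal d ^ j * tau j t)"
  proof -
    have "(\<Sum>j. ennreal ((d * t)^j /\<^sub>R fact j)) = ennreal (exp (d * t))"
      unfolding exp_def using summable_exp_generic[of "d * t"] d t
      by (intro suminf_ennreal_eq summable_sums) auto
    moreover have "ennreal ((d * t)^j /\<^sub>R fact j) = ennreal d ^ j * tau j t" for j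
      unfolding tau_def using d t
      by (simp add: ennreal_mult[symmetric] ennreal_power power_mult_distrib divide_inverse mult_ac)
    ultimately show ?thesis by simp
  qed
  show ?thesis
    unfolding e K_def[OF v] ennreal_Cauchy_product using v
    by (subst K_def) (auto simp: D_shift[OF v] mult.assoc)
qed

end

section \<open>Kernel operators on square-integrable functions\<close>

text \<open>The real part turns complex functions into a real semi-inner product space, to which the
  theory above applies; the forms are determined by their diagonal values, which are real.\<close>

definition ip :: "'a measure \<Rightarrow> ('a \<Rightarrow> complex) \<Rightarrow> ('a \<Rightarrow> complex) \<Rightarrow> real" where
  "ip M f g = Re (L2_inner M f g)"

definition lcc :: "real \<Rightarrow> ('a \<Rightarrow> complex) \<Rightarrow> real \<Rightarrow> ('a \<Rightarrow> complex) \<Rightarrow> 'a \<Rightarrow> complex" where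
  "lcc a f b g = (\<lambda>x. complex_of_real a * f x + complex_of_real b * g x)"

lemma cnj_measurable [measurable]: "cnj \<in> borel_measurable borel"
  by (intro borel_measurable_continuous_onI continuous_intros)

lemma cnj_mult_self: "cnj z * z = complex_of_real ((cmod z)\<^sup>2)"
  using complex_norm_square[of z] by (simp only: mult.commute)

lemma L2_measurable: "f \<in> L2 M \<Longrightarrow> f \<in> borel_measurable M"
  by (simp add: L2_def)

lemma L2_iff_nn:
  "f \<in> L2 M \<longleftrightarrow> f \<in> borel_measurable M \<and> (\<integral>\<^sup>+ x. ennreal ((cmod (f x))\<^sup>2) \<partial>M) < \<infinity>"
  by (auto simp: L2_def integrable_iff_bounded)

lemma ennreal_L2_sqnorm: "f \<in> L2 M \<Longrightarrow> ennreal (L2_sqnorm M f) = (\<integral>\<^sup>+ x. ennreal ((cmod (f x))\<^sup>2) \<partial>M)"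
  unfolding L2_sqnorm_def by (subst nn_integral_eq_integral) (auto simp: L2_def)

lemma two_mult_le_squares: "2 * (a * b) \<le> a\<^sup>2 + b\<^sup>2" for a b :: ennreal
proof (cases a; cases b)
  fix r s assume "a = ennreal r" "0 \<le> r" "b = ennreal s" "0 \<le> s"
  moreover have "2 * (r * s) \<le> r\<^sup>2 + s\<^sup>2" using sum_squares_bound[of r s] by simp
  ultimately show ?thesis
    by (simp add: ennreal_mult[symmetric] ennreal_plus[symmetric] ennreal_power del: ennreal_plus
        flip: ennreal_numeral)
qed (auto simp: power2_eq_square ennreal_top_mult ennreal_mult_top)

lemma mult_le_squares: "a * b \<le> a\<^sup>2 + b\<^sup>2" for a b :: ennreal
proof -
  have "a * b \<le> a * b + a * b" by simp
  also have "\<dots> = 2 * (a * b)" by (simp add: mult_2)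
  finally show ?thesis using two_mult_le_squares[of a b] by (rule order_trans)
qed

lemma L2_inner_integrable:
  assumes "f \<in> L2 M" "g \<in> L2 M"
  shows "integrable M (\<lambda>x. cnj (f x) * g x)"
proof (rule Bochner_Integration.integrable_bound)
  show "integrable M (\<lambda>x. (cmod (f x))\<^sup>2 + (cmod (g x))\<^sup>2)" using assms by (auto simp: L2_def)
  show "AE x in M. norm (cnj (f x) * g x) \<le> norm ((cmod (f x))\<^sup>2 + (cmod (g x))\<^sup>2)"
  proof (rule AE_I2)
    fix x
    have "cmod (f x) * cmod (g x) * 2 \<le> (cmod (f x))\<^sup>2 + (cmod (g x))\<^sup>2"
      using sum_squares_bound[of "cmod (f x)" "cmod (g x)"] by simp
    moreover have "0 \<le> cmod (f x) * cmod (g x)" by simp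
    ultimately have "cmod (f x) * cmod (g x) \<le> (cmod (f x))\<^sup>2 + (cmod (g x))\<^sup>2" by linarith
    then show "norm (cnj (f x) * g x) \<le> norm ((cmod (f x))\<^sup>2 + (cmod (g x))\<^sup>2)"
      by (simp add: norm_mult)
  qed
  have [measurable]: "f \<in> borel_measurable M" "g \<in> borel_measurable M" using assms L2_measurable by auto
  show "(\<lambda>x. cnj (f x) * g x) \<in> borel_measurable M" by measurable
qed

lemma lcc_in_L2:
  assumes "f \<in> L2 M" "g \<in> L2 M" shows "lcc a f b g \<in> L2 M"
proof -
  have [measurable]: "f \<in> borel_measurable M" "g \<in> borel_measurable M" using assms L2_measurable by auto
  have "integrable M (\<lambda>x. (cmod (lcc a f b g x))\<^sup>2)"
  proof (rule Bochner_Integration.integrable_bound)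
    show "integrable M (\<lambda>x. 2 * a\<^sup>2 * (cmod (f x))\<^sup>2 + 2 * b\<^sup>2 * (cmod (g x))\<^sup>2)"
      using assms by (auto simp: L2_def)
    show "AE x in M. norm ((cmod (lcc a f b g x))\<^sup>2) \<le> norm (2 * a\<^sup>2 * (cmod (f x))\<^sup>2 + 2 * b\<^sup>2 * (cmod (g x))\<^sup>2)"
    proof (rule AE_I2)
      fix x
      let ?u = "\<bar>a\<bar> * cmod (f x)" let ?v = "\<bar>b\<bar> * cmod (g x)"
      have "cmod (lcc a f b g x) \<le> ?u + ?v"
        unfolding lcc_def by (rule order_trans[OF norm_triangle_ineq]) (simp add: norm_mult)
      then have "(cmod (lcc a f b g x))\<^sup>2 \<le> (?u + ?v)\<^sup>2" by (intro power_mono) auto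
      also have "\<dots> \<le> 2 * ?u\<^sup>2 + 2 * ?v\<^sup>2"
        using sum_squares_bound[of ?u ?v] by (simp add: power2_sum)
      finally show "norm ((cmod (lcc a f b g x))\<^sup>2) \<le> norm (2 * a\<^sup>2 * (cmod (f x))\<^sup>2 + 2 * b\<^sup>2 * (cmod (g x))\<^sup>2)"
        by (simp add: power_mult_distrib)
    qed
  qed (simp add: lcc_def)
  then show ?thesis by (simp add: L2_def lcc_def)
qed

lemma L2_diff: "f \<in> L2 M \<Longrightarrow> g \<in> L2 M \<Longrightarrow> (\<lambda>x. f x - g x) \<in> L2 M"
  using lcc_in_L2[of f M g 1 "-1"] by (simp add: lcc_def)

lemma L2_inner_lcc:
  assumes "f \<in> L2 M" "g \<in> L2 M" "h \<in> L2 M"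
  shows "L2_inner M (lcc a f b g) h = of_real a * L2_inner M f h + of_real b * L2_inner M g h"
proof -
  have "L2_inner M (lcc a f b g) h = (\<integral>x. of_real a * (cnj (f x) * h x) + of_real b * (cnj (g x) * h x) \<partial>M)"
    unfolding L2_inner_def lcc_def by (intro Bochner_Integration.integral_cong) (auto simp: algebra_simps)
  then show ?thesis unfolding L2_inner_def
    using L2_inner_integrable[OF assms(1,3)] L2_inner_integrable[OF assms(2,3)] by simp
qed

lemma L2_inner_cnj: "L2_inner M g f = cnj (L2_inner M f g)"
  unfolding L2_inner_def by (subst Bochner_Integration.integral_cnj[symmetric]) (simp add: mult.commute)

lemma ip_self: "ip M f f = L2_sqnorm M f"
proof -
  have "L2_inner M f f = (\<integral>x. complex_of_real ((cmod (f x))\<^sup>2) \<partial>M)"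
    unfolding L2_inner_def by (simp only: cnj_mult_self)
  also have "\<dots> = complex_of_real (L2_sqnorm M f)" unfolding L2_sqnorm_def by (rule integral_complex_of_real)
  finally show ?thesis by (simp add: ip_def)
qed

lemma L2_semi_inner: "semi_inner (L2 M) (ip M) lcc"
proof
  fix f g h a b assume "f \<in> L2 M" "g \<in> L2 M" "h \<in> L2 M"
  then show "ip M (lcc a f b g) h = a * ip M f h + b * ip M g h" by (simp add: ip_def L2_inner_lcc)
next
  fix f g show "ip M f g = ip M g f" unfolding ip_def using L2_inner_cnj[of M g f] by simp
next
  fix f show "0 \<le> ip M f f" by (simp add: ip_self L2_sqnorm_def)
qed (rule lcc_in_L2)

lemma nd_L2: "f \<in> L2 M \<Longrightarrow> g \<in> L2 M \<Longrightarrow> semi_inner.nd (ip M) f g = L2_sqnorm M (\<lambda>x. f x - g x)"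
  using semi_inner.nd_eq[OF L2_semi_inner, of f M g] by (simp add: ip_self lcc_def)

section \<open>Positive kernels as bounded operators\<close>

context sigma_finite_measure
begin

interpretation MM: pair_sigma_finite M M ..

definition app :: "('a \<Rightarrow> 'a \<Rightarrow> ennreal) \<Rightarrow> ('a \<Rightarrow> ennreal) \<Rightarrow> 'a \<Rightarrow> ennreal" where
  "app k g x = (\<integral>\<^sup>+ y. k x y * g y \<partial>M)"

definition kop :: "('a \<Rightarrow> 'a \<Rightarrow> ennreal) \<Rightarrow> ('a \<Rightarrow> complex) \<Rightarrow> 'a \<Rightarrow> complex" where
  "kop k f x = (\<integral>y. complex_of_real (enn2real (k x y)) * f y \<partial>M)"

definition L2bd :: "('a \<Rightarrow> 'a \<Rightarrow> ennreal) \<Rightarrow> real \<Rightarrow> bool" where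
  "L2bd k C \<longleftrightarrow> (\<lambda>(x, y). k x y) \<in> borel_measurable (M \<Otimes>\<^sub>M M) \<and> 0 \<le> C \<and>
     (\<forall>g\<in>borel_measurable M. (\<integral>\<^sup>+ x. (app k g x)\<^sup>2 \<partial>M) \<le> ennreal C * (\<integral>\<^sup>+ x. (g x)\<^sup>2 \<partial>M))"

lemma app_measurable:
  assumes [measurable]: "(\<lambda>(x, y). k x y) \<in> borel_measurable (M \<Otimes>\<^sub>M M)" "g \<in> borel_measurable M"
  shows "app k g \<in> borel_measurable M"
  unfolding app_def by measurable

lemma kop_measurable:
  assumes [measurable]: "(\<lambda>(x, y). k x y) \<in> borel_measurable (M \<Otimes>\<^sub>M M)" "f \<in> borel_measurable M"
  shows "kop k f \<in> borel_measurable M"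
proof -
  have [measurable]: "(\<lambda>w. k (fst w) (snd w)) \<in> borel_measurable (M \<Otimes>\<^sub>M M)"
    using assms(1) by (simp add: case_prod_beta')
  show ?thesis unfolding kop_def by (rule borel_measurable_lebesgue_integral) (simp add: case_prod_beta')
qed

lemma kernel_slice:
  assumes "(\<lambda>(x, y). k x y) \<in> borel_measurable (M \<Otimes>\<^sub>M M)" "x \<in> space M"
  shows "(\<lambda>y. k x y) \<in> borel_measurable M"
  using measurable_Pair2[OF assms] by simp

lemma kop_norm_le: "ennreal (cmod (kop k f x)) \<le> app k (\<lambda>y. ennreal (cmod (f y))) x"
proof (cases "integrable M (\<lambda>y. complex_of_real (enn2real (k x y)) * f y)")
  case True
  have "ennreal (cmod (kop k f x)) \<le> (\<integral>\<^sup>+ y. ennreal (norm (complex_of_real (enn2real (k x y)) * f y)) \<partial>M)"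
    unfolding kop_def by (rule integral_norm_bound_ennreal[OF True])
  also have "\<dots> \<le> app k (\<lambda>y. ennreal (cmod (f y))) x"
    unfolding app_def
  proof (rule nn_integral_mono)
    fix y
    have "ennreal (enn2real (k x y)) \<le> k x y" by (cases "k x y") auto
    then show "ennreal (norm (complex_of_real (enn2real (k x y)) * f y)) \<le> k x y * ennreal (cmod (f y))"
      by (simp add: norm_mult ennreal_mult mult_right_mono)
  qed
  finally show ?thesis .
\<comment> \<open>A product that is not integrable has Bochner integral 0.\<close>
qed (simp add: kop_def not_integrable_integral_eq)

lemma L2bd_measurable: "L2bd k C \<Longrightarrow> (\<lambda>(x, y). k x y) \<in> borel_measurable (M \<Otimes>\<^sub>M M)"
  by (simp add: L2bd_def)

lemma app_L2:
  assumes "L2bd k C" "f \<in> L2 M"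
  shows "(\<integral>\<^sup>+ x. (app k (\<lambda>y. ennreal (cmod (f y))) x)\<^sup>2 \<partial>M) \<le> ennreal (C * L2_sqnorm M f)"
    and "AE x in M. app k (\<lambda>y. ennreal (cmod (f y))) x < \<infinity>"
proof -
  have [measurable]: "f \<in> borel_measurable M" using assms L2_measurable by auto
  have "(\<integral>\<^sup>+ x. (app k (\<lambda>y. ennreal (cmod (f y))) x)\<^sup>2 \<partial>M) \<le> ennreal C * (\<integral>\<^sup>+ x. (ennreal (cmod (f x)))\<^sup>2 \<partial>M)"
    using assms(1) unfolding L2bd_def by auto
  also have "\<dots> = ennreal (C * L2_sqnorm M f)"
    using assms ennreal_L2_sqnorm[OF assms(2)]
    by (simp add: ennreal_power ennreal_mult' L2bd_def)
  finally show *: "(\<integral>\<^sup>+ x. (app k (\<lambda>y. ennreal (cmod (f y))) x)\<^sup>2 \<partial>M) \<le> ennreal (C * L2_sqnorm M f)" .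
  have "AE x in M. (app k (\<lambda>y. ennreal (cmod (f y))) x)\<^sup>2 \<noteq> \<infinity>"
    using * app_measurable[OF L2bd_measurable[OF assms(1)], of "\<lambda>y. ennreal (cmod (f y))"]
    by (intro nn_integral_PInf_AE) (auto simp: top_unique)
  then show "AE x in M. app k (\<lambda>y. ennreal (cmod (f y))) x < \<infinity>"
    by eventually_elim (auto simp: less_top power2_eq_square ennreal_mult_eq_top_iff)
qed

lemma kop_L2:
  assumes "L2bd k C" "f \<in> L2 M"
  shows "kop k f \<in> L2 M" "L2_sqnorm M (kop k f) \<le> C * L2_sqnorm M f"
proof -
  have [measurable]: "kop k f \<in> borel_measurable M"
    by (intro kop_measurable L2bd_measurable[OF assms(1)] L2_measurable[OF assms(2)])
  have "(\<integral>\<^sup>+ x. ennreal ((cmod (kop k f x))\<^sup>2) \<partial>M) \<le> (\<integral>\<^sup>+ x. (app k (\<lambda>y. ennreal (cmod (f y))) x)\<^sup>2 \<partial>M)"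
    by (intro nn_integral_mono) (simp add: ennreal_power[symmetric] power_mono kop_norm_le)
  also have "\<dots> \<le> ennreal (C * L2_sqnorm M f)" by (rule app_L2[OF assms])
  finally have *: "(\<integral>\<^sup>+ x. ennreal ((cmod (kop k f x))\<^sup>2) \<partial>M) \<le> ennreal (C * L2_sqnorm M f)" .
  then show L: "kop k f \<in> L2 M" unfolding L2_iff_nn using le_less_trans[OF * ennreal_less_top] by simp
  have "0 \<le> C * L2_sqnorm M f" using assms by (simp add: L2bd_def L2_sqnorm_def)
  then show "L2_sqnorm M (kop k f) \<le> C * L2_sqnorm M f" using * ennreal_L2_sqnorm[OF L] by (metis ennreal_le_iff)
qed

lemma kop_bilinear:
  assumes k: "L2bd k C" and f: "f \<in> L2 M" and g: "g \<in> L2 M"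
  shows "integrable (M \<Otimes>\<^sub>M M) (\<lambda>(x, y). cnj (f x) * (complex_of_real (enn2real (k x y)) * g y))"
    and "L2_inner M f (kop k g) = (\<integral>x. \<integral>y. cnj (f x) * (complex_of_real (enn2real (k x y)) * g y) \<partial>M \<partial>M)"
proof -
  have [measurable]: "f \<in> borel_measurable M" "g \<in> borel_measurable M" using f g L2_measurable by auto
  have km: "(\<lambda>(x, y). k x y) \<in> borel_measurable (M \<Otimes>\<^sub>M M)" by (rule L2bd_measurable[OF k])
  then have [measurable]: "(\<lambda>w. k (fst w) (snd w)) \<in> borel_measurable (M \<Otimes>\<^sub>M M)" by (simp add: case_prod_beta')
  have [measurable]: "app k (\<lambda>y. ennreal (cmod (g y))) \<in> borel_measurable M"
    by (rule app_measurable[OF km]) measurable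
  let ?F = "\<lambda>(x, y). cnj (f x) * (complex_of_real (enn2real (k x y)) * g y)"
  have F[measurable]: "?F \<in> borel_measurable (M \<Otimes>\<^sub>M M)" unfolding case_prod_beta' by measurable
  have "(\<integral>\<^sup>+ w. ennreal (norm (?F w)) \<partial>(M \<Otimes>\<^sub>M M)) = (\<integral>\<^sup>+ x. \<integral>\<^sup>+ y. ennreal (norm (?F (x, y))) \<partial>M \<partial>M)"
    by (rule nn_integral_fst[symmetric]) measurable
  also have "\<dots> \<le> (\<integral>\<^sup>+ x. (ennreal (cmod (f x)))\<^sup>2 + (app k (\<lambda>y. ennreal (cmod (g y))) x)\<^sup>2 \<partial>M)"
  proof (rule nn_integral_mono)
    fix x assume x: "x \<in> space M"
    note [measurable] = kernel_slice[OF km x]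
    have "(\<integral>\<^sup>+ y. ennreal (norm (?F (x, y))) \<partial>M) \<le> (\<integral>\<^sup>+ y. ennreal (cmod (f x)) * (k x y * ennreal (cmod (g y))) \<partial>M)"
    proof (rule nn_integral_mono)
      fix y
      have "ennreal (enn2real (k x y)) \<le> k x y" by (cases "k x y") auto
      then show "ennreal (norm (?F (x, y))) \<le> ennreal (cmod (f x)) * (k x y * ennreal (cmod (g y)))"
        by (simp add: norm_mult ennreal_mult mult_right_mono mult_left_mono)
    qed
    also have "\<dots> = ennreal (cmod (f x)) * app k (\<lambda>y. ennreal (cmod (g y))) x"
      unfolding app_def by (rule nn_integral_cmult) measurable
    also have "\<dots> \<le> (ennreal (cmod (f x)))\<^sup>2 + (app k (\<lambda>y. ennreal (cmod (g y))) x)\<^sup>2" by (rule mult_le_squares)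
    finally show "(\<integral>\<^sup>+ y. ennreal (norm (?F (x, y))) \<partial>M) \<le> \<dots>" .
  qed
  also have "\<dots> = (\<integral>\<^sup>+ x. (ennreal (cmod (f x)))\<^sup>2 \<partial>M) + (\<integral>\<^sup>+ x. (app k (\<lambda>y. ennreal (cmod (g y))) x)\<^sup>2 \<partial>M)"
    by (rule nn_integral_add) measurable
  also have "\<dots> < \<infinity>"
    using le_less_trans[OF app_L2(1)[OF k g] ennreal_less_top] f by (simp add: L2_iff_nn ennreal_power)
  finally show int: "integrable (M \<Otimes>\<^sub>M M) ?F" by (subst integrable_iff_bounded) auto
  show "L2_inner M f (kop k g) = (\<integral>x. \<integral>y. cnj (f x) * (complex_of_real (enn2real (k x y)) * g y) \<partial>M \<partial>M)"
    unfolding L2_inner_def kop_def by simp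
qed

lemma kop_sym:
  assumes k: "L2bd k C" and f: "f \<in> L2 M" and g: "g \<in> L2 M" and sym: "\<And>x y. k x y = k y x"
  shows "L2_inner M f (kop k g) = L2_inner M (kop k f) g"
proof -
  have "L2_inner M f (kop k g) = (\<integral>y. \<integral>x. cnj (f x) * (complex_of_real (enn2real (k x y)) * g y) \<partial>M \<partial>M)"
    unfolding kop_bilinear(2)[OF k f g] by (rule MM.Fubini_integral[symmetric, OF kop_bilinear(1)[OF k f g]])
  also have "\<dots> = (\<integral>y. cnj (\<integral>x. cnj (g y) * (complex_of_real (enn2real (k y x)) * f x) \<partial>M) \<partial>M)"
    by (subst Bochner_Integration.integral_cnj[symmetric]) (simp add: mult_ac sym)
  also have "\<dots> = cnj (L2_inner M g (kop k f))"
    unfolding kop_bilinear(2)[OF k g f] by (rule Bochner_Integration.integral_cnj)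
  also have "\<dots> = L2_inner M (kop k f) g" by (rule L2_inner_cnj[symmetric])
  finally show ?thesis .
qed

text \<open>Fubini's theorem is applicable at every \<open>x\<close> where the composed kernel maps
  the absolute value of \<open>f\<close> to a finite number, hence almost everywhere.\<close>

lemma kop_comp:
  assumes k: "L2bd k C" and l: "L2bd l C'" and kl: "L2bd (\<lambda>x y. \<integral>\<^sup>+ z. k x z * l z y \<partial>M) C''" and f: "f \<in> L2 M"
    and fin: "\<And>x y. k x y < \<infinity>" "\<And>x y. l x y < \<infinity>" "\<And>x y. (\<integral>\<^sup>+ z. k x z * l z y \<partial>M) < \<infinity>"
  shows "AE x in M. kop k (kop l f) x = kop (\<lambda>x y. \<integral>\<^sup>+ z. k x z * l z y \<partial>M) f x"
  using app_L2(2)[OF kl f] AE_space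
proof eventually_elim
  case (elim x)
  have fm[measurable]: "f \<in> borel_measurable M" using f L2_measurable by auto
  have km: "(\<lambda>(x, y). k x y) \<in> borel_measurable (M \<Otimes>\<^sub>M M)" by (rule L2bd_measurable[OF k])
  have lm[measurable]: "(\<lambda>(x, y). l x y) \<in> borel_measurable (M \<Otimes>\<^sub>M M)" by (rule L2bd_measurable[OF l])
  then have lm'[measurable]: "(\<lambda>w. l (fst w) (snd w)) \<in> borel_measurable (M \<Otimes>\<^sub>M M)" by (simp add: case_prod_beta')
  note kx[measurable] = kernel_slice[OF km elim(2)]
  let ?F = "\<lambda>(z, y). complex_of_real (enn2real (k x z)) * (complex_of_real (enn2real (l z y)) * f y)"
  have F[measurable]: "?F \<in> borel_measurable (M \<Otimes>\<^sub>M M)" unfolding case_prod_beta' by measurable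
  have nF: "ennreal (norm (?F (z, y))) = k x z * l z y * ennreal (cmod (f y))" for z y
    using fin by (simp add: norm_mult ennreal_mult mult.assoc)
  have ly: "(\<lambda>z. l z y) \<in> borel_measurable M" if "y \<in> space M" for y
    using measurable_Pair1[OF lm that] by simp
  have "(\<integral>\<^sup>+ w. ennreal (norm (?F w)) \<partial>(M \<Otimes>\<^sub>M M)) = (\<integral>\<^sup>+ y. \<integral>\<^sup>+ z. ennreal (norm (?F (z, y))) \<partial>M \<partial>M)"
    by (rule MM.nn_integral_snd[symmetric]) measurable
  also have "\<dots> = app (\<lambda>x y. \<integral>\<^sup>+ z. k x z * l z y \<partial>M) (\<lambda>y. ennreal (cmod (f y))) x"
    unfolding nF app_def by (intro nn_integral_cong nn_integral_multc borel_measurable_times_ennreal kx ly)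
  finally have int: "integrable (M \<Otimes>\<^sub>M M) ?F"
    using elim(1) by (subst integrable_iff_bounded) auto
  have "kop k (kop l f) x = (\<integral>z. \<integral>y. ?F (z, y) \<partial>M \<partial>M)" unfolding kop_def by simp
  also have "\<dots> = (\<integral>y. \<integral>z. ?F (z, y) \<partial>M \<partial>M)"
    using MM.Fubini_integral[of "\<lambda>z y. ?F (z, y)"] int by simp
  also have "\<dots> = kop (\<lambda>x y. \<integral>\<^sup>+ z. k x z * l z y \<partial>M) f x"
    unfolding kop_def
  proof (rule Bochner_Integration.integral_cong[OF refl])
    fix y assume y: "y \<in> space M"
    note [measurable] = ly[OF y]
    have "(\<integral>z. enn2real (k x z) * enn2real (l z y) \<partial>M) = enn2real (\<integral>\<^sup>+ z. ennreal (enn2real (k x z) * enn2real (l z y)) \<partial>M)"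
      by (rule integral_eq_nn_integral) auto
    also have "(\<integral>\<^sup>+ z. ennreal (enn2real (k x z) * enn2real (l z y)) \<partial>M) = (\<integral>\<^sup>+ z. k x z * l z y \<partial>M)"
      using fin by (intro nn_integral_cong) (simp add: ennreal_mult)
    finally have e: "(\<integral>z. enn2real (k x z) * enn2real (l z y) \<partial>M) = enn2real (\<integral>\<^sup>+ z. k x z * l z y \<partial>M)" .
    have "(\<integral>z. ?F (z, y) \<partial>M) = (\<integral>z. complex_of_real (enn2real (k x z) * enn2real (l z y)) * f y \<partial>M)"
      by (simp add: mult_ac)
    also have "\<dots> = complex_of_real (enn2real (\<integral>\<^sup>+ z. k x z * l z y \<partial>M)) * f y"
      unfolding e[symmetric] by (simp only: integral_mult_left_zero integral_complex_of_real)
    finally show "(\<integral>z. ?F (z, y) \<partial>M) = complex_of_real (enn2real (\<integral>\<^sup>+ z. k x z * l z y \<partial>M)) * f y" .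
  qed
  finally show ?case .
qed

lemma L2bd_mono:
  assumes "L2bd l C" "\<And>x y. k x y \<le> l x y" "(\<lambda>(x, y). k x y) \<in> borel_measurable (M \<Otimes>\<^sub>M M)"
  shows "L2bd k C"
  unfolding L2bd_def
proof (intro conjI ballI)
  fix g :: "'a \<Rightarrow> ennreal" assume g: "g \<in> borel_measurable M"
  have "(\<integral>\<^sup>+ x. (app k g x)\<^sup>2 \<partial>M) \<le> (\<integral>\<^sup>+ x. (app l g x)\<^sup>2 \<partial>M)"
    unfolding app_def using assms(2) by (intro nn_integral_mono power_mono mult_right_mono) auto
  then show "(\<integral>\<^sup>+ x. (app k g x)\<^sup>2 \<partial>M) \<le> ennreal C * (\<integral>\<^sup>+ x. (g x)\<^sup>2 \<partial>M)"
    using assms(1) g unfolding L2bd_def by (meson order_trans)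
qed (use assms in \<open>auto simp: L2bd_def\<close>)

text \<open>Dominated convergence twice: in \<open>y\<close> for almost every fixed
  \<open>x\<close>, with majorant \<open>l x y\<close> times the absolute value of
  \<open>f y\<close>, and then in \<open>x\<close>, where the factor 4 comes from
  \<open>(a + b)^2 \<le> 4 c^2\<close> for \<open>a\<close> and \<open>b\<close> between 0 and
  \<open>c\<close>.\<close>

lemma kop_tendsto:
  assumes l: "L2bd l C" and le: "\<And>n x y. k n x y \<le> l x y" "\<And>x y. k' x y \<le> l x y"
    and km: "\<And>n. (\<lambda>(x, y). k n x y) \<in> borel_measurable (M \<Otimes>\<^sub>M M)" "(\<lambda>(x, y). k' x y) \<in> borel_measurable (M \<Otimes>\<^sub>M M)"
    and lim: "\<And>x y. (\<lambda>n. k n x y) \<longlonglongrightarrow> k' x y" and f: "f \<in> L2 M"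
  shows "(\<lambda>n. L2_sqnorm M (\<lambda>x. kop (k n) f x - kop k' f x)) \<longlonglongrightarrow> 0"
proof -
  have fm[measurable]: "f \<in> borel_measurable M" using f L2_measurable by auto
  let ?a = "app l (\<lambda>y. ennreal (cmod (f y)))"
  have am[measurable]: "?a \<in> borel_measurable M" by (intro app_measurable L2bd_measurable[OF l]) measurable
  have [measurable]: "kop (k n) f \<in> borel_measurable M" "kop k' f \<in> borel_measurable M" for n
    using km by (auto intro: kop_measurable)
  have bd: "cmod (kop h f x) \<le> enn2real (?a x)" if "\<And>x y. h x y \<le> l x y" "?a x < \<infinity>" for h :: "'a \<Rightarrow> 'a \<Rightarrow> ennreal" and x
  proof -
    have "ennreal (cmod (kop h f x)) \<le> app h (\<lambda>y. ennreal (cmod (f y))) x" by (rule kop_norm_le)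
    also have "\<dots> \<le> ?a x" unfolding app_def using that(1) by (intro nn_integral_mono mult_right_mono) auto
    finally show ?thesis using that(2) by (cases "?a x") auto
  qed
  have pt: "AE x in M. (\<lambda>n. kop (k n) f x) \<longlonglongrightarrow> kop k' f x"
    using app_L2(2)[OF l f] AE_space
  proof eventually_elim
    case (elim x)
    note lx[measurable] = kernel_slice[OF L2bd_measurable[OF l] elim(2)]
    note [measurable] = kernel_slice[OF km(1) elim(2)] kernel_slice[OF km(2) elim(2)]
    have ae: "AE y in M. l x y * ennreal (cmod (f y)) \<noteq> \<infinity>"
      using elim(1) by (intro nn_integral_PInf_AE) (auto simp: app_def)
    show ?case unfolding kop_def
    proof (rule integral_dominated_convergence[where w="\<lambda>y. enn2real (l x y * ennreal (cmod (f y)))"])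
      show "integrable M (\<lambda>y. enn2real (l x y * ennreal (cmod (f y))))"
      proof (subst integrable_iff_bounded, intro conjI)
        have "(\<integral>\<^sup>+ y. ennreal (norm (enn2real (l x y * ennreal (cmod (f y))))) \<partial>M) \<le> ?a x"
          unfolding app_def
        proof (rule nn_integral_mono)
          fix y show "ennreal (norm (enn2real (l x y * ennreal (cmod (f y))))) \<le> l x y * ennreal (cmod (f y))"
            by (cases "l x y * ennreal (cmod (f y))") auto
        qed
        then show "(\<integral>\<^sup>+ y. ennreal (norm (enn2real (l x y * ennreal (cmod (f y))))) \<partial>M) < \<infinity>"
          using elim(1) by simp
      qed measurable
      show "AE y in M. (\<lambda>n. complex_of_real (enn2real (k n x y)) * f y) \<longlonglongrightarrow> complex_of_real (enn2real (k' x y)) * f y"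
        using ae
      proof eventually_elim
        case (elim y)
        show ?case
        proof (cases "f y = 0")
          case False
          then have "l x y \<noteq> \<infinity>" using elim by (auto simp: ennreal_mult_eq_top_iff)
          then have "k' x y \<noteq> \<infinity>" using le(2)[of x y] by (auto simp: top_unique)
          then have "(\<lambda>n. enn2real (k n x y)) \<longlonglongrightarrow> enn2real (k' x y)"
            using lim[of x y] by (simp add: tendsto_enn2real less_top)
          then show ?thesis by (intro tendsto_mult tendsto_of_real tendsto_const)
        qed simp
      qed
      show "AE y in M. norm (complex_of_real (enn2real (k n x y)) * f y) \<le> enn2real (l x y * ennreal (cmod (f y)))" for n
        using ae
      proof eventually_elim
        case (elim y)
        show ?case
        proof (cases "f y = 0")
          case False
          then have "l x y \<noteq> \<infinity>" using elim by (auto simp: ennreal_mult_eq_top_iff)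
          then have "enn2real (k n x y) \<le> enn2real (l x y)" using le(1)[of n x y] by (simp add: enn2real_mono less_top)
          then show ?thesis by (simp add: norm_mult enn2real_mult mult_right_mono)
        qed simp
      qed
    qed measurable
  qed
  have "(\<lambda>n. \<integral>x. (cmod (kop (k n) f x - kop k' f x))\<^sup>2 \<partial>M) \<longlonglongrightarrow> (\<integral>x. 0 \<partial>M)"
  proof (rule integral_dominated_convergence[where w="\<lambda>x. 4 * (enn2real (?a x))\<^sup>2"])
    show "integrable M (\<lambda>x. 4 * (enn2real (?a x))\<^sup>2)"
    proof -
      have "integrable M (\<lambda>x. (enn2real (?a x))\<^sup>2)"
      proof (subst integrable_iff_bounded, intro conjI)
        have "(\<integral>\<^sup>+ x. ennreal (norm ((enn2real (?a x))\<^sup>2)) \<partial>M) \<le> (\<integral>\<^sup>+ x. (?a x)\<^sup>2 \<partial>M)"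
        proof (rule nn_integral_mono)
          fix x
          have "ennreal (enn2real (?a x)) \<le> ?a x" by (cases "?a x") auto
          then show "ennreal (norm ((enn2real (?a x))\<^sup>2)) \<le> (?a x)\<^sup>2"
            by (simp add: ennreal_power[symmetric] power_mono)
        qed
        then show "(\<integral>\<^sup>+ x. ennreal (norm ((enn2real (?a x))\<^sup>2)) \<partial>M) < \<infinity>"
          using le_less_trans[OF order_trans[OF _ app_L2(1)[OF l f]] ennreal_less_top] by simp
      qed measurable
      then show ?thesis by simp
    qed
    show "AE x in M. (\<lambda>n. (cmod (kop (k n) f x - kop k' f x))\<^sup>2) \<longlonglongrightarrow> 0"
      using pt
    proof eventually_elim
      case (elim x)
      then have "(\<lambda>n. (cmod (kop (k n) f x - kop k' f x))\<^sup>2) \<longlonglongrightarrow> (cmod (kop k' f x - kop k' f x))\<^sup>2"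
        by (intro tendsto_intros)
      then show ?case by simp
    qed
    show "AE x in M. norm ((cmod (kop (k n) f x - kop k' f x))\<^sup>2) \<le> 4 * (enn2real (?a x))\<^sup>2" for n
      using app_L2(2)[OF l f]
    proof eventually_elim
      case (elim x)
      have "cmod (kop (k n) f x - kop k' f x) \<le> 2 * enn2real (?a x)"
        using norm_triangle_ineq4[of "kop (k n) f x" "kop k' f x"] bd[of "k n", OF le(1) elim] bd[of k', OF le(2) elim]
        by linarith
      then have "(cmod (kop (k n) f x - kop k' f x))\<^sup>2 \<le> (2 * enn2real (?a x))\<^sup>2" by (intro power_mono) auto
      then show ?case by (simp add: power_mult_distrib)
    qed
  qed measurable
  then show ?thesis by (simp add: L2_sqnorm_def)
qed

text \<open>On nonnegative square-integrable functions the complex operator of a positive kernel is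
  the positive operator, so an operator norm bound is also a bound in the sense of
  \<open>L2bd\<close>; the rough bound \<open>C'\<close> makes the integrals finite. In this way
  constants depending on the truncation are replaced by uniform ones.\<close>

lemma L2bd_if_kop_bound:
  assumes k: "L2bd k C'" and C: "0 < C" "\<And>f. f \<in> L2 M \<Longrightarrow> L2_sqnorm M (kop k f) \<le> C * L2_sqnorm M f"
    and fin: "\<And>x y. k x y < \<infinity>"
  shows "L2bd k C"
  unfolding L2bd_def
proof (intro conjI ballI)
  show km: "(\<lambda>(x, y). k x y) \<in> borel_measurable (M \<Otimes>\<^sub>M M)" by (rule L2bd_measurable[OF k])
  fix g :: "'a \<Rightarrow> ennreal" assume g[measurable]: "g \<in> borel_measurable M"
  show "(\<integral>\<^sup>+ x. (app k g x)\<^sup>2 \<partial>M) \<le> ennreal C * (\<integral>\<^sup>+ x. (g x)\<^sup>2 \<partial>M)"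
  proof (cases "(\<integral>\<^sup>+ x. (g x)\<^sup>2 \<partial>M) = \<infinity>")
    case True
    then have "ennreal C * (\<integral>\<^sup>+ x. (g x)\<^sup>2 \<partial>M) = \<infinity>" using C by (simp add: ennreal_mult_top)
    then show ?thesis by simp
  next
    case False
    have "AE x in M. (g x)\<^sup>2 \<noteq> \<infinity>" using False by (intro nn_integral_PInf_AE) auto
    then have gfin: "AE x in M. g x < \<infinity>"
      by eventually_elim (auto simp: less_top power2_eq_square ennreal_mult_eq_top_iff)
    define f where "f x = complex_of_real (enn2real (g x))" for x
    have [measurable]: "f \<in> borel_measurable M" unfolding f_def by measurable
    have fg: "AE x in M. ennreal (cmod (f x)) = g x"
      using gfin by eventually_elim (simp add: f_def less_top)
    have nf: "(\<integral>\<^sup>+ x. ennreal ((cmod (f x))\<^sup>2) \<partial>M) = (\<integral>\<^sup>+ x. (g x)\<^sup>2 \<partial>M)"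
      by (rule nn_integral_cong_AE) (use fg in \<open>eventually_elim, simp add: ennreal_power[symmetric]\<close>)
    then have f: "f \<in> L2 M" using False by (simp add: L2_iff_nn less_top)
    have ap: "app k (\<lambda>y. ennreal (cmod (f y))) x = app k g x" for x
      unfolding app_def by (rule nn_integral_cong_AE) (use fg in \<open>eventually_elim, simp\<close>)
    have "AE x in M. ennreal (cmod (kop k f x)) = app k g x"
      using app_L2(2)[OF k f] AE_space
    proof eventually_elim
      case (elim x)
      note [measurable] = kernel_slice[OF km elim(2)]
      have "kop k f x = complex_of_real (\<integral>y. enn2real (k x y) * enn2real (g y) \<partial>M)"
        unfolding kop_def f_def by (simp flip: of_real_mult)
      also have "(\<integral>y. enn2real (k x y) * enn2real (g y) \<partial>M) =
          enn2real (\<integral>\<^sup>+ y. ennreal (enn2real (k x y) * enn2real (g y)) \<partial>M)"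
        by (rule integral_eq_nn_integral) auto
      also have "(\<integral>\<^sup>+ y. ennreal (enn2real (k x y) * enn2real (g y)) \<partial>M) = app k (\<lambda>y. ennreal (cmod (f y))) x"
        unfolding app_def f_def using fin by (intro nn_integral_cong) (simp add: ennreal_mult)
      finally show ?case using elim(1) ap[of x] by simp
    qed
    then have "AE x in M. (app k g x)\<^sup>2 = ennreal ((cmod (kop k f x))\<^sup>2)"
      by eventually_elim (simp add: ennreal_power[symmetric])
    then have "(\<integral>\<^sup>+ x. (app k g x)\<^sup>2 \<partial>M) = (\<integral>\<^sup>+ x. ennreal ((cmod (kop k f x))\<^sup>2) \<partial>M)"
      by (rule nn_integral_cong_AE)
    also have "\<dots> = ennreal (L2_sqnorm M (kop k f))" using ennreal_L2_sqnorm[OF kop_L2(1)[OF k f]] by simp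
    also have "\<dots> \<le> ennreal (C * L2_sqnorm M f)" using C(2)[OF f] by (rule ennreal_leI)
    also have "\<dots> = ennreal C * (\<integral>\<^sup>+ x. (g x)\<^sup>2 \<partial>M)"
      using C ennreal_L2_sqnorm[OF f] nf by (simp add: ennreal_mult')
    finally show ?thesis .
  qed
qed (use C in simp)

end

section \<open>Bounded potentials\<close>

lemma ip_cong_AE:
  assumes "AE x in M. f x = f' x" "f \<in> borel_measurable M" "f' \<in> borel_measurable M" "g \<in> borel_measurable M"
  shows "ip M f g = ip M f' g"
proof -
  note [measurable] = assms(2-4)
  have "L2_inner M f g = L2_inner M f' g"
    unfolding L2_inner_def using assms(1) by (intro integral_cong_AE) (auto elim: eventually_mono)
  then show ?thesis by (simp add: ip_def)
qed

text \<open>Agreement is required at positive times only, since \<open>sg\<close> prescribes the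
  identity at time 0 and the given families do not.\<close>

lemma semigroup_form_eq_frm:
  assumes "\<And>t. 0 < t \<Longrightarrow> T t f \<in> L2 M" "f \<in> L2 M" "\<And>t. 0 < t \<Longrightarrow> T' t f = T t f"
  shows "semigroup_form M T f = semi_inner.frm (ip M) T' f"
proof -
  interpret semi_inner "L2 M" "ip M" lcc by (rule L2_semi_inner)
  show ?thesis unfolding semigroup_form_def frm_def
  proof (rule SUP_cong[OF refl])
    fix t :: real assume "t \<in> {0<..}"
    then have t: "0 < t" by simp
    have "Re (L2_inner M (\<lambda>x. f x - T t f x) f) = ip M (lcc 1 f (-1) (T t f)) f"
      by (simp add: ip_def lcc_def)
    also have "\<dots> = ip M f f - ip M (T t f) f" using assms(1)[OF t] assms(2) by (simp add: B_lc)
    finally show "ereal ((1 / t) * Re (L2_inner M (\<lambda>x. f x - T t f x) f)) = ereal (dq T' t f f)"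
      using assms(3)[OF t] by (simp add: dq_def)
  qed
qed

lemma bounded_mult_L2:
  assumes f: "f \<in> L2 M" and v: "v \<in> borel_measurable M" "\<And>x. \<bar>v x\<bar> \<le> (c::real)"
  shows "(\<lambda>x. complex_of_real (v x) * f x) \<in> L2 M"
    and "L2_sqnorm M (\<lambda>x. complex_of_real (v x) * f x) \<le> c\<^sup>2 * L2_sqnorm M f"
proof -
  have [measurable]: "f \<in> borel_measurable M" "v \<in> borel_measurable M" using f v L2_measurable by auto
  have le: "(cmod (complex_of_real (v x) * f x))\<^sup>2 \<le> c\<^sup>2 * (cmod (f x))\<^sup>2" for x
  proof -
    have "(v x)\<^sup>2 \<le> c\<^sup>2" using power_mono[OF v(2)[of x], of 2] by simp
    then show ?thesis by (simp add: norm_mult power_mult_distrib mult_right_mono)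
  qed
  have int: "integrable M (\<lambda>x. c\<^sup>2 * (cmod (f x))\<^sup>2)" using f by (auto simp: L2_def)
  have "integrable M (\<lambda>x. (cmod (complex_of_real (v x) * f x))\<^sup>2)"
    by (rule Bochner_Integration.integrable_bound[OF int]) (use le in auto)
  then show L: "(\<lambda>x. complex_of_real (v x) * f x) \<in> L2 M" by (simp add: L2_def)
  have "L2_sqnorm M (\<lambda>x. complex_of_real (v x) * f x) \<le> (\<integral>x. c\<^sup>2 * (cmod (f x))\<^sup>2 \<partial>M)"
    unfolding L2_sqnorm_def using L le by (intro integral_mono int) (auto simp: L2_def)
  then show "L2_sqnorm M (\<lambda>x. complex_of_real (v x) * f x) \<le> c\<^sup>2 * L2_sqnorm M f"
    by (simp add: L2_sqnorm_def)
qed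

lemma ip_bounded_mult:
  "ip M f (\<lambda>x. complex_of_real (v x) * f x) = (\<integral>x. v x * (cmod (f x))\<^sup>2 \<partial>M)"
proof -
  have "cnj (f x) * (complex_of_real (v x) * f x) = complex_of_real (v x * (cmod (f x))\<^sup>2)" for x
    using cnj_mult_self[of "f x"] by (simp add: mult.left_commute)
  then have "L2_inner M f (\<lambda>x. complex_of_real (v x) * f x) = (\<integral>x. complex_of_real (v x * (cmod (f x))\<^sup>2) \<partial>M)"
    unfolding L2_inner_def by (simp only:)
  also have "\<dots> = complex_of_real (\<integral>x. v x * (cmod (f x))\<^sup>2 \<partial>M)" by (rule integral_complex_of_real)
  finally show ?thesis by (simp add: ip_def)
qed

locale heat_semigroup = heat_kernel M P for M :: "'a measure" and P +
  assumes P_cont: "f \<in> L2 M \<Longrightarrow> ((\<lambda>t. L2_sqnorm M (\<lambda>x. kop (P t) f x - f x)) \<longlongrightarrow> 0) (at_right 0)"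
begin

sublocale L2: semi_inner "L2 M" "ip M" lcc by (rule L2_semi_inner)

text \<open>The kernels vanish at time 0, so the identity there has to be inserted by hand.\<close>

definition sgo :: "(real \<Rightarrow> 'a \<Rightarrow> 'a \<Rightarrow> ennreal) \<Rightarrow> real \<Rightarrow> ('a \<Rightarrow> complex) \<Rightarrow> 'a \<Rightarrow> complex" where
  "sgo k t f = (if t = 0 then f else kop (k t) f)"

lemma mk_slice: "mk f \<Longrightarrow> (\<lambda>(x, y). f t x y) \<in> borel_measurable (M \<Otimes>\<^sub>M M)"
  using mkD[of f "\<lambda>_. t" "M \<Otimes>\<^sub>M M" fst snd] by (simp add: case_prod_beta')

text \<open>Jensen's inequality for the sub-probability density \<open>P t x\<close>, followed by
  integration in \<open>x\<close>, where symmetry allows the mass bound to be used a second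
  time.\<close>

lemma P_L2bd: "L2bd (P t) 1"
  unfolding L2bd_def
proof (intro conjI ballI)
  show "(\<lambda>(x, y). P t x y) \<in> borel_measurable (M \<Otimes>\<^sub>M M)" by (rule mk_slice[OF mk_P])
  fix g :: "'a \<Rightarrow> ennreal" assume [measurable]: "g \<in> borel_measurable M"
  have J: "(app (P t) g x)\<^sup>2 \<le> (\<integral>\<^sup>+ y. P t x y * (g y)\<^sup>2 \<partial>M)" for x
  proof -
    define I where "I = (\<integral>\<^sup>+ y. P t x y * (g y)\<^sup>2 \<partial>M)"
    \<comment> \<open>Jensen's inequality in \<open>[0, \<infinity>]\<close>: the doubled square is
      a double integral, in which \<open>2 g y g z \<le> (g y)^2 + (g z)^2\<close> is applied, so
      that no subtraction occurs.\<close>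
    have "2 * (app (P t) g x)\<^sup>2 = (\<integral>\<^sup>+ y. \<integral>\<^sup>+ z. 2 * ((P t x y * g y) * (P t x z * g z)) \<partial>M \<partial>M)"
      unfolding app_def power2_eq_square by (simp add: nn_integral_cmult nn_integral_multc)
    also have "\<dots> \<le> (\<integral>\<^sup>+ y. \<integral>\<^sup>+ z. P t x y * (g y)\<^sup>2 * P t x z + P t x y * (P t x z * (g z)\<^sup>2) \<partial>M \<partial>M)"
    proof (intro nn_integral_mono)
      fix y z
      have "2 * ((P t x y * g y) * (P t x z * g z)) = (P t x y * P t x z) * (2 * (g y * g z))" by (simp add: mult_ac)
      also have "\<dots> \<le> (P t x y * P t x z) * ((g y)\<^sup>2 + (g z)\<^sup>2)" by (intro mult_left_mono two_mult_le_squares) auto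
      also have "\<dots> = P t x y * (g y)\<^sup>2 * P t x z + P t x y * (P t x z * (g z)\<^sup>2)"
        unfolding distrib_left by (simp only: mult_ac)
      finally show "2 * ((P t x y * g y) * (P t x z * g z)) \<le> P t x y * (g y)\<^sup>2 * P t x z + P t x y * (P t x z * (g z)\<^sup>2)" .
    qed
    also have "\<dots> = I * (\<integral>\<^sup>+ z. P t x z \<partial>M) + (\<integral>\<^sup>+ y. P t x y \<partial>M) * I"
      by (simp add: nn_integral_add nn_integral_cmult nn_integral_multc I_def)
    also have "\<dots> \<le> I * 1 + 1 * I" by (intro add_mono mult_mono P_sub) auto
    also have "\<dots> = 2 * I" by (simp add: mult_2)
    finally show ?thesis unfolding I_def[symmetric]
      using ennreal_mult_le_mult_iff[of 2 "(app (P t) g x)\<^sup>2" I] by simp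
  qed
  have "(\<integral>\<^sup>+ x. (app (P t) g x)\<^sup>2 \<partial>M) \<le> (\<integral>\<^sup>+ x. \<integral>\<^sup>+ y. P t x y * (g y)\<^sup>2 \<partial>M \<partial>M)"
    by (intro nn_integral_mono J)
  also have "\<dots> = (\<integral>\<^sup>+ y. \<integral>\<^sup>+ x. P t x y * (g y)\<^sup>2 \<partial>M \<partial>M)" by (rule swap_MM) measurable
  also have "\<dots> = (\<integral>\<^sup>+ y. (\<integral>\<^sup>+ x. P t y x \<partial>M) * (g y)\<^sup>2 \<partial>M)"
    by (simp add: nn_integral_multc P_sym[of t _ y for y])
  also have "\<dots> \<le> (\<integral>\<^sup>+ y. 1 * (g y)\<^sup>2 \<partial>M)" by (intro nn_integral_mono mult_right_mono P_sub) auto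
  finally show "(\<integral>\<^sup>+ x. (app (P t) g x)\<^sup>2 \<partial>M) \<le> ennreal 1 * (\<integral>\<^sup>+ x. (g x)\<^sup>2 \<partial>M)" by simp
qed simp

lemma L2bd_cmult:
  assumes "L2bd k C" "0 \<le> c"
  shows "L2bd (\<lambda>x y. ennreal c * k x y) (c\<^sup>2 * C)"
  unfolding L2bd_def
proof (intro conjI ballI)
  have km: "(\<lambda>(x, y). k x y) \<in> borel_measurable (M \<Otimes>\<^sub>M M)" by (rule L2bd_measurable[OF assms(1)])
  then show "(\<lambda>(x, y). ennreal c * k x y) \<in> borel_measurable (M \<Otimes>\<^sub>M M)" by (simp add: case_prod_beta')
  show "0 \<le> c\<^sup>2 * C" using assms by (simp add: L2bd_def)
  fix g :: "'a \<Rightarrow> ennreal" assume g[measurable]: "g \<in> borel_measurable M"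
  have [measurable]: "app k g \<in> borel_measurable M" by (rule app_measurable[OF km g])
  have "app (\<lambda>x y. ennreal c * k x y) g x = ennreal c * app k g x" for x
    unfolding app_def using kernel_slice[OF km, of x] space_M by (simp add: mult.assoc nn_integral_cmult)
  then have "(\<integral>\<^sup>+ x. (app (\<lambda>x y. ennreal c * k x y) g x)\<^sup>2 \<partial>M) = (ennreal c)\<^sup>2 * (\<integral>\<^sup>+ x. (app k g x)\<^sup>2 \<partial>M)"
    by (simp add: power_mult_distrib nn_integral_cmult)
  also have "\<dots> \<le> (ennreal c)\<^sup>2 * (ennreal C * (\<integral>\<^sup>+ x. (g x)\<^sup>2 \<partial>M))"
    using assms(1) g unfolding L2bd_def by (intro mult_left_mono) auto
  also have "\<dots> = ennreal (c\<^sup>2 * C) * (\<integral>\<^sup>+ x. (g x)\<^sup>2 \<partial>M)"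
    using assms by (simp add: ennreal_power ennreal_mult L2bd_def mult.assoc)
  finally show "(\<integral>\<^sup>+ x. (app (\<lambda>x y. ennreal c * k x y) g x)\<^sup>2 \<partial>M) \<le> ennreal (c\<^sup>2 * C) * (\<integral>\<^sup>+ x. (g x)\<^sup>2 \<partial>M)" .
qed

text \<open>\<open>FK n w t\<close> is the kernel of the Schroedinger semigroup with potential \<open>w \<le> n\<close>; subtracting
  \<open>n\<close> makes all terms of its perturbation series nonnegative.\<close>
definition FK :: "real \<Rightarrow> ('a \<Rightarrow> real) \<Rightarrow> real \<Rightarrow> 'a \<Rightarrow> 'a \<Rightarrow> ennreal" where
  "FK n w t x y = ennreal (exp (- n * t)) * K (\<lambda>x. ennreal (n - w x)) t x y"

lemma K_nonpos: "v \<in> borel_measurable M \<Longrightarrow> t \<le> 0 \<Longrightarrow> K v t x y = 0"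
  by (simp add: K_def D_nonpos)

lemma FK_mono:
  assumes "\<And>x. w x \<le> w' x" and [measurable]: "w \<in> borel_measurable M" "w' \<in> borel_measurable M"
  shows "FK n w' t x y \<le> FK n w t x y"
  unfolding FK_def using assms(1) by (intro mult_left_mono K_mono ennreal_leI) auto

lemma FK_shift:
  assumes [measurable]: "w \<in> borel_measurable M" and w: "\<And>x. w x \<le> n" and n: "n \<le> n'"
  shows "FK n' w t x y = FK n w t x y"
proof (cases "0 \<le> t")
  case True
  have "(\<lambda>x. ennreal (n' - w x)) = (\<lambda>x. ennreal (n - w x) + ennreal (n' - n))"
    using w n by (subst ennreal_plus[symmetric]) auto
  then have "FK n' w t x y = ennreal (exp (- n' * t)) * (ennreal (exp ((n' - n) * t)) * K (\<lambda>x. ennreal (n - w x)) t x y)"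
    unfolding FK_def using n True by (simp add: K_shift)
  also have "\<dots> = ennreal (exp (- n' * t) * exp ((n' - n) * t)) * K (\<lambda>x. ennreal (n - w x)) t x y"
    by (simp add: ennreal_mult mult.assoc)
  also have "exp (- n' * t) * exp ((n' - n) * t) = exp (- n * t)"
    by (simp add: exp_add[symmetric] algebra_simps)
  finally show ?thesis by (simp add: FK_def)
qed (simp add: FK_def K_nonpos)

lemma kop_eq_cmult:
  assumes "0 \<le> c" shows "kop (\<lambda>x y. ennreal c * k x y) f x = complex_of_real c * kop k f x"
  unfolding kop_def using assms by (simp add: enn2real_mult mult.assoc)

lemma kop_integrable:
  assumes km: "(\<lambda>(x, y). k x y) \<in> borel_measurable (M \<Otimes>\<^sub>M M)" and [measurable]: "f \<in> borel_measurable M"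
    and fin: "app k (\<lambda>y. ennreal (cmod (f y))) x < \<infinity>"
  shows "integrable M (\<lambda>y. complex_of_real (enn2real (k x y)) * f y)"
proof (subst integrable_iff_bounded, intro conjI)
  have "(\<lambda>y. k x y) \<in> borel_measurable M" by (rule kernel_slice[OF km]) (simp add: space_M)
  then show "(\<lambda>y. complex_of_real (enn2real (k x y)) * f y) \<in> borel_measurable M" by measurable
  have "(\<integral>\<^sup>+ y. ennreal (norm (complex_of_real (enn2real (k x y)) * f y)) \<partial>M) \<le> app k (\<lambda>y. ennreal (cmod (f y))) x"
    unfolding app_def
  proof (rule nn_integral_mono)
    fix y
    have "ennreal (enn2real (k x y)) \<le> k x y" by (cases "k x y") auto
    then show "ennreal (norm (complex_of_real (enn2real (k x y)) * f y)) \<le> k x y * ennreal (cmod (f y))"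
      by (simp add: norm_mult ennreal_mult mult_right_mono)
  qed
  then show "(\<integral>\<^sup>+ y. ennreal (norm (complex_of_real (enn2real (k x y)) * f y)) \<partial>M) < \<infinity>"
    using fin by (rule le_less_trans)
qed

lemma kop_add:
  assumes a: "L2bd a C" and b: "L2bd b C'" and fin: "\<And>x y. a x y < \<infinity>" "\<And>x y. b x y < \<infinity>" and f: "f \<in> L2 M"
  shows "AE x in M. kop (\<lambda>x y. a x y + b x y) f x = kop a f x + kop b f x"
  using app_L2(2)[OF a f] app_L2(2)[OF b f]
proof eventually_elim
  case (elim x)
  have "kop (\<lambda>x y. a x y + b x y) f x =
     (\<integral>y. complex_of_real (enn2real (a x y)) * f y + complex_of_real (enn2real (b x y)) * f y \<partial>M)"
    unfolding kop_def using fin by (simp add: enn2real_plus distrib_right)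
  also have "\<dots> = kop a f x + kop b f x"
    unfolding kop_def using elim
    by (intro Bochner_Integration.integral_add kop_integrable L2bd_measurable[OF a] L2bd_measurable[OF b] L2_measurable[OF f])
  finally show ?case .
qed

lemma ip_kop_abs_le:
  assumes "L2bd k (c\<^sup>2)" "0 \<le> c" "f \<in> L2 M"
  shows "\<bar>ip M (kop k f) f\<bar> \<le> c * L2_sqnorm M f"
proof -
  have nn: "0 \<le> L2_sqnorm M f" by (simp add: L2_sqnorm_def)
  have "(ip M (kop k f) f)\<^sup>2 \<le> L2_sqnorm M (kop k f) * L2_sqnorm M f"
    using L2.Cauchy_Schwarz[OF kop_L2(1)[OF assms(1,3)] assms(3)] by (simp add: ip_self)
  also have "\<dots> \<le> (c\<^sup>2 * L2_sqnorm M f) * L2_sqnorm M f"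
    by (rule mult_right_mono[OF kop_L2(2)[OF assms(1,3)] nn])
  also have "\<dots> = (c * L2_sqnorm M f)\<^sup>2" by (simp add: power2_eq_square)
  finally show ?thesis using assms nn by (simp add: abs_le_square_iff[symmetric])
qed

section \<open>The semigroup of a potential between \<open>- m\<close> and \<open>n\<close>\<close>

context
  fixes w :: "'a \<Rightarrow> real" and m n :: real
  assumes w[measurable]: "w \<in> borel_measurable M" and w_le: "\<And>x. w x \<le> n" and w_ge: "\<And>x. - m \<le> w x"
    and mn: "0 \<le> m" "0 \<le> n"
begin

abbreviation (input) "vv \<equiv> \<lambda>x. ennreal (n - w x)"

lemma vv_measurable [measurable]: "vv \<in> borel_measurable M" by measurable

lemma mk_FK: "mk (FK n w)"
proof -
  note mkD[OF mk_K[OF vv_measurable], measurable (raw)]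
  show ?thesis unfolding mk_def FK_def by measurable
qed

lemma FK_sym: "FK n w t x y = FK n w t y x"
  unfolding FK_def using K_sym[OF vv_measurable] by simp

lemma FK_CK:
  assumes "0 < t" "0 < s"
  shows "(\<integral>\<^sup>+ z. FK n w t x z * FK n w s z y \<partial>M) = FK n w (t + s) x y"
proof -
  note mkD[OF mk_K[OF vv_measurable], measurable (raw)]
  have "(\<integral>\<^sup>+ z. FK n w t x z * FK n w s z y \<partial>M) =
     (\<integral>\<^sup>+ z. ennreal (exp (- n * t) * exp (- n * s)) * (K vv t x z * K vv s z y) \<partial>M)"
    unfolding FK_def by (intro nn_integral_cong) (simp add: ennreal_mult mult_ac)
  also have "\<dots> = ennreal (exp (- n * t) * exp (- n * s)) * K vv (t + s) x y"
    by (simp add: nn_integral_cmult K_CK[OF vv_measurable assms])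
  also have "exp (- n * t) * exp (- n * s) = exp (- n * (t + s))"
    by (simp add: exp_add[symmetric] algebra_simps)
  finally show ?thesis by (simp add: FK_def)
qed

lemma vv_le: "vv x \<le> ennreal (n + m)"
  using w_ge[of x] by (intro ennreal_leI) simp

lemma FK_le: "FK n w t x y \<le> ennreal (exp (m * t)) * P t x y"
proof -
  have "FK n w t x y \<le> ennreal (exp (- n * t)) * (ennreal (exp ((n + m) * t)) * P t x y)"
    unfolding FK_def using mn vv_le by (intro mult_left_mono K_le[OF vv_measurable]) auto
  also have "\<dots> = ennreal (exp (- n * t) * exp ((n + m) * t)) * P t x y" by (simp add: ennreal_mult mult.assoc)
  also have "exp (- n * t) * exp ((n + m) * t) = exp (m * t)" by (simp add: exp_add[symmetric] algebra_simps)
  finally show ?thesis .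
qed

lemma FK_finite: "FK n w t x y < \<infinity>"
  by (rule le_less_trans[OF FK_le]) (use P_finite in \<open>simp add: ennreal_mult_less_top\<close>)

lemma FK_L2bd: "L2bd (FK n w t) ((exp (m * t))\<^sup>2)"
  using L2bd_mono[OF L2bd_cmult[OF P_L2bd, of "exp (m * t)"] FK_le mk_slice[OF mk_FK]] by simp

lemma kop_FK_in: "f \<in> L2 M \<Longrightarrow> kop (FK n w t) f \<in> L2 M"
  by (rule kop_L2(1)[OF FK_L2bd])

lemma D_vv_le: "0 \<le> t \<Longrightarrow> D vv k t x y \<le> ennreal ((n + m)^k * (t^k / fact k)) * P t x y"
  using D_le[OF vv_measurable vv_le, of k t x y] mn ennreal_mult[of "(n + m)^k" "t^k / fact k"]
  by (simp add: tau_def del: times_divide_eq_right)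

lemma D_L2bd: "0 \<le> t \<Longrightarrow> L2bd (D vv k t) (((n + m)^k * t^k / fact k)\<^sup>2)"
proof -
  assume t: "0 \<le> t"
  have "D vv k t x y \<le> ennreal ((n + m)^k * t^k / fact k) * P t x y" for x y
    using D_vv_le[OF t, of k x y] by simp
  from L2bd_mono[OF L2bd_cmult[OF P_L2bd] this mk_slice[OF mk_D[OF vv_measurable]]] mn t
  show ?thesis by simp
qed

text \<open>All terms of order at least 2 are together of order \<open>t^2\<close>, because
  \<open>fact k \<le> fact (k + 2)\<close> leaves an exponential series after \<open>t^2\<close> has
  been factored out. They therefore disappear in the difference quotient. The outer square is due to
  \<open>L2bd\<close> bounding squared norms.\<close>

lemma K_expansion:
  assumes t: "0 \<le> t"
  shows "\<exists>R. (\<forall>x y. K vv t x y = P t x y + D vv 1 t x y + R x y) \<and>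
     L2bd R (((n + m)\<^sup>2 * t\<^sup>2 * exp ((n + m) * t))\<^sup>2)"
proof -
  define R where "R x y = (\<Sum>k. D vv (k + 2) t x y)" for x y
  have "K vv t x y = P t x y + D vv 1 t x y + R x y" for x y
    unfolding K_def[OF vv_measurable] R_def
    using suminf_offset[of "\<lambda>k. D vv k t x y" 2] by (simp add: numeral_2_eq_2 add.commute)
  moreover have "L2bd R (((n + m)\<^sup>2 * t\<^sup>2 * exp ((n + m) * t))\<^sup>2 * 1)"
  proof (rule L2bd_mono[OF L2bd_cmult[OF P_L2bd]])
    show "(\<lambda>(x, y). R x y) \<in> borel_measurable (M \<Otimes>\<^sub>M M)"
    proof -
      note mkD[OF mk_D[OF vv_measurable], measurable (raw)]
      show ?thesis unfolding R_def by measurable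
    qed
    define c where "c = n + m"
    have c: "0 \<le> c" using mn by (simp add: c_def)
    fix x y
    have "R x y \<le> (\<Sum>k. ennreal (c\<^sup>2 * t\<^sup>2) * (ennreal ((c * t)^k /\<^sub>R fact k) * P t x y))"
      unfolding R_def
    proof (intro suminf_le allI)
      fix k
      have "D vv (k + 2) t x y \<le> ennreal (c^(k+2) * (t^(k+2) / fact (k+2))) * P t x y"
        unfolding c_def by (rule D_vv_le[OF t])
      also have "c^(k+2) * (t^(k+2) / fact (k+2)) \<le> c\<^sup>2 * t\<^sup>2 * ((c * t)^k /\<^sub>R fact k)"
      proof -
        have "fact k \<le> (fact (k+2) :: real)" by (intro fact_mono) auto
        then have "c^(k+2) * t^(k+2) / fact (k+2) \<le> c^(k+2) * t^(k+2) / fact k"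
          using c t by (intro divide_left_mono) auto
        also have "\<dots> = c\<^sup>2 * t\<^sup>2 * ((c * t)^k /\<^sub>R fact k)"
          by (simp add: power_add power_mult_distrib divide_inverse mult_ac power2_eq_square)
        finally show ?thesis by simp
      qed
      finally show "D vv (k + 2) t x y \<le> ennreal (c\<^sup>2 * t\<^sup>2) * (ennreal ((c * t)^k /\<^sub>R fact k) * P t x y)"
        using c t by (simp add: ennreal_mult mult_right_mono mult.assoc ennreal_leI)
    qed auto
    also have "\<dots> = ennreal (c\<^sup>2 * t\<^sup>2) * ((\<Sum>k. ennreal ((c * t)^k /\<^sub>R fact k)) * P t x y)" by simp
    also have "(\<Sum>k. ennreal ((c * t)^k /\<^sub>R fact k)) = ennreal (exp (c * t))"
      unfolding exp_def using summable_exp_generic[of "c * t"] c t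
      by (intro suminf_ennreal_eq summable_sums) auto
    finally show "R x y \<le> ennreal ((n + m)\<^sup>2 * t\<^sup>2 * exp ((n + m) * t)) * P t x y"
      by (simp add: ennreal_mult c_def mult.assoc)
  qed simp
  ultimately show ?thesis by auto
qed

text \<open>The integrand at a fixed time \<open>s\<close> of the first-order term
  \<open>D vv 1 t\<close>. Chapman-Kolmogorov bounds it uniformly in \<open>s\<close>, which makes
  it a kernel operator of its own.\<close>

lemma slice_le: "(\<integral>\<^sup>+ z. P (t - s) x z * vv z * P s z y \<partial>M) \<le> ennreal (n + m) * P t x y"
proof (cases "0 < s \<and> s < t")
  case True
  have "(\<integral>\<^sup>+ z. P (t - s) x z * vv z * P s z y \<partial>M) \<le> (\<integral>\<^sup>+ z. ennreal (n + m) * (P (t - s) x z * P s z y) \<partial>M)"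
  proof (rule nn_integral_mono)
    fix z
    have "P (t - s) x z * vv z * P s z y \<le> P (t - s) x z * ennreal (n + m) * P s z y"
      by (intro mult_mono vv_le) auto
    then show "P (t - s) x z * vv z * P s z y \<le> ennreal (n + m) * (P (t - s) x z * P s z y)"
      by (simp add: mult_ac)
  qed
  also have "\<dots> = ennreal (n + m) * P t x y"
    using P_CK[of "t - s" s x y] True by (simp add: nn_integral_cmult)
  finally show ?thesis .
next
  case False
  then have z: "P (t - s) x z * vv z * P s z y = 0" for z
    using P_nonpos[of "t - s"] P_nonpos[of s] by (cases "0 < s") auto
  show ?thesis unfolding z by simp
qed

lemma slice_L2bd: "L2bd (\<lambda>x y. \<integral>\<^sup>+ z. P (t - s) x z * vv z * P s z y \<partial>M) ((n + m)\<^sup>2)"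
  using L2bd_mono[OF L2bd_cmult[OF P_L2bd, of "n + m"] slice_le] mn by simp

lemma slice_finite: "(\<integral>\<^sup>+ z. P (t - s) x z * vv z * P s z y \<partial>M) < \<infinity>"
  by (rule le_less_trans[OF slice_le]) (use P_finite in \<open>simp add: ennreal_mult_less_top\<close>)

text \<open>The operator of the time slice factors into \<open>P (t - s)\<close>, multiplication by
  \<open>n - w\<close>, and \<open>P s\<close>; symmetry moves the outer factor to the other
  argument.\<close>

lemma slice_inner:
  assumes f: "f \<in> L2 M"
  shows "L2_inner M f (kop (\<lambda>x y. \<integral>\<^sup>+ z. P (t - s) x z * vv z * P s z y \<partial>M) f) =
    L2_inner M (kop (P (t - s)) f) (\<lambda>z. complex_of_real (n - w z) * kop (P s) f z)"
proof -
  let ?c = "\<lambda>x y. \<integral>\<^sup>+ z. P (t - s) x z * vv z * P s z y \<partial>M"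
  let ?l = "\<lambda>z y. vv z * P s z y"
  let ?g = "\<lambda>z. complex_of_real (n - w z) * kop (P s) f z"
  have Pf: "kop (P r) f \<in> L2 M" for r by (rule kop_L2(1)[OF P_L2bd f])
  have g: "?g \<in> L2 M"
  proof (rule bounded_mult_L2(1)[OF Pf])
    show "\<bar>n - w x\<bar> \<le> n + m" for x using w_le[of x] w_ge[of x] by simp
  qed measurable
  have c: "?c = (\<lambda>x y. \<integral>\<^sup>+ z. P (t - s) x z * ?l z y \<partial>M)" by (simp add: mult.assoc)
  have l: "L2bd ?l ((n + m)\<^sup>2 * 1)"
  proof (rule L2bd_mono[OF L2bd_cmult[OF P_L2bd]])
    show "?l z y \<le> ennreal (n + m) * P s z y" for z y by (intro mult_right_mono vv_le) auto
    show "(\<lambda>(z, y). ?l z y) \<in> borel_measurable (M \<Otimes>\<^sub>M M)" by measurable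
  qed (use mn in auto)
  have "kop ?l f = ?g"
    unfolding kop_def using w_le by (intro ext) (simp add: enn2real_mult mult.assoc)
  moreover have "?l z y < \<infinity>" for z y using P_finite by (simp add: ennreal_mult_less_top)
  ultimately have "AE x in M. kop (P (t - s)) ?g x = kop ?c f x"
    using kop_comp[OF P_L2bd l slice_L2bd[of t s, unfolded mult.assoc] f P_finite _ slice_finite[of t s, unfolded mult.assoc]]
    unfolding c by simp
  then have "L2_inner M f (kop ?c f) = L2_inner M f (kop (P (t - s)) ?g)"
    unfolding L2_inner_def
    using L2_measurable[OF f] L2_measurable[OF kop_L2(1)[OF slice_L2bd f, of t s]] L2_measurable[OF kop_L2(1)[OF P_L2bd g]]
    by (intro integral_cong_AE) (auto elim: eventually_mono)
  also have "\<dots> = L2_inner M (kop (P (t - s)) f) ?g"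
    by (rule kop_sym[OF P_L2bd f g P_sym])
  finally show ?thesis .
qed

text \<open>The two semigroup factors are replaced by the identity one after the other. Each
  replacement costs \<open>(n + m) * sqrt (L2_sqnorm M f) * d\<close>, since \<open>n + m\<close>
  bounds \<open>n - w\<close>.\<close>

lemma slice_inner_close:
  assumes f: "f \<in> L2 M" and d: "0 \<le> d" "L2_sqnorm M (\<lambda>x. kop (P s) f x - f x) \<le> d\<^sup>2"
     "L2_sqnorm M (\<lambda>x. kop (P (t - s)) f x - f x) \<le> d\<^sup>2"
  shows "\<bar>ip M (kop (P (t - s)) f) (\<lambda>z. complex_of_real (n - w z) * kop (P s) f z) -
     (\<integral>x. (n - w x) * (cmod (f x))\<^sup>2 \<partial>M)\<bar> \<le> 2 * (n + m) * sqrt (L2_sqnorm M f) * d"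
proof -
  define N where "N = sqrt (L2_sqnorm M f)"
  have N: "N\<^sup>2 = L2_sqnorm M f" "0 \<le> N" by (auto simp: N_def L2_sqnorm_def)
  define c where "c = n + m"
  have c: "0 \<le> c" using mn by (simp add: c_def)
  have vb: "\<bar>n - w x\<bar> \<le> c" for x using w_le[of x] w_ge[of x] by (simp add: c_def)
  define vm where "vm g = (\<lambda>z. complex_of_real (n - w z) * g z)" for g :: "'a \<Rightarrow> complex"
  have nm: "(\<lambda>x. n - w x) \<in> borel_measurable M" by measurable
  have vL: "vm g \<in> L2 M" "L2_sqnorm M (vm g) \<le> c\<^sup>2 * L2_sqnorm M g" if "g \<in> L2 M" for g
    unfolding vm_def using bounded_mult_L2[OF that nm vb] by auto
  define a where "a = kop (P (t - s)) f" define b where "b = kop (P s) f"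
  have ab: "a \<in> L2 M" "b \<in> L2 M" unfolding a_def b_def by (auto intro: kop_L2(1)[OF P_L2bd f])
  have bn: "L2_sqnorm M b \<le> N\<^sup>2" unfolding b_def using kop_L2(2)[OF P_L2bd f, of s] N by simp
  have da: "L2.nd a f \<le> d\<^sup>2" "L2.nd b f \<le> d\<^sup>2"
    using nd_L2[OF ab(1) f] nd_L2[OF ab(2) f] d by (auto simp: a_def b_def)
  have 1: "\<bar>ip M a (vm b) - ip M f (vm b)\<bar> \<le> c * N * d"
  proof -
    have "\<bar>ip M a (vm b) - ip M f (vm b)\<bar> \<le> sqrt (L2.nd a f * ip M (vm b) (vm b))"
      by (rule L2.abs_B_diff_le) (use ab f vL in auto)
    also have "\<dots> \<le> sqrt (d\<^sup>2 * (c\<^sup>2 * N\<^sup>2))"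
    proof (intro real_sqrt_le_mono mult_mono da)
      have "c\<^sup>2 * L2_sqnorm M b \<le> c\<^sup>2 * N\<^sup>2" using bn by (intro mult_left_mono) auto
      then show "ip M (vm b) (vm b) \<le> c\<^sup>2 * N\<^sup>2" using vL(2)[OF ab(2)] by (simp add: ip_self)
    qed (use L2.B_nonneg vL ab in auto)
    also have "\<dots> = c * N * d" using c N(2) d(1) by (simp add: real_sqrt_mult)
    finally show ?thesis .
  qed
  have 2: "\<bar>ip M f (vm b) - ip M f (vm f)\<bar> \<le> c * N * d"
  proof -
    have "ip M f (vm g) = ip M g (vm f)" if "g \<in> L2 M" for g
    proof -
      have "L2_inner M f (vm g) = L2_inner M (vm f) g"
        unfolding L2_inner_def vm_def by (simp add: mult_ac)
      then show ?thesis using L2.B_sym[OF vL(1)[OF f] that] by (simp add: ip_def)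
    qed
    then have "\<bar>ip M f (vm b) - ip M f (vm f)\<bar> = \<bar>ip M b (vm f) - ip M f (vm f)\<bar>" using ab by simp
    also have "\<dots> \<le> sqrt (L2.nd b f * ip M (vm f) (vm f))"
      by (rule L2.abs_B_diff_le) (use ab f vL in auto)
    also have "\<dots> \<le> sqrt (d\<^sup>2 * (c\<^sup>2 * N\<^sup>2))"
    proof (intro real_sqrt_le_mono mult_mono da)
      show "ip M (vm f) (vm f) \<le> c\<^sup>2 * N\<^sup>2" using vL(2)[OF f] N by (simp add: ip_self)
    qed (use L2.B_nonneg vL f in auto)
    also have "\<dots> = c * N * d" using c N(2) d(1) by (simp add: real_sqrt_mult)
    finally show ?thesis .
  qed
  have "ip M f (vm f) = (\<integral>x. (n - w x) * (cmod (f x))\<^sup>2 \<partial>M)" unfolding vm_def by (rule ip_bounded_mult)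
  then have "\<bar>ip M a (vm b) - (\<integral>x. (n - w x) * (cmod (f x))\<^sup>2 \<partial>M)\<bar> \<le> 2 * c * N * d"
    using 1 2 by linarith
  then show ?thesis by (simp add: a_def b_def vm_def c_def N_def)
qed

text \<open>The time integral is moved out of the inner product. The absolute values of the slices
  add up to the kernel \<open>D vv 1 t\<close>, whose own boundedness is the integrability that
  Fubini's theorem asks for.\<close>

lemma D_one_inner:
  assumes f: "f \<in> L2 M" and t: "0 < t"
  defines "h \<equiv> \<lambda>s. L2_inner M (kop (P (t - s)) f) (\<lambda>z. complex_of_real (n - w z) * kop (P s) f z)"
  shows "set_integrable lborel {0<..<t} h" "L2_inner M f (kop (D vv 1 t) f) = (LINT s:{0<..<t}|lborel. h s)"
proof -
  have fm[measurable]: "f \<in> borel_measurable M" by (rule L2_measurable[OF f])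
  define c where "c s x y = (\<integral>\<^sup>+ z. P (t - s) x z * vv z * P s z y \<partial>M)" for s x y
  have cm[measurable]: "(\<lambda>w. c (fst w) (fst (snd w)) (snd (snd w))) \<in> borel_measurable (lborel \<Otimes>\<^sub>M M \<Otimes>\<^sub>M M)"
    unfolding c_def by measurable
  have cfin: "c s x y < \<infinity>" for s x y unfolding c_def by (rule slice_finite)
  have c0: "c s x y = 0" if "s \<notin> {0<..<t}" for s x y
  proof -
    have z: "P (t - s) x z * vv z * P s z y = 0" for z
      using that P_nonpos[of "t - s"] P_nonpos[of s] by (cases "0 < s") auto
    show ?thesis unfolding c_def z by simp
  qed
  have cD: "(\<integral>\<^sup>+ s. c s x y \<partial>lborel) = D vv 1 t x y" for x y
    unfolding c_def by (simp add: conv_def)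
  define F where "F = (\<lambda>(s, x, y). cnj (f x) * (complex_of_real (enn2real (c s x y)) * f y))"
  have Fm[measurable]: "F \<in> borel_measurable (lborel \<Otimes>\<^sub>M (M \<Otimes>\<^sub>M M))"
    unfolding F_def case_prod_beta' by measurable
  interpret MM2: sigma_finite_measure "M \<Otimes>\<^sub>M M"
    by (intro sigma_finite_pair_measure sigma_finite_measure_axioms)
  interpret L3: pair_sigma_finite "lborel :: real measure" "M \<Otimes>\<^sub>M M" ..
  have D1: "L2bd (D vv 1 t) (((n + m)^1 * t^1 / fact 1)\<^sup>2)" by (rule D_L2bd) (use t in simp)
  have intD: "integrable (M \<Otimes>\<^sub>M M) (\<lambda>(x, y). cnj (f x) * (complex_of_real (enn2real (D vv 1 t x y)) * f y))"
    by (rule kop_bilinear(1)[OF D1 f f])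
  have Dfin: "D vv 1 t x y < \<infinity>" for x y
    by (rule le_less_trans[OF D_vv_le]) (use P_finite t in \<open>auto simp: ennreal_mult_less_top\<close>)
  have cm2: "(\<lambda>s. c s x y) \<in> borel_measurable borel" for x y unfolding c_def by measurable
  have normF: "(\<integral>\<^sup>+ s. ennreal (norm (F (s, x, y))) \<partial>lborel) =
      ennreal (norm (cnj (f x) * (complex_of_real (enn2real (D vv 1 t x y)) * f y)))" for x y
  proof -
    have "(\<integral>\<^sup>+ s. ennreal (norm (F (s, x, y))) \<partial>lborel) = (\<integral>\<^sup>+ s. ennreal (cmod (f x) * cmod (f y)) * c s x y \<partial>lborel)"
      using cfin by (intro nn_integral_cong) (simp add: F_def norm_mult ennreal_mult mult_ac)
    also have "\<dots> = ennreal (cmod (f x) * cmod (f y)) * D vv 1 t x y"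
      using cm2 by (simp add: nn_integral_cmult cD del: D.simps One_nat_def)
    also have "\<dots> = ennreal (norm (cnj (f x) * (complex_of_real (enn2real (D vv 1 t x y)) * f y)))"
      using Dfin by (simp add: norm_mult ennreal_mult mult_ac del: D.simps One_nat_def)
    finally show ?thesis .
  qed
  have "(\<integral>\<^sup>+ q. ennreal (norm (F q)) \<partial>(lborel \<Otimes>\<^sub>M (M \<Otimes>\<^sub>M M))) =
      (\<integral>\<^sup>+ p. \<integral>\<^sup>+ s. ennreal (norm (F (s, p))) \<partial>lborel \<partial>(M \<Otimes>\<^sub>M M))"
    by (rule L3.nn_integral_snd[symmetric]) measurable
  also have "\<dots> = (\<integral>\<^sup>+ p. ennreal (norm ((\<lambda>(x, y). cnj (f x) * (complex_of_real (enn2real (D vv 1 t x y)) * f y)) p)) \<partial>(M \<Otimes>\<^sub>M M))"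
    by (intro nn_integral_cong) (auto simp only: normF split: prod.split)
  also have "\<dots> < \<infinity>" using intD unfolding integrable_iff_bounded by blast
  finally have Fi: "integrable (lborel \<Otimes>\<^sub>M (M \<Otimes>\<^sub>M M)) F" by (subst integrable_iff_bounded) auto
  have Fi': "integrable (lborel \<Otimes>\<^sub>M (M \<Otimes>\<^sub>M M)) (\<lambda>(s, p). F (s, p))" using Fi by simp
  have hs: "(\<integral>p. F (s, p) \<partial>(M \<Otimes>\<^sub>M M)) = indicator {0<..<t} s *\<^sub>R h s" for s
  proof (cases "s \<in> {0<..<t}")
    case True
    have "(\<integral>p. F (s, p) \<partial>(M \<Otimes>\<^sub>M M)) = (\<integral>x. \<integral>y. cnj (f x) * (complex_of_real (enn2real (c s x y)) * f y) \<partial>M \<partial>M)"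
      using MM.integral_fst'[OF kop_bilinear(1)[OF slice_L2bd f f, of t s]] by (simp add: F_def c_def)
    also have "\<dots> = L2_inner M f (kop (c s) f)"
    proof -
      have "c s = (\<lambda>x y. \<integral>\<^sup>+ z. P (t - s) x z * vv z * P s z y \<partial>M)" by (intro ext) (simp add: c_def)
      then show ?thesis using kop_bilinear(2)[OF slice_L2bd f f, of t s] by simp
    qed
    also have "\<dots> = h s" using slice_inner[OF f, of t s] by (simp add: h_def c_def[abs_def])
    finally show ?thesis using True by simp
  next
    case False
    then show ?thesis using c0[OF False] by (simp add: F_def case_prod_beta')
  qed
  show "set_integrable lborel {0<..<t} h"
    using L3.integrable_fst'[OF Fi] unfolding set_integrable_def hs .
  have "(LINT s:{0<..<t}|lborel. h s) = (\<integral>s. \<integral>p. F (s, p) \<partial>(M \<Otimes>\<^sub>M M) \<partial>lborel)"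
    unfolding set_lebesgue_integral_def hs ..
  also have "\<dots> = (\<integral>p. \<integral>s. F (s, p) \<partial>lborel \<partial>(M \<Otimes>\<^sub>M M))"
    using L3.Fubini_integral[OF Fi'] by simp
  also have "\<dots> = (\<integral>p. (\<lambda>(x, y). cnj (f x) * (complex_of_real (enn2real (D vv 1 t x y)) * f y)) p \<partial>(M \<Otimes>\<^sub>M M))"
  proof (rule Bochner_Integration.integral_cong[OF refl])
    fix p :: "'a \<times> 'a"
    obtain x y where p: "p = (x, y)" by (cases p)
    have "(\<integral>s. enn2real (c s x y) \<partial>lborel) = enn2real (\<integral>\<^sup>+ s. ennreal (enn2real (c s x y)) \<partial>lborel)"
      using cm2 by (intro integral_eq_nn_integral) auto
    also have "(\<integral>\<^sup>+ s. ennreal (enn2real (c s x y)) \<partial>lborel) = D vv 1 t x y"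
      using cfin by (simp add: cD[symmetric] del: D.simps One_nat_def)
    finally have e: "(\<integral>s. enn2real (c s x y) \<partial>lborel) = enn2real (D vv 1 t x y)" .
    have "(\<integral>s. F (s, p) \<partial>lborel) = cnj (f x) * ((\<integral>s. complex_of_real (enn2real (c s x y)) \<partial>lborel) * f y)"
      unfolding F_def p by (simp only: prod.case integral_mult_right_zero integral_mult_left_zero)
    also have "(\<integral>s. complex_of_real (enn2real (c s x y)) \<partial>lborel) = complex_of_real (enn2real (D vv 1 t x y))"
      by (simp only: integral_complex_of_real e)
    finally show "(\<integral>s. F (s, p) \<partial>lborel) = (\<lambda>(x, y). cnj (f x) * (complex_of_real (enn2real (D vv 1 t x y)) * f y)) p"
      by (simp only: p prod.case)
  qed
  also have "\<dots> = L2_inner M f (kop (D vv 1 t) f)"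
    using MM.integral_fst'[OF intD] kop_bilinear(2)[OF D1 f f] by (simp only: prod.case)
  finally show "L2_inner M f (kop (D vv 1 t) f) = (LINT s:{0<..<t}|lborel. h s)" ..
qed

lemma D_one_tendsto:
  assumes f: "f \<in> L2 M"
  shows "((\<lambda>t. ip M (kop (D vv 1 t) f) f / t) \<longlongrightarrow> (\<integral>x. (n - w x) * (cmod (f x))\<^sup>2 \<partial>M)) (at_right 0)"
proof (rule tendstoI)
  fix e :: real assume e: "0 < e"
  define A where "A = (\<integral>x. (n - w x) * (cmod (f x))\<^sup>2 \<partial>M)"
  define B where "B = 2 * (n + m) * sqrt (L2_sqnorm M f)"
  have B: "0 \<le> B" using mn by (simp add: B_def L2_sqnorm_def)
  \<comment> \<open>Chosen so that \<open>B * d < e\<close>; the summand 1 covers the case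
    \<open>B = 0\<close>.\<close>
  define d where "d = e / (2 * (B + 1))"
  have "(B + 1) * d = e / 2" using B by (simp add: d_def field_simps add_nonneg_eq_0_iff)
  moreover have d0: "0 < d" using e B by (simp add: d_def)
  ultimately have d: "0 < d" "B * d < e" using e by (simp_all add: distrib_right)
  have "\<forall>\<^sub>F t in at_right 0. L2_sqnorm M (\<lambda>x. kop (P t) f x - f x) < d\<^sup>2"
    by (rule order_tendstoD[OF P_cont[OF f]]) (use d in simp)
  then obtain b where b: "0 < b" "\<And>t. 0 < t \<Longrightarrow> t < b \<Longrightarrow> L2_sqnorm M (\<lambda>x. kop (P t) f x - f x) < d\<^sup>2"
    unfolding eventually_at_right[OF zero_less_one] by auto
  show "\<forall>\<^sub>F t in at_right 0. dist (ip M (kop (D vv 1 t) f) f / t) (\<integral>x. (n - w x) * (cmod (f x))\<^sup>2 \<partial>M) < e"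
  proof (rule eventually_at_rightI[OF _ b(1)])
    fix t assume "t \<in> {0<..<b}"
    then have t: "0 < t" "t < b" by auto
    define h where "h s = L2_inner M (kop (P (t - s)) f) (\<lambda>z. complex_of_real (n - w z) * kop (P s) f z)" for s
    have hi: "set_integrable lborel {0<..<t} h" and hI: "L2_inner M f (kop (D vv 1 t) f) = (LINT s:{0<..<t}|lborel. h s)"
      unfolding h_def using D_one_inner[OF f t(1)] by auto
    have Rhi: "set_integrable lborel {0<..<t} (\<lambda>s. Re (h s))"
      using integrable_Re[OF hi[unfolded set_integrable_def]] by (simp add: set_integrable_def)
    have Ai: "set_integrable lborel {0<..<t} (\<lambda>s. A)" "(LINT s:{0<..<t}|lborel. A) = t * A"
      using t by (auto simp: set_integrable_def set_lebesgue_integral_def)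
    have L: "kop (D vv 1 t) f \<in> L2 M" using kop_L2(1)[OF D_L2bd f, of t 1] t by simp
    have "ip M (kop (D vv 1 t) f) f = ip M f (kop (D vv 1 t) f)" by (rule L2.B_sym[OF L f])
    also have "\<dots> = (LINT s:{0<..<t}|lborel. Re (h s))"
      unfolding ip_def hI set_lebesgue_integral_def
      using integral_Re[OF hi[unfolded set_integrable_def]] by simp
    finally have "ip M (kop (D vv 1 t) f) f - t * A = (LINT s:{0<..<t}|lborel. Re (h s) - A)"
      using set_integral_diff(2)[OF Rhi Ai(1)] Ai(2) by simp
    also have "\<bar>\<dots>\<bar> \<le> (LINT s:{0<..<t}|lborel. \<bar>Re (h s) - A\<bar>)"
      using set_integral_norm_bound[OF set_integral_diff(1)[OF Rhi Ai(1)]] by simp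
    also have "\<dots> \<le> (LINT s:{0<..<t}|lborel. B * d)"
    proof (rule set_integral_mono)
      show "set_integrable lborel {0<..<t} (\<lambda>s. \<bar>Re (h s) - A\<bar>)"
        using set_integrable_norm[OF set_integral_diff(1)[OF Rhi Ai(1)]] by simp
      show "set_integrable lborel {0<..<t} (\<lambda>s. B * d)" using t by (auto simp: set_integrable_def)
      fix s assume s: "s \<in> {0<..<t}"
      have "\<bar>ip M (kop (P (t - s)) f) (\<lambda>z. complex_of_real (n - w z) * kop (P s) f z) - A\<bar> \<le>
         2 * (n + m) * sqrt (L2_sqnorm M f) * d"
        unfolding A_def by (rule slice_inner_close[OF f]) (use d b(2)[of s] b(2)[of "t - s"] s t in auto)
      then show "\<bar>Re (h s) - A\<bar> \<le> B * d" by (simp add: h_def ip_def B_def)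
    qed
    also have "\<dots> = t * (B * d)" using t by (simp add: set_lebesgue_integral_def)
    finally have "\<bar>ip M (kop (D vv 1 t) f) f - t * A\<bar> \<le> t * (B * d)" .
    then have "\<bar>(ip M (kop (D vv 1 t) f) f - t * A) / t\<bar> \<le> B * d"
      using t by (simp add: abs_divide pos_divide_le_eq mult.commute)
    then show "dist (ip M (kop (D vv 1 t) f) f / t) (\<integral>x. (n - w x) * (cmod (f x))\<^sup>2 \<partial>M) < e"
      using t d by (simp add: dist_real_def A_def[symmetric] diff_divide_distrib del: D.simps One_nat_def)
  qed
qed

text \<open>Up to \<open>exp (- n t)\<close> the kernel is \<open>P + D vv 1 + R\<close>, so the
  quotient is \<open>(1 - exp (- n t)) / t\<close> times \<open>p t\<close> minus
  \<open>exp (- n t) (q t + r t / t)\<close>. In the limit the contribution \<open>n N\<close>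
  cancels the \<open>n\<close> in the integral of \<open>(n - w)\<close> against the squared modulus
  of \<open>f\<close>.\<close>

lemma FK_diff_tendsto:
  assumes f: "f \<in> L2 M"
  shows "((\<lambda>t. (ip M (kop (P t) f) f - ip M (kop (FK n w t) f) f) / t) \<longlongrightarrow>
     (\<integral>x. w x * (cmod (f x))\<^sup>2 \<partial>M)) (at_right 0)"
proof -
  define N where "N = L2_sqnorm M f"
  have Nn: "0 \<le> N" by (simp add: N_def L2_sqnorm_def)
  define c where "c = n + m"
  have c: "0 \<le> c" using mn by (simp add: c_def)
  define p where "p t = ip M (kop (P t) f) f" for t
  define q where "q t = ip M (kop (D vv 1 t) f) f / t" for t
  \<comment> \<open>The contribution of the remainder of \<open>K_expansion\<close>, defined by
    subtraction because the remainder kernel itself is only given existentially for each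
    \<open>t\<close>.\<close>
  define r where "r t = exp (n * t) * ip M (kop (FK n w t) f) f - p t - t * q t" for t
  have rb: "\<bar>r t\<bar> \<le> c\<^sup>2 * t\<^sup>2 * exp (c * t) * N" if t: "0 < t" for t
  proof -
    obtain R where R: "\<And>x y. K vv t x y = P t x y + D vv 1 t x y + R x y"
      "L2bd R ((c\<^sup>2 * t\<^sup>2 * exp (c * t))\<^sup>2)"
      using K_expansion[of t] t unfolding c_def by auto
    have Kfin: "K vv t x y < \<infinity>" for x y
      by (rule le_less_trans[OF K_le[OF vv_measurable vv_le]]) (use P_finite mn in \<open>auto simp: ennreal_mult_less_top\<close>)
    have fin: "D vv 1 t x y < \<infinity>" "R x y < \<infinity>" for x y using Kfin[of x y] unfolding R(1) by auto
    have fin2: "D vv 1 t x y + R x y < \<infinity>" for x y using fin by simp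
    have D1: "L2bd (D vv 1 t) (((n + m)^1 * t^1 / fact 1)\<^sup>2)" by (rule D_L2bd) (use t in simp)
    have D1R: "L2bd (\<lambda>x y. D vv 1 t x y + R x y) ((exp ((n + m) * t))\<^sup>2 * 1)"
    proof (rule L2bd_mono[OF L2bd_cmult[OF P_L2bd]])
      fix x y
      have "D vv 1 t x y + R x y \<le> K vv t x y" unfolding R(1) by (simp add: add.assoc)
      also have "\<dots> \<le> ennreal (exp ((n + m) * t)) * P t x y"
        by (rule K_le[OF vv_measurable vv_le]) (use mn in auto)
      finally show "D vv 1 t x y + R x y \<le> ennreal (exp ((n + m) * t)) * P t x y" .
    next
      have [measurable]: "(\<lambda>w. D vv 1 t (fst w) (snd w)) \<in> borel_measurable (M \<Otimes>\<^sub>M M)" "(\<lambda>w. R (fst w) (snd w)) \<in> borel_measurable (M \<Otimes>\<^sub>M M)"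
        using L2bd_measurable[OF D1] L2bd_measurable[OF R(2)] by (simp_all add: case_prod_beta')
      show "(\<lambda>(x, y). D vv 1 t x y + R x y) \<in> borel_measurable (M \<Otimes>\<^sub>M M)" unfolding case_prod_beta' by measurable
    qed simp
    have L: "kop (P t) f \<in> L2 M" "kop (D vv 1 t) f \<in> L2 M" "kop R f \<in> L2 M" "kop (FK n w t) f \<in> L2 M"
      by (rule kop_L2(1)[OF P_L2bd f] kop_L2(1)[OF D1 f] kop_L2(1)[OF R(2) f] kop_FK_in[OF f])+
    have "AE x in M. kop (FK n w t) f x = lcc (exp (- n * t)) (lcc 1 (kop (P t) f) 1 (lcc 1 (kop (D vv 1 t) f) 1 (kop R f))) 0 f x"
      using kop_add[OF P_L2bd[of t] D1R P_finite fin2 f] kop_add[OF D1 R(2) fin f]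
    proof eventually_elim
      case (elim x)
      have "kop (FK n w t) f x = complex_of_real (exp (- n * t)) * kop (K vv t) f x"
        using kop_eq_cmult[of "exp (- n * t)" "K vv t" f x] by (simp add: FK_def[abs_def])
      moreover have "K vv t = (\<lambda>x y. P t x y + (D vv 1 t x y + R x y))" using R(1) by (intro ext) (simp add: add.assoc)
      ultimately show ?case using elim by (simp add: lcc_def del: D.simps One_nat_def)
    qed
    then have "ip M (kop (FK n w t) f) f = ip M (lcc (exp (- n * t)) (lcc 1 (kop (P t) f) 1 (lcc 1 (kop (D vv 1 t) f) 1 (kop R f))) 0 f) f"
      by (rule ip_cong_AE) (intro L2_measurable L2.lc_in L f)+
    also have "\<dots> = exp (- n * t) * (p t + (t * q t + ip M (kop R f) f))"
      using L f t by (simp add: L2.B_lc L2.lc_in p_def q_def del: D.simps One_nat_def)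
    finally have "r t = ip M (kop R f) f" by (simp add: r_def exp_minus field_simps)
    then show ?thesis using ip_kop_abs_le[OF R(2) _ f] c by (simp add: N_def)
  qed
  have p: "(p \<longlongrightarrow> N) (at_right 0)"
  proof -
    have "((\<lambda>t. L2.nd (kop (P t) f) f) \<longlongrightarrow> 0) (at_right 0)"
      using P_cont[OF f] nd_L2[OF kop_L2(1)[OF P_L2bd f] f] by simp
    then show ?thesis unfolding p_def N_def ip_self[symmetric]
      by (rule L2.tendsto_B_left) (use kop_L2(1)[OF P_L2bd f] f in auto)
  qed
  have q: "(q \<longlongrightarrow> (\<integral>x. (n - w x) * (cmod (f x))\<^sup>2 \<partial>M)) (at_right 0)"
    unfolding q_def by (rule D_one_tendsto[OF f])
  have r: "((\<lambda>t. r t / t) \<longlongrightarrow> 0) (at_right 0)"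
  proof (rule Lim_null_comparison)
    have "((\<lambda>t. c\<^sup>2 * t * exp (c * t) * N) \<longlongrightarrow> c\<^sup>2 * 0 * exp (c * 0) * N) (at_right 0)" by (intro tendsto_intros)
    then show "((\<lambda>t. c\<^sup>2 * t * exp (c * t) * N) \<longlongrightarrow> 0) (at_right 0)" by simp
    show "\<forall>\<^sub>F t in at_right 0. norm (r t / t) \<le> c\<^sup>2 * t * exp (c * t) * N"
    proof (rule eventually_at_rightI[of 0 1])
      fix t :: real assume "t \<in> {0<..<1}"
      then have t: "0 < t" by simp
      have "\<bar>r t\<bar> / t \<le> c\<^sup>2 * t\<^sup>2 * exp (c * t) * N / t" using rb[OF t] t by (intro divide_right_mono) auto
      then show "norm (r t / t) \<le> c\<^sup>2 * t * exp (c * t) * N" using t by (simp add: power2_eq_square)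
    qed simp
  qed
  have ex: "((\<lambda>t. (exp (- n * t) - 1) / t) \<longlongrightarrow> - n) (at_right 0)"
  proof -
    have "((\<lambda>t. exp (- n * t)) has_real_derivative - n) (at 0 within {0<..})"
      by (auto intro!: derivative_eq_intros)
    then show ?thesis unfolding has_field_derivative_iff by simp
  qed
  have "((\<lambda>t. - ((exp (- n * t) - 1) / t) * p t - exp (- n * t) * (q t + r t / t)) \<longlongrightarrow>
      - (- n) * N - exp (- n * 0) * ((\<integral>x. (n - w x) * (cmod (f x))\<^sup>2 \<partial>M) + 0)) (at_right 0)"
    by (intro tendsto_intros ex p q r)
  moreover have "- (- n) * N - exp (- n * 0) * ((\<integral>x. (n - w x) * (cmod (f x))\<^sup>2 \<partial>M) + 0) = (\<integral>x. w x * (cmod (f x))\<^sup>2 \<partial>M)"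
  proof -
    have i1: "integrable M (\<lambda>x. (cmod (f x))\<^sup>2)" using f by (simp add: L2_def)
    have i2: "integrable M (\<lambda>x. w x * (cmod (f x))\<^sup>2)"
    proof (rule Bochner_Integration.integrable_bound)
      show "integrable M (\<lambda>x. (n + m) * (cmod (f x))\<^sup>2)" using i1 by simp
      show "AE x in M. norm (w x * (cmod (f x))\<^sup>2) \<le> norm ((n + m) * (cmod (f x))\<^sup>2)"
      proof (rule AE_I2)
        fix x
        have "\<bar>w x\<bar> \<le> n + m" using w_le[of x] w_ge[of x] mn by simp
        then show "norm (w x * (cmod (f x))\<^sup>2) \<le> norm ((n + m) * (cmod (f x))\<^sup>2)"
          using mn by (simp add: abs_mult mult_right_mono)
      qed
      have [measurable]: "f \<in> borel_measurable M" by (rule L2_measurable[OF f])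
      show "(\<lambda>x. w x * (cmod (f x))\<^sup>2) \<in> borel_measurable M" by measurable
    qed
    have "(\<integral>x. (n - w x) * (cmod (f x))\<^sup>2 \<partial>M) = n * N - (\<integral>x. w x * (cmod (f x))\<^sup>2 \<partial>M)"
      unfolding left_diff_distrib N_def L2_sqnorm_def using i1 i2 by simp
    then show ?thesis by simp
  qed
  ultimately have lim: "((\<lambda>t. - ((exp (- n * t) - 1) / t) * p t - exp (- n * t) * (q t + r t / t)) \<longlongrightarrow>
      (\<integral>x. w x * (cmod (f x))\<^sup>2 \<partial>M)) (at_right 0)" by simp
  show ?thesis
  proof (rule Lim_transform_eventually[OF lim])
    show "\<forall>\<^sub>F t in at_right 0. - ((exp (- n * t) - 1) / t) * p t - exp (- n * t) * (q t + r t / t) =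
       (ip M (kop (P t) f) f - ip M (kop (FK n w t) f) f) / t"
    proof (rule eventually_at_rightI[of 0 1])
      fix t :: real assume "t \<in> {0<..<1}"
      then have t: "t \<noteq> 0" by simp
      have "q t + r t / t = (exp (n * t) * ip M (kop (FK n w t) f) f - p t) / t"
        using t by (simp add: r_def field_simps)
      then have "exp (- n * t) * (q t + r t / t) = (exp (- n * t) * exp (n * t) * ip M (kop (FK n w t) f) f - exp (- n * t) * p t) / t"
        by (simp add: right_diff_distrib mult.assoc)
      also have "exp (- n * t) * exp (n * t) = 1" by (simp add: exp_add[symmetric])
      finally have e: "exp (- n * t) * (q t + r t / t) = (ip M (kop (FK n w t) f) f - exp (- n * t) * p t) / t" by simp
      show "- ((exp (- n * t) - 1) / t) * p t - exp (- n * t) * (q t + r t / t) =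
         (ip M (kop (P t) f) f - ip M (kop (FK n w t) f) f) / t"
        unfolding e p_def[symmetric] using t by (simp add: field_simps)
    qed simp
  qed
qed

lemma sg_FK: "L2.sg (sgo (FK n w))"
  unfolding L2.sg_def
proof (intro conjI allI impI ballI)
  show "sgo (FK n w) 0 f = f" for f by (simp add: sgo_def)
  show S: "sgo (FK n w) t f \<in> L2 M" if "f \<in> L2 M" for t f
    using that kop_FK_in by (simp add: sgo_def)
  show "\<exists>C. \<forall>f\<in>L2 M. ip M (sgo (FK n w) t f) (sgo (FK n w) t f) \<le> C * ip M f f" if "0 \<le> t" for t
  proof (intro exI ballI)
    fix f assume f: "f \<in> L2 M"
    show "ip M (sgo (FK n w) t f) (sgo (FK n w) t f) \<le> (exp (m * t))\<^sup>2 * ip M f f"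
      using kop_L2(2)[OF FK_L2bd f, of t] by (simp add: sgo_def ip_self)
  qed
  show "ip M f (sgo (FK n w) t g) = ip M (sgo (FK n w) t f) g" if "f \<in> L2 M" "g \<in> L2 M" for t f g
    using kop_sym[OF FK_L2bd that FK_sym, of t] by (simp add: sgo_def ip_def)
  show "ip M (sgo (FK n w) (t + s) f) g = ip M (sgo (FK n w) t (sgo (FK n w) s f)) g"
    if "0 \<le> t" "0 \<le> s" "f \<in> L2 M" "g \<in> L2 M" for t s f g
  proof (cases "t = 0 \<or> s = 0")
    case False
    then have ts: "0 < t" "0 < s" using that by auto
    have e: "(\<lambda>x y. \<integral>\<^sup>+ z. FK n w t x z * FK n w s z y \<partial>M) = FK n w (t + s)"
      by (intro ext FK_CK ts)
    have "AE x in M. kop (FK n w t) (kop (FK n w s) f) x = kop (FK n w (t + s)) f x"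
      using kop_comp[OF FK_L2bd FK_L2bd, of t s, unfolded e, OF FK_L2bd that(3)] FK_finite FK_CK[OF ts]
      by (simp add: e)
    then have "ip M (kop (FK n w t) (kop (FK n w s) f)) g = ip M (kop (FK n w (t + s)) f) g"
      by (rule ip_cong_AE) (intro L2_measurable kop_FK_in that)+
    then show ?thesis using False ts by (simp add: sgo_def)
  qed (auto simp: sgo_def)
  show "((\<lambda>t. L2.nd (sgo (FK n w) t f) f) \<longlongrightarrow> 0) (at_right 0)" if f: "f \<in> L2 M" for f
  proof -
    define N where "N = L2_sqnorm M f"
    define d where "d t = (ip M (kop (P t) f) f - ip M (kop (FK n w t) f) f) / t" for t
    define p where "p t = ip M (kop (P t) f) f" for t
    have p: "(p \<longlongrightarrow> N) (at_right 0)"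
    proof -
      have "((\<lambda>t. L2.nd (kop (P t) f) f) \<longlongrightarrow> 0) (at_right 0)"
        using P_cont[OF f] nd_L2[OF kop_L2(1)[OF P_L2bd f] f] by simp
      then show ?thesis unfolding p_def N_def ip_self[symmetric]
        by (rule L2.tendsto_B_left) (use kop_L2(1)[OF P_L2bd f] f in auto)
    qed
    have d: "(d \<longlongrightarrow> (\<integral>x. w x * (cmod (f x))\<^sup>2 \<partial>M)) (at_right 0)"
      unfolding d_def by (rule FK_diff_tendsto[OF f])
    \<comment> \<open>Expanding the squared distance leaves the squared norm, at most
      \<open>(exp (m t))^2 N\<close>, and the diagonal coefficient, which tends to \<open>N\<close>
      by the first-order expansion.\<close>
    have "((\<lambda>t. (exp (m * t))\<^sup>2 * N - 2 * (p t - t * d t) + N) \<longlongrightarrow>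
       (exp (m * 0))\<^sup>2 * N - 2 * (N - 0 * (\<integral>x. w x * (cmod (f x))\<^sup>2 \<partial>M)) + N) (at_right 0)"
      by (intro tendsto_intros p d)
    then have up: "((\<lambda>t. (exp (m * t))\<^sup>2 * N - 2 * (p t - t * d t) + N) \<longlongrightarrow> 0) (at_right 0)" by simp
    have nn: "\<forall>\<^sub>F t in at_right 0. 0 \<le> L2.nd (sgo (FK n w) t f) f"
      by (intro always_eventually allI L2.nd_nonneg S f)
    have "\<forall>\<^sub>F t in at_right 0. L2.nd (sgo (FK n w) t f) f \<le> (exp (m * t))\<^sup>2 * N - 2 * (p t - t * d t) + N"
    proof (rule eventually_at_rightI[of 0 1])
      fix t :: real assume "t \<in> {0<..<1}"
      then have t: "0 < t" by simp
      have "p t - t * d t = ip M (kop (FK n w t) f) f" using t by (simp add: p_def d_def)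
      then show "L2.nd (sgo (FK n w) t f) f \<le> (exp (m * t))\<^sup>2 * N - 2 * (p t - t * d t) + N"
        using kop_L2(2)[OF FK_L2bd f, of t] t by (simp add: L2.nd_def sgo_def ip_self N_def)
    qed simp
    then show ?thesis by (rule tendsto_sandwich[OF nn _ tendsto_const up])
  qed
qed

end

text \<open>Through the potential 0 the free semigroup inherits the axioms \<open>sg\<close> from
  the perturbed ones.\<close>

lemma FK_zero: "FK 0 (\<lambda>_. 0) = P"
proof (intro ext)
  fix t x y
  have "D (\<lambda>_. 0) (Suc k) t x y = 0" for k by (simp add: conv_def)
  then have "(\<Sum>k. D (\<lambda>_. 0) k t x y) = (\<Sum>k\<in>{0}. D (\<lambda>_. 0) k t x y)"
    by (intro suminf_finite) (auto simp: gr0_conv_Suc simp del: D.simps)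
  then show "FK 0 (\<lambda>_. 0) t x y = P t x y" by (simp add: FK_def K_def)
qed

lemma sg_P: "L2.sg (sgo P)"
  using sg_FK[of "\<lambda>_. 0" 0 0] by (simp add: FK_zero)

lemma frm_FK:
  assumes "w \<in> borel_measurable M" "\<And>x. w x \<le> n" "\<And>x. - m \<le> w x" "0 \<le> m" "0 \<le> n" "f \<in> L2 M"
  shows "L2.frm (sgo (FK n w)) f = L2.frm (sgo P) f + ereal (\<integral>x. w x * (cmod (f x))\<^sup>2 \<partial>M)"
proof (rule L2.frm_add[OF sg_FK[OF assms(1-5)] sg_P assms(6)])
  show "((\<lambda>e. L2.dq (sgo (FK n w)) e f f - L2.dq (sgo P) e f f) \<longlongrightarrow> (\<integral>x. w x * (cmod (f x))\<^sup>2 \<partial>M)) (at_right 0)"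
  proof (rule Lim_transform_eventually[OF FK_diff_tendsto[OF assms]])
    show "\<forall>\<^sub>F t in at_right 0. (ip M (kop (P t) f) f - ip M (kop (FK n w t) f) f) / t =
       L2.dq (sgo (FK n w)) t f f - L2.dq (sgo P) t f f"
      by (rule eventually_at_rightI[of 0 1]) (auto simp: L2.dq_def sgo_def diff_divide_distrib)
  qed
qed

end

section \<open>Unbounded potentials\<close>

context heat_semigroup
begin

lemma L2bd_SUP:
  assumes bd: "\<And>m. L2bd (k m) C" and inc: "\<And>x y. incseq (\<lambda>m. k m x y)"
  shows "L2bd (\<lambda>x y. SUP m. k m x y) C"
  unfolding L2bd_def
proof (intro conjI ballI)
  have [measurable]: "(\<lambda>w. k m (fst w) (snd w)) \<in> borel_measurable (M \<Otimes>\<^sub>M M)" for m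
    using L2bd_measurable[OF bd, of m] by (simp add: case_prod_beta')
  show "(\<lambda>(x, y). SUP m. k m x y) \<in> borel_measurable (M \<Otimes>\<^sub>M M)" unfolding case_prod_beta' by measurable
  show "0 \<le> C" using bd by (simp add: L2bd_def)
  fix g :: "'a \<Rightarrow> ennreal" assume g[measurable]: "g \<in> borel_measurable M"
  have [measurable]: "k m x \<in> borel_measurable M" for m x
    using kernel_slice[OF L2bd_measurable[OF bd], of x m] by (simp add: space_M)
  have [measurable]: "app (k m) g \<in> borel_measurable M" for m by (intro app_measurable L2bd_measurable[OF bd] g)
  have inc2: "incseq (\<lambda>m. app (k m) g x)" for x
    using inc unfolding app_def by (auto simp: incseq_def intro!: nn_integral_mono mult_right_mono)
  have "app (\<lambda>x y. SUP m. k m x y) g x = (SUP m. app (k m) g x)" for x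
  proof -
    have "app (\<lambda>x y. SUP m. k m x y) g x = (\<integral>\<^sup>+ y. (SUP m. k m x y * g y) \<partial>M)"
      unfolding app_def by (simp add: SUP_mult_right_ennreal)
    also have "\<dots> = (SUP m. \<integral>\<^sup>+ y. k m x y * g y \<partial>M)"
      using inc by (intro nn_integral_monotone_convergence_SUP) (auto simp: incseq_def le_fun_def intro!: mult_right_mono)
    finally show ?thesis by (simp add: app_def)
  qed
  moreover have "(SUP m. app (k m) g x)\<^sup>2 = (SUP m. (app (k m) g x)\<^sup>2)" for x
  proof -
    define u where "u = (SUP m. app (k m) g x)"
    have "(\<lambda>m. app (k m) g x) \<longlonglongrightarrow> u" unfolding u_def by (rule LIMSEQ_SUP[OF inc2])
    then have "(\<lambda>m. (app (k m) g x)\<^sup>2) \<longlonglongrightarrow> u\<^sup>2"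
      unfolding power2_eq_square by (intro tendsto_mult_ennreal) auto
    then have a: "(\<lambda>m. (app (k m) g x)\<^sup>2) \<longlonglongrightarrow> (SUP m. app (k m) g x)\<^sup>2" by (simp only: u_def)
    have b: "(\<lambda>m. (app (k m) g x)\<^sup>2) \<longlonglongrightarrow> (SUP m. (app (k m) g x)\<^sup>2)"
      using inc2[of x] by (intro LIMSEQ_SUP) (auto simp: incseq_def intro!: power_mono)
    show ?thesis by (rule LIMSEQ_unique[OF a b])
  qed
  ultimately have "(\<integral>\<^sup>+ x. (app (\<lambda>x y. SUP m. k m x y) g x)\<^sup>2 \<partial>M) = (\<integral>\<^sup>+ x. (SUP m. (app (k m) g x)\<^sup>2) \<partial>M)" by simp
  also have "\<dots> = (SUP m. \<integral>\<^sup>+ x. (app (k m) g x)\<^sup>2 \<partial>M)"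
    using inc2 by (intro nn_integral_monotone_convergence_SUP) (auto simp: incseq_def le_fun_def intro!: power_mono)
  also have "\<dots> \<le> ennreal C * (\<integral>\<^sup>+ x. (g x)\<^sup>2 \<partial>M)"
    using bd g by (intro SUP_least) (auto simp: L2bd_def)
  finally show "(\<integral>\<^sup>+ x. (app (\<lambda>x y. SUP m. k m x y) g x)\<^sup>2 \<partial>M) \<le> ennreal C * (\<integral>\<^sup>+ x. (g x)\<^sup>2 \<partial>M)" .
qed

lemma nd_kop_tendsto:
  assumes "L2bd l C" "\<And>n x y. k n x y \<le> l x y" "\<And>x y. k' x y \<le> l x y"
    and km: "\<And>n. (\<lambda>(x, y). k n x y) \<in> borel_measurable (M \<Otimes>\<^sub>M M)" "(\<lambda>(x, y). k' x y) \<in> borel_measurable (M \<Otimes>\<^sub>M M)"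
    and "\<And>x y. (\<lambda>n. k n x y) \<longlonglongrightarrow> k' x y" and f: "f \<in> L2 M"
  shows "(\<lambda>n. L2.nd (kop (k n) f) (kop k' f)) \<longlonglongrightarrow> 0"
proof -
  have "kop (k n) f \<in> L2 M" "kop k' f \<in> L2 M" for n
    using kop_L2(1)[OF L2bd_mono[OF assms(1,2) km(1)] f] kop_L2(1)[OF L2bd_mono[OF assms(1,3) km(2)] f] by auto
  then show ?thesis using kop_tendsto[OF assms] by (simp add: nd_L2)
qed

end

lemma integrable_weight:
  fixes u :: "'a \<Rightarrow> real"
  assumes "f \<in> L2 M" "u \<in> borel_measurable M" "(\<integral>\<^sup>+ x. ennreal (\<bar>u x\<bar> * (cmod (f x))\<^sup>2) \<partial>M) < \<infinity>"
  shows "integrable M (\<lambda>x. u x * (cmod (f x))\<^sup>2)"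
  using assms L2_measurable[OF assms(1)] by (subst integrable_iff_bounded) (simp add: abs_mult)

text \<open>The relative bound on the negative part enters with coefficient 1 in front of the free
  form, just enough for all truncated forms to be bounded below by \<open>- C0\<close>.
  \<open>frm_T\<close> describes the form sum on its maximal domain.\<close>

locale schroedinger = heat_semigroup M P for M :: "'a measure" and P +
  fixes w :: "'a \<Rightarrow> real" and C0 :: real and T :: "real \<Rightarrow> ('a \<Rightarrow> complex) \<Rightarrow> 'a \<Rightarrow> complex"
  assumes w[measurable]: "w \<in> borel_measurable M"
    and C0: "0 \<le> C0"
    and neg_bound: "\<And>f q. f \<in> L2 M \<Longrightarrow> semi_inner.frm (ip M) (heat_semigroup.sgo M P) f = ereal q \<Longrightarrow>
       (\<integral>\<^sup>+ x. ennreal (max (- w x) 0 * (cmod (f x))\<^sup>2) \<partial>M) \<le> ennreal (q + C0 * L2_sqnorm M f)"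
    and T: "semi_inner.sg (L2 M) (ip M) T"
    and frm_T: "\<And>f. f \<in> L2 M \<Longrightarrow> semi_inner.frm (ip M) T f =
      (if semi_inner.frm (ip M) (heat_semigroup.sgo M P) f < \<infinity> \<and> (\<integral>\<^sup>+ x. ennreal (\<bar>w x\<bar> * (cmod (f x))\<^sup>2) \<partial>M) < \<infinity>
       then semi_inner.frm (ip M) (heat_semigroup.sgo M P) f + ereal (\<integral>x. w x * (cmod (f x))\<^sup>2 \<partial>M) else \<infinity>)"
begin

section \<open>Truncated potentials and the limits of their kernels\<close>

abbreviation "frmP \<equiv> L2.frm (sgo P)"

definition wt :: "nat \<Rightarrow> nat \<Rightarrow> 'a \<Rightarrow> real" where
  "wt m n x = min (max (w x) (- real m)) (real n)"

lemma wt_measurable [measurable]: "wt m n \<in> borel_measurable M"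
  unfolding wt_def by measurable

lemma wt_le: "wt m n x \<le> real n" and wt_ge: "- real m \<le> wt m n x"
  by (auto simp: wt_def)

lemma wt_neg: "- max (- w x) 0 \<le> wt m n x"
  by (auto simp: wt_def)

definition Fmn :: "nat \<Rightarrow> nat \<Rightarrow> real \<Rightarrow> 'a \<Rightarrow> 'a \<Rightarrow> ennreal" where
  "Fmn m n = FK (real n) (wt m n)"

text \<open>The upper cut-off is removed first: for fixed \<open>m\<close> everything lies below
  \<open>exp (m t) P\<close>, as decreasing limits require. The increasing limit in \<open>m\<close>
  needs no such majorant to exist.\<close>

definition km :: "nat \<Rightarrow> real \<Rightarrow> 'a \<Rightarrow> 'a \<Rightarrow> ennreal" where
  "km m t x y = (INF n. Fmn m n t x y)"

definition kk :: "real \<Rightarrow> 'a \<Rightarrow> 'a \<Rightarrow> ennreal" where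
  "kk t x y = (SUP m. km m t x y)"

lemmas Fmn_context = wt_measurable wt_le wt_ge of_nat_0_le_iff of_nat_0_le_iff

lemma mk_Fmn: "mk (Fmn m n)" unfolding Fmn_def by (rule mk_FK[OF Fmn_context])

lemma mk_km: "mk (km m)"
proof -
  note mkD[OF mk_Fmn, measurable (raw)]
  show ?thesis unfolding mk_def km_def by measurable
qed

lemma mk_kk: "mk kk"
proof -
  note mkD[OF mk_km, measurable (raw)]
  show ?thesis unfolding mk_def kk_def by measurable
qed

text \<open>\<open>FK_shift\<close> allows both kernels to be written with the same bound
  \<open>Suc n\<close>; only then are the potentials comparable by \<open>FK_mono\<close>.\<close>

lemma Fmn_decseq: "decseq (\<lambda>n. Fmn m n t x y)"
proof (rule decseq_SucI)
  fix n
  have "Fmn m (Suc n) t x y \<le> FK (real (Suc n)) (wt m n) t x y"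
    unfolding Fmn_def by (rule FK_mono) (auto simp: wt_def)
  also have "\<dots> = Fmn m n t x y"
    unfolding Fmn_def by (rule FK_shift) (auto simp: wt_le)
  finally show "Fmn m (Suc n) t x y \<le> Fmn m n t x y" .
qed

lemma km_incseq: "incseq (\<lambda>m. km m t x y)"
proof (rule incseq_SucI)
  fix m
  have "Fmn m n t x y \<le> Fmn (Suc m) n t x y" for n
    unfolding Fmn_def by (rule FK_mono) (auto simp: wt_def)
  then show "km m t x y \<le> km (Suc m) t x y" unfolding km_def by (intro INF_mono) auto
qed

lemma km_lim: "(\<lambda>n. Fmn m n t x y) \<longlonglongrightarrow> km m t x y"
  unfolding km_def by (rule LIMSEQ_INF[OF Fmn_decseq])

lemma kk_lim: "(\<lambda>m. km m t x y) \<longlonglongrightarrow> kk t x y"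
  unfolding kk_def by (rule LIMSEQ_SUP[OF km_incseq])

lemma Fmn_le: "Fmn m n t x y \<le> ennreal (exp (real m * t)) * P t x y"
  unfolding Fmn_def by (rule FK_le[OF Fmn_context])

lemma Fmn_finite: "Fmn m n t x y < \<infinity>"
  unfolding Fmn_def by (rule FK_finite[OF Fmn_context])

lemma km_le_kk: "km m t x y \<le> kk t x y"
  unfolding kk_def by (rule SUP_upper) simp

lemma km_le_Fmn: "km m t x y \<le> Fmn m n t x y"
  unfolding km_def by (rule INF_lower) simp

lemma Fmn_sym: "Fmn m n t x y = Fmn m n t y x"
  unfolding Fmn_def by (rule FK_sym[OF Fmn_context])

lemma kk_sym: "kk t x y = kk t y x"
  unfolding kk_def km_def using Fmn_sym by simp

text \<open>Monotone convergence from above needs one finite integral, here the one for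
  \<open>n = 0\<close>, which is the finite value \<open>Fmn m 0 (t + s) x y\<close>.\<close>

lemma km_CK:
  assumes "0 < t" "0 < s"
  shows "(\<integral>\<^sup>+ z. km m t x z * km m s z y \<partial>M) = km m (t + s) x y"
proof -
  note mkD[OF mk_Fmn, measurable (raw)]
  have lim: "(\<lambda>n. Fmn m n t x z * Fmn m n s z y) \<longlonglongrightarrow> km m t x z * km m s z y" for z
    using Fmn_finite le_less_trans[OF km_le_Fmn[of m _ _ _ 0] Fmn_finite]
    by (intro tendsto_mult_ennreal km_lim) (auto simp: less_top)
  have "(\<integral>\<^sup>+ z. km m t x z * km m s z y \<partial>M) = (\<integral>\<^sup>+ z. (INF n. Fmn m n t x z * Fmn m n s z y) \<partial>M)"
  proof (rule nn_integral_cong)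
    fix z
    have "decseq (\<lambda>n. Fmn m n t x z * Fmn m n s z y)"
      using Fmn_decseq[of m t x z] Fmn_decseq[of m s z y] by (auto simp: decseq_def intro!: mult_mono)
    then have "(\<lambda>n. Fmn m n t x z * Fmn m n s z y) \<longlonglongrightarrow> (INF n. Fmn m n t x z * Fmn m n s z y)"
      by (rule LIMSEQ_INF)
    then show "km m t x z * km m s z y = (INF n. Fmn m n t x z * Fmn m n s z y)"
      using lim[of z] LIMSEQ_unique by blast
  qed
  also have "\<dots> = (INF n. \<integral>\<^sup>+ z. Fmn m n t x z * Fmn m n s z y \<partial>M)"
  proof (rule nn_integral_monotone_convergence_INF_decseq)
    show "decseq (\<lambda>n z. Fmn m n t x z * Fmn m n s z y)"
      by (rule decseq_SucI, rule le_funI, intro mult_mono decseq_SucD[OF Fmn_decseq]) auto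
    show "(\<integral>\<^sup>+ z. Fmn m 0 t x z * Fmn m 0 s z y \<partial>M) < \<infinity>"
      using FK_CK[OF Fmn_context assms, of 0 m x y] FK_finite[OF Fmn_context, of 0 m "t + s" x y]
      by (simp add: Fmn_def)
  qed measurable
  also have "\<dots> = km m (t + s) x y"
    unfolding km_def Fmn_def using FK_CK[OF Fmn_context assms] by simp
  finally show ?thesis .
qed

lemma kk_CK:
  assumes "0 < t" "0 < s"
  shows "(\<integral>\<^sup>+ z. kk t x z * kk s z y \<partial>M) = kk (t + s) x y"
proof -
  note mkD[OF mk_km, measurable (raw)]
  have "(\<integral>\<^sup>+ z. kk t x z * kk s z y \<partial>M) = (\<integral>\<^sup>+ z. (SUP m. km m t x z * km m s z y) \<partial>M)"
  proof (rule nn_integral_cong)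
    fix z
    have i: "incseq (\<lambda>m. km m t x z * km m s z y)"
      using km_incseq[of t x z] km_incseq[of s z y] by (auto simp: incseq_def intro!: mult_mono)
    show "kk t x z * kk s z y = (SUP m. km m t x z * km m s z y)"
    proof (rule antisym)
      have "km m t x z * km m' s z y \<le> (SUP m. km m t x z * km m s z y)" for m m'
      proof -
        \<comment> \<open>The double supremum is attained along the diagonal, as both factors
          increase.\<close>
        have "km m t x z * km m' s z y \<le> km (max m m') t x z * km (max m m') s z y"
          using km_incseq[of t x z] km_incseq[of s z y] by (intro mult_mono) (auto simp: incseq_def)
        also have "\<dots> \<le> (SUP m. km m t x z * km m s z y)" by (rule SUP_upper) simp
        finally show ?thesis .
      qed
      then show "kk t x z * kk s z y \<le> (SUP m. km m t x z * km m s z y)"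
        unfolding kk_def by (simp add: SUP_mult_left_ennreal SUP_mult_right_ennreal SUP_least)
      show "(SUP m. km m t x z * km m s z y) \<le> kk t x z * kk s z y"
        unfolding kk_def by (intro SUP_least mult_mono SUP_upper) auto
    qed
  qed
  also have "\<dots> = (SUP m. \<integral>\<^sup>+ z. km m t x z * km m s z y \<partial>M)"
    using km_incseq by (intro nn_integral_monotone_convergence_SUP) (auto simp: incseq_def le_fun_def intro!: mult_mono)
  also have "\<dots> = kk (t + s) x y" unfolding kk_def using km_CK[OF assms] by simp
  finally show ?thesis .
qed

section \<open>Convergence of the truncated semigroups and of their forms\<close>

abbreviation "S1 m n \<equiv> sgo (Fmn m n)"
abbreviation "S2 m \<equiv> sgo (km m)"
abbreviation "S3 \<equiv> sgo kk"

lemma sg_S1: "L2.sg (S1 m n)"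
  unfolding Fmn_def by (rule sg_FK[OF Fmn_context])

lemma frm_S1: "f \<in> L2 M \<Longrightarrow> L2.frm (S1 m n) f = frmP f + ereal (\<integral>x. wt m n x * (cmod (f x))\<^sup>2 \<partial>M)"
  unfolding Fmn_def by (rule frm_FK[OF Fmn_context])

lemma wt_integrable: "f \<in> L2 M \<Longrightarrow> integrable M (\<lambda>x. wt m n x * (cmod (f x))\<^sup>2)"
proof -
  assume f: "f \<in> L2 M"
  note [measurable] = L2_measurable[OF f]
  show ?thesis
  proof (rule Bochner_Integration.integrable_bound)
    show "integrable M (\<lambda>x. (real n + real m) * (cmod (f x))\<^sup>2)" using f by (simp add: L2_def)
    show "AE x in M. norm (wt m n x * (cmod (f x))\<^sup>2) \<le> norm ((real n + real m) * (cmod (f x))\<^sup>2)"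
    proof (rule AE_I2)
      fix x
      have "\<bar>wt m n x\<bar> \<le> real n + real m" using wt_le[of m n x] wt_ge[of m n x] by linarith
      then show "norm (wt m n x * (cmod (f x))\<^sup>2) \<le> norm ((real n + real m) * (cmod (f x))\<^sup>2)"
        by (simp add: abs_mult mult_right_mono)
    qed
  qed measurable
qed

lemma neg_integrable:
  assumes f: "f \<in> L2 M" and q: "frmP f = ereal q"
  shows "integrable M (\<lambda>x. max (- w x) 0 * (cmod (f x))\<^sup>2)"
    and "(\<integral>x. max (- w x) 0 * (cmod (f x))\<^sup>2 \<partial>M) \<le> q + C0 * L2_sqnorm M f"
proof -
  have b: "(\<integral>\<^sup>+ x. ennreal (max (- w x) 0 * (cmod (f x))\<^sup>2) \<partial>M) \<le> ennreal (q + C0 * L2_sqnorm M f)"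
    by (rule neg_bound[OF f q])
  show i: "integrable M (\<lambda>x. max (- w x) 0 * (cmod (f x))\<^sup>2)"
    by (rule integrable_weight[OF f]) (use le_less_trans[OF b ennreal_less_top] in simp_all)
  have "0 \<le> q" using L2.dq_le_frm[of 1 "sgo P" f] kop_L2(2)[OF P_L2bd f, of 1] q
    L2.nd_nonneg[OF kop_L2(1)[OF P_L2bd f, of 1] f]
    by (simp add: L2.dq_def sgo_def L2.nd_def ip_self)
  then have "0 \<le> q + C0 * L2_sqnorm M f" using C0 by (simp add: L2_sqnorm_def)
  moreover have "ennreal (\<integral>x. max (- w x) 0 * (cmod (f x))\<^sup>2 \<partial>M) \<le> ennreal (q + C0 * L2_sqnorm M f)"
    using b nn_integral_eq_integral[OF i] by simp
  ultimately show "(\<integral>x. max (- w x) 0 * (cmod (f x))\<^sup>2 \<partial>M) \<le> q + C0 * L2_sqnorm M f"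
    by simp
qed

text \<open>Whatever \<open>m\<close> and \<open>n\<close> are, the truncated potential never falls
  below minus the negative part of \<open>w\<close>, and the relative bound with coefficient 1 lets
  the free form absorb that part.\<close>

lemma frm_S1_ge:
  assumes f: "f \<in> L2 M"
  shows "ereal (- C0 * ip M f f) \<le> L2.frm (S1 m n) f"
proof (cases "frmP f")
  case (real q)
  have "- (\<integral>x. max (- w x) 0 * (cmod (f x))\<^sup>2 \<partial>M) \<le> (\<integral>x. wt m n x * (cmod (f x))\<^sup>2 \<partial>M)"
    unfolding Bochner_Integration.integral_minus[symmetric]
  proof (rule integral_mono)
    fix x show "- (max (- w x) 0 * (cmod (f x))\<^sup>2) \<le> wt m n x * (cmod (f x))\<^sup>2"
      using mult_right_mono[OF wt_neg[of x m n], of "(cmod (f x))\<^sup>2"] by simp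
  qed (use neg_integrable[OF f real] wt_integrable[OF f] in auto)
  then have "- C0 * ip M f f \<le> q + (\<integral>x. wt m n x * (cmod (f x))\<^sup>2 \<partial>M)"
    using neg_integrable(2)[OF f real] by (simp add: ip_self)
  then show ?thesis by (simp add: frm_S1[OF f] real)
qed (use frm_S1[OF f] L2.frm_ne_minus_inf in auto)

lemma S1_bound: "0 \<le> r \<Longrightarrow> f \<in> L2 M \<Longrightarrow> ip M (S1 m n r f) (S1 m n r f) * (1 - 2 * r * C0) \<le> ip M f f"
  by (rule L2.sg_bound_if_frm_ge[OF sg_S1 frm_S1_ge])

lemma km_L2bd: "L2bd (km m t) ((exp (real m * t))\<^sup>2)"
proof -
  have "km m t x y \<le> ennreal (exp (real m * t)) * P t x y" for x y
    by (rule order_trans[OF km_le_Fmn Fmn_le])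
  from L2bd_mono[OF L2bd_cmult[OF P_L2bd] this mk_slice[OF mk_km]] show ?thesis by simp
qed

lemma S2_conv:
  assumes "0 < t" "f \<in> L2 M"
  shows "(\<lambda>n. L2.nd (S1 m n t f) (S2 m t f)) \<longlonglongrightarrow> 0"
  unfolding sgo_def using assms
  by (simp, intro nd_kop_tendsto[OF L2bd_cmult[OF P_L2bd, of "exp (real m * t)" t]])
    (auto intro: Fmn_le order_trans[OF km_le_Fmn Fmn_le] mk_slice mk_Fmn mk_km km_lim)

lemma S2_in: "0 < t \<Longrightarrow> f \<in> L2 M \<Longrightarrow> S2 m t f \<in> L2 M"
  unfolding sgo_def using kop_L2(1)[OF km_L2bd] by simp

lemma frm_S2_le:
  assumes f: "f \<in> L2 M" and q: "frmP f = ereal q" and wf: "(\<integral>\<^sup>+ x. ennreal (\<bar>w x\<bar> * (cmod (f x))\<^sup>2) \<partial>M) < \<infinity>"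
  shows "L2.frm (S2 m) f \<le> ereal (q + (\<integral>x. max (w x) (- real m) * (cmod (f x))\<^sup>2 \<partial>M))"
proof (rule L2.frm_limit_le[where S="S2 m" and Sk="S1 m", OF S2_in[OF _ f] _ S2_conv[OF _ f] _ tendsto_const f])
  note [measurable] = L2_measurable[OF f]
  have i: "integrable M (\<lambda>x. max (w x) (- real m) * (cmod (f x))\<^sup>2)"
  proof (rule Bochner_Integration.integrable_bound[OF integrable_weight[OF f w wf]])
    show "AE x in M. norm (max (w x) (- real m) * (cmod (f x))\<^sup>2) \<le> norm (w x * (cmod (f x))\<^sup>2)"
      by (intro AE_I2) (auto simp: abs_mult intro!: mult_right_mono)
  qed measurable
  show "S1 m n t f \<in> L2 M" if "0 < t" for n t using L2.sg_in[OF sg_S1, of t f] that f by simp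
  show "\<forall>\<^sub>F n in sequentially. L2.frm (S1 m n) f \<le> ereal (q + (\<integral>x. max (w x) (- real m) * (cmod (f x))\<^sup>2 \<partial>M))"
  proof (rule always_eventually, rule allI)
    fix n
    have "(\<integral>x. wt m n x * (cmod (f x))\<^sup>2 \<partial>M) \<le> (\<integral>x. max (w x) (- real m) * (cmod (f x))\<^sup>2 \<partial>M)"
      by (rule integral_mono[OF wt_integrable[OF f] i]) (auto simp: wt_def intro!: mult_right_mono)
    then show "L2.frm (S1 m n) f \<le> ereal (q + (\<integral>x. max (w x) (- real m) * (cmod (f x))\<^sup>2 \<partial>M))"
      by (simp add: frm_S1[OF f] q)
  qed
qed auto

text \<open>The given semigroup supplies the dense set: \<open>T s f\<close> has finite form for
  \<open>0 < s\<close> by \<open>frm_sg_le\<close>, and it tends to \<open>f\<close> by strong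
  continuity.\<close>

lemma form_dom_dense:
  assumes f: "f \<in> L2 M" and e: "0 < e"
  shows "\<exists>g\<in>L2 M. L2.nd g f < e \<and> (\<exists>q. frmP g = ereal q) \<and> (\<integral>\<^sup>+ x. ennreal (\<bar>w x\<bar> * (cmod (g x))\<^sup>2) \<partial>M) < \<infinity>"
proof -
  have "\<forall>\<^sub>F s in at_right 0. L2.nd (T s f) f < e"
    by (rule order_tendstoD(2)[OF L2.sg_cont[OF T f] e])
  moreover have "\<forall>\<^sub>F s in at_right (0::real). 0 < s" by (simp add: eventually_at_right_less)
  ultimately have "\<forall>\<^sub>F s in at_right 0. L2.nd (T s f) f < e \<and> 0 < s" by eventually_elim simp
  then obtain s where s: "0 < s" "L2.nd (T s f) f < e"
    using eventually_happens'[OF trivial_limit_at_right_real] by blast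
  have g: "T s f \<in> L2 M" using L2.sg_in[OF T, of s f] s f by simp
  have "L2.frm T (T s f) < \<infinity>" using L2.frm_sg_le[OF T s(1) f] by (rule le_less_trans) simp
  then have *: "frmP (T s f) < \<infinity>" "(\<integral>\<^sup>+ x. ennreal (\<bar>w x\<bar> * (cmod (T s f x))\<^sup>2) \<partial>M) < \<infinity>"
    using frm_T[OF g] by (auto split: if_splits)
  then have "\<exists>q. frmP (T s f) = ereal q" using L2.frm_ne_minus_inf[of "sgo P" "T s f"] by (cases "frmP (T s f)") auto
  then show ?thesis using g s(2) * by blast
qed

lemma sg_S2: "L2.sg (S2 m)"
  and S2_bound: "0 \<le> r \<Longrightarrow> f \<in> L2 M \<Longrightarrow> ip M (S2 m r f) (S2 m r f) * (1 - 2 * r * C0) \<le> ip M f f"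
proof -
  have dense: "\<exists>g\<in>L2 M. L2.nd g f < e \<and> L2.frm (S2 m) g < \<infinity>" if fe: "f \<in> L2 M" "0 < e" for f e
  proof -
    obtain g q where g: "g \<in> L2 M" "L2.nd g f < e" "frmP g = ereal q" "(\<integral>\<^sup>+ x. ennreal (\<bar>w x\<bar> * (cmod (g x))\<^sup>2) \<partial>M) < \<infinity>"
      using form_dom_dense[OF fe] by blast
    have "L2.frm (S2 m) g < \<infinity>" using frm_S2_le[OF g(1,3,4)] by (rule le_less_trans) simp
    then show ?thesis using g by blast
  qed
  show "L2.sg (S2 m)"
    by (rule L2.sg_limitI(1)[OF sg_S1 _ S2_in S2_conv S1_bound C0 dense]) (auto simp: sgo_def)
  show "0 \<le> r \<Longrightarrow> f \<in> L2 M \<Longrightarrow> ip M (S2 m r f) (S2 m r f) * (1 - 2 * r * C0) \<le> ip M f f"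
    by (rule L2.sg_limitI(2)[OF sg_S1 _ S2_in S2_conv S1_bound C0 dense]) (auto simp: sgo_def)
qed

text \<open>The form of \<open>S1 m j\<close> lies below those of \<open>S1 m n\<close> for
  \<open>n \<ge> j\<close>, hence below that of the limit \<open>S2 m\<close>. As \<open>j\<close>
  grows, monotone convergence on the positive part shows that a finite value forces a finite free
  form and integrability of \<open>w\<close> against the squared modulus of \<open>f\<close>, which
  is the form domain of \<open>T\<close>.\<close>

lemma frm_S2_ge:
  assumes f: "f \<in> L2 M" shows "L2.frm T f \<le> L2.frm (S2 m) f"
proof (cases "L2.frm (S2 m) f")
  case (real r)
  note [measurable] = L2_measurable[OF f]
  have le: "frmP f + ereal (\<integral>x. wt m j x * (cmod (f x))\<^sup>2 \<partial>M) \<le> ereal r" for j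
  proof -
    have "L2.frm (S1 m j) f \<le> L2.frm (S2 m) f"
    proof (rule L2.frm_le_limit[OF sg_S2 sg_S1 sg_S1 S2_conv _ f])
      show "\<forall>\<^sub>F n in sequentially. \<forall>f\<in>L2 M. L2.frm (S1 m j) f \<le> L2.frm (S1 m n) f"
        using eventually_ge_at_top[of j]
      proof eventually_elim
        case (elim n)
        have "(\<integral>x. wt m j x * (cmod (g x))\<^sup>2 \<partial>M) \<le> (\<integral>x. wt m n x * (cmod (g x))\<^sup>2 \<partial>M)" if "g \<in> L2 M" for g
          by (rule integral_mono[OF wt_integrable[OF that] wt_integrable[OF that]])
            (use elim in \<open>auto simp: wt_def intro!: mult_right_mono\<close>)
        then show ?case by (auto simp: frm_S1 intro!: add_left_mono)
      qed
    qed
    then show ?thesis using real frm_S1[OF f] by simp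
  qed
  obtain q where q: "frmP f = ereal q"
    using le[of 0] L2.frm_ne_minus_inf[of "sgo P" f] by (cases "frmP f") auto
  have le': "(\<integral>x. wt m j x * (cmod (f x))\<^sup>2 \<partial>M) \<le> r - q" for j using le[of j] q by simp
  define nI where "nI = (\<integral>x. max (- w x) 0 * (cmod (f x))\<^sup>2 \<partial>M)"
  note ni = neg_integrable(1)[OF f q]
  have pj: "(\<integral>\<^sup>+ x. ennreal (min (max (w x) 0) (real j) * (cmod (f x))\<^sup>2) \<partial>M) \<le> ennreal (r - q + nI)" for j
  proof -
    have i: "integrable M (\<lambda>x. wt m j x * (cmod (f x))\<^sup>2 + max (- w x) 0 * (cmod (f x))\<^sup>2)"
      using wt_integrable[OF f] ni by auto
    have nn: "min (max (w x) 0) (real j) * (cmod (f x))\<^sup>2 \<le> wt m j x * (cmod (f x))\<^sup>2 + max (- w x) 0 * (cmod (f x))\<^sup>2" for x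
    proof -
      have "min (max (w x) 0) (real j) \<le> wt m j x + max (- w x) 0" by (auto simp: wt_def)
      then have "min (max (w x) 0) (real j) * (cmod (f x))\<^sup>2 \<le> (wt m j x + max (- w x) 0) * (cmod (f x))\<^sup>2"
        by (rule mult_right_mono) simp
      then show ?thesis by (simp add: distrib_right)
    qed
    have "0 \<le> min (max (w x) 0) (real j) * (cmod (f x))\<^sup>2" for x by auto
    then have nn0: "0 \<le> wt m j x * (cmod (f x))\<^sup>2 + max (- w x) 0 * (cmod (f x))\<^sup>2" for x using nn order_trans by blast
    have "(\<integral>\<^sup>+ x. ennreal (min (max (w x) 0) (real j) * (cmod (f x))\<^sup>2) \<partial>M) \<le>
       (\<integral>\<^sup>+ x. ennreal (wt m j x * (cmod (f x))\<^sup>2 + max (- w x) 0 * (cmod (f x))\<^sup>2) \<partial>M)"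
      by (intro nn_integral_mono ennreal_leI nn)
    also have "\<dots> = ennreal (\<integral>x. wt m j x * (cmod (f x))\<^sup>2 + max (- w x) 0 * (cmod (f x))\<^sup>2 \<partial>M)"
      by (rule nn_integral_eq_integral[OF i]) (use nn0 in simp)
    also have "\<dots> \<le> ennreal (r - q + nI)"
      using le'[of j] wt_integrable[OF f] ni by (intro ennreal_leI) (simp add: nI_def)
    finally show ?thesis .
  qed
  have "(\<integral>\<^sup>+ x. ennreal (max (w x) 0 * (cmod (f x))\<^sup>2) \<partial>M) =
      (\<integral>\<^sup>+ x. (SUP j. ennreal (min (max (w x) 0) (real j) * (cmod (f x))\<^sup>2)) \<partial>M)"
  proof (rule nn_integral_cong)
    fix x
    show "ennreal (max (w x) 0 * (cmod (f x))\<^sup>2) = (SUP j. ennreal (min (max (w x) 0) (real j) * (cmod (f x))\<^sup>2))"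
    proof (rule antisym)
      obtain j where "max (w x) 0 \<le> real j" using real_arch_simple by blast
      then have "ennreal (max (w x) 0 * (cmod (f x))\<^sup>2) = ennreal (min (max (w x) 0) (real j) * (cmod (f x))\<^sup>2)"
        by (simp add: min_def)
      also have "\<dots> \<le> (SUP j. ennreal (min (max (w x) 0) (real j) * (cmod (f x))\<^sup>2))" by (rule SUP_upper) simp
      finally show "ennreal (max (w x) 0 * (cmod (f x))\<^sup>2) \<le> (SUP j. ennreal (min (max (w x) 0) (real j) * (cmod (f x))\<^sup>2))" .
      show "(SUP j. ennreal (min (max (w x) 0) (real j) * (cmod (f x))\<^sup>2)) \<le> ennreal (max (w x) 0 * (cmod (f x))\<^sup>2)"
        by (intro SUP_least ennreal_leI mult_right_mono) auto
    qed
  qed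
  also have "\<dots> = (SUP j. \<integral>\<^sup>+ x. ennreal (min (max (w x) 0) (real j) * (cmod (f x))\<^sup>2) \<partial>M)"
    by (rule nn_integral_monotone_convergence_SUP)
      (auto simp: incseq_def le_fun_def intro!: ennreal_leI mult_right_mono)
  also have "\<dots> \<le> ennreal (r - q + nI)" by (intro SUP_least pj)
  finally have pos: "(\<integral>\<^sup>+ x. ennreal (max (w x) 0 * (cmod (f x))\<^sup>2) \<partial>M) \<le> ennreal (r - q + nI)" .
  have pi: "integrable M (\<lambda>x. max (w x) 0 * (cmod (f x))\<^sup>2)"
    by (rule integrable_weight[OF f]) (use le_less_trans[OF pos ennreal_less_top] in simp_all)
  \<comment> \<open>\<open>ennreal\<close> sends negative numbers to 0, so \<open>pos\<close>
    becomes an inequality between reals only once its right-hand side is known to be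
    nonnegative.\<close>
  have "0 \<le> r - q + nI"
  proof -
    have "0 \<le> (\<integral>x. wt m 0 x * (cmod (f x))\<^sup>2 + max (- w x) 0 * (cmod (f x))\<^sup>2 \<partial>M)"
    proof (intro integral_nonneg_AE AE_I2)
      fix x
      have "0 \<le> wt m 0 x + max (- w x) 0" by (auto simp: wt_def)
      then have "0 \<le> (wt m 0 x + max (- w x) 0) * (cmod (f x))\<^sup>2" by simp
      then show "0 \<le> wt m 0 x * (cmod (f x))\<^sup>2 + max (- w x) 0 * (cmod (f x))\<^sup>2" by (simp add: distrib_right)
    qed
    then show ?thesis using le'[of 0] wt_integrable[OF f] ni by (simp add: nI_def)
  qed
  then have pI: "(\<integral>x. max (w x) 0 * (cmod (f x))\<^sup>2 \<partial>M) \<le> r - q + nI"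
    using pos nn_integral_eq_integral[OF pi] by simp
  have ww: "w x * (cmod (f x))\<^sup>2 = max (w x) 0 * (cmod (f x))\<^sup>2 - max (- w x) 0 * (cmod (f x))\<^sup>2" for x
    unfolding left_diff_distrib[symmetric] by (auto simp: max_def)
  have wi: "integrable M (\<lambda>x. w x * (cmod (f x))\<^sup>2)" unfolding ww using pi ni by auto
  have "(\<integral>x. w x * (cmod (f x))\<^sup>2 \<partial>M) \<le> r - q"
    unfolding ww using pI pi ni by (simp add: nI_def)
  moreover have "(\<integral>\<^sup>+ x. ennreal (\<bar>w x\<bar> * (cmod (f x))\<^sup>2) \<partial>M) < \<infinity>"
    using wi by (simp add: integrable_iff_bounded abs_mult)
  ultimately show ?thesis using frm_T[OF f] q real by simp
qed (use L2.frm_ne_minus_inf in auto)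

text \<open>The majorant \<open>exp (m t) P\<close> explodes with \<open>m\<close>. The growth bound
  \<open>2^N\<close> depends on \<open>t\<close> and \<open>C0\<close> alone, passes to the kernels
  by \<open>L2bd_if_kop_bound\<close>, and survives both monotone limits.\<close>

lemma kk_L2bd:
  assumes t: "0 < t" shows "\<exists>C. L2bd (kk t) C"
proof -
  define N where "N = nat \<lceil>4 * t * C0\<rceil> + 1"
  have N: "0 < N" "4 * t * C0 \<le> real N" unfolding N_def by linarith+
  have "L2bd (Fmn m n t) (2^N)" for m n
  proof (rule L2bd_if_kop_bound)
    show "L2bd (Fmn m n t) ((exp (real m * t))\<^sup>2)" unfolding Fmn_def by (rule FK_L2bd[OF Fmn_context])
    show "Fmn m n t x y < \<infinity>" for x y by (rule Fmn_finite)
    fix f assume f: "f \<in> L2 M"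
    show "L2_sqnorm M (kop (Fmn m n t) f) \<le> 2^N * L2_sqnorm M f"
      using L2.sg_growth[OF sg_S1 S1_bound N _ f, of m n] t by (simp add: sgo_def ip_self)
  qed simp
  then have "L2bd (km m t) (2^N)" for m
    by (rule L2bd_mono[OF _ km_le_Fmn mk_slice[OF mk_km]])
  then have "L2bd (kk t) (2^N)"
    using L2bd_SUP[of "\<lambda>m. km m t"] km_incseq by (simp add: kk_def[abs_def])
  then show ?thesis by blast
qed

lemma S3_in: "0 < t \<Longrightarrow> f \<in> L2 M \<Longrightarrow> S3 t f \<in> L2 M"
  using kk_L2bd[of t] kop_L2(1) by (auto simp: sgo_def)

lemma S3_conv:
  assumes "0 < t" "f \<in> L2 M"
  shows "(\<lambda>m. L2.nd (S2 m t f) (S3 t f)) \<longlonglongrightarrow> 0"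
proof -
  obtain C where C: "L2bd (kk t) C" using kk_L2bd[OF assms(1)] by blast
  show ?thesis unfolding sgo_def using assms
    by (simp, intro nd_kop_tendsto[OF C])
      (auto intro: mk_slice mk_kk mk_km kk_lim km_le_kk)
qed

lemma frm_S3_le:
  assumes f: "f \<in> L2 M" and q: "frmP f = ereal q" and wf: "(\<integral>\<^sup>+ x. ennreal (\<bar>w x\<bar> * (cmod (f x))\<^sup>2) \<partial>M) < \<infinity>"
  shows "L2.frm S3 f \<le> ereal (q + (\<integral>x. w x * (cmod (f x))\<^sup>2 \<partial>M))"
proof (rule L2.frm_limit_le[where S=S3 and Sk=S2, OF S3_in[OF _ f] S2_in[OF _ f] S3_conv[OF _ f] _ _ f])
  note [measurable] = L2_measurable[OF f]
  show "\<forall>\<^sub>F m in sequentially. L2.frm (S2 m) f \<le> ereal (q + (\<integral>x. max (w x) (- real m) * (cmod (f x))\<^sup>2 \<partial>M))"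
    using frm_S2_le[OF f q wf] by simp
  have "(\<lambda>m. \<integral>x. max (w x) (- real m) * (cmod (f x))\<^sup>2 \<partial>M) \<longlonglongrightarrow> (\<integral>x. w x * (cmod (f x))\<^sup>2 \<partial>M)"
  proof (rule integral_dominated_convergence[where w="\<lambda>x. \<bar>w x * (cmod (f x))\<^sup>2\<bar>"])
    show "integrable M (\<lambda>x. \<bar>w x * (cmod (f x))\<^sup>2\<bar>)" using integrable_weight[OF f w wf] by simp
    show "AE x in M. (\<lambda>m. max (w x) (- real m) * (cmod (f x))\<^sup>2) \<longlonglongrightarrow> w x * (cmod (f x))\<^sup>2"
    proof (rule AE_I2)
      fix x
      obtain k where k: "- w x \<le> real k" using real_arch_simple by blast
      have "\<forall>\<^sub>F m in sequentially. max (w x) (- real m) * (cmod (f x))\<^sup>2 = w x * (cmod (f x))\<^sup>2"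
        using eventually_ge_at_top[of k] by eventually_elim (use k in \<open>simp add: max_def\<close>)
      then show "(\<lambda>m. max (w x) (- real m) * (cmod (f x))\<^sup>2) \<longlonglongrightarrow> w x * (cmod (f x))\<^sup>2"
        by (rule tendsto_eventually)
    qed
    show "AE x in M. norm (max (w x) (- real m) * (cmod (f x))\<^sup>2) \<le> \<bar>w x * (cmod (f x))\<^sup>2\<bar>" for m
      by (intro AE_I2) (auto simp: abs_mult intro!: mult_right_mono)
  qed measurable
  then show "(\<lambda>m. q + (\<integral>x. max (w x) (- real m) * (cmod (f x))\<^sup>2 \<partial>M)) \<longlonglongrightarrow> q + (\<integral>x. w x * (cmod (f x))\<^sup>2 \<partial>M)"
    by (intro tendsto_intros)
qed

lemma sg_S3: "L2.sg S3"
proof -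
  have dense: "\<exists>g\<in>L2 M. L2.nd g f < e \<and> L2.frm S3 g < \<infinity>" if fe: "f \<in> L2 M" "0 < e" for f e
  proof -
    obtain g q where g: "g \<in> L2 M" "L2.nd g f < e" "frmP g = ereal q" "(\<integral>\<^sup>+ x. ennreal (\<bar>w x\<bar> * (cmod (g x))\<^sup>2) \<partial>M) < \<infinity>"
      using form_dom_dense[OF fe] by blast
    have "L2.frm S3 g < \<infinity>" using frm_S3_le[OF g(1,3,4)] by (rule le_less_trans) simp
    then show ?thesis using g by blast
  qed
  show ?thesis
    by (rule L2.sg_limitI(1)[OF sg_S2 _ S3_in S3_conv S2_bound C0 dense]) (auto simp: sgo_def)
qed

text \<open>The two forms coincide: the lower estimate for each \<open>S2 m\<close> is stable under
  \<open>frm_le_limit\<close>, and the upper one has to be checked only where the form of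
  \<open>T\<close> is finite. Functions are compared up to a null set, hence the vanishing squared
  distance.\<close>

theorem T_eq_kop:
  assumes t: "0 < t" and f: "f \<in> L2 M"
  shows "L2_sqnorm M (\<lambda>x. T t f x - kop (kk t) f x) = 0"
proof -
  have "L2.frm T f = L2.frm S3 f" if f: "f \<in> L2 M" for f
  proof (rule antisym)
    show "L2.frm T f \<le> L2.frm S3 f"
      by (rule L2.frm_le_limit[OF sg_S3 sg_S2 T S3_conv _ f]) (use frm_S2_ge in auto)
    show "L2.frm S3 f \<le> L2.frm T f"
    proof (cases "frmP f < \<infinity> \<and> (\<integral>\<^sup>+ x. ennreal (\<bar>w x\<bar> * (cmod (f x))\<^sup>2) \<partial>M) < \<infinity>")
      case True
      then obtain q where "frmP f = ereal q" using L2.frm_ne_minus_inf[of "sgo P" f] by (cases "frmP f") auto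
      then show ?thesis using frm_T[OF f] frm_S3_le[OF f] True by simp
    next
      case False
      have "L2.frm T f = \<infinity>" unfolding frm_T[OF f] by (simp only: False if_False)
      then show ?thesis by simp
    qed
  qed
  then have "L2.nd (T t f) (S3 t f) = 0" by (rule L2.sg_unique[OF T sg_S3 _ t f])
  moreover have "T t f \<in> L2 M" "S3 t f \<in> L2 M" using L2.sg_in[OF T, of t f] S3_in t f by auto
  ultimately show ?thesis using t by (simp add: nd_L2 sgo_def)
qed

end

section \<open>Feynman-Kac formula for the bridge\<close>

text \<open>The power rule for a primitive of a merely measurable, possibly infinite
  \<open>f\<close>. The product of \<open>A s\<close> with the induction hypothesis splits into two
  ordered regions: the one where the new time is the smaller one yields \<open>k + 1\<close> copies
  of the next integral, the other one a further copy.\<close>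

lemma nn_integral_pow_primitive:
  fixes f :: "real \<Rightarrow> ennreal"
  assumes f[measurable]: "f \<in> borel_measurable borel"
  defines "A \<equiv> \<lambda>s. \<integral>\<^sup>+ u. indicator {0<..<s} u * f u \<partial>lborel"
  shows "of_nat (Suc k) * (\<integral>\<^sup>+ r. indicator {0<..<s} r * (f r * A r ^ k) \<partial>lborel) = A s ^ Suc k"
proof (induction k arbitrary: s)
  case 0 then show ?case by (simp add: A_def)
next
  case (Suc k)
  have Am[measurable]: "A \<in> borel_measurable borel"
  proof -
    have "A = (\<lambda>s. \<integral>\<^sup>+ u. (if 0 < u \<and> u < s then f u else 0) \<partial>lborel)"
      unfolding A_def by (intro ext nn_integral_cong) (simp add: indicator_def)
    then show ?thesis by simp
  qed
  let ?c = "of_nat (Suc k) :: ennreal"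
  let ?i = "\<lambda>u r. if 0 < u \<and> u < r then 1 else (0::ennreal)"
  have ind: "indicator {0<..<s} u = ?i u s" for u s :: real by (simp add: indicator_def)
  define g where "g r = f r * A r ^ k" for r
  have g[measurable]: "g \<in> borel_measurable borel" unfolding g_def by measurable
  have "A s ^ Suc (Suc k) = A s * (?c * (\<integral>\<^sup>+ r. ?i r s * g r \<partial>lborel))"
    using Suc.IH[of s] by (simp add: g_def ind)
  also have "\<dots> = ?c * ((\<integral>\<^sup>+ u. ?i u s * f u \<partial>lborel) * (\<integral>\<^sup>+ r. ?i r s * g r \<partial>lborel))"
    unfolding A_def ind by (rule mult.left_commute)
  also have "(\<integral>\<^sup>+ u. ?i u s * f u \<partial>lborel) * (\<integral>\<^sup>+ r. ?i r s * g r \<partial>lborel) =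
      (\<integral>\<^sup>+ u. \<integral>\<^sup>+ r. (?i u s * f u) * (?i r s * g r) \<partial>lborel \<partial>lborel)"
    by (subst nn_integral_cmult, measurable, subst nn_integral_multc, measurable)
  \<comment> \<open>The two orders of \<open>u\<close> and \<open>r\<close> exhaust everything
    except the diagonal, which is a null set.\<close>
  also have "(\<integral>\<^sup>+ u. \<integral>\<^sup>+ r. (?i u s * f u) * (?i r s * g r) \<partial>lborel \<partial>lborel) =
     (\<integral>\<^sup>+ u. \<integral>\<^sup>+ r. ?i u r * ?i r s * f u * g r + ?i r u * ?i u s * f u * g r \<partial>lborel \<partial>lborel)"
  proof (rule nn_integral_cong)
    fix u :: real
    show "(\<integral>\<^sup>+ r. (?i u s * f u) * (?i r s * g r) \<partial>lborel) = (\<integral>\<^sup>+ r. ?i u r * ?i r s * f u * g r + ?i r u * ?i u s * f u * g r \<partial>lborel)"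
      by (rule nn_integral_cong_AE) (use AE_lborel_singleton[of u] in \<open>eventually_elim, auto\<close>)
  qed
  also have "\<dots> = (\<integral>\<^sup>+ u. \<integral>\<^sup>+ r. ?i u r * ?i r s * f u * g r \<partial>lborel \<partial>lborel) +
      (\<integral>\<^sup>+ u. \<integral>\<^sup>+ r. ?i r u * ?i u s * f u * g r \<partial>lborel \<partial>lborel)"
    by (simp add: nn_integral_add)
  also have "(\<integral>\<^sup>+ u. \<integral>\<^sup>+ r. ?i u r * ?i r s * f u * g r \<partial>lborel \<partial>lborel) =
      (\<integral>\<^sup>+ r. \<integral>\<^sup>+ u. ?i u r * ?i r s * f u * g r \<partial>lborel \<partial>lborel)"
    by (rule lborel_pair.Fubini') measurable
  also have "\<dots> = (\<integral>\<^sup>+ r. ?i r s * (f r * A r ^ Suc k) \<partial>lborel)"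
  proof (rule nn_integral_cong)
    fix r :: real
    have "(\<integral>\<^sup>+ u. ?i u r * ?i r s * f u * g r \<partial>lborel) = (\<integral>\<^sup>+ u. (?i u r * f u) * (?i r s * g r) \<partial>lborel)"
      by (intro nn_integral_cong) (simp add: mult_ac)
    also have "\<dots> = A r * (?i r s * g r)" unfolding A_def ind by (rule nn_integral_multc) measurable
    finally show "(\<integral>\<^sup>+ u. ?i u r * ?i r s * f u * g r \<partial>lborel) = ?i r s * (f r * A r ^ Suc k)"
      by (simp add: g_def mult_ac)
  qed
  also have "(\<integral>\<^sup>+ u. \<integral>\<^sup>+ r. ?i r u * ?i u s * f u * g r \<partial>lborel \<partial>lborel) =
     (\<integral>\<^sup>+ u. ?i u s * f u * (\<integral>\<^sup>+ r. ?i r u * g r \<partial>lborel) \<partial>lborel)"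
  proof (rule nn_integral_cong)
    fix u :: real
    have "(\<integral>\<^sup>+ r. ?i r u * ?i u s * f u * g r \<partial>lborel) = (\<integral>\<^sup>+ r. (?i u s * f u) * (?i r u * g r) \<partial>lborel)"
      by (intro nn_integral_cong) (simp add: mult_ac)
    also have "\<dots> = (?i u s * f u) * (\<integral>\<^sup>+ r. ?i r u * g r \<partial>lborel)" by (rule nn_integral_cmult) measurable
    finally show "(\<integral>\<^sup>+ r. ?i r u * ?i u s * f u * g r \<partial>lborel) = (?i u s * f u) * (\<integral>\<^sup>+ r. ?i r u * g r \<partial>lborel)" .
  qed
  also have "?c * ((\<integral>\<^sup>+ r. ?i r s * (f r * A r ^ Suc k) \<partial>lborel) +
      (\<integral>\<^sup>+ u. ?i u s * f u * (\<integral>\<^sup>+ r. ?i r u * g r \<partial>lborel) \<partial>lborel)) =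
     ?c * (\<integral>\<^sup>+ r. ?i r s * (f r * A r ^ Suc k) \<partial>lborel) +
     (\<integral>\<^sup>+ u. ?i u s * f u * (?c * (\<integral>\<^sup>+ r. ?i r u * g r \<partial>lborel)) \<partial>lborel)"
    by (simp add: distrib_left nn_integral_cmult[symmetric] mult.left_commute)
  also have "(\<integral>\<^sup>+ u. ?i u s * f u * (?c * (\<integral>\<^sup>+ r. ?i r u * g r \<partial>lborel)) \<partial>lborel) =
     (\<integral>\<^sup>+ r. ?i r s * (f r * A r ^ Suc k) \<partial>lborel)"
    using Suc.IH by (simp add: g_def ind mult.assoc)
  finally show ?case unfolding ind by (simp only: of_nat_Suc[of "Suc k"] distrib_right mult_1_left add.commute)
qed

text \<open>In contrast to \<open>fidi\<close> the sets are indexed by the times themselves and the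
  chain ends with a weight \<open>h\<close>: a set can then be changed at a single time, and a chain
  can be cut into two.\<close>

fun path_fid :: "'a measure \<Rightarrow> (real \<Rightarrow> 'a \<Rightarrow> 'a \<Rightarrow> ennreal) \<Rightarrow> (real \<Rightarrow> 'a set) \<Rightarrow> real \<Rightarrow> real list
    \<Rightarrow> (real \<Rightarrow> 'a \<Rightarrow> ennreal) \<Rightarrow> 'a \<Rightarrow> ennreal" where
  "path_fid M P A s [] h y = h s y"
| "path_fid M P A s (u # us) h y = (\<integral>\<^sup>+ z. indicator (A u) z * P (u - s) y z * path_fid M P A u us h z \<partial>M)"

lemma sorted_le_last: "sorted_wrt (<) ts \<Longrightarrow> u \<in> set ts \<Longrightarrow> u \<le> last (ts :: real list)"
proof (induction ts)
  case (Cons a ts)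
  show ?case
  proof (cases "ts = []")
    case False
    then have "a \<le> last ts" using Cons(2) by (simp add: less_imp_le)
    then show ?thesis using Cons False by (cases "u = a") auto
  qed (use Cons in simp)
qed simp

text \<open>The times in \<open>W_fdd\<close> lie strictly between 0 and \<open>t\<close>; the
  endpoint is integrated out, which leaves the mass of \<open>P (t - r)\<close> as terminal
  weight.\<close>

locale bridge = heat_kernel M P for M :: "'a::{metric_space, second_countable_topology} measure" and P +
  fixes t :: real and x :: 'a and W Pin :: "(real \<Rightarrow> 'a) measure"
  assumes sets_M: "sets M = sets borel" and t: "0 < t"
    and P_pos: "0 < s \<Longrightarrow> 0 < P s y z"
    and sets_W: "sets W = sets (path_filtration t t)" and W_le: "emeasure W (space W) \<le> 1"
    and W_fdd: "\<And>ts A. sorted_wrt (<) ts \<Longrightarrow> (\<And>u. u \<in> set ts \<Longrightarrow> 0 < u \<and> u < t) \<Longrightarrow> (\<And>u. A u \<in> sets borel) \<Longrightarrow>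
        emeasure W {\<gamma> \<in> cadlag_paths t. \<forall>u\<in>set ts. \<gamma> u \<in> A u} =
          path_fid M P A 0 ts (\<lambda>r y. \<integral>\<^sup>+ z. P (t - r) y z \<partial>M) x"
    and sets_Pin: "sets Pin = sets (path_filtration_minus t)" and Pin_1: "emeasure Pin (space Pin) = 1"
    and Pin_eq: "\<And>s A. 0 < s \<Longrightarrow> s < t \<Longrightarrow> A \<in> sets (path_filtration t s) \<Longrightarrow>
        P t x x * emeasure Pin A = (\<integral>\<^sup>+ \<gamma>. P (t - s) (\<gamma> s) x * indicator A \<gamma> \<partial>W)"
begin

section \<open>Path space, cylinders and the Markov property\<close>

abbreviation "\<Omega> \<equiv> cadlag_paths t"

lemma space_filtration: "space (path_filtration t s) = \<Omega>"
  unfolding path_filtration_def by (rule space_measure_of) auto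

lemma sets_filtration:
  "sets (path_filtration t s) = sigma_sets \<Omega> {{\<gamma> \<in> \<Omega>. \<gamma> u \<in> A} | u A. 0 \<le> u \<and> u \<le> s \<and> A \<in> sets borel}"
  unfolding path_filtration_def by (rule sets_measure_of) auto

lemma sets_filtration_minus:
  "sets (path_filtration_minus t) = sigma_sets \<Omega> (\<Union>u\<in>{0..<t}. sets (path_filtration t u))"
  unfolding path_filtration_minus_def
  by (rule sets_measure_of) (use sets.space_closed[of "path_filtration t _"] space_filtration in blast)

lemma space_W: "space W = \<Omega>"
  using sets_eq_imp_space_eq[OF sets_W] space_filtration by simp

lemma space_Pin: "space Pin = \<Omega>"
proof -
  have "space (path_filtration_minus t) = \<Omega>"
    unfolding path_filtration_minus_def
    by (rule space_measure_of) (use sets.space_closed[of "path_filtration t _"] space_filtration in blast)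
  then show ?thesis using sets_eq_imp_space_eq[OF sets_Pin] by simp
qed

definition cyl :: "real set \<Rightarrow> (real \<Rightarrow> 'a set) \<Rightarrow> (real \<Rightarrow> 'a) set" where
  "cyl J A = {\<gamma> \<in> \<Omega>. \<forall>u\<in>J. \<gamma> u \<in> A u}"

text \<open>The last time \<open>r\<close> always belongs to the index set, possibly with
  \<open>UNIV\<close> as its set, so that the law of the path at \<open>r\<close> can be read off a
  cylinder. Time 0 is left out, because \<open>W_fdd\<close> says nothing about it.\<close>

definition cyls :: "real \<Rightarrow> (real \<Rightarrow> 'a) set set" where
  "cyls r = {cyl J A | J A. finite J \<and> r \<in> J \<and> J \<subseteq> {0<..r} \<and> (\<forall>u. A u \<in> sets borel)}"

definition Gr :: "real \<Rightarrow> (real \<Rightarrow> 'a) measure" where "Gr r = sigma \<Omega> (cyls r)"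

lemma cyls_sub: "cyls r \<subseteq> Pow \<Omega>" by (auto simp: cyls_def cyl_def)

lemma space_Gr: "space (Gr r) = \<Omega>" unfolding Gr_def by (rule space_measure_of[OF cyls_sub])

lemma sets_Gr: "sets (Gr r) = sigma_sets \<Omega> (cyls r)" unfolding Gr_def by (rule sets_measure_of[OF cyls_sub])

lemma Int_stable_cyls: "Int_stable (cyls r)"
proof (rule Int_stableI)
  fix a b assume "a \<in> cyls r" "b \<in> cyls r"
  then obtain J A J' A' where *: "a = cyl J A" "finite J" "r \<in> J" "J \<subseteq> {0<..r}" "\<And>u. A u \<in> sets borel"
    "b = cyl J' A'" "finite J'" "r \<in> J'" "J' \<subseteq> {0<..r}" "\<And>u. A' u \<in> sets borel"
    unfolding cyls_def by blast
  define A'' where "A'' u = (if u \<in> J then A u else UNIV) \<inter> (if u \<in> J' then A' u else UNIV)" for u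
  have "a \<inter> b = cyl (J \<union> J') A''" unfolding * cyl_def A''_def by auto
  moreover have "A'' u \<in> sets borel" for u unfolding A''_def using * by auto
  ultimately show "a \<inter> b \<in> cyls r" unfolding cyls_def using * by blast
qed

lemma cyl_in_filtration:
  assumes "finite J" "J \<subseteq> {0<..r}" "\<And>u. A u \<in> sets borel"
  shows "cyl J A \<in> sets (path_filtration t r)"
proof -
  have "cyl J A = (\<Inter>u\<in>J. {\<gamma> \<in> \<Omega>. \<gamma> u \<in> A u}) \<inter> space (path_filtration t r)"
    unfolding cyl_def space_filtration by auto
  also have "\<dots> \<in> sets (path_filtration t r)"
  proof (cases "J = {}")
    case False
    have "{\<gamma> \<in> \<Omega>. \<gamma> u \<in> A u} \<in> sets (path_filtration t r)" if "u \<in> J" for u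
      unfolding sets_filtration using assms that by (intro sigma_sets.Basic) force
    then show ?thesis using False assms(1) by (intro sets.Int sets.finite_INT) auto
  qed auto
  finally show ?thesis .
qed

lemma Gr_sub_filtration: "sets (Gr r) \<subseteq> sets (path_filtration t r)"
  unfolding sets_Gr
  by (rule sets.sigma_sets_subset[of _ "path_filtration t r", unfolded space_filtration])
    (auto simp: cyls_def intro: cyl_in_filtration)

lemma filtration_mono: "r \<le> s \<Longrightarrow> sets (path_filtration t r) \<subseteq> sets (path_filtration t s)"
  unfolding sets_filtration by (rule sigma_sets_mono') (auto intro: order_trans)

lemma Gr_sub_W: "r \<le> t \<Longrightarrow> sets (Gr r) \<subseteq> sets W"
  using Gr_sub_filtration[of r] filtration_mono[of r t] sets_W by auto

lemma Gr_sub_Pin: "0 \<le> r \<Longrightarrow> r < t \<Longrightarrow> sets (Gr r) \<subseteq> sets Pin"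
  using Gr_sub_filtration[of r] unfolding sets_Pin sets_filtration_minus by (auto intro!: sigma_sets.Basic)

lemma measurable_Gr_W: "r \<le> t \<Longrightarrow> f \<in> measurable (Gr r) N \<Longrightarrow> f \<in> measurable W N"
  using Gr_sub_W[of r] by (auto simp: measurable_def space_Gr space_W)

lemma measurable_Gr_Pin: "0 \<le> r \<Longrightarrow> r < t \<Longrightarrow> f \<in> measurable (Gr r) N \<Longrightarrow> f \<in> measurable Pin N"
  using Gr_sub_Pin[of r] by (auto simp: measurable_def space_Gr space_Pin)

lemma coord_Gr: "0 < u \<Longrightarrow> u \<le> r \<Longrightarrow> (\<lambda>\<gamma>. \<gamma> u) \<in> measurable (Gr r) borel"
proof (rule measurableI)
  fix B :: "'a set" assume u: "0 < u" "u \<le> r" and B: "B \<in> sets borel"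
  have "(\<lambda>\<gamma>. \<gamma> u) -` B \<inter> space (Gr r) = cyl {u, r} ((\<lambda>_. UNIV)(u := B))"
    unfolding space_Gr cyl_def by auto
  also have "\<dots> \<in> sets (Gr r)"
    unfolding sets_Gr using u B by (intro sigma_sets.Basic) (auto simp: cyls_def intro!: exI[of _ "{u, r}"] exI)
  finally show "(\<lambda>\<gamma>. \<gamma> u) -` B \<inter> space (Gr r) \<in> sets (Gr r)" .
qed auto

lemma borel_M: "measurable N borel = measurable N M"
  using measurable_cong_sets[OF refl sets_M] by blast

lemma coord_W [measurable]: "0 < u \<Longrightarrow> u \<le> t \<Longrightarrow> (\<lambda>\<gamma>. \<gamma> u) \<in> measurable W M"
  using measurable_Gr_W[OF order_refl coord_Gr] borel_M by blast

text \<open>Density of the law of the last coordinate on the event that the path, started in \<open>y\<close> at time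
  \<open>s\<close>, visits the prescribed sets.\<close>
fun dens :: "(real \<Rightarrow> 'a set) \<Rightarrow> real \<Rightarrow> 'a \<Rightarrow> real list \<Rightarrow> 'a \<Rightarrow> ennreal" where
  "dens A s y [] z = 0"
| "dens A s y [u] z = indicator (A u) z * P (u - s) y z"
| "dens A s y (u # u' # us) z = (\<integral>\<^sup>+ a. indicator (A u) a * P (u - s) y a * dens A u a (u' # us) z \<partial>M)"

abbreviation "fid \<equiv> path_fid M P"

lemma dens_measurable:
  assumes A: "\<And>u. A u \<in> sets borel"
  shows "(\<lambda>(y, z). dens A s y ts z) \<in> borel_measurable (M \<Otimes>\<^sub>M M)"
proof (induction ts arbitrary: s rule: induct_list012)
  case (2 u)
  have [measurable]: "A u \<in> sets M" using A sets_M by simp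
  show ?case by simp
next
  case (3 u u' us)
  have [measurable]: "A u \<in> sets M" using A sets_M by simp
  have [measurable]: "(\<lambda>w. dens A u (fst w) (u' # us) (snd w)) \<in> borel_measurable (M \<Otimes>\<^sub>M M)"
    using 3(2)[of u] by (simp add: case_prod_beta')
  have "(\<lambda>w. dens A u (snd w) (u' # us) (snd (fst w))) \<in> borel_measurable ((M \<Otimes>\<^sub>M M) \<Otimes>\<^sub>M M)"
    using measurable_compose[of "\<lambda>w. (snd w, snd (fst w))" "(M \<Otimes>\<^sub>M M) \<Otimes>\<^sub>M M" "M \<Otimes>\<^sub>M M" "\<lambda>w. dens A u (fst w) (u' # us) (snd w)"]
    by simp
  note [measurable] = this
  show ?case unfolding dens.simps case_prod_beta' by measurable
qed (simp add: case_prod_beta')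

lemma fid_append:
  assumes A: "\<And>u. A u \<in> sets borel" and h: "\<And>r. h r \<in> borel_measurable M"
  shows "ts \<noteq> [] \<Longrightarrow> fid A s ts h y = (\<integral>\<^sup>+ z. dens A s y ts z * h (last ts) z \<partial>M)"
proof (induction ts arbitrary: s y rule: induct_list012)
  case (3 u u' us)
  have [measurable]: "A u \<in> sets M" using A sets_M by simp
  have [measurable]: "(\<lambda>w. dens A u (fst w) (u' # us) (snd w)) \<in> borel_measurable (M \<Otimes>\<^sub>M M)"
    using dens_measurable[of A u "u' # us", OF A] by (simp add: case_prod_beta')
  note h[measurable]
  have dz: "(\<lambda>z. dens A u a (u' # us) z) \<in> borel_measurable M" for a
    using measurable_Pair2[OF dens_measurable[of A u "u' # us", OF A], of a] by (simp add: space_M)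
  have da: "(\<lambda>a. dens A u a (u' # us) z) \<in> borel_measurable M" for z
    using measurable_Pair1[OF dens_measurable[of A u "u' # us", OF A], of z] by (simp add: space_M)
  let ?h = "h (last (u' # us))"
  have "fid A s (u # u' # us) h y =
     (\<integral>\<^sup>+ a. indicator (A u) a * P (u - s) y a * (\<integral>\<^sup>+ z. dens A u a (u' # us) z * ?h z \<partial>M) \<partial>M)"
    using 3(2)[of u] by (simp del: dens.simps)
  also have "\<dots> = (\<integral>\<^sup>+ a. \<integral>\<^sup>+ z. (indicator (A u) a * P (u - s) y a * dens A u a (u' # us) z) * ?h z \<partial>M \<partial>M)"
    using dz by (simp add: nn_integral_cmult[symmetric] mult.assoc del: dens.simps)
  also have "\<dots> = (\<integral>\<^sup>+ z. \<integral>\<^sup>+ a. (indicator (A u) a * P (u - s) y a * dens A u a (u' # us) z) * ?h z \<partial>M \<partial>M)"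
    by (rule swap_MM) (simp add: case_prod_beta' del: dens.simps)
  also have "\<dots> = (\<integral>\<^sup>+ z. dens A s y (u # u' # us) z * ?h z \<partial>M)"
    using da by (simp add: nn_integral_multc dens.simps(3))
  finally show ?case by simp
qed (auto simp: mult_ac)

lemma dens_restrict:
  assumes "distinct ts" "ts \<noteq> []" "last ts = r"
  shows "dens (A(r := A r \<inter> C)) s y ts z = indicator C z * dens A s y ts z"
  using assms
proof (induction ts arbitrary: s y rule: induct_list012)
  case (3 u u' us)
  have "last (u' # us) = r" using 3(5) by simp
  then have ne: "u \<noteq> r" using 3(3) last_in_set[of "u' # us"] by auto
  have IH: "dens (A(r := A r \<inter> C)) u a (u' # us) z = indicator C z * dens A u a (u' # us) z" for a
    by (rule 3(2)) (use 3(3,5) in auto)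
  show ?case unfolding dens.simps(3) IH using ne by (cases "z \<in> C") simp_all
qed (auto simp: indicator_def)

text \<open>The probability that a path from \<open>y\<close> survives up to time
  \<open>s\<close>.\<close>

definition H :: "real \<Rightarrow> 'a \<Rightarrow> ennreal" where "H s y = (\<integral>\<^sup>+ z. P s y z \<partial>M)"

lemma H_measurable [measurable]: "H s \<in> borel_measurable M"
  unfolding H_def by measurable

lemma W_cyl:
  assumes "sorted_wrt (<) ts" "\<And>u. u \<in> set ts \<Longrightarrow> 0 < u \<and> u < t" "\<And>u. A u \<in> sets borel"
  shows "emeasure W (cyl (set ts) A) = fid A 0 ts (\<lambda>r. H (t - r)) x"
  unfolding cyl_def H_def[abs_def] by (rule W_fdd[OF assms])

lemma W_coord:
  assumes "0 < s" "s < t" and [measurable]: "g \<in> borel_measurable M"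
  shows "(\<integral>\<^sup>+ \<gamma>. g (\<gamma> s) \<partial>W) = (\<integral>\<^sup>+ y. P s x y * H (t - s) y * g y \<partial>M)"
proof -
  note [measurable] = coord_W[of s]
  have "distr W M (\<lambda>\<gamma>. \<gamma> s) = density M (\<lambda>y. P s x y * H (t - s) y)"
  proof (rule measure_eqI)
    fix B assume "B \<in> sets (distr W M (\<lambda>\<gamma>. \<gamma> s))"
    then have B[measurable]: "B \<in> sets M" by simp
    have "(\<lambda>\<gamma>. \<gamma> s) -` B \<inter> space W = cyl (set [s]) (\<lambda>_. B)" unfolding cyl_def space_W by auto
    then have "emeasure (distr W M (\<lambda>\<gamma>. \<gamma> s)) B = fid (\<lambda>_. B) 0 [s] (\<lambda>r. H (t - r)) x"
      using W_cyl[of "[s]" "\<lambda>_. B"] assms B sets_M by (subst emeasure_distr) auto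
    also have "\<dots> = emeasure (density M (\<lambda>y. P s x y * H (t - s) y)) B"
      by (subst emeasure_density) (auto simp: mult_ac)
    finally show "emeasure (distr W M (\<lambda>\<gamma>. \<gamma> s)) B = emeasure (density M (\<lambda>y. P s x y * H (t - s) y)) B" .
  qed simp
  then have "(\<integral>\<^sup>+ y. g y \<partial>distr W M (\<lambda>\<gamma>. \<gamma> s)) = (\<integral>\<^sup>+ y. g y \<partial>density M (\<lambda>y. P s x y * H (t - s) y))" by simp
  then show ?thesis using assms by (simp add: nn_integral_distr nn_integral_density)
qed

text \<open>The bridge has full mass only if the heat kernel is stochastically complete.\<close>
lemma H_eq_1:
  assumes s: "0 < s" "s < t" shows "AE y in M. H s y = 1"
proof -
  define r where "r = t - s"
  have r: "0 < r" "r < t" "t - r = s" using s by (auto simp: r_def)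
  let ?f = "\<lambda>y. P r x y * P s y x"
  have fin: "(\<integral>\<^sup>+ y. ?f y \<partial>M) = P t x x" using P_CK[of r s x x] r s by (simp add: r_def)
  \<comment> \<open>The mass 1 of \<open>Pin\<close>, computed through \<open>W\<close> at time
    \<open>r\<close>, carries the extra factor \<open>H s\<close>; as the weight
    \<open>P r x y * P s y x\<close> is positive and has a finite integral, \<open>H s\<close> must
    be 1 almost everywhere.\<close>
  have "P t x x * 1 = (\<integral>\<^sup>+ \<gamma>. P s (\<gamma> r) x * indicator \<Omega> \<gamma> \<partial>W)"
    using Pin_eq[OF r(1,2) sets.top[of "path_filtration t r", unfolded space_filtration]] Pin_1 r(3)
    by (simp add: space_Pin)
  also have "\<dots> = (\<integral>\<^sup>+ \<gamma>. P s (\<gamma> r) x \<partial>W)" by (intro nn_integral_cong) (simp add: space_W)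
  also have "\<dots> = (\<integral>\<^sup>+ y. ?f y * H s y \<partial>M)"
    using W_coord[OF r(1,2), of "\<lambda>y. P s y x"] r(3) by (simp add: mult_ac)
  finally have eq: "(\<integral>\<^sup>+ y. ?f y * H s y \<partial>M) = (\<integral>\<^sup>+ y. ?f y \<partial>M)" using fin by simp
  have le: "H s y \<le> 1" for y unfolding H_def by (rule P_sub)
  have "(\<integral>\<^sup>+ y. ?f y - ?f y * H s y \<partial>M) = (\<integral>\<^sup>+ y. ?f y \<partial>M) - (\<integral>\<^sup>+ y. ?f y * H s y \<partial>M)"
  proof (rule nn_integral_diff)
    show "(\<integral>\<^sup>+ y. ?f y * H s y \<partial>M) \<noteq> \<infinity>" unfolding eq fin using P_finite[of t x x] by auto
    show "AE y in M. ?f y * H s y \<le> ?f y" using mult_left_mono[OF le, of "?f _"] by simp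
  qed measurable
  also have "\<dots> = 0" using eq fin P_finite[of t x x] by simp
  finally have "AE y in M. ?f y - ?f y * H s y = 0" by (subst (asm) nn_integral_0_iff_AE) auto
  then show ?thesis
  proof eventually_elim
    case (elim y)
    have f: "?f y \<noteq> 0" "?f y \<noteq> \<infinity>"
      using P_pos[OF r(1), of x y] P_pos[OF s(1), of y x] P_finite[of r x y] P_finite[of s y x]
      by (auto simp: ennreal_mult_eq_top_iff)
    have "?f y \<le> ?f y * H s y" using elim by (simp add: diff_eq_0_iff_ennreal f)
    then have "?f y * 1 \<le> ?f y * H s y" by simp
    then have "1 \<le> H s y" using f ennreal_mult_le_mult_iff[of "?f y" 1 "H s y"] by simp
    then show ?case using le[of y] by simp
  qed
qed

lemma finite_W: "finite_measure W"
  by (rule finite_measureI) (use W_le in \<open>auto simp: top_unique\<close>)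

text \<open>Both sides are integrals of \<open>Z\<close> against measures on \<open>Gr r\<close>, so
  they need to be compared only on the intersection-stable cylinders. There the factors
  \<open>H\<close> coming from the law of \<open>W\<close> are 1 almost everywhere.\<close>

lemma markov_indicator:
  assumes rs: "0 < r" "r < s" "s < t" and B[measurable]: "B \<in> sets M" and Z: "Z \<in> borel_measurable (Gr r)"
  shows "(\<integral>\<^sup>+ \<gamma>. Z \<gamma> * indicator B (\<gamma> s) \<partial>W) = (\<integral>\<^sup>+ \<gamma>. Z \<gamma> * (\<integral>\<^sup>+ y. P (s - r) (\<gamma> r) y * indicator B y \<partial>M) \<partial>W)"
proof -
  note [measurable] = coord_W[of s] coord_W[of r]
  have ts: "0 < s" "s \<le> t" "r \<le> t" using rs by auto
  define \<phi> where "\<phi> z = (\<integral>\<^sup>+ y. P (s - r) z y * indicator B y \<partial>M)" for z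
  have [measurable]: "\<phi> \<in> borel_measurable M" unfolding \<phi>_def by measurable
  have ms: "(\<lambda>\<gamma>. indicator B (\<gamma> s) :: ennreal) \<in> borel_measurable W" "(\<lambda>\<gamma>. \<phi> (\<gamma> r)) \<in> borel_measurable W"
    using ts rs by measurable
  have id: "(\<lambda>\<gamma>. \<gamma>) \<in> measurable W (Gr r)"
  proof (rule measurableI)
    fix A assume A: "A \<in> sets (Gr r)"
    then have "(\<lambda>\<gamma>. \<gamma>) -` A \<inter> space W = A" using sets.sets_into_space[OF A] space_W space_Gr by auto
    then show "(\<lambda>\<gamma>. \<gamma>) -` A \<inter> space W \<in> sets W" using A Gr_sub_W[OF ts(3)] by auto
  qed (simp add: space_W space_Gr)
  let ?N1 = "distr (density W (\<lambda>\<gamma>. indicator B (\<gamma> s))) (Gr r) (\<lambda>\<gamma>. \<gamma>)"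
  let ?N2 = "distr (density W (\<lambda>\<gamma>. \<phi> (\<gamma> r))) (Gr r) (\<lambda>\<gamma>. \<gamma>)"
  have e1: "emeasure ?N1 A = (\<integral>\<^sup>+ \<gamma>. indicator B (\<gamma> s) * indicator A \<gamma> \<partial>W)"
    "emeasure ?N2 A = (\<integral>\<^sup>+ \<gamma>. \<phi> (\<gamma> r) * indicator A \<gamma> \<partial>W)" if "A \<in> sets (Gr r)" for A
  proof -
    have "A \<inter> space W = A" using sets.sets_into_space[OF that] space_W space_Gr by auto
    moreover have "A \<in> sets W" using that Gr_sub_W[OF ts(3)] by auto
    ultimately show "emeasure ?N1 A = (\<integral>\<^sup>+ \<gamma>. indicator B (\<gamma> s) * indicator A \<gamma> \<partial>W)"
      "emeasure ?N2 A = (\<integral>\<^sup>+ \<gamma>. \<phi> (\<gamma> r) * indicator A \<gamma> \<partial>W)"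
      using that id ms by (simp_all add: emeasure_distr emeasure_density)
  qed
  have "?N1 = ?N2"
  proof (rule measure_eqI_generator_eq[OF Int_stable_cyls cyls_sub, of r])
    fix X assume "X \<in> cyls r"
    then obtain J A where X: "X = cyl J A" "finite J" "r \<in> J" "J \<subseteq> {0<..r}" and A: "\<And>u. A u \<in> sets borel"
      unfolding cyls_def by blast
    have XG: "X \<in> sets (Gr r)" unfolding sets_Gr using \<open>X \<in> cyls r\<close> by (rule sigma_sets.Basic)
    define ts where "ts = sorted_list_of_set J"
    have tsJ: "set ts = J" "sorted_wrt (<) ts" "distinct ts" "ts \<noteq> []"
      using X by (auto simp: ts_def strict_sorted_list_of_set)
    have lr: "last ts = r"
    proof -
      have "last ts \<in> J" using tsJ last_in_set by blast
      then have "last ts \<le> r" using X by auto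
      moreover have "r \<le> last ts" by (rule sorted_le_last) (use tsJ X in auto)
      ultimately show ?thesis by simp
    qed
    have bd: "0 < u \<and> u < t" if "u \<in> set ts" for u using that X tsJ rs by auto
    have Am: "A u \<in> sets M" for u using A sets_M by simp
    define d where "d = dens A 0 x ts"
    have [measurable]: "d \<in> borel_measurable M"
      unfolding d_def using measurable_Pair2[OF dens_measurable[of A 0 ts, OF A], of x] by (simp add: space_M)
    \<comment> \<open>On the cylinder \<open>X\<close> the coordinate at \<open>r\<close> has
      density \<open>d\<close>: intersecting the last set of the cylinder with \<open>C\<close>
      multiplies \<open>dens\<close> by the indicator of \<open>C\<close>.\<close>
    have law: "(\<integral>\<^sup>+ \<gamma>. g (\<gamma> r) * indicator X \<gamma> \<partial>W) = (\<integral>\<^sup>+ y. d y * g y \<partial>M)" if g[measurable]: "g \<in> borel_measurable M" for g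
    proof -
      have XW[measurable]: "X \<in> sets W" using XG Gr_sub_W[OF \<open>r \<le> t\<close>] by auto
      have "distr (density W (indicator X)) M (\<lambda>\<gamma>. \<gamma> r) = density M (\<lambda>y. d y * H (t - r) y)"
      proof (rule measure_eqI)
        fix C assume "C \<in> sets (distr (density W (indicator X)) M (\<lambda>\<gamma>. \<gamma> r))"
        then have C[measurable]: "C \<in> sets M" by simp
        define A' where "A' = A(r := A r \<inter> C)"
        have A': "A' u \<in> sets borel" for u using A C sets_M by (auto simp: A'_def)
        have "emeasure (distr (density W (indicator X)) M (\<lambda>\<gamma>. \<gamma> r)) C = emeasure W (X \<inter> ((\<lambda>\<gamma>. \<gamma> r) -` C \<inter> space W))"
        proof -
          have S: "(\<lambda>\<gamma>. \<gamma> r) -` C \<inter> space W \<in> sets W"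
            by (rule measurable_sets[OF coord_W C]) (use rs in auto)
          have "emeasure (distr (density W (indicator X)) M (\<lambda>\<gamma>. \<gamma> r)) C =
              emeasure (density W (indicator X)) ((\<lambda>\<gamma>. \<gamma> r) -` C \<inter> space W)"
            using coord_W[of r] rs C by (subst emeasure_distr) auto
          also have "\<dots> = (\<integral>\<^sup>+ \<gamma>. indicator X \<gamma> * indicator ((\<lambda>\<gamma>. \<gamma> r) -` C \<inter> space W) \<gamma> \<partial>W)"
            using S by (intro emeasure_density) auto
          also have "\<dots> = (\<integral>\<^sup>+ \<gamma>. indicator (X \<inter> ((\<lambda>\<gamma>. \<gamma> r) -` C \<inter> space W)) \<gamma> \<partial>W)"
            by (simp only: indicator_inter_arith)
          also have "\<dots> = emeasure W (X \<inter> ((\<lambda>\<gamma>. \<gamma> r) -` C \<inter> space W))"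
            using S by (intro nn_integral_indicator) auto
          finally show ?thesis .
        qed
        also have "X \<inter> ((\<lambda>\<gamma>. \<gamma> r) -` C \<inter> space W) = cyl (set ts) A'"
          unfolding X(1) tsJ(1) cyl_def A'_def space_W using X(3) by auto
        also have "emeasure W \<dots> = fid A' 0 ts (\<lambda>r. H (t - r)) x" by (rule W_cyl[of ts A', OF tsJ(2) bd A'])
        also have "\<dots> = (\<integral>\<^sup>+ z. dens A' 0 x ts z * H (t - r) z \<partial>M)"
          using fid_append[of A' "\<lambda>r. H (t - r)", OF A' _ tsJ(4), of 0 x] lr by simp
        also have "\<dots> = emeasure (density M (\<lambda>y. d y * H (t - r) y)) C"
          unfolding A'_def dens_restrict[OF tsJ(3,4) lr] d_def[symmetric]
          by (subst emeasure_density) (auto simp: mult_ac)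
        finally show "emeasure (distr (density W (indicator X)) M (\<lambda>\<gamma>. \<gamma> r)) C = emeasure (density M (\<lambda>y. d y * H (t - r) y)) C" .
      qed simp
      then have "(\<integral>\<^sup>+ y. g y \<partial>distr (density W (indicator X)) M (\<lambda>\<gamma>. \<gamma> r)) = (\<integral>\<^sup>+ y. g y \<partial>density M (\<lambda>y. d y * H (t - r) y))" by simp
      then have "(\<integral>\<^sup>+ \<gamma>. g (\<gamma> r) * indicator X \<gamma> \<partial>W) = (\<integral>\<^sup>+ y. d y * H (t - r) y * g y \<partial>M)"
        using rs by (simp add: nn_integral_distr nn_integral_density mult_ac)
      also have "\<dots> = (\<integral>\<^sup>+ y. d y * g y \<partial>M)"
        by (rule nn_integral_cong_AE) (use H_eq_1[of "t - r"] rs in \<open>auto elim: eventually_mono\<close>)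
      finally show ?thesis .
    qed
    have "emeasure ?N1 X = emeasure W (cyl (set (ts @ [s])) (A(s := B)))"
    proof -
      have "X \<inter> ((\<lambda>\<gamma>. \<gamma> s) -` B \<inter> space W) = cyl (set (ts @ [s])) (A(s := B))"
        unfolding X(1) cyl_def space_W set_append tsJ(1) using X(4) rs by fastforce
      moreover have "emeasure ?N1 X = emeasure W (X \<inter> ((\<lambda>\<gamma>. \<gamma> s) -` B \<inter> space W))"
        unfolding e1(1)[OF XG] using XG Gr_sub_W[OF \<open>r \<le> t\<close>] rs ts
        by (subst nn_integral_indicator[symmetric]) (auto intro!: nn_integral_cong simp: indicator_def)
      ultimately show ?thesis by simp
    qed
    also have "\<dots> = fid (A(s := B)) 0 (ts @ [s]) (\<lambda>r. H (t - r)) x"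
    proof (rule W_cyl)
      show "sorted_wrt (<) (ts @ [s])" using tsJ X(4) rs by (auto simp: sorted_wrt_append)
      show "0 < u \<and> u < t" if "u \<in> set (ts @ [s])" for u using that bd rs by auto
      show "(A(s := B)) u \<in> sets borel" for u using A B sets_M by auto
    qed
    also have "\<dots> = fid (A(s := B)) 0 ts (\<lambda>r z. \<integral>\<^sup>+ y. indicator B y * P (s - r) z y * H (t - s) y \<partial>M) x"
    proof -
      have "fid A s' (us @ [s]) h y = fid A s' us (\<lambda>r z. fid A r [s] h z) y" for A s' us h y
        by (induction us arbitrary: s' y) auto
      then show ?thesis by simp
    qed
    also have "\<dots> = fid A 0 ts (\<lambda>r z. \<integral>\<^sup>+ y. indicator B y * P (s - r) z y * H (t - s) y \<partial>M) x"
    proof -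
      have "fid (A(s := B)) s' us h y = fid A s' us h y" if "s \<notin> set us" for s' us h y
        using that by (induction us arbitrary: s' y) auto
      moreover have "s \<notin> set ts" using tsJ(1) X(4) rs by auto
      ultimately show ?thesis by blast
    qed
    also have "\<dots> = (\<integral>\<^sup>+ z. d z * (\<integral>\<^sup>+ y. indicator B y * P (s - r) z y * H (t - s) y \<partial>M) \<partial>M)"
      unfolding d_def by (subst fid_append[of A, OF A _ tsJ(4)]) (auto simp: lr)
    also have "\<dots> = (\<integral>\<^sup>+ z. d z * \<phi> z \<partial>M)"
    proof (intro nn_integral_cong)
      fix z
      have "(\<integral>\<^sup>+ y. indicator B y * P (s - r) z y * H (t - s) y \<partial>M) = \<phi> z"
        unfolding \<phi>_def by (rule nn_integral_cong_AE)
          (use H_eq_1[of "t - s"] rs in \<open>auto elim!: eventually_mono simp: mult_ac\<close>)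
      then show "d z * (\<integral>\<^sup>+ y. indicator B y * P (s - r) z y * H (t - s) y \<partial>M) = d z * \<phi> z" by simp
    qed
    also have "\<dots> = emeasure ?N2 X" unfolding e1(2)[OF XG] by (rule law[symmetric]) measurable
    finally show "emeasure ?N1 X = emeasure ?N2 X" .
  next
    show "sets ?N1 = sigma_sets \<Omega> (cyls r)" "sets ?N2 = sigma_sets \<Omega> (cyls r)" by (simp_all add: sets_Gr)
    show "range (\<lambda>_::nat. \<Omega>) \<subseteq> cyls r"
    proof -
      have "\<Omega> = cyl {r} (\<lambda>_. UNIV)" by (simp add: cyl_def)
      moreover have "cyl {r} (\<lambda>_. UNIV) \<in> cyls r"
        unfolding cyls_def using rs by (intro CollectI exI[of _ "{r}"] exI[of _ "\<lambda>_. UNIV"]) auto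
      ultimately show ?thesis by auto
    qed
    show "(\<Union>i::nat. \<Omega>) = \<Omega>" by simp
    show "emeasure ?N1 \<Omega> \<noteq> \<infinity>" for i :: nat
    proof -
      have "emeasure ?N1 \<Omega> \<le> (\<integral>\<^sup>+ \<gamma>. 1 \<partial>W)"
      proof -
        have "\<Omega> \<in> sets (Gr r)" using sets.top[of "Gr r"] by (simp add: space_Gr)
        then have "emeasure ?N1 \<Omega> = (\<integral>\<^sup>+ \<gamma>. indicator B (\<gamma> s) * indicator \<Omega> \<gamma> \<partial>W)" by (rule e1(1))
        also have "\<dots> \<le> (\<integral>\<^sup>+ \<gamma>. 1 \<partial>W)" by (intro nn_integral_mono) (simp add: indicator_def)
        finally show ?thesis .
      qed
      also have "\<dots> \<le> 1" using W_le by simp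
      finally show ?thesis by (auto simp: top_unique)
    qed
  qed
  then have "(\<integral>\<^sup>+ \<gamma>. Z \<gamma> \<partial>?N1) = (\<integral>\<^sup>+ \<gamma>. Z \<gamma> \<partial>?N2)" by simp
  moreover have "Z \<in> borel_measurable W" by (rule measurable_Gr_W[OF ts(3) Z])
  ultimately show ?thesis unfolding \<phi>_def[symmetric] using id Z ms
    by (simp add: nn_integral_distr nn_integral_density mult.commute)
qed

lemma markov:
  assumes rs: "0 < r" "r < s" "s < t" and Z: "Z \<in> borel_measurable (Gr r)" and g: "g \<in> borel_measurable M"
  shows "(\<integral>\<^sup>+ \<gamma>. Z \<gamma> * g (\<gamma> s) \<partial>W) = (\<integral>\<^sup>+ \<gamma>. Z \<gamma> * (\<integral>\<^sup>+ y. P (s - r) (\<gamma> r) y * g y \<partial>M) \<partial>W)"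
  using g
proof (induction g rule: borel_measurable_induct)
  case (cong f g)
  then have "f = g" using space_M by auto
  then show ?case using cong by simp
next
  case (set B)
  then show ?case using markov_indicator[OF rs _ Z] by simp
next
  case (mult u c)
  note [measurable] = mult(2)
  have [measurable]: "(\<lambda>\<gamma>. \<gamma> s) \<in> measurable W M" "(\<lambda>\<gamma>. \<gamma> r) \<in> measurable W M" using rs by (auto intro: coord_W)
  have [measurable]: "Z \<in> borel_measurable W" using measurable_Gr_W[OF _ Z] rs by simp
  have "(\<integral>\<^sup>+ \<gamma>. Z \<gamma> * (c * u (\<gamma> s)) \<partial>W) = c * (\<integral>\<^sup>+ \<gamma>. Z \<gamma> * u (\<gamma> s) \<partial>W)"
    by (simp add: nn_integral_cmult[symmetric] mult.left_commute)
  also have "\<dots> = c * (\<integral>\<^sup>+ \<gamma>. Z \<gamma> * (\<integral>\<^sup>+ y. P (s - r) (\<gamma> r) y * u y \<partial>M) \<partial>W)" using mult by simp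
  also have "\<dots> = (\<integral>\<^sup>+ \<gamma>. Z \<gamma> * (\<integral>\<^sup>+ y. P (s - r) (\<gamma> r) y * (c * u y) \<partial>M) \<partial>W)"
    by (simp add: nn_integral_cmult[symmetric] mult.left_commute)
  finally show ?case .
next
  case (add u v)
  note [measurable] = add(1,2) add
  have [measurable]: "(\<lambda>\<gamma>. \<gamma> s) \<in> measurable W M" "(\<lambda>\<gamma>. \<gamma> r) \<in> measurable W M" using rs by (auto intro: coord_W)
  have [measurable]: "Z \<in> borel_measurable W" using measurable_Gr_W[OF _ Z] rs by simp
  show ?case using add by (simp add: nn_integral_add distrib_left)
next
  case (seq U)
  note [measurable] = seq(1)
  have [measurable]: "(\<lambda>\<gamma>. \<gamma> s) \<in> measurable W M" "(\<lambda>\<gamma>. \<gamma> r) \<in> measurable W M" using rs by (auto intro: coord_W)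
  have [measurable]: "Z \<in> borel_measurable W" using measurable_Gr_W[OF _ Z] rs by simp
  have g: "Sup (range U) y = (SUP i. U i y)" for y by (simp add: image_comp)
  have inc: "U i y \<le> U j y" if "i \<le> j" for i j y using seq that by (auto simp: incseq_def le_fun_def)
  have "(\<integral>\<^sup>+ \<gamma>. Z \<gamma> * Sup (range U) (\<gamma> s) \<partial>W) = (SUP i. \<integral>\<^sup>+ \<gamma>. Z \<gamma> * U i (\<gamma> s) \<partial>W)"
    unfolding g SUP_mult_left_ennreal
    by (rule nn_integral_monotone_convergence_SUP) (auto simp: incseq_def le_fun_def intro!: mult_left_mono inc)
  also have "\<dots> = (SUP i. \<integral>\<^sup>+ \<gamma>. Z \<gamma> * (\<integral>\<^sup>+ y. P (s - r) (\<gamma> r) y * U i y \<partial>M) \<partial>W)" using seq by simp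
  also have "\<dots> = (\<integral>\<^sup>+ \<gamma>. (SUP i. Z \<gamma> * (\<integral>\<^sup>+ y. P (s - r) (\<gamma> r) y * U i y \<partial>M)) \<partial>W)"
    by (rule nn_integral_monotone_convergence_SUP[symmetric])
      (auto simp: incseq_def le_fun_def intro!: mult_left_mono nn_integral_mono inc)
  also have "\<dots> = (\<integral>\<^sup>+ \<gamma>. Z \<gamma> * (\<integral>\<^sup>+ y. P (s - r) (\<gamma> r) y * Sup (range U) y \<partial>M) \<partial>W)"
  proof (rule nn_integral_cong)
    fix \<gamma> :: "real \<Rightarrow> 'a"
    have "(\<integral>\<^sup>+ y. P (s - r) (\<gamma> r) y * Sup (range U) y \<partial>M) = (SUP i. \<integral>\<^sup>+ y. P (s - r) (\<gamma> r) y * U i y \<partial>M)"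
      unfolding g SUP_mult_left_ennreal
      by (rule nn_integral_monotone_convergence_SUP) (auto simp: incseq_def le_fun_def intro!: mult_left_mono inc)
    then show "(SUP i. Z \<gamma> * (\<integral>\<^sup>+ y. P (s - r) (\<gamma> r) y * U i y \<partial>M)) = Z \<gamma> * (\<integral>\<^sup>+ y. P (s - r) (\<gamma> r) y * Sup (range U) y \<partial>M)"
      by (simp add: SUP_mult_left_ennreal)
  qed
  finally show ?case .
qed

lemma id_Gr_W: "r \<le> t \<Longrightarrow> (\<lambda>\<gamma>. \<gamma>) \<in> measurable W (Gr r)"
  by (erule measurable_Gr_W) simp

lemma id_Gr_Pin: "0 \<le> r \<Longrightarrow> r < t \<Longrightarrow> (\<lambda>\<gamma>. \<gamma>) \<in> measurable Pin (Gr r)"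
  by (erule (1) measurable_Gr_Pin) simp

lemma measurable_pair_id:
  assumes "(\<lambda>\<gamma>. \<gamma>) \<in> measurable N N'" "f \<in> measurable (L \<Otimes>\<^sub>M N') L'"
  shows "f \<in> measurable (L \<Otimes>\<^sub>M N) L'"
proof -
  have "(\<lambda>p. (fst p, snd p)) \<in> measurable (L \<Otimes>\<^sub>M N) (L \<Otimes>\<^sub>M N')"
    by (intro measurable_Pair measurable_fst measurable_compose[OF measurable_snd assms(1)])
  from measurable_compose[OF this assms(2)] show ?thesis by simp
qed

text \<open>The defining identity of \<open>Pin\<close> on events up to time \<open>r\<close> says
  that two image measures on \<open>Gr r\<close> are equal, which extends it from events to
  nonnegative functions.\<close>

lemma Pin_W:
  assumes r: "0 < r" "r < t" and Z: "Z \<in> borel_measurable (Gr r)"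
  shows "P t x x * (\<integral>\<^sup>+ \<gamma>. Z \<gamma> \<partial>Pin) = (\<integral>\<^sup>+ \<gamma>. Z \<gamma> * P (t - r) (\<gamma> r) x \<partial>W)"
proof -
  have [measurable]: "(\<lambda>\<gamma>. \<gamma> r) \<in> measurable W M" by (rule coord_W) (use r in auto)
  note id = id_Gr_W[OF less_imp_le[OF r(2)]] id_Gr_Pin[OF less_imp_le[OF r(1)] r(2)]
  let ?N1 = "distr (density Pin (\<lambda>_. P t x x)) (Gr r) (\<lambda>\<gamma>. \<gamma>)"
  let ?N2 = "distr (density W (\<lambda>\<gamma>. P (t - r) (\<gamma> r) x)) (Gr r) (\<lambda>\<gamma>. \<gamma>)"
  have "?N1 = ?N2"
  proof (rule measure_eqI)
    fix A assume "A \<in> sets ?N1"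
    then have A: "A \<in> sets (Gr r)" by simp
    have AA: "A \<inter> space W = A" "A \<inter> space Pin = A"
      using sets.sets_into_space[OF A] space_W space_Gr space_Pin by auto
    have [measurable]: "A \<in> sets W" "A \<in> sets Pin" using A Gr_sub_W[of r] Gr_sub_Pin[of r] r by auto
    have "emeasure ?N1 A = P t x x * emeasure Pin A"
      using A id AA by (simp add: emeasure_distr emeasure_density nn_integral_cmult)
    also have "\<dots> = (\<integral>\<^sup>+ \<gamma>. P (t - r) (\<gamma> r) x * indicator A \<gamma> \<partial>W)"
      by (rule Pin_eq[OF r]) (use A Gr_sub_filtration in auto)
    also have "\<dots> = emeasure ?N2 A"
      using A id AA by (simp add: emeasure_distr emeasure_density)
    finally show "emeasure ?N1 A = emeasure ?N2 A" .
  qed simp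
  then have "(\<integral>\<^sup>+ \<gamma>. Z \<gamma> \<partial>?N1) = (\<integral>\<^sup>+ \<gamma>. Z \<gamma> \<partial>?N2)" by simp
  moreover have "Z \<in> borel_measurable W" "Z \<in> borel_measurable Pin"
    using measurable_Gr_W[OF _ Z] measurable_Gr_Pin[OF _ _ Z] r by auto
  ultimately show ?thesis using id Z
    by (simp add: nn_integral_distr nn_integral_density nn_integral_cmult[symmetric]) (simp add: mult.commute)
qed

section \<open>Moments of the additive functional\<close>

context
  fixes v :: "'a \<Rightarrow> real" and c :: real
  assumes v_cont: "continuous_on UNIV v" and v_nonneg: "\<And>y. 0 \<le> v y" and v_le: "\<And>y. v y \<le> c"
begin

abbreviation "ve \<equiv> \<lambda>y. ennreal (v y)"

lemma v_meas [measurable]: "v \<in> borel_measurable M"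
  using borel_measurable_continuous_onI[OF v_cont] sets_M by (simp cong: measurable_cong_sets)

text \<open>By right continuity the value at \<open>u\<close> is a limit of values at grid points to
  the right of \<open>u\<close>. At each stage only countably many coordinates occur, which gives
  joint measurability in time and path.\<close>

lemma path_joint_measurable:
  assumes r: "0 < r" "r \<le> t"
  shows "(\<lambda>p. indicator {0<..<r} (fst p) * ve (snd p (fst p))) \<in> borel_measurable ((lborel :: real measure) \<Otimes>\<^sub>M Gr r)"
proof -
  \<comment> \<open>The grid point strictly to the right of every \<open>u\<close> with index
    \<open>i\<close>, cut off at \<open>r\<close> to stay within \<open>Gr r\<close>; negative
    indices get the harmless value \<open>r\<close>.\<close>
  define \<tau> where "\<tau> n i = (if i < 0 then r else min r ((of_int i + 1) / real (Suc n)))" for n :: nat and i :: int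
  have \<tau>: "0 < \<tau> n i" "\<tau> n i \<le> r" for n i using r by (auto simp: \<tau>_def)
  define f where "f n p = indicator {0<..<r} (fst p) * v (snd p (\<tau> n \<lfloor>fst p * real (Suc n)\<rfloor>))" for n and p :: "real \<times> (real \<Rightarrow> 'a)"
  have fm: "f n \<in> borel_measurable ((lborel :: real measure) \<Otimes>\<^sub>M Gr r)" for n
    unfolding f_def
  proof (rule borel_measurable_times)
    show "(\<lambda>p. v (snd p (\<tau> n \<lfloor>fst p * real (Suc n)\<rfloor>))) \<in> borel_measurable ((lborel :: real measure) \<Otimes>\<^sub>M Gr r)"
    proof (rule measurable_compose_countable[where f="\<lambda>i p. v (snd p (\<tau> n i))"])
      fix i
      have "(\<lambda>\<gamma>. \<gamma> (\<tau> n i)) \<in> measurable (Gr r) M" using coord_Gr[OF \<tau>] borel_M by blast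
      then show "(\<lambda>p. v (snd p (\<tau> n i))) \<in> borel_measurable ((lborel :: real measure) \<Otimes>\<^sub>M Gr r)" by measurable
    next
      show "(\<lambda>p. \<lfloor>fst p * real (Suc n)\<rfloor>) \<in> measurable ((lborel :: real measure) \<Otimes>\<^sub>M Gr r) (count_space UNIV)" by measurable
    qed
  qed measurable
  have "(\<lambda>p. indicator {0<..<r} (fst p) * v (snd p (fst p))) \<in> borel_measurable ((lborel :: real measure) \<Otimes>\<^sub>M Gr r)"
  proof (rule borel_measurable_LIMSEQ_metric[OF fm])
    fix p assume "p \<in> space ((lborel :: real measure) \<Otimes>\<^sub>M Gr r)"
    then obtain u \<gamma> where p: "p = (u, \<gamma>)" and \<gamma>: "\<gamma> \<in> \<Omega>" by (auto simp: space_pair_measure space_Gr)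
    show "(\<lambda>n. f n p) \<longlonglongrightarrow> indicator {0<..<r} (fst p) * v (snd p (fst p))"
    proof (cases "u \<in> {0<..<r}")
      case True
      then have u: "0 < u" "u < r" by auto
      define s where "s n = \<tau> n \<lfloor>u * real (Suc n)\<rfloor>" for n
      have s: "u < s n" "s n \<le> u + 1 / real (Suc n)" for n
      proof -
        have "0 \<le> u * real (Suc n)" using u by simp
        then have se: "s n = min r ((of_int \<lfloor>u * real (Suc n)\<rfloor> + 1) / real (Suc n))"
          unfolding s_def \<tau>_def by (simp add: not_less)
        have "u * real (Suc n) < of_int \<lfloor>u * real (Suc n)\<rfloor> + 1" "of_int \<lfloor>u * real (Suc n)\<rfloor> \<le> u * real (Suc n)"
          by linarith+
        then have "u < (of_int \<lfloor>u * real (Suc n)\<rfloor> + 1) / real (Suc n)"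
          "(of_int \<lfloor>u * real (Suc n)\<rfloor> + 1) / real (Suc n) \<le> (u * real (Suc n) + 1) / real (Suc n)"
          by (simp_all add: pos_less_divide_eq divide_right_mono del: of_nat_Suc)
        moreover have "(u * real (Suc n) + 1) / real (Suc n) = u + 1 / real (Suc n)"
          by (simp add: add_divide_distrib del: of_nat_Suc)
        ultimately show "u < s n" "s n \<le> u + 1 / real (Suc n)" unfolding se using u by auto
      qed
      have lim: "s \<longlonglongrightarrow> u"
      proof (rule tendsto_sandwich[where f="\<lambda>_. u" and h="\<lambda>n. u + 1 / real (Suc n)"])
        show "(\<lambda>n. u + 1 / real (Suc n)) \<longlonglongrightarrow> u"
          using tendsto_add[OF tendsto_const LIMSEQ_inverse_real_of_nat, of u] by (simp add: inverse_eq_divide)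
      qed (use s in \<open>auto simp: less_imp_le\<close>)
      have "filterlim s (at_right u) sequentially"
        unfolding filterlim_at using lim s(1) by (auto intro!: always_eventually simp: less_imp_neq[symmetric])
      moreover have "(\<gamma> \<longlongrightarrow> \<gamma> u) (at_right u)" using \<gamma> u r by (auto simp: cadlag_paths_def)
      ultimately have "(\<lambda>n. \<gamma> (s n)) \<longlonglongrightarrow> \<gamma> u" by (rule filterlim_compose[rotated])
      then have "(\<lambda>n. v (\<gamma> (s n))) \<longlonglongrightarrow> v (\<gamma> u)"
        using v_cont by (intro continuous_on_tendsto_compose[OF v_cont]) auto
      then show ?thesis using True by (simp add: f_def p s_def)
    qed (simp add: f_def p)
  qed
  then have "(\<lambda>p. ennreal (indicator {0<..<r} (fst p) * v (snd p (fst p)))) \<in> borel_measurable ((lborel :: real measure) \<Otimes>\<^sub>M Gr r)"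
    by measurable
  moreover have "ennreal (indicator {0<..<r} (fst p) * v (snd p (fst p))) = indicator {0<..<r} (fst p) * ve (snd p (fst p))" for p :: "real \<times> (real \<Rightarrow> 'a)"
    by (simp add: indicator_def)
  ultimately show ?thesis by simp
qed

definition AA :: "real \<Rightarrow> (real \<Rightarrow> 'a) \<Rightarrow> ennreal" where
  "AA r \<gamma> = (\<integral>\<^sup>+ u. indicator {0<..<r} u * ve (\<gamma> u) \<partial>lborel)"

lemma AA_measurable: "0 < r \<Longrightarrow> r \<le> t \<Longrightarrow> AA r \<in> borel_measurable (Gr r)"
proof -
  assume r: "0 < r" "r \<le> t"
  have "(\<lambda>\<gamma>. \<integral>\<^sup>+ u. (\<lambda>p. indicator {0<..<r} (fst p) * ve (snd p (fst p))) (u, \<gamma>) \<partial>lborel) \<in> borel_measurable (Gr r)"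
    using measurable_compose[OF measurable_pair_swap' path_joint_measurable[OF r]]
    by (intro lborel.borel_measurable_nn_integral) (simp add: case_prod_beta')
  then show ?thesis unfolding AA_def[abs_def] by simp
qed

text \<open>Both \<open>W\<close> and \<open>Pin\<close> are used as \<open>N\<close>; for \<open>Pin\<close> the horizon \<open>s = t\<close> is approached from below.\<close>
lemma AA_pow_integrand_measurable:
  assumes F: "(\<lambda>p. indicator {0<..<s} (fst p) * ve (snd p (fst p))) \<in> borel_measurable (lborel \<Otimes>\<^sub>M N)"
  shows "(\<lambda>(r, \<gamma>). indicator {0<..<s} r * (ve (\<gamma> r) * AA r \<gamma> ^ k)) \<in> borel_measurable (lborel \<Otimes>\<^sub>M N)"
proof -
  define F where "F p = indicator {0<..<s} (fst p) * ve (snd p (fst p))" for p :: "real \<times> (real \<Rightarrow> 'a)"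
  have [measurable]: "F \<in> borel_measurable (lborel \<Otimes>\<^sub>M N)" using F unfolding F_def .
  have [measurable]: "(\<lambda>q. F (snd q, snd (fst q))) \<in> borel_measurable ((lborel \<Otimes>\<^sub>M N) \<Otimes>\<^sub>M lborel)"
    by measurable
  have m: "(\<lambda>p. \<integral>\<^sup>+ u. (if u < fst p then F (u, snd p) else 0) \<partial>lborel) \<in> borel_measurable (lborel \<Otimes>\<^sub>M N)"
    by (rule lborel.borel_measurable_nn_integral) (simp add: case_prod_beta')
  have "(\<lambda>p. F p * (\<integral>\<^sup>+ u. (if u < fst p then F (u, snd p) else 0) \<partial>lborel) ^ k) \<in> borel_measurable (lborel \<Otimes>\<^sub>M N)"
    using m by measurable
  moreover have "F p * (\<integral>\<^sup>+ u. (if u < fst p then F (u, snd p) else 0) \<partial>lborel) ^ k =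
     (case p of (r, \<gamma>) \<Rightarrow> indicator {0<..<s} r * (ve (\<gamma> r) * AA r \<gamma> ^ k))" for p
  proof (cases "fst p \<in> {0<..<s}")
    case True
    have "(\<integral>\<^sup>+ u. (if u < fst p then F (u, snd p) else 0) \<partial>lborel) = AA (fst p) (snd p)"
      unfolding AA_def F_def using True by (intro nn_integral_cong) (auto simp: indicator_def)
    then show ?thesis by (simp add: F_def case_prod_beta' mult.assoc)
  qed (simp add: F_def case_prod_beta')
  ultimately show ?thesis by simp
qed

lemma AA_Suc: "\<gamma> \<in> \<Omega> \<Longrightarrow> s \<le> t \<Longrightarrow> 0 < s \<Longrightarrow>
    AA s \<gamma> ^ Suc k = of_nat (Suc k) * (\<integral>\<^sup>+ r. indicator {0<..<s} r * (ve (\<gamma> r) * AA r \<gamma> ^ k) \<partial>lborel)"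
proof -
  assume \<gamma>: "\<gamma> \<in> \<Omega>" and s: "s \<le> t" "0 < s"
  define f where "f u = indicator {0<..<s} u * ve (\<gamma> u)" for u
  have "(\<lambda>u. (\<lambda>p. indicator {0<..<s} (fst p) * ve (snd p (fst p))) (u, \<gamma>)) \<in> borel_measurable lborel"
    by (rule measurable_Pair1[OF path_joint_measurable[OF s(2,1)]]) (simp add: space_Gr \<gamma>)
  then have fm: "f \<in> borel_measurable borel" by (simp add: f_def[abs_def])
  have A: "(\<integral>\<^sup>+ u. indicator {0<..<r} u * f u \<partial>lborel) = AA r \<gamma>" if "r \<le> s" for r
    unfolding AA_def f_def using that by (intro nn_integral_cong) (auto simp: indicator_def)
  have "(\<integral>\<^sup>+ r. indicator {0<..<s} r * (f r * (\<integral>\<^sup>+ u. indicator {0<..<r} u * f u \<partial>lborel) ^ k) \<partial>lborel) =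
     (\<integral>\<^sup>+ r. indicator {0<..<s} r * (ve (\<gamma> r) * AA r \<gamma> ^ k) \<partial>lborel)"
  proof (rule nn_integral_cong)
    fix r
    show "indicator {0<..<s} r * (f r * (\<integral>\<^sup>+ u. indicator {0<..<r} u * f u \<partial>lborel) ^ k) =
       indicator {0<..<s} r * (ve (\<gamma> r) * AA r \<gamma> ^ k)"
      using A[of r] by (cases "r \<in> {0<..<s}") (simp_all add: f_def[of r])
  qed
  then show ?thesis using nn_integral_pow_primitive[OF fm, of k s] A[of s] by simp
qed

lemma conv_flip:
  assumes f: "mk f" and g: "mk g"
  shows "conv ve f g s y z = (\<integral>\<^sup>+ r. \<integral>\<^sup>+ a. f r y a * ve a * g (s - r) a z \<partial>M \<partial>lborel)"
proof -
  note mkD[OF f, measurable (raw)] mkD[OF g, measurable (raw)]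
  show ?thesis unfolding conv_def
    by (subst nn_integral_real_affine[where c="-1" and t=s]) auto
qed

lemma ve_measurable [measurable]: "ve \<in> borel_measurable M" by measurable

lemmas D_ve_measurable [measurable (raw)] = mkD[OF mk_D[OF ve_measurable]]

text \<open>The power rule singles out the latest insertion time \<open>r\<close>. The Markov
  property at \<open>r\<close> leaves \<open>AA r ^ k\<close> times a function of the position at
  \<open>r\<close>, to which the induction hypothesis applies; hence the generality in
  \<open>g\<close>, and the use of the recursion of \<open>D\<close> from the right.\<close>

lemma AA_moment:
  assumes "0 < s" "s < t" "g \<in> borel_measurable M"
  shows "(\<integral>\<^sup>+ \<gamma>. AA s \<gamma> ^ k * g (\<gamma> s) \<partial>W) = of_nat (fact k) * (\<integral>\<^sup>+ y. D ve k s x y * g y \<partial>M)"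
  using assms
proof (induction k arbitrary: s g)
  case 0
  have "(\<integral>\<^sup>+ y. P s x y * H (t - s) y * g y \<partial>M) = (\<integral>\<^sup>+ y. P s x y * g y \<partial>M)"
    by (rule nn_integral_cong_AE) (use H_eq_1[of "t - s"] 0 in \<open>auto elim!: eventually_mono\<close>)
  then show ?case using W_coord[OF 0] by simp
next
  case (Suc k)
  note s = Suc(2,3) and g[measurable] = Suc(4)
  interpret W: finite_measure W by (rule finite_W)
  interpret LW: pair_sigma_finite "lborel :: real measure" W ..
  have gm[measurable]: "(\<lambda>\<gamma>. \<gamma> s) \<in> measurable W M" by (rule coord_W) (use s in auto)
  have F: "(\<lambda>p. indicator {0<..<s} (fst p) * ve (snd p (fst p))) \<in> borel_measurable (lborel \<Otimes>\<^sub>M W)"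
    by (rule measurable_pair_id[OF id_Gr_W path_joint_measurable]) (use s in auto)
  note Fk = AA_pow_integrand_measurable[OF F, of k]
  define E where "E r \<gamma> = indicator {0<..<s} r * (ve (\<gamma> r) * AA r \<gamma> ^ k)" for r \<gamma>
  have [measurable]: "(\<lambda>p. E (fst p) (snd p)) \<in> borel_measurable (lborel \<Otimes>\<^sub>M W)"
    using Fk by (simp add: E_def case_prod_beta')
  have Er: "(\<lambda>r. E r \<gamma>) \<in> borel_measurable lborel" if "\<gamma> \<in> \<Omega>" for \<gamma>
    using measurable_Pair1[OF Fk[unfolded E_def[symmetric]], of \<gamma>] that by (simp add: space_W)
  have "(\<integral>\<^sup>+ \<gamma>. AA s \<gamma> ^ Suc k * g (\<gamma> s) \<partial>W) = (\<integral>\<^sup>+ \<gamma>. \<integral>\<^sup>+ r. of_nat (Suc k) * (E r \<gamma> * g (\<gamma> s)) \<partial>lborel \<partial>W)"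
  proof (rule nn_integral_cong)
    fix \<gamma> assume "\<gamma> \<in> space W"
    then have \<gamma>: "\<gamma> \<in> \<Omega>" by (simp add: space_W)
    have "AA s \<gamma> ^ Suc k * g (\<gamma> s) = of_nat (Suc k) * ((\<integral>\<^sup>+ r. E r \<gamma> \<partial>lborel) * g (\<gamma> s))"
      using AA_Suc[OF \<gamma>, of s k] s by (simp only: E_def mult.assoc less_imp_le)
    also have "\<dots> = (\<integral>\<^sup>+ r. of_nat (Suc k) * (E r \<gamma> * g (\<gamma> s)) \<partial>lborel)"
      using Er[OF \<gamma>] by (simp add: nn_integral_cmult nn_integral_multc del: of_nat_Suc)
    finally show "AA s \<gamma> ^ Suc k * g (\<gamma> s) = (\<integral>\<^sup>+ r. of_nat (Suc k) * (E r \<gamma> * g (\<gamma> s)) \<partial>lborel)" .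
  qed
  also have "\<dots> = (\<integral>\<^sup>+ r. \<integral>\<^sup>+ \<gamma>. of_nat (Suc k) * (E r \<gamma> * g (\<gamma> s)) \<partial>W \<partial>lborel)"
    by (rule LW.Fubini'[where f="\<lambda>r \<gamma>. of_nat (Suc k) * (E r \<gamma> * g (\<gamma> s))"]) (simp add: case_prod_beta' del: of_nat_Suc)
  also have "\<dots> = (\<integral>\<^sup>+ r. of_nat (fact (Suc k)) * (\<integral>\<^sup>+ y. \<integral>\<^sup>+ z. D ve k r x y * ve y * P (s - r) y z * g z \<partial>M \<partial>M) \<partial>lborel)"
  proof (rule nn_integral_cong)
    fix r :: real
    show "(\<integral>\<^sup>+ \<gamma>. of_nat (Suc k) * (E r \<gamma> * g (\<gamma> s)) \<partial>W) =
       of_nat (fact (Suc k)) * (\<integral>\<^sup>+ y. \<integral>\<^sup>+ z. D ve k r x y * ve y * P (s - r) y z * g z \<partial>M \<partial>M)"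
    proof (cases "r \<in> {0<..<s}")
      case True
      then have r: "0 < r" "r < s" "r < t" using s by auto
      have cr: "(\<lambda>\<gamma>. \<gamma> r) \<in> measurable (Gr r) M" using coord_Gr[of r r] r borel_M by auto
      have Z: "(\<lambda>\<gamma>. ve (\<gamma> r) * AA r \<gamma> ^ k) \<in> borel_measurable (Gr r)"
        using cr AA_measurable[OF r(1) less_imp_le[OF r(3)]] by measurable
      have ZW: "(\<lambda>\<gamma>. ve (\<gamma> r) * AA r \<gamma> ^ k) \<in> borel_measurable W" by (rule measurable_Gr_W[OF _ Z]) (use r in simp)
      have "(\<integral>\<^sup>+ \<gamma>. of_nat (Suc k) * (E r \<gamma> * g (\<gamma> s)) \<partial>W) = of_nat (Suc k) * (\<integral>\<^sup>+ \<gamma>. ve (\<gamma> r) * AA r \<gamma> ^ k * g (\<gamma> s) \<partial>W)"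
        using True ZW by (simp add: E_def nn_integral_cmult del: of_nat_Suc)
      also have "(\<integral>\<^sup>+ \<gamma>. ve (\<gamma> r) * AA r \<gamma> ^ k * g (\<gamma> s) \<partial>W) =
         (\<integral>\<^sup>+ \<gamma>. ve (\<gamma> r) * AA r \<gamma> ^ k * (\<integral>\<^sup>+ z. P (s - r) (\<gamma> r) z * g z \<partial>M) \<partial>W)"
        by (rule markov[OF r(1,2) s(2) Z g])
      also have "\<dots> = (\<integral>\<^sup>+ \<gamma>. AA r \<gamma> ^ k * (ve (\<gamma> r) * (\<integral>\<^sup>+ z. P (s - r) (\<gamma> r) z * g z \<partial>M)) \<partial>W)"
        by (simp add: mult_ac)
      also have "\<dots> = of_nat (fact k) * (\<integral>\<^sup>+ y. D ve k r x y * (ve y * (\<integral>\<^sup>+ z. P (s - r) y z * g z \<partial>M)) \<partial>M)"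
        by (rule Suc.IH[of r "\<lambda>y. ve y * (\<integral>\<^sup>+ z. P (s - r) y z * g z \<partial>M)"]) (use r in auto)
      also have "(\<integral>\<^sup>+ y. D ve k r x y * (ve y * (\<integral>\<^sup>+ z. P (s - r) y z * g z \<partial>M)) \<partial>M) =
         (\<integral>\<^sup>+ y. \<integral>\<^sup>+ z. D ve k r x y * ve y * P (s - r) y z * g z \<partial>M \<partial>M)"
        by (simp add: nn_integral_cmult[symmetric] mult.assoc)
      finally show ?thesis by (simp only: fact_Suc of_nat_mult of_nat_id mult.assoc)
    next
      case False
      then have z: "D ve k r x y * ve y * P (s - r) y z * g z = 0" for y z
        using D_nonpos[of r] P_nonpos[of "s - r"] by (cases "0 < r") auto
      show ?thesis unfolding z using False by (simp add: E_def)
    qed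
  qed
  also have "\<dots> = of_nat (fact (Suc k)) * (\<integral>\<^sup>+ r. \<integral>\<^sup>+ y. \<integral>\<^sup>+ z. D ve k r x y * ve y * P (s - r) y z * g z \<partial>M \<partial>M \<partial>lborel)"
    by (rule nn_integral_cmult) measurable
  also have "(\<integral>\<^sup>+ r. \<integral>\<^sup>+ y. \<integral>\<^sup>+ z. D ve k r x y * ve y * P (s - r) y z * g z \<partial>M \<partial>M \<partial>lborel) =
      (\<integral>\<^sup>+ r. \<integral>\<^sup>+ z. \<integral>\<^sup>+ y. D ve k r x y * ve y * P (s - r) y z * g z \<partial>M \<partial>M \<partial>lborel)"
    by (intro nn_integral_cong swap_MM) measurable
  also have "\<dots> = (\<integral>\<^sup>+ z. \<integral>\<^sup>+ r. \<integral>\<^sup>+ y. D ve k r x y * ve y * P (s - r) y z * g z \<partial>M \<partial>lborel \<partial>M)"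
    by (rule swap_lM) measurable
  also have "\<dots> = (\<integral>\<^sup>+ z. D ve (Suc k) s x z * g z \<partial>M)"
    unfolding D_right[OF ve_measurable] conv_flip[OF mk_D[OF ve_measurable] mk_P]
    by (simp add: nn_integral_multc)
  finally show ?case .
qed

text \<open>The sigma-algebra of \<open>Pin\<close> is generated by the events strictly before
  \<open>t\<close>, so the horizon \<open>t\<close> is reached only as a limit of earlier
  ones.\<close>

lemma path_joint_Pin:
  "(\<lambda>p. indicator {0<..<t} (fst p) * ve (snd p (fst p))) \<in> borel_measurable ((lborel :: real measure) \<Otimes>\<^sub>M Pin)"
proof (rule borel_measurable_LIMSEQ_order)
  \<comment> \<open>With \<open>n + 2\<close> even the first horizon \<open>r 0 = t/2\<close> is
    positive.\<close>
  define r where "r n = t - t / real (n + 2)" for n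
  have r: "0 < r n" "r n < t" for n using t by (auto simp: r_def field_simps intro: add_pos_nonneg)
  show "(\<lambda>p. indicator {0<..<r n} (fst p) * ve (snd p (fst p))) \<in> borel_measurable ((lborel :: real measure) \<Otimes>\<^sub>M Pin)" for n
    by (rule measurable_pair_id[OF id_Gr_Pin path_joint_measurable]) (use r[of n] in auto)
  fix p :: "real \<times> (real \<Rightarrow> 'a)"
  have "r \<longlonglongrightarrow> t - 0"
    unfolding r_def by (intro tendsto_diff tendsto_const)
      (rule LIMSEQ_ignore_initial_segment[where f="\<lambda>n. t / real n" and k=2], rule lim_const_over_n)
  then have lim: "r \<longlonglongrightarrow> t" by simp
  show "(\<lambda>n. indicator {0<..<r n} (fst p) * ve (snd p (fst p))) \<longlonglongrightarrow> indicator {0<..<t} (fst p) * ve (snd p (fst p))"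
  proof (cases "fst p < t")
    case True
    have "\<forall>\<^sub>F n in sequentially. fst p < r n" by (rule order_tendstoD(1)[OF lim True])
    then have "\<forall>\<^sub>F n in sequentially. indicator {0<..<r n} (fst p) * ve (snd p (fst p)) = indicator {0<..<t} (fst p) * ve (snd p (fst p))"
      by eventually_elim (use True in \<open>simp add: indicator_def\<close>)
    then show ?thesis by (rule tendsto_eventually)
  next
    case False
    then have "\<not> fst p < r n" for n using r(2)[of n] by simp
    then show ?thesis using False by (simp add: indicator_def)
  qed
qed

lemma AA_Pin_measurable [measurable]: "AA t \<in> borel_measurable Pin"
proof -
  have "(\<lambda>\<gamma>. \<integral>\<^sup>+ u. (\<lambda>p. indicator {0<..<t} (fst p) * ve (snd p (fst p))) (u, \<gamma>) \<partial>lborel) \<in> borel_measurable Pin"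
    using measurable_compose[OF measurable_pair_swap' path_joint_Pin]
    by (intro lborel.borel_measurable_nn_integral) (simp add: case_prod_beta')
  then show ?thesis unfolding AA_def[abs_def] by simp
qed

text \<open>\<open>Pin\<close> can be compared with \<open>W\<close> only before \<open>t\<close>.
  The power rule isolates the latest insertion time \<open>r < t\<close>, the rest is measurable up
  to \<open>r\<close>, and after passing to \<open>W\<close> the transition back to \<open>x\<close>
  becomes part of the test function of \<open>AA_moment\<close>.\<close>

lemma AA_Pin_moment: "P t x x * (\<integral>\<^sup>+ \<gamma>. AA t \<gamma> ^ k \<partial>Pin) = of_nat (fact k) * D ve k t x x"
proof (cases k)
  case 0
  then show ?thesis using Pin_1 by simp
next
  case (Suc k)
  interpret Pn: finite_measure Pin by (rule finite_measureI) (simp add: Pin_1)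
  interpret LP: pair_sigma_finite "lborel :: real measure" Pin ..
  note Fk = AA_pow_integrand_measurable[OF path_joint_Pin, of k]
  define E where "E r \<gamma> = indicator {0<..<t} r * (ve (\<gamma> r) * AA r \<gamma> ^ k)" for r \<gamma>
  have Em[measurable]: "(\<lambda>p. E (fst p) (snd p)) \<in> borel_measurable (lborel \<Otimes>\<^sub>M Pin)"
    using Fk by (simp add: E_def case_prod_beta')
  have "P t x x * (\<integral>\<^sup>+ \<gamma>. AA t \<gamma> ^ Suc k \<partial>Pin) = P t x x * (\<integral>\<^sup>+ \<gamma>. of_nat (Suc k) * (\<integral>\<^sup>+ r. E r \<gamma> \<partial>lborel) \<partial>Pin)"
    by (intro arg_cong2[where f="(*)"] refl nn_integral_cong) (simp only: space_Pin AA_Suc t order_refl E_def)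
  also have "\<dots> = of_nat (Suc k) * (P t x x * (\<integral>\<^sup>+ \<gamma>. \<integral>\<^sup>+ r. E r \<gamma> \<partial>lborel \<partial>Pin))"
  proof -
    have "(\<lambda>\<gamma>. \<integral>\<^sup>+ r. E r \<gamma> \<partial>lborel) \<in> borel_measurable Pin"
      using measurable_compose[OF measurable_pair_swap' Em]
      by (intro lborel.borel_measurable_nn_integral) (simp add: case_prod_beta')
    then show ?thesis by (simp add: nn_integral_cmult mult.left_commute del: of_nat_Suc)
  qed
  also have "(\<integral>\<^sup>+ \<gamma>. \<integral>\<^sup>+ r. E r \<gamma> \<partial>lborel \<partial>Pin) = (\<integral>\<^sup>+ r. \<integral>\<^sup>+ \<gamma>. E r \<gamma> \<partial>Pin \<partial>lborel)"
    by (rule LP.Fubini'[where f=E]) (simp add: case_prod_beta')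
  also have "P t x x * \<dots> = (\<integral>\<^sup>+ r. P t x x * (\<integral>\<^sup>+ \<gamma>. E r \<gamma> \<partial>Pin) \<partial>lborel)"
  proof -
    have "(\<lambda>r. \<integral>\<^sup>+ \<gamma>. E r \<gamma> \<partial>Pin) \<in> borel_measurable lborel"
      by (rule Pn.borel_measurable_nn_integral) (use Em in \<open>simp add: case_prod_beta'\<close>)
    then show ?thesis by (simp add: nn_integral_cmult)
  qed
  also have "\<dots> = (\<integral>\<^sup>+ r. of_nat (fact k) * (\<integral>\<^sup>+ y. D ve k r x y * ve y * P (t - r) y x \<partial>M) \<partial>lborel)"
  proof (rule nn_integral_cong)
    fix r :: real
    show "P t x x * (\<integral>\<^sup>+ \<gamma>. E r \<gamma> \<partial>Pin) = of_nat (fact k) * (\<integral>\<^sup>+ y. D ve k r x y * ve y * P (t - r) y x \<partial>M)"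
    proof (cases "r \<in> {0<..<t}")
      case True
      then have r: "0 < r" "r < t" by auto
      have cr: "(\<lambda>\<gamma>. \<gamma> r) \<in> measurable (Gr r) M" using coord_Gr[of r r] r borel_M by auto
      have Z: "(\<lambda>\<gamma>. ve (\<gamma> r) * AA r \<gamma> ^ k) \<in> borel_measurable (Gr r)"
        using cr AA_measurable[OF r(1) less_imp_le[OF r(2)]] by measurable
      have "P t x x * (\<integral>\<^sup>+ \<gamma>. E r \<gamma> \<partial>Pin) = (\<integral>\<^sup>+ \<gamma>. ve (\<gamma> r) * AA r \<gamma> ^ k * P (t - r) (\<gamma> r) x \<partial>W)"
        using Pin_W[OF r Z] True by (simp add: E_def)
      also have "\<dots> = (\<integral>\<^sup>+ \<gamma>. AA r \<gamma> ^ k * (ve (\<gamma> r) * P (t - r) (\<gamma> r) x) \<partial>W)" by (simp add: mult_ac)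
      also have "\<dots> = of_nat (fact k) * (\<integral>\<^sup>+ y. D ve k r x y * (ve y * P (t - r) y x) \<partial>M)"
        by (rule AA_moment[OF r, of "\<lambda>y. ve y * P (t - r) y x"]) measurable
      finally show ?thesis by (simp add: mult.assoc)
    next
      case False
      then have z: "D ve k r x y * ve y * P (t - r) y x = 0" for y
        using D_nonpos[of r] P_nonpos[of "t - r"] by (cases "0 < r") auto
      show ?thesis unfolding z using False by (simp add: E_def)
    qed
  qed
  also have "\<dots> = of_nat (fact k) * (\<integral>\<^sup>+ r. \<integral>\<^sup>+ y. D ve k r x y * ve y * P (t - r) y x \<partial>M \<partial>lborel)"
    by (rule nn_integral_cmult) measurable
  also have "(\<integral>\<^sup>+ r. \<integral>\<^sup>+ y. D ve k r x y * ve y * P (t - r) y x \<partial>M \<partial>lborel) = D ve (Suc k) t x x"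
    unfolding D_right[OF ve_measurable] conv_flip[OF mk_D[OF ve_measurable] mk_P] ..
  finally show ?thesis unfolding Suc by (simp only: fact_Suc of_nat_mult of_nat_id mult.assoc)
qed

text \<open>Connects the extended-real functional \<open>AA\<close> with the gauge integral of the
  theorem. Boundedness of \<open>v\<close> gives Lebesgue integrability, and the endpoints of the
  interval do not change the gauge integral.\<close>

lemma path_has_integral:
  assumes \<gamma>: "\<gamma> \<in> \<Omega>"
  shows "\<exists>L\<ge>0. AA t \<gamma> = ennreal L \<and> ((\<lambda>s. v (\<gamma> s)) has_integral L) {0..t}"
proof -
  define f where "f u = indicator {0<..<t} u * v (\<gamma> u)" for u
  have "(\<lambda>u. (\<lambda>p. indicator {0<..<t} (fst p) * ve (snd p (fst p))) (u, \<gamma>)) \<in> borel_measurable lborel"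
    by (rule measurable_Pair1[OF path_joint_measurable[OF t order_refl]]) (simp add: space_Gr \<gamma>)
  then have m: "(\<lambda>u. enn2real (indicator {0<..<t} u * ve (\<gamma> u))) \<in> borel_measurable borel" by simp
  have fe: "f u = enn2real (indicator {0<..<t} u * ve (\<gamma> u))" for u
    using v_nonneg by (simp add: f_def indicator_def)
  have fm[measurable]: "f \<in> borel_measurable borel" using m by (simp add: fe[abs_def])
  have fi: "integrable lborel f"
  proof (rule Bochner_Integration.integrable_bound)
    show "integrable lborel (\<lambda>u. c * indicator {0<..<t} u)" using t by simp
    show "AE u in lborel. norm (f u) \<le> norm (c * indicator {0<..<t} u)"
    proof (rule AE_I2)
      fix u
      have "\<bar>v (\<gamma> u)\<bar> \<le> \<bar>c\<bar>" using v_nonneg[of "\<gamma> u"] v_le[of "\<gamma> u"] by simp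
      then show "norm (f u) \<le> norm (c * indicator {0<..<t} u)" by (simp add: f_def indicator_def)
    qed
  qed measurable
  define L where "L = (\<integral>u. f u \<partial>lborel)"
  have nn: "0 \<le> f u" for u using v_nonneg by (simp add: f_def)
  have "AA t \<gamma> = (\<integral>\<^sup>+ u. ennreal (f u) \<partial>lborel)"
    unfolding AA_def f_def by (intro nn_integral_cong) (simp add: indicator_def)
  also have "\<dots> = ennreal L" unfolding L_def by (rule nn_integral_eq_integral[OF fi]) (use nn in simp)
  finally have "AA t \<gamma> = ennreal L" .
  moreover have "(f has_integral L) UNIV" unfolding L_def by (rule has_integral_integral_lborel[OF fi])
  then have "((\<lambda>u. if u \<in> {0<..<t} then v (\<gamma> u) else 0) has_integral L) UNIV"
    by (rule has_integral_eq[rotated]) (simp add: f_def indicator_def)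
  then have "((\<lambda>s. v (\<gamma> s)) has_integral L) {0<..<t}" by (simp only: has_integral_restrict_UNIV)
  then have "((\<lambda>s. v (\<gamma> s)) has_integral L) {0..t}"
    using has_integral_open_interval[of "\<lambda>s. v (\<gamma> s)" L 0 t] by (simp add: cbox_interval box_real)
  moreover have "0 \<le> L" unfolding L_def using nn by (intro integral_nonneg_AE AE_I2)
  ultimately show ?thesis by blast
qed

lemma Pin_exp:
  "P t x x * (\<integral>\<^sup>+ \<gamma>. ennreal (exp (integral {0..t} (\<lambda>s. v (\<gamma> s)))) \<partial>Pin) = K ve t x x"
proof -
  have "(\<integral>\<^sup>+ \<gamma>. ennreal (exp (integral {0..t} (\<lambda>s. v (\<gamma> s)))) \<partial>Pin) = (\<integral>\<^sup>+ \<gamma>. (\<Sum>k. AA t \<gamma> ^ k / of_nat (fact k)) \<partial>Pin)"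
  proof (rule nn_integral_cong)
    fix \<gamma> assume "\<gamma> \<in> space Pin"
    then obtain L where L: "0 \<le> L" "AA t \<gamma> = ennreal L" "((\<lambda>s. v (\<gamma> s)) has_integral L) {0..t}"
      using path_has_integral space_Pin by auto
    have "AA t \<gamma> ^ k / of_nat (fact k) = ennreal (L^k /\<^sub>R fact k)" for k
    proof -
      have "(of_nat (fact k) :: ennreal) = ennreal (fact k)"
        by (simp only: ennreal_of_nat_eq_real_of_nat of_nat_fact)
      then show ?thesis
        unfolding L(2) ennreal_power[OF L(1)] using L(1) by (simp only:) (subst divide_ennreal; simp add: divide_inverse mult.commute)
    qed
    moreover have "(\<Sum>k. ennreal (L^k /\<^sub>R fact k)) = ennreal (exp L)"
      unfolding exp_def using summable_exp_generic[of L] L(1)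
      by (intro suminf_ennreal_eq summable_sums) auto
    ultimately show "ennreal (exp (integral {0..t} (\<lambda>s. v (\<gamma> s)))) = (\<Sum>k. AA t \<gamma> ^ k / of_nat (fact k))"
      using integral_unique[OF L(3)] by simp
  qed
  also have "\<dots> = (\<Sum>k. (\<integral>\<^sup>+ \<gamma>. AA t \<gamma> ^ k \<partial>Pin) / of_nat (fact k))"
    by (simp add: nn_integral_suminf nn_integral_divide)
  finally have "P t x x * (\<integral>\<^sup>+ \<gamma>. ennreal (exp (integral {0..t} (\<lambda>s. v (\<gamma> s)))) \<partial>Pin) =
     (\<Sum>k. P t x x * ((\<integral>\<^sup>+ \<gamma>. AA t \<gamma> ^ k \<partial>Pin) / of_nat (fact k)))" by simp
  also have "\<dots> = (\<Sum>k. D ve k t x x)"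
  proof (rule suminf_cong)
    fix k
    have "P t x x * ((\<integral>\<^sup>+ \<gamma>. AA t \<gamma> ^ k \<partial>Pin) / of_nat (fact k)) = D ve k t x x * of_nat (fact k) / of_nat (fact k)"
      using AA_Pin_moment[of k] by (simp only: ennreal_times_divide mult.commute)
    also have "\<dots> = D ve k t x x" by (rule ennreal_mult_divide_eq) auto
    finally show "P t x x * ((\<integral>\<^sup>+ \<gamma>. AA t \<gamma> ^ k \<partial>Pin) / of_nat (fact k)) = D ve k t x x" .
  qed
  finally show ?thesis by (simp add: K_def)
qed

end

text \<open>The previous results are applied to \<open>n - u\<close>, which is nonnegative, so that
  exponential series and moments can be summed term by term without convergence questions;
  \<open>exp (- n * t)\<close> undoes the shift.\<close>

lemma Feynman_Kac_bounded:
  assumes u: "continuous_on UNIV u" "\<And>y. u y \<le> n" "\<And>y. - m \<le> (u y :: real)"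
  shows "P t x x * (\<integral>\<^sup>+ \<gamma>. ennreal (exp (- integral {0..t} (\<lambda>s. u (\<gamma> s)))) \<partial>Pin) =
    ennreal (exp (- n * t)) * K (\<lambda>y. ennreal (n - u y)) t x x"
    and "\<And>\<gamma>. \<gamma> \<in> \<Omega> \<Longrightarrow> (\<lambda>s. u (\<gamma> s)) integrable_on {0..t}"
    and "(\<lambda>\<gamma>. ennreal (exp (- integral {0..t} (\<lambda>s. u (\<gamma> s))))) \<in> borel_measurable Pin"
proof -
  have v: "continuous_on UNIV (\<lambda>y. n - u y)" "0 \<le> n - u y" "n - u y \<le> n + m" for y
  proof -
    show "continuous_on UNIV (\<lambda>y. n - u y)" by (intro continuous_intros u(1))
    show "0 \<le> n - u y" "n - u y \<le> n + m" using u(2)[of y] u(3)[of y] by linarith+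
  qed
  have int: "(\<lambda>s. u (\<gamma> s)) integrable_on {0..t} \<and> - integral {0..t} (\<lambda>s. u (\<gamma> s)) = - n * t + integral {0..t} (\<lambda>s. n - u (\<gamma> s))"
    if \<gamma>: "\<gamma> \<in> \<Omega>" for \<gamma>
  proof -
    obtain L where L: "((\<lambda>s. n - u (\<gamma> s)) has_integral L) {0..t}" using path_has_integral[OF v \<gamma>] by blast
    have "((\<lambda>s. n) has_integral n * t) {0..t}" using has_integral_const_real[of n 0 t] t by (simp add: mult.commute)
    then have "((\<lambda>s. n - (n - u (\<gamma> s))) has_integral n * t - L) {0..t}" by (rule has_integral_diff[OF _ L])
    then have hI: "((\<lambda>s. u (\<gamma> s)) has_integral n * t - L) {0..t}" by simp
    then show ?thesis using integral_unique[OF L] integral_unique[OF hI] by (auto simp: integrable_on_def)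
  qed
  then show "(\<lambda>s. u (\<gamma> s)) integrable_on {0..t}" if "\<gamma> \<in> \<Omega>" for \<gamma> using that by blast
  have e: "ennreal (exp (- integral {0..t} (\<lambda>s. u (\<gamma> s)))) = ennreal (exp (- n * t)) * ennreal (exp (integral {0..t} (\<lambda>s. n - u (\<gamma> s))))"
    if "\<gamma> \<in> space Pin" for \<gamma>
  proof -
    have "- integral {0..t} (\<lambda>s. u (\<gamma> s)) = - n * t + integral {0..t} (\<lambda>s. n - u (\<gamma> s))"
      using int[of \<gamma>] that space_Pin by blast
    then have "exp (- integral {0..t} (\<lambda>s. u (\<gamma> s))) = exp (- n * t) * exp (integral {0..t} (\<lambda>s. n - u (\<gamma> s)))"
      by (simp only: exp_add)
    then show ?thesis by (simp only: ennreal_mult[OF exp_ge_zero exp_ge_zero])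
  qed
  have L: "ennreal (exp (integral {0..t} (\<lambda>s. n - u (\<gamma> s)))) = ennreal (exp (enn2real (AA (\<lambda>y. n - u y) t \<gamma>)))" if \<gamma>: "\<gamma> \<in> space Pin" for \<gamma>
  proof -
    obtain L where L: "0 \<le> L" "AA (\<lambda>y. n - u y) t \<gamma> = ennreal L" "((\<lambda>s. n - u (\<gamma> s)) has_integral L) {0..t}"
      using path_has_integral[OF v] \<gamma> space_Pin by auto
    then show ?thesis using integral_unique[OF L(3)] by simp
  qed
  have am: "(\<lambda>\<gamma>. ennreal (exp (enn2real (AA (\<lambda>y. n - u y) t \<gamma>)))) \<in> borel_measurable Pin"
    using AA_Pin_measurable[OF v] by measurable
  then have m: "(\<lambda>\<gamma>. ennreal (exp (integral {0..t} (\<lambda>s. n - u (\<gamma> s))))) \<in> borel_measurable Pin"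
    by (subst measurable_cong[OF L])
  show "(\<lambda>\<gamma>. ennreal (exp (- integral {0..t} (\<lambda>s. u (\<gamma> s))))) \<in> borel_measurable Pin"
    by (subst measurable_cong[OF e]) (use m in measurable)
  have "(\<integral>\<^sup>+ \<gamma>. ennreal (exp (- integral {0..t} (\<lambda>s. u (\<gamma> s)))) \<partial>Pin) =
     ennreal (exp (- n * t)) * (\<integral>\<^sup>+ \<gamma>. ennreal (exp (integral {0..t} (\<lambda>s. n - u (\<gamma> s)))) \<partial>Pin)"
    unfolding nn_integral_cmult[OF m, symmetric] by (rule nn_integral_cong) (rule e)
  then have "P t x x * (\<integral>\<^sup>+ \<gamma>. ennreal (exp (- integral {0..t} (\<lambda>s. u (\<gamma> s)))) \<partial>Pin) =
     ennreal (exp (- n * t)) * (P t x x * (\<integral>\<^sup>+ \<gamma>. ennreal (exp (integral {0..t} (\<lambda>s. n - u (\<gamma> s)))) \<partial>Pin))"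
    by (simp only: mult.left_commute)
  also have "P t x x * (\<integral>\<^sup>+ \<gamma>. ennreal (exp (integral {0..t} (\<lambda>s. n - u (\<gamma> s)))) \<partial>Pin) = K (\<lambda>y. ennreal (n - u y)) t x x"
    by (rule Pin_exp[OF v])
  finally show "P t x x * (\<integral>\<^sup>+ \<gamma>. ennreal (exp (- integral {0..t} (\<lambda>s. u (\<gamma> s)))) \<partial>Pin) =
    ennreal (exp (- n * t)) * K (\<lambda>y. ennreal (n - u y)) t x x" .
qed

end

section \<open>Hilbert-Schmidt norms of kernel operators\<close>

lemma L2_sum:
  assumes "finite F" "\<And>f. f \<in> F \<Longrightarrow> h f \<in> L2 M"
  shows "(\<lambda>x. \<Sum>f\<in>F. c f * h f x) \<in> L2 M"
  using assms
proof (induction F rule: finite_induct)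
  case empty
  then show ?case by (simp add: L2_def)
next
  case (insert f F)
  have "(\<lambda>x. c f * h f x) \<in> L2 M"
  proof -
    have "h f \<in> L2 M" using insert by simp
    then show ?thesis by (auto simp: L2_def norm_mult power_mult_distrib intro!: borel_measurable_times)
  qed
  moreover have "(\<lambda>x. \<Sum>f\<in>F. c f * h f x) \<in> L2 M" using insert by simp
  ultimately show ?case using lcc_in_L2[of _ M _ 1 1] insert by (simp add: lcc_def)
qed

lemma L2_inner_sum:
  assumes "finite F" "\<And>f. f \<in> F \<Longrightarrow> h f \<in> L2 M" "g \<in> L2 M"
  shows "L2_inner M g (\<lambda>x. \<Sum>f\<in>F. c f * h f x) = (\<Sum>f\<in>F. c f * L2_inner M g (h f))"
proof -
  have "L2_inner M g (\<lambda>x. \<Sum>f\<in>F. c f * h f x) = (\<integral>x. (\<Sum>f\<in>F. c f * (cnj (g x) * h f x)) \<partial>M)"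
    unfolding L2_inner_def by (simp add: sum_distrib_left mult_ac)
  also have "\<dots> = (\<Sum>f\<in>F. \<integral>x. c f * (cnj (g x) * h f x) \<partial>M)"
    by (rule Bochner_Integration.integral_sum) (intro integrable_mult_right L2_inner_integrable assms)
  finally show ?thesis by (simp add: L2_inner_def)
qed

lemma Bessel_L2:
  assumes F: "finite F" "orthonormal_L2 M F" and g: "g \<in> L2 M"
  shows "(\<Sum>f\<in>F. (cmod (L2_inner M g f))\<^sup>2) \<le> L2_sqnorm M g"
proof -
  interpret semi_inner "L2 M" "ip M" lcc by (rule L2_semi_inner)
  have FL: "f \<in> L2 M" if "f \<in> F" for f using F that by (auto simp: orthonormal_L2_def)
  define c where "c f = L2_inner M f g" for f
  define s where "s x = (\<Sum>f\<in>F. c f * f x)" for x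
  have s: "s \<in> L2 M" unfolding s_def by (rule L2_sum[OF F(1)]) (use FL in auto)
  have "L2_inner M h s = (\<Sum>f\<in>F. c f * L2_inner M h f)" if "h \<in> L2 M" for h
    unfolding s_def by (rule L2_inner_sum[OF F(1) _ that]) (use FL in auto)
  note ls = this
  have cc: "c f * cnj (c f) = complex_of_real ((cmod (c f))\<^sup>2)" for f by (rule complex_norm_square[symmetric])
  have gs: "L2_inner M g s = complex_of_real (\<Sum>f\<in>F. (cmod (c f))\<^sup>2)"
  proof -
    have "L2_inner M g s = (\<Sum>f\<in>F. c f * cnj (c f))"
      unfolding ls[OF g] c_def using L2_inner_cnj[of M g] by simp
    then show ?thesis unfolding cc by simp
  qed
  have "L2_inner M s s = (\<Sum>f\<in>F. c f * cnj (c f))"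
    unfolding ls[OF s]
  proof (rule sum.cong[OF refl])
    fix f assume f: "f \<in> F"
    have "L2_inner M f s = (\<Sum>f'\<in>F. c f' * (if f = f' then 1 else 0))"
      unfolding ls[OF FL[OF f]] using F f by (intro sum.cong) (auto simp: orthonormal_L2_def)
    also have "\<dots> = (\<Sum>f'\<in>F. if f = f' then c f' else 0)" by (intro sum.cong) auto
    also have "\<dots> = c f" using sum.delta'[OF F(1), of f c] f by simp
    finally show "c f * L2_inner M s f = c f * cnj (c f)" using L2_inner_cnj[of M s f] by simp
  qed
  then have ss: "L2_inner M s s = complex_of_real (\<Sum>f\<in>F. (cmod (c f))\<^sup>2)" unfolding cc by simp
  have "0 \<le> nd g s" by (rule nd_nonneg[OF g s])
  then have "(\<Sum>f\<in>F. (cmod (c f))\<^sup>2) \<le> ip M g g"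
    unfolding nd_def ip_def[of M g s] ip_def[of M s s] gs ss by simp
  moreover have "cmod (c f) = cmod (L2_inner M g f)" for f
    unfolding c_def using L2_inner_cnj[of M f g] by simp
  ultimately show ?thesis by (simp add: ip_self)
qed

section \<open>Comparison of orthonormal sums with the integral of the squared kernel\<close>

context sigma_finite_measure
begin

text \<open>For fixed \<open>x\<close> the values \<open>kop k f x\<close> are the Fourier
  coefficients of the row \<open>k x\<close>, so Bessel's inequality holds pointwise in
  \<open>x\<close> whenever the row is square integrable; otherwise the bound is infinite.\<close>

lemma HS_upper:
  assumes k: "L2bd k C" and F: "finite F" "orthonormal_L2 M F"
  shows "ennreal (\<Sum>f\<in>F. L2_sqnorm M (kop k f)) \<le> (\<integral>\<^sup>+ x. \<integral>\<^sup>+ y. (k x y)\<^sup>2 \<partial>M \<partial>M)"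
proof -
  have FL: "f \<in> L2 M" if "f \<in> F" for f using F that by (auto simp: orthonormal_L2_def)
  have kL: "kop k f \<in> L2 M" if "f \<in> F" for f by (rule kop_L2(1)[OF k FL[OF that]])
  have "ennreal (\<Sum>f\<in>F. L2_sqnorm M (kop k f)) = (\<Sum>f\<in>F. \<integral>\<^sup>+ x. ennreal ((cmod (kop k f x))\<^sup>2) \<partial>M)"
    using ennreal_L2_sqnorm[OF kL] by (subst sum_ennreal[symmetric]) (auto simp: L2_sqnorm_def)
  also have "\<dots> = (\<integral>\<^sup>+ x. (\<Sum>f\<in>F. ennreal ((cmod (kop k f x))\<^sup>2)) \<partial>M)"
    using L2_measurable[OF kL] by (intro nn_integral_sum[symmetric]) auto
  also have "\<dots> \<le> (\<integral>\<^sup>+ x. \<integral>\<^sup>+ y. (k x y)\<^sup>2 \<partial>M \<partial>M)"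
  proof (rule nn_integral_mono)
    fix x assume x: "x \<in> space M"
    note [measurable] = kernel_slice[OF L2bd_measurable[OF k] x]
    show "(\<Sum>f\<in>F. ennreal ((cmod (kop k f x))\<^sup>2)) \<le> (\<integral>\<^sup>+ y. (k x y)\<^sup>2 \<partial>M)"
    proof (cases "(\<integral>\<^sup>+ y. (k x y)\<^sup>2 \<partial>M) = \<infinity>")
      case False
      define g where "g y = complex_of_real (enn2real (k x y))" for y
      have le: "(\<integral>\<^sup>+ y. ennreal ((cmod (g y))\<^sup>2) \<partial>M) \<le> (\<integral>\<^sup>+ y. (k x y)\<^sup>2 \<partial>M)"
      proof (rule nn_integral_mono)
        fix y
        have "ennreal (enn2real (k x y)) \<le> k x y" by (cases "k x y") auto
        then show "ennreal ((cmod (g y))\<^sup>2) \<le> (k x y)\<^sup>2"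
          by (simp add: g_def ennreal_power[symmetric] power_mono)
      qed
      have g: "g \<in> L2 M" unfolding L2_iff_nn
      proof
        show "g \<in> borel_measurable M" unfolding g_def by measurable
        show "(\<integral>\<^sup>+ y. ennreal ((cmod (g y))\<^sup>2) \<partial>M) < \<infinity>" using le False by (simp add: less_top[symmetric] top_unique) (metis le top_unique)
      qed
      have "kop k f x = L2_inner M g f" for f unfolding kop_def L2_inner_def g_def by simp
      then have "(\<Sum>f\<in>F. (cmod (kop k f x))\<^sup>2) \<le> L2_sqnorm M g" using Bessel_L2[OF F g] by simp
      then have "(\<Sum>f\<in>F. ennreal ((cmod (kop k f x))\<^sup>2)) \<le> ennreal (L2_sqnorm M g)" by (simp add: sum_ennreal ennreal_leI)
      then show ?thesis using ennreal_L2_sqnorm[OF g] le by simp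
    qed simp
  qed
  finally show ?thesis .
qed

text \<open>Where the positive operator is finite, infinite kernel values, which \<open>kop\<close>
  reads as 0, occur only at zeros of \<open>g\<close> up to a null set.\<close>

lemma kop_nonneg:
  assumes k: "L2bd k C" and f: "(\<lambda>y. complex_of_real (g y)) \<in> L2 M" and g: "\<And>y. 0 \<le> g y"
  shows "AE x in M. ennreal (cmod (kop k (\<lambda>y. complex_of_real (g y)) x)) = app k (\<lambda>y. ennreal (g y)) x"
  using app_L2(2)[OF k f] AE_space
proof eventually_elim
  case (elim x)
  have [measurable]: "g \<in> borel_measurable M"
  proof -
    have "(\<lambda>y. Re (complex_of_real (g y))) \<in> borel_measurable M" using L2_measurable[OF f] by measurable
    then show ?thesis by simp
  qed
  note [measurable] = kernel_slice[OF L2bd_measurable[OF k] elim(2)]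
  have fin: "app k (\<lambda>y. ennreal (g y)) x < \<infinity>" using elim(1) g by simp
  then have "AE y in M. k x y * ennreal (g y) \<noteq> \<infinity>"
    unfolding app_def by (intro nn_integral_PInf_AE) auto
  then have ae: "AE y in M. ennreal (enn2real (k x y) * g y) = k x y * ennreal (g y)"
  proof eventually_elim
    case (elim y)
    then show ?case using g[of y] by (cases "k x y") (auto simp: ennreal_mult ennreal_mult_eq_top_iff)
  qed
  have "kop k (\<lambda>y. complex_of_real (g y)) x = complex_of_real (\<integral>y. enn2real (k x y) * g y \<partial>M)"
    unfolding kop_def by (simp flip: of_real_mult)
  also have "(\<integral>y. enn2real (k x y) * g y \<partial>M) = enn2real (\<integral>\<^sup>+ y. ennreal (enn2real (k x y) * g y) \<partial>M)"
    by (rule integral_eq_nn_integral) (use g in auto)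
  also have "(\<integral>\<^sup>+ y. ennreal (enn2real (k x y) * g y) \<partial>M) = app k (\<lambda>y. ennreal (g y)) x"
    unfolding app_def by (rule nn_integral_cong_AE[OF ae])
  finally show ?case using fin by simp
qed

lemma indicator_orthonormal:
  fixes A :: "'i \<Rightarrow> 'a set"
  assumes I: "finite I" and A: "\<And>i. i \<in> I \<Longrightarrow> A i \<in> sets M" "disjoint_family_on A I"
    and m: "\<And>i. i \<in> I \<Longrightarrow> 0 < measure M (A i)"
  defines "f \<equiv> \<lambda>i y. complex_of_real (indicator (A i) y / sqrt (measure M (A i)))"
  shows "inj_on f I" "orthonormal_L2 M (f ` I)"
proof -
  have fin: "emeasure M (A i) < \<infinity>" if "i \<in> I" for i
    using m[OF that] by (auto simp: measure_def less_top[symmetric])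
  show inj: "inj_on f I"
  proof (rule inj_onI, rule ccontr)
    fix i j assume ij: "i \<in> I" "j \<in> I" "f i = f j" "i \<noteq> j"
    have "A i \<noteq> {}" using m[OF ij(1)] by auto
    then obtain y where y: "y \<in> A i" by blast
    moreover have "y \<notin> A j" using y A(2) ij by (auto simp: disjoint_family_on_def)
    ultimately show False using fun_cong[OF ij(3), of y] m[OF ij(1)] by (simp add: f_def)
  qed
  have ind: "integrable M (indicator (A i) :: 'a \<Rightarrow> real)" if "i \<in> I" for i
    using A(1)[OF that] fin[OF that] by simp
  have L: "f i \<in> L2 M" if i: "i \<in> I" for i
  proof -
    have "(cmod (f i y))\<^sup>2 = indicator (A i) y / measure M (A i)" for y
      using m[OF i] by (simp add: f_def indicator_def power_divide norm_divide)
    moreover have "f i \<in> borel_measurable M" unfolding f_def using A(1)[OF i] by measurable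
    ultimately show ?thesis using ind[OF i] by (simp add: L2_def)
  qed
  have ip: "L2_inner M (f i) (f j) = (if i = j then 1 else 0)" if ij: "i \<in> I" "j \<in> I" for i j
  proof (cases "i = j")
    case True
    have "cnj (f i y) * f i y = complex_of_real (indicator (A i) y / measure M (A i))" for y
      using m[OF ij(1)] by (simp add: f_def indicator_def flip: of_real_mult)
    then have "L2_inner M (f i) (f i) = complex_of_real (\<integral>y. indicator (A i) y / measure M (A i) \<partial>M)"
      unfolding L2_inner_def by (simp only: integral_complex_of_real)
    then show ?thesis using True m[OF ij(1)] A(1)[OF ij(1)] by (simp add: sets.Int_space_eq2)
  next
    case False
    have z: "cnj (f i y) * f j y = 0" for y
      using A(2) False ij by (auto simp: f_def indicator_def disjoint_family_on_def)
    show ?thesis unfolding L2_inner_def z using False by simp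
  qed
  show "orthonormal_L2 M (f ` I)"
    unfolding orthonormal_L2_def using L ip inj by (auto dest: inj_onD)
qed

text \<open>The indicators of the cells, divided by the roots of their measures, are orthonormal,
  and the left-hand side is the sum of the squared norms of their images.\<close>

lemma HS_partition_le:
  fixes A :: "'i \<Rightarrow> 'a set"
  assumes k: "L2bd k C" and I: "finite I" and A: "\<And>i. i \<in> I \<Longrightarrow> A i \<in> sets M" "disjoint_family_on A I"
    and fin: "\<And>i. i \<in> I \<Longrightarrow> emeasure M (A i) < \<infinity>"
    and ub: "\<And>F. finite F \<Longrightarrow> orthonormal_L2 M F \<Longrightarrow> ennreal (\<Sum>f\<in>F. L2_sqnorm M (kop k f)) \<le> B"
  shows "(\<integral>\<^sup>+ x. (\<Sum>i\<in>I. (\<integral>\<^sup>+ y. k x y * indicator (A i) y \<partial>M)\<^sup>2 / emeasure M (A i)) \<partial>M) \<le> B"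
proof -
  define J where "J = {i\<in>I. 0 < measure M (A i)}"
  have J: "finite J" "J \<subseteq> I" using I by (auto simp: J_def)
  define f where "f i y = complex_of_real (indicator (A i) y / sqrt (measure M (A i)))" for i y
  have dj: "disjoint_family_on A J" using A(2) J(2) by (auto simp: disjoint_family_on_def)
  have on: "inj_on f J" "orthonormal_L2 M (f ` J)"
  proof -
    have 1: "\<And>i. i \<in> J \<Longrightarrow> A i \<in> sets M" using A(1) J(2) by blast
    have 2: "\<And>i. i \<in> J \<Longrightarrow> 0 < measure M (A i)" unfolding J_def by blast
    show "inj_on f J" unfolding f_def[abs_def] by (rule indicator_orthonormal(1)[OF J(1) 1 dj 2])
    show "orthonormal_L2 M (f ` J)" unfolding f_def[abs_def] by (rule indicator_orthonormal(2)[OF J(1) 1 dj 2])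
  qed
  have em: "emeasure M (A i) = ennreal (measure M (A i))" if "i \<in> I" for i
    using fin[OF that] by (simp add: emeasure_eq_ennreal_measure less_top[symmetric])
  have km: "(\<lambda>y. k x y) \<in> borel_measurable M" if "x \<in> space M" for x
    by (rule kernel_slice[OF L2bd_measurable[OF k] that])
  have trm: "(\<integral>\<^sup>+ x. (\<integral>\<^sup>+ y. k x y * indicator (A i) y \<partial>M)\<^sup>2 / emeasure M (A i) \<partial>M) = ennreal (L2_sqnorm M (kop k (f i)))"
    if i: "i \<in> J" for i
  proof -
    define m where "m = measure M (A i)"
    have m: "0 < m" "emeasure M (A i) = ennreal m" using i em by (auto simp: J_def m_def)
    have fL: "f i \<in> L2 M" using on(2) i by (auto simp: orthonormal_L2_def)
    have fi: "f i = (\<lambda>y. complex_of_real (indicator (A i) y / sqrt m))" by (simp add: f_def m_def fun_eq_iff)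
    have "ennreal (L2_sqnorm M (kop k (f i))) = (\<integral>\<^sup>+ x. ennreal ((cmod (kop k (f i) x))\<^sup>2) \<partial>M)"
      by (rule ennreal_L2_sqnorm[OF kop_L2(1)[OF k fL]])
    also have "\<dots> = (\<integral>\<^sup>+ x. (\<integral>\<^sup>+ y. k x y * indicator (A i) y \<partial>M)\<^sup>2 / emeasure M (A i) \<partial>M)"
    proof (rule nn_integral_cong_AE)
      have "AE x in M. ennreal (cmod (kop k (f i) x)) = app k (\<lambda>y. ennreal (indicator (A i) y / sqrt m)) x"
        unfolding fi by (rule kop_nonneg[OF k fL[unfolded fi]]) (use m in simp)
      then show "AE x in M. ennreal ((cmod (kop k (f i) x))\<^sup>2) = (\<integral>\<^sup>+ y. k x y * indicator (A i) y \<partial>M)\<^sup>2 / emeasure M (A i)"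
        using AE_space
      proof eventually_elim
        case (elim x)
        note [measurable] = km[OF elim(2)]
        have Ai[measurable]: "A i \<in> sets M" using A i J by auto
        have "app k (\<lambda>y. ennreal (indicator (A i) y / sqrt m)) x = (\<integral>\<^sup>+ y. k x y * indicator (A i) y / ennreal (sqrt m) \<partial>M)"
          unfolding app_def using m
          by (intro nn_integral_cong) (auto simp: divide_ennreal[symmetric] ennreal_times_divide indicator_def)
        also have "\<dots> = (\<integral>\<^sup>+ y. k x y * indicator (A i) y \<partial>M) / ennreal (sqrt m)"
          by (rule nn_integral_divide) measurable
        finally have "ennreal ((cmod (kop k (f i) x))\<^sup>2) = ((\<integral>\<^sup>+ y. k x y * indicator (A i) y \<partial>M) / ennreal (sqrt m))\<^sup>2"
          using elim(1) by (simp add: ennreal_power[symmetric])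
        also have "\<dots> = (\<integral>\<^sup>+ y. k x y * indicator (A i) y \<partial>M)\<^sup>2 / ennreal m"
        proof -
          have "inverse (ennreal (sqrt m)) * inverse (ennreal (sqrt m)) = ennreal (inverse (sqrt m) * inverse (sqrt m))"
            using m(1) by (simp add: inverse_ennreal ennreal_mult)
          also have "inverse (sqrt m) * inverse (sqrt m) = inverse m"
            using m(1) by (simp flip: inverse_mult_distrib)
          finally have i2: "inverse (ennreal (sqrt m)) * inverse (ennreal (sqrt m)) = inverse (ennreal m)"
            using m(1) by (simp add: inverse_ennreal)
          have "(a / b)\<^sup>2 = a\<^sup>2 * (inverse b * inverse b)" for a b :: ennreal
            unfolding divide_ennreal_def power2_eq_square by (simp only: mult_ac)
          then show ?thesis using i2 unfolding divide_ennreal_def by simp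
        qed
        finally show ?case using m by simp
      qed
    qed
    finally show ?thesis by simp
  qed
  have mm: "(\<lambda>x. (\<integral>\<^sup>+ y. k x y * indicator (A i) y \<partial>M)\<^sup>2 / emeasure M (A i)) \<in> borel_measurable M" if "i \<in> I" for i
  proof -
    have "(\<lambda>x. \<integral>\<^sup>+ y. k x y * indicator (A i) y \<partial>M) \<in> borel_measurable M"
      using app_measurable[OF L2bd_measurable[OF k], of "indicator (A i)"] A(1)[OF that] unfolding app_def by simp
    then show ?thesis unfolding power2_eq_square
      by (intro borel_measurable_divide_ennreal borel_measurable_times measurable_const) auto
  qed
  \<comment> \<open>Cells of measure 0 cannot be normalised and are left out of \<open>J\<close>;
    their terms are \<open>0 / 0\<close>, which is 0 in the extended nonnegative reals.\<close>
  have zero: "(\<integral>\<^sup>+ x. (\<integral>\<^sup>+ y. k x y * indicator (A i) y \<partial>M)\<^sup>2 / emeasure M (A i) \<partial>M) = 0" if i: "i \<in> I - J" for i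
  proof -
    have "emeasure M (A i) = 0" using i em[of i] by (auto simp: J_def not_less measure_le_0_iff)
    then have "AE y in M. y \<notin> A i" using i A(1)[of i] by (intro AE_not_in) (auto simp: null_sets_def)
    then have "(\<integral>\<^sup>+ y. k x y * indicator (A i) y \<partial>M) = (\<integral>\<^sup>+ y. 0 \<partial>M)" for x
      by (intro nn_integral_cong_AE) (auto elim!: eventually_mono)
    then show ?thesis by simp
  qed
  have "(\<integral>\<^sup>+ x. (\<Sum>i\<in>I. (\<integral>\<^sup>+ y. k x y * indicator (A i) y \<partial>M)\<^sup>2 / emeasure M (A i)) \<partial>M) =
     (\<Sum>i\<in>I. \<integral>\<^sup>+ x. (\<integral>\<^sup>+ y. k x y * indicator (A i) y \<partial>M)\<^sup>2 / emeasure M (A i) \<partial>M)"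
    by (rule nn_integral_sum) (use mm in auto)
  also have "\<dots> = (\<Sum>i\<in>J. \<integral>\<^sup>+ x. (\<integral>\<^sup>+ y. k x y * indicator (A i) y \<partial>M)\<^sup>2 / emeasure M (A i) \<partial>M)"
    using J I zero by (intro sum.mono_neutral_right) auto
  also have "\<dots> = (\<Sum>i\<in>J. ennreal (L2_sqnorm M (kop k (f i))))" using trm by simp
  also have "\<dots> = ennreal (\<Sum>g\<in>f ` J. L2_sqnorm M (kop k g))"
    using on(1) by (subst sum_ennreal) (auto simp: sum.reindex L2_sqnorm_def)
  also have "\<dots> \<le> B" by (rule ub) (use J on in auto)
  finally show ?thesis .
qed

end

text \<open>The values of \<open>sig C n\<close> label the atoms of the algebra generated by \<open>C 0, \<dots>, C (n - 1)\<close>.\<close>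
definition sig :: "(nat \<Rightarrow> 'a set) \<Rightarrow> nat \<Rightarrow> 'a \<Rightarrow> nat set" where
  "sig C n y = {i. i < n \<and> y \<in> C i}"

lemma sig_restrict: "n \<le> m \<Longrightarrow> sig C n y = sig C m y \<inter> {..<n}"
  by (auto simp: sig_def)

locale outer_regular = sigma_finite_measure M for M :: "'a::second_countable_topology measure" +
  fixes C :: "nat \<Rightarrow> 'a set"
  assumes sets_M: "sets M = sets borel"
    and outer: "A \<in> sets borel \<Longrightarrow> emeasure M A = (INF U\<in>{U. open U \<and> A \<subseteq> U}. emeasure M U)"
    and C_open: "open (C i)"
    and C_base: "open U \<Longrightarrow> \<exists>I. U = (\<Union>i\<in>I. C i)"
begin

lemma space_M': "space M = UNIV" using sets_eq_imp_space_eq[OF sets_M] by simp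

lemma C_sets [measurable]: "C i \<in> sets M" using C_open sets_M by auto

lemma sig_sets [measurable]: "{y. sig C n y = \<sigma>} \<in> sets M"
proof -
  have "{y. sig C n y = \<sigma>} = {y \<in> space M. \<forall>i\<in>{..<n}. (y \<in> C i) = (i \<in> \<sigma>)} \<inter> (if \<sigma> \<subseteq> {..<n} then UNIV else {})"
    by (auto simp: sig_def space_M')
  also have "\<dots> \<in> sets M"
  proof (cases "\<sigma> \<subseteq> {..<n}")
    case True
    have "{y \<in> space M. \<forall>i\<in>{..<n}. (y \<in> C i) = (i \<in> \<sigma>)} \<in> sets M" by measurable
    then show ?thesis using True by simp
  qed simp
  finally show ?thesis .
qed

lemma sig_fun_measurable: "(\<lambda>y. \<phi> (sig C n y)) \<in> measurable M N" if "range \<phi> \<subseteq> space N" for \<phi> :: "nat set \<Rightarrow> 'b" and N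
proof (rule measurableI)
  show "\<phi> (sig C n y) \<in> space N" for y using that by auto
  fix S
  have "(\<lambda>y. \<phi> (sig C n y)) -` S \<inter> space M = (\<Union>\<sigma>\<in>{\<sigma>\<in>Pow {..<n}. \<phi> \<sigma> \<in> S}. {y. sig C n y = \<sigma>})"
    by (auto simp: space_M' sig_def)
  also have "\<dots> \<in> sets M" by (intro sets.finite_UN) auto
  finally show "(\<lambda>y. \<phi> (sig C n y)) -` S \<inter> space M \<in> sets M" .
qed

section \<open>Approximation along a refining sequence of partitions\<close>

context
  fixes E :: "'a set" assumes E[measurable]: "E \<in> sets M" and Efin: "emeasure M E < \<infinity>"
begin

text \<open>Functions of \<open>sig C n\<close> are the step functions over the \<open>n\<close>-th
  partition, so this is approximability by step functions in the square mean on
  \<open>E\<close>.\<close>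

definition approx :: "('a \<Rightarrow> real) \<Rightarrow> bool" where
  "approx s \<longleftrightarrow> (\<forall>e>0. \<exists>n \<phi>. (\<integral>\<^sup>+ y. ennreal ((s y - \<phi> (sig C n y))\<^sup>2) * indicator E y \<partial>M) \<le> ennreal e)"

text \<open>Outer regularity encloses \<open>A \<inter> E\<close> in an open set \<open>U\<close> of
  nearly the same measure. \<open>U\<close> is a union of base sets, and its part made of the first
  \<open>n\<close> base sets is a union of cells that exhausts \<open>U\<close>; finiteness of the
  measure makes both errors small.\<close>

lemma approx_indicator:
  assumes A: "A \<in> sets M" shows "approx (indicator A)"
  unfolding approx_def
proof (intro allI impI)
  fix e :: real assume e: "0 < e"
  define A' where "A' = A \<inter> E"
  have A'[measurable]: "A' \<in> sets M" and A'fin: "emeasure M A' < \<infinity>"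
    using A E le_less_trans[OF emeasure_mono[of A' E M] Efin] by (auto simp: A'_def)
  have "(INF U\<in>{U. open U \<and> A' \<subseteq> U}. emeasure M U) < emeasure M A' + ennreal (e/2)"
  proof -
    have "emeasure M A' < emeasure M A' + ennreal (e/2)"
      using A'fin e by (cases "emeasure M A'") (auto simp: ennreal_less_iff simp flip: ennreal_plus)
    then show ?thesis using outer[of A'] A' sets_M by simp
  qed
  then obtain U where U: "open U" "A' \<subseteq> U" "emeasure M U < emeasure M A' + ennreal (e/2)"
    unfolding INF_less_iff by auto
  have Us[measurable]: "U \<in> sets M" using U sets_M by auto
  have UA: "emeasure M (U - A') \<le> ennreal (e/2)"
  proof -
    have "emeasure M (U - A') = emeasure M U - emeasure M A'"
      by (rule emeasure_Diff) (use A'fin U(2) in auto)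
    also have "\<dots> \<le> ennreal (e/2)"
      unfolding ennreal_minus_le_iff using U(3) A'fin by (auto simp: less_imp_le)
    finally show ?thesis .
  qed
  have "emeasure M A' + ennreal (e/2) < \<infinity>" using A'fin by (simp add: ennreal_add_less_top)
  then have Ufin: "emeasure M U < \<infinity>" by (rule less_trans[OF U(3)])
  obtain I where I: "U = (\<Union>i\<in>I. C i)" using C_base[OF U(1)] by blast
  define V where "V n = (\<Union>i\<in>I \<inter> {..<n}. C i)" for n
  have Vs[measurable]: "V n \<in> sets M" for n unfolding V_def by measurable
  have "(\<lambda>n. emeasure M (U - V n)) \<longlonglongrightarrow> emeasure M (\<Inter>n. U - V n)"
  proof (rule Lim_emeasure_decseq)
    show "range (\<lambda>n. U - V n) \<subseteq> sets M" by auto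
    show "decseq (\<lambda>n. U - V n)" by (auto simp: decseq_def V_def)
    show "emeasure M (U - V n) \<noteq> \<infinity>" for n
      using le_less_trans[OF emeasure_mono[of "U - V n" U M] Ufin] by auto
  qed
  also have "(\<Inter>n. U - V n) = {}" unfolding I V_def by (auto intro: lessI)
  finally have "(\<lambda>n. emeasure M (U - V n)) \<longlonglongrightarrow> 0" by simp
  then have "\<forall>\<^sub>F n in sequentially. emeasure M (U - V n) < ennreal (e/2)"
    by (rule order_tendstoD(2)) (use e in simp)
  then obtain n where n: "emeasure M (U - V n) < ennreal (e/2)" by (auto simp: eventually_sequentially)
  define \<phi> where "\<phi> \<sigma> = (if I \<inter> \<sigma> \<noteq> {} then 1 else 0 :: real)" for \<sigma>
  have phi: "\<phi> (sig C n y) = indicator (V n) y" for y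
    by (auto simp: \<phi>_def sig_def V_def indicator_def)
  have "(\<integral>\<^sup>+ y. ennreal ((indicator A y - \<phi> (sig C n y))\<^sup>2) * indicator E y \<partial>M) \<le>
     (\<integral>\<^sup>+ y. indicator (U - A') y + indicator (U - V n) y \<partial>M)"
  proof (rule nn_integral_mono)
    fix y
    show "ennreal ((indicator A y - \<phi> (sig C n y))\<^sup>2) * indicator E y \<le> indicator (U - A') y + indicator (U - V n) y"
      unfolding phi using U(2) I by (auto simp: indicator_def A'_def V_def)
  qed
  also have "\<dots> = emeasure M (U - A') + emeasure M (U - V n)" by (subst nn_integral_add) auto
  also have "\<dots> \<le> ennreal (e/2) + ennreal (e/2)" using UA n by (intro add_mono) auto
  also have "\<dots> = ennreal e" using e by (simp flip: ennreal_plus)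
  finally show "\<exists>n \<phi>. (\<integral>\<^sup>+ y. ennreal ((indicator A y - \<phi> (sig C n y))\<^sup>2) * indicator E y \<partial>M) \<le> ennreal e" by blast
qed

lemma approx_add_cmult:
  assumes s: "approx s" "approx s'" and [measurable]: "s \<in> borel_measurable M" "s' \<in> borel_measurable M"
  shows "approx (\<lambda>y. a * s y + s' y)"
  unfolding approx_def
proof (intro allI impI)
  fix e :: real assume e: "0 < e"
  \<comment> \<open>Because of \<open>(a p + q)^2 \<le> 2 a^2 p^2 + 2 q^2\<close> this choice gives
    each function a share of \<open>e/2\<close>; the summand 1 covers \<open>a = 0\<close>.\<close>
  define e1 where "e1 = e / (4 * (a\<^sup>2 + 1))"
  have e1: "0 < e1" using e by (simp add: e1_def add_nonneg_pos)
  obtain n \<phi> where n: "(\<integral>\<^sup>+ y. ennreal ((s y - \<phi> (sig C n y))\<^sup>2) * indicator E y \<partial>M) \<le> ennreal e1"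
    using s(1) e1 unfolding approx_def by blast
  have "0 < e/4" using e by simp
  then obtain n' \<phi>' where n': "(\<integral>\<^sup>+ y. ennreal ((s' y - \<phi>' (sig C n' y))\<^sup>2) * indicator E y \<partial>M) \<le> ennreal (e/4)"
    using s(2) unfolding approx_def by blast
  define N where "N = max n n'"
  define \<psi> where "\<psi> \<sigma> = a * \<phi> (\<sigma> \<inter> {..<n}) + \<phi>' (\<sigma> \<inter> {..<n'})" for \<sigma>
  have psi: "\<psi> (sig C N y) = a * \<phi> (sig C n y) + \<phi>' (sig C n' y)" for y
    unfolding \<psi>_def using sig_restrict[of n N C y] sig_restrict[of n' N C y] by (simp add: N_def)
  have [measurable]: "(\<lambda>y. \<phi> (sig C n y)) \<in> borel_measurable M" "(\<lambda>y. \<phi>' (sig C n' y)) \<in> borel_measurable M"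
    by (rule sig_fun_measurable; simp)+
  have "(\<integral>\<^sup>+ y. ennreal ((a * s y + s' y - \<psi> (sig C N y))\<^sup>2) * indicator E y \<partial>M) \<le>
    (\<integral>\<^sup>+ y. ennreal (2 * a\<^sup>2) * (ennreal ((s y - \<phi> (sig C n y))\<^sup>2) * indicator E y) +
       ennreal 2 * (ennreal ((s' y - \<phi>' (sig C n' y))\<^sup>2) * indicator E y) \<partial>M)"
  proof (rule nn_integral_mono)
    fix y
    define p where "p = s y - \<phi> (sig C n y)" define q where "q = s' y - \<phi>' (sig C n' y)"
    have "a * s y + s' y - \<psi> (sig C N y) = a * p + q" unfolding psi p_def q_def by (simp add: algebra_simps)
    moreover have "(a * p + q)\<^sup>2 \<le> 2 * a\<^sup>2 * p\<^sup>2 + 2 * q\<^sup>2"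
      using sum_squares_bound[of "a * p" q] by (simp add: power2_sum power_mult_distrib)
    ultimately have "ennreal ((a * s y + s' y - \<psi> (sig C N y))\<^sup>2) \<le> ennreal (2 * a\<^sup>2 * p\<^sup>2 + 2 * q\<^sup>2)"
      by (simp only: ennreal_leI)
    also have "\<dots> = ennreal (2 * a\<^sup>2 * p\<^sup>2) + ennreal (2 * q\<^sup>2)" by (rule ennreal_plus) auto
    also have "\<dots> = ennreal (2 * a\<^sup>2) * ennreal (p\<^sup>2) + ennreal 2 * ennreal (q\<^sup>2)"
      by (intro arg_cong2[where f="(+)"] ennreal_mult) auto
    finally show "ennreal ((a * s y + s' y - \<psi> (sig C N y))\<^sup>2) * indicator E y \<le>
       ennreal (2 * a\<^sup>2) * (ennreal ((s y - \<phi> (sig C n y))\<^sup>2) * indicator E y) +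
       ennreal 2 * (ennreal ((s' y - \<phi>' (sig C n' y))\<^sup>2) * indicator E y)"
      unfolding p_def[symmetric] q_def[symmetric] by (simp add: indicator_def)
  qed
  also have "\<dots> = ennreal (2 * a\<^sup>2) * (\<integral>\<^sup>+ y. ennreal ((s y - \<phi> (sig C n y))\<^sup>2) * indicator E y \<partial>M) +
       ennreal 2 * (\<integral>\<^sup>+ y. ennreal ((s' y - \<phi>' (sig C n' y))\<^sup>2) * indicator E y \<partial>M)"
    by (subst nn_integral_add, measurable, subst nn_integral_cmult, measurable, subst nn_integral_cmult, measurable)
  also have "\<dots> \<le> ennreal (2 * a\<^sup>2) * ennreal e1 + ennreal 2 * ennreal (e/4)"
    using n n' by (intro add_mono mult_left_mono) auto
  also have "\<dots> = ennreal (2 * a\<^sup>2 * e1 + 2 * (e/4))"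
  proof -
    have "ennreal (2 * a\<^sup>2 * e1 + 2 * (e/4)) = ennreal (2 * a\<^sup>2 * e1) + ennreal (2 * (e/4))"
      by (rule ennreal_plus) (use e e1 in auto)
    also have "\<dots> = ennreal (2 * a\<^sup>2) * ennreal e1 + ennreal 2 * ennreal (e/4)"
      using e e1 by (intro arg_cong2[where f="(+)"] ennreal_mult) auto
    finally show ?thesis by simp
  qed
  also have "\<dots> \<le> ennreal e"
  proof (rule ennreal_leI)
    have "2 * a\<^sup>2 * e1 \<le> 2 * (a\<^sup>2 + 1) * e1" using e1 by (intro mult_right_mono) auto
    also have "\<dots> = e/2" unfolding e1_def using add_nonneg_pos[of "a\<^sup>2" 1] by (simp add: field_simps)
    finally show "2 * a\<^sup>2 * e1 + 2 * (e/4) \<le> e" by simp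
  qed
  finally show "\<exists>n \<phi>. (\<integral>\<^sup>+ y. ennreal ((a * s y + s' y - \<phi> (sig C n y))\<^sup>2) * indicator E y \<partial>M) \<le> ennreal e" by blast
qed

lemma approx_simple:
  assumes s: "simple_function M (s :: 'a \<Rightarrow> real)" shows "approx s"
proof -
  have fin: "finite (range s)" using simple_functionD(1)[OF s] by (simp add: space_M')
  have sm: "s -` {a} \<in> sets M" for a using simple_functionD(2)[OF s, of "{a}"] by (simp add: space_M')
  have "approx (\<lambda>y. \<Sum>a\<in>R. a * indicator (s -` {a}) y) \<and> (\<lambda>y. \<Sum>a\<in>R. a * indicator (s -` {a}) y) \<in> borel_measurable M" if "finite R" for R :: "real set"
    using that
  proof (induction R rule: finite_induct)
    case empty
    have "approx (indicator {})" by (rule approx_indicator) simp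
    moreover have "indicator {} = (\<lambda>y::'a. 0::real)" by (simp add: fun_eq_iff)
    ultimately show ?case by simp
  next
    case (insert a R)
    have [measurable]: "(indicator (s -` {a}) :: 'a \<Rightarrow> real) \<in> borel_measurable M" using sm by simp
    have "approx (\<lambda>y. a * indicator (s -` {a}) y + (\<Sum>a\<in>R. a * indicator (s -` {a}) y))"
    proof (rule approx_add_cmult)
      show "approx (indicator (s -` {a}))" by (rule approx_indicator[OF sm])
      show "approx (\<lambda>y. \<Sum>a\<in>R. a * indicator (s -` {a}) y)" "(\<lambda>y. \<Sum>a\<in>R. a * indicator (s -` {a}) y) \<in> borel_measurable M"
        using insert.IH by blast+
    qed measurable
    moreover have "(\<lambda>y. a * indicator (s -` {a}) y + (\<Sum>a\<in>R. a * indicator (s -` {a}) y)) \<in> borel_measurable M"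
      by (rule borel_measurable_add[OF _ conjunct2[OF insert.IH]]) measurable
    ultimately show ?case by (simp only: sum.insert[OF insert.hyps])
  qed
  note * = this[OF fin]
  have "(\<Sum>a\<in>range s. a * indicator (s -` {a}) y) = s y" for y
  proof -
    have "(\<Sum>a\<in>range s. a * indicator (s -` {a}) y) = (\<Sum>a\<in>range s. if s y = a then a else 0)"
      by (intro sum.cong) (auto simp: indicator_def)
    then show ?thesis using fin by simp
  qed
  then show ?thesis using * by simp
qed

text \<open>The squared norm on \<open>E\<close> of the conditional expectation of \<open>g\<close>
  given the \<open>n\<close>-th partition; null cells contribute 0.\<close>

definition Sn :: "nat \<Rightarrow> ('a \<Rightarrow> ennreal) \<Rightarrow> ennreal" where
  "Sn n g = (\<Sum>\<sigma>\<in>Pow {..<n}. (\<integral>\<^sup>+ y. g y * indicator ({y. sig C n y = \<sigma>} \<inter> E) y \<partial>M)\<^sup>2 / emeasure M ({y. sig C n y = \<sigma>} \<inter> E))"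

lemma Sn_mono: "(\<And>y. g y \<le> h y) \<Longrightarrow> Sn n g \<le> Sn n h"
  unfolding Sn_def by (intro sum_mono divide_right_mono_ennreal power_mono nn_integral_mono mult_right_mono) auto

text \<open>Pythagoras for conditional expectations: the square mean of \<open>s\<close> exceeds
  that of its cell averages by the squared distance to them, and no step function over the partition
  is closer to \<open>s\<close>. A step function for \<open>n0\<close> is also one for every finer
  \<open>n\<close>.\<close>

lemma Sn_lower:
  assumes s: "s \<in> borel_measurable M" "\<And>y. 0 \<le> s y" "\<And>y. s y \<le> b"
    and e: "(\<integral>\<^sup>+ y. ennreal ((s y - \<phi> (sig C n0 y))\<^sup>2) * indicator E y \<partial>M) \<le> ennreal e" "0 \<le> e" and n: "n0 \<le> n"
  shows "(\<integral>\<^sup>+ y. ennreal ((s y)\<^sup>2) * indicator E y \<partial>M) \<le> Sn n (\<lambda>y. ennreal (s y)) + ennreal e"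
proof -
  note [measurable] = s(1)
  define A where "A \<sigma> = {y. sig C n y = \<sigma>} \<inter> E" for \<sigma>
  define c where "c \<sigma> = \<phi> (\<sigma> \<inter> {..<n0})" for \<sigma>
  have A[measurable]: "A \<sigma> \<in> sets M" for \<sigma> unfolding A_def by measurable
  have Afin: "emeasure M (A \<sigma>) < \<infinity>" for \<sigma>
    using le_less_trans[OF emeasure_mono[of "A \<sigma>" E M] Efin] by (auto simp: A_def)
  have split: "(\<integral>\<^sup>+ y. h y * indicator E y \<partial>M) = (\<Sum>\<sigma>\<in>Pow {..<n}. \<integral>\<^sup>+ y. h y * indicator (A \<sigma>) y \<partial>M)"
    if [measurable]: "h \<in> borel_measurable M" for h :: "'a \<Rightarrow> ennreal"
  proof -
    have "indicator E y = (\<Sum>\<sigma>\<in>Pow {..<n}. indicator (A \<sigma>) y :: ennreal)" for y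
    proof -
      have "(\<Sum>\<sigma>\<in>Pow {..<n}. indicator (A \<sigma>) y :: ennreal) = (\<Sum>\<sigma>\<in>Pow {..<n}. if sig C n y = \<sigma> then indicator E y else 0)"
        by (intro sum.cong) (auto simp: A_def indicator_def)
      also have "\<dots> = indicator E y" by (subst sum.delta') (auto simp: sig_def)
      finally show ?thesis by simp
    qed
    then have "(\<integral>\<^sup>+ y. h y * indicator E y \<partial>M) = (\<integral>\<^sup>+ y. (\<Sum>\<sigma>\<in>Pow {..<n}. h y * indicator (A \<sigma>) y) \<partial>M)"
      by (simp only: sum_distrib_left)
    also have "\<dots> = (\<Sum>\<sigma>\<in>Pow {..<n}. \<integral>\<^sup>+ y. h y * indicator (A \<sigma>) y \<partial>M)"
      by (rule nn_integral_sum) measurable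
    finally show ?thesis .
  qed
  have atom: "(\<integral>\<^sup>+ y. ennreal ((s y)\<^sup>2) * indicator (A \<sigma>) y \<partial>M) \<le>
      (\<integral>\<^sup>+ y. ennreal (s y) * indicator (A \<sigma>) y \<partial>M)\<^sup>2 / emeasure M (A \<sigma>) +
      (\<integral>\<^sup>+ y. ennreal ((s y - \<phi> (sig C n0 y))\<^sup>2) * indicator (A \<sigma>) y \<partial>M)" for \<sigma>
  proof -
    define m where "m = measure M (A \<sigma>)"
    have em: "emeasure M (A \<sigma>) = ennreal m" unfolding m_def using Afin by (simp add: emeasure_eq_ennreal_measure less_top[symmetric])
    have m0: "0 \<le> m" by (simp add: m_def)
    have i1: "integrable M (indicator (A \<sigma>) :: 'a \<Rightarrow> real)" using Afin by simp
    have ib: "integrable M (\<lambda>y. h y * indicator (A \<sigma>) y)" if [measurable]: "h \<in> borel_measurable M" and "\<And>y. \<bar>h y\<bar> \<le> K" for h :: "'a \<Rightarrow> real" and K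
      by (rule Bochner_Integration.integrable_bound[OF integrable_mult_right[OF i1, of K]])
        (use that(2) in \<open>auto simp: indicator_def intro: order_trans[OF _ abs_ge_self]\<close>)
    have sb: "\<bar>s y\<bar> \<le> b" "\<bar>(s y)\<^sup>2\<bar> \<le> b\<^sup>2" for y using s(2,3)[of y] by (auto intro: power_mono)
    have ints: "integrable M (\<lambda>y. s y * indicator (A \<sigma>) y)" by (rule ib[OF s(1) sb(1)])
    have ints2: "integrable M (\<lambda>y. (s y)\<^sup>2 * indicator (A \<sigma>) y)" by (rule ib[OF _ sb(2)]) measurable
    define a where "a = (\<integral>y. s y * indicator (A \<sigma>) y \<partial>M)"
    define q where "q = (\<integral>y. (s y)\<^sup>2 * indicator (A \<sigma>) y \<partial>M)"
    define d where "d = c \<sigma>"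
    have a: "(\<integral>\<^sup>+ y. ennreal (s y) * indicator (A \<sigma>) y \<partial>M) = ennreal a" "0 \<le> a"
    proof -
      have "(\<integral>\<^sup>+ y. ennreal (s y) * indicator (A \<sigma>) y \<partial>M) = (\<integral>\<^sup>+ y. ennreal (s y * indicator (A \<sigma>) y) \<partial>M)"
        by (intro nn_integral_cong) (auto simp: indicator_def)
      then show "(\<integral>\<^sup>+ y. ennreal (s y) * indicator (A \<sigma>) y \<partial>M) = ennreal a"
        unfolding a_def using nn_integral_eq_integral[OF ints] s(2) by simp
      show "0 \<le> a" unfolding a_def using s(2) by (intro integral_nonneg_AE) auto
    qed
    have q: "(\<integral>\<^sup>+ y. ennreal ((s y)\<^sup>2) * indicator (A \<sigma>) y \<partial>M) = ennreal q"
    proof -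
      have "(\<integral>\<^sup>+ y. ennreal ((s y)\<^sup>2) * indicator (A \<sigma>) y \<partial>M) = (\<integral>\<^sup>+ y. ennreal ((s y)\<^sup>2 * indicator (A \<sigma>) y) \<partial>M)"
        by (intro nn_integral_cong) (auto simp: indicator_def)
      then show ?thesis unfolding q_def using nn_integral_eq_integral[OF ints2] by simp
    qed
    have ph: "\<phi> (sig C n0 y) = d" if "y \<in> A \<sigma>" for y
      using that sig_restrict[OF n, of C y] by (auto simp: A_def d_def c_def)
    have expd: "(s y - d)\<^sup>2 * indicator (A \<sigma>) y = (s y)\<^sup>2 * indicator (A \<sigma>) y - 2 * d * (s y * indicator (A \<sigma>) y) + d\<^sup>2 * indicator (A \<sigma>) y" for y
      by (simp add: power2_diff algebra_simps)
    have r: "(\<integral>\<^sup>+ y. ennreal ((s y - \<phi> (sig C n0 y))\<^sup>2) * indicator (A \<sigma>) y \<partial>M) = ennreal (q - 2 * d * a + d\<^sup>2 * m)"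
    proof -
      have "(\<integral>\<^sup>+ y. ennreal ((s y - \<phi> (sig C n0 y))\<^sup>2) * indicator (A \<sigma>) y \<partial>M) = (\<integral>\<^sup>+ y. ennreal ((s y - d)\<^sup>2 * indicator (A \<sigma>) y) \<partial>M)"
        by (intro nn_integral_cong) (auto simp: indicator_def ph)
      also have "\<dots> = ennreal (\<integral>y. (s y - d)\<^sup>2 * indicator (A \<sigma>) y \<partial>M)"
      proof (rule nn_integral_eq_integral)
        show "integrable M (\<lambda>y. (s y - d)\<^sup>2 * indicator (A \<sigma>) y)"
          unfolding expd using ints ints2 i1 by (simp del: integrable_indicator_iff)
      qed simp
      also have "(\<integral>y. (s y - d)\<^sup>2 * indicator (A \<sigma>) y \<partial>M) = q - 2 * d * a + d\<^sup>2 * m"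
        unfolding expd using ints ints2 i1 by (simp add: q_def a_def m_def sets.Int_space_eq2 del: integrable_indicator_iff)
      finally show ?thesis .
    qed
    have nn: "0 \<le> q - 2 * d * a + d\<^sup>2 * m"
    proof -
      have "0 \<le> (\<integral>y. (s y - d)\<^sup>2 * indicator (A \<sigma>) y \<partial>M)" by (intro integral_nonneg_AE) auto
      then show ?thesis
        unfolding expd using ints ints2 i1 by (simp add: q_def a_def m_def sets.Int_space_eq2 del: integrable_indicator_iff)
    qed
    show ?thesis
    proof (cases "m = 0")
      case True
      then have "AE y in M. y \<notin> A \<sigma>" using em by (intro AE_not_in) (auto simp: null_sets_def)
      then have "(\<integral>\<^sup>+ y. ennreal ((s y)\<^sup>2) * indicator (A \<sigma>) y \<partial>M) = (\<integral>\<^sup>+ y. 0 \<partial>M)"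
        by (intro nn_integral_cong_AE) (auto elim!: eventually_mono)
      then show ?thesis by simp
    next
      case False
      then have m: "0 < m" using m0 by simp
      \<comment> \<open>On a cell the average \<open>a / m\<close> is the best constant; the square
        measures how far the constant \<open>d\<close> is from it.\<close>
      have "0 \<le> (a - d * m)\<^sup>2 / m" using m by simp
      also have "\<dots> = a\<^sup>2 / m - 2 * d * a + d\<^sup>2 * m" using m by (simp add: power2_eq_square field_simps)
      finally have "q \<le> a\<^sup>2 / m + (q - 2 * d * a + d\<^sup>2 * m)" by simp
      then have "ennreal q \<le> ennreal (a\<^sup>2 / m) + ennreal (q - 2 * d * a + d\<^sup>2 * m)"
        using nn m by (simp flip: ennreal_plus add: ennreal_leI)
      moreover have "ennreal a ^ 2 / ennreal m = ennreal (a\<^sup>2 / m)"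
        using a(2) m by (simp add: ennreal_power divide_ennreal)
      ultimately show ?thesis unfolding q r a(1) em by simp
    qed
  qed
  have [measurable]: "(\<lambda>y. \<phi> (sig C n0 y)) \<in> borel_measurable M" by (rule sig_fun_measurable) simp
  have "(\<integral>\<^sup>+ y. ennreal ((s y)\<^sup>2) * indicator E y \<partial>M) \<le> (\<Sum>\<sigma>\<in>Pow {..<n}.
      (\<integral>\<^sup>+ y. ennreal (s y) * indicator (A \<sigma>) y \<partial>M)\<^sup>2 / emeasure M (A \<sigma>) +
      (\<integral>\<^sup>+ y. ennreal ((s y - \<phi> (sig C n0 y))\<^sup>2) * indicator (A \<sigma>) y \<partial>M))"
    by (subst split, measurable) (intro sum_mono atom)
  also have "\<dots> = Sn n (\<lambda>y. ennreal (s y)) + (\<integral>\<^sup>+ y. ennreal ((s y - \<phi> (sig C n0 y))\<^sup>2) * indicator E y \<partial>M)"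
    unfolding sum.distrib Sn_def A_def[symmetric] by (subst split, measurable)
  also have "\<dots> \<le> Sn n (\<lambda>y. ennreal (s y)) + ennreal e" using e by (intro add_left_mono)
  finally show ?thesis .
qed

text \<open>\<open>g\<close> may be unbounded or infinite, so \<open>Sn_lower\<close> is applied to
  simple functions below \<open>g\<close>, and \<open>Sn\<close> is monotone. A lower limit is all
  that Fatou's lemma needs, and convergence of \<open>Sn n g\<close> is not an issue.\<close>

lemma Sn_liminf:
  assumes g: "g \<in> borel_measurable M"
  shows "(\<integral>\<^sup>+ y. (g y)\<^sup>2 * indicator E y \<partial>M) \<le> liminf (\<lambda>n. Sn n g)"
proof -
  obtain f where f: "\<And>i. simple_function M (f i)" "incseq f" "\<And>i x. f i x < top" "\<And>x. (SUP i. f i x) = g x"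
    using borel_measurable_implies_simple_function_sequence'[OF g] by metis
  have fm[measurable]: "f i \<in> borel_measurable M" for i using f(1) by (rule borel_measurable_simple_function)
  have one: "(\<integral>\<^sup>+ y. (f i y)\<^sup>2 * indicator E y \<partial>M) \<le> liminf (\<lambda>n. Sn n g)" for i
  proof (rule ennreal_le_epsilon)
    fix e :: real assume e: "0 < e"
    define s where "s y = enn2real (f i y)" for y
    have ss: "simple_function M s" unfolding s_def[abs_def] by (rule simple_function_compose1[OF f(1)])
    have sf: "ennreal (s y) = f i y" for y using f(3)[of i y] by (simp add: s_def)
    have fin: "finite (range s)" using simple_functionD(1)[OF ss] by (simp add: space_M')
    obtain n0 \<phi> where n0: "(\<integral>\<^sup>+ y. ennreal ((s y - \<phi> (sig C n0 y))\<^sup>2) * indicator E y \<partial>M) \<le> ennreal e"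
      using approx_simple[OF ss] e unfolding approx_def by blast
    have "(\<integral>\<^sup>+ y. (f i y)\<^sup>2 * indicator E y \<partial>M) \<le> Sn n g + ennreal e" if "n0 \<le> n" for n
    proof -
      have "(\<integral>\<^sup>+ y. ennreal ((s y)\<^sup>2) * indicator E y \<partial>M) \<le> Sn n (\<lambda>y. ennreal (s y)) + ennreal e"
      proof (rule Sn_lower[OF _ _ _ n0 _ that])
        show "s \<in> borel_measurable M" unfolding s_def by measurable
        show "s y \<le> Max (range s)" for y using fin by (intro Max_ge) auto
      qed (use e in \<open>auto simp: s_def\<close>)
      moreover have "ennreal ((s y)\<^sup>2) = (f i y)\<^sup>2" for y
        using sf[of y] by (simp add: s_def ennreal_power[symmetric])
      moreover have "Sn n (\<lambda>y. ennreal (s y)) \<le> Sn n g"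
        unfolding sf by (rule Sn_mono) (metis SUP_upper UNIV_I f(4))
      ultimately show ?thesis by (simp only:) (blast intro: order_trans add_right_mono)
    qed
    then have ev: "\<forall>\<^sub>F n in sequentially. (\<integral>\<^sup>+ y. (f i y)\<^sup>2 * indicator E y \<partial>M) - ennreal e \<le> Sn n g"
      unfolding eventually_sequentially by (auto simp: ennreal_minus_le_iff add.commute)
    have "(\<integral>\<^sup>+ y. (f i y)\<^sup>2 * indicator E y \<partial>M) - ennreal e \<le> liminf (\<lambda>n. Sn n g)"
      by (rule Liminf_bounded[OF ev])
    then show "(\<integral>\<^sup>+ y. (f i y)\<^sup>2 * indicator E y \<partial>M) \<le> liminf (\<lambda>n. Sn n g) + ennreal e"
      by (simp add: ennreal_minus_le_iff add.commute)
  qed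
  have sq: "(g y)\<^sup>2 = (SUP i. (f i y)\<^sup>2)" for y
  proof -
    have inc: "incseq (\<lambda>i. f i y)" using f(2) by (auto simp: incseq_def le_fun_def)
    have "(\<lambda>i. f i y) \<longlonglongrightarrow> g y" using LIMSEQ_SUP[OF inc] f(4) by simp
    then have a: "(\<lambda>i. (f i y)\<^sup>2) \<longlonglongrightarrow> (g y)\<^sup>2"
      unfolding power2_eq_square by (intro tendsto_mult_ennreal) auto
    have b: "(\<lambda>i. (f i y)\<^sup>2) \<longlonglongrightarrow> (SUP i. (f i y)\<^sup>2)"
      using inc by (intro LIMSEQ_SUP) (auto simp: incseq_def intro!: power_mono)
    show ?thesis by (rule LIMSEQ_unique[OF a b])
  qed
  have "(\<integral>\<^sup>+ y. (g y)\<^sup>2 * indicator E y \<partial>M) = (\<integral>\<^sup>+ y. (SUP i. (f i y)\<^sup>2 * indicator E y) \<partial>M)"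
    unfolding sq by (simp add: SUP_mult_right_ennreal)
  also have "\<dots> = (SUP i. \<integral>\<^sup>+ y. (f i y)\<^sup>2 * indicator E y \<partial>M)"
    using f(2) by (intro nn_integral_monotone_convergence_SUP) (auto simp: incseq_def le_fun_def intro!: mult_right_mono power_mono)
  also have "\<dots> \<le> liminf (\<lambda>n. Sn n g)" by (intro SUP_least one)
  finally show ?thesis .
qed

text \<open>Each row of the kernel is recovered from its cell averages in the lower limit; Fatou's
  lemma exchanges this limit with the integral in \<open>x\<close>, where
  \<open>HS_partition_le\<close> bounds every stage by \<open>B\<close>.\<close>

lemma HS_lower_on:
  assumes k: "L2bd k c" and ub: "\<And>F. finite F \<Longrightarrow> orthonormal_L2 M F \<Longrightarrow> ennreal (\<Sum>f\<in>F. L2_sqnorm M (kop k f)) \<le> B"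
  shows "(\<integral>\<^sup>+ x. \<integral>\<^sup>+ y. (k x y)\<^sup>2 * indicator E y \<partial>M \<partial>M) \<le> B"
proof -
  have km: "k x \<in> borel_measurable M" for x
    using kernel_slice[OF L2bd_measurable[OF k], of x] by (simp add: space_M')
  have Sm: "(\<lambda>x. Sn n (k x)) \<in> borel_measurable M" for n
  proof -
    have "(\<lambda>x. \<integral>\<^sup>+ y. k x y * indicator ({y. sig C n y = \<sigma>} \<inter> E) y \<partial>M) \<in> borel_measurable M" for \<sigma>
    proof -
      have "(indicator ({y. sig C n y = \<sigma>} \<inter> E) :: 'a \<Rightarrow> ennreal) \<in> borel_measurable M" by measurable
      then show ?thesis using app_measurable[OF L2bd_measurable[OF k]] unfolding app_def by blast
    qed
    then show ?thesis unfolding Sn_def power2_eq_square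
      by (intro borel_measurable_sum borel_measurable_divide_ennreal borel_measurable_times measurable_const) auto
  qed
  have "(\<integral>\<^sup>+ x. \<integral>\<^sup>+ y. (k x y)\<^sup>2 * indicator E y \<partial>M \<partial>M) \<le> (\<integral>\<^sup>+ x. liminf (\<lambda>n. Sn n (k x)) \<partial>M)"
    by (intro nn_integral_mono Sn_liminf km)
  also have "\<dots> \<le> liminf (\<lambda>n. \<integral>\<^sup>+ x. Sn n (k x) \<partial>M)" by (rule nn_integral_liminf[OF Sm])
  also have "\<dots> \<le> limsup (\<lambda>n. \<integral>\<^sup>+ x. Sn n (k x) \<partial>M)" by (rule Liminf_le_Limsup) simp
  also have "\<dots> \<le> B"
  proof (rule Limsup_bounded, intro always_eventually allI)
    fix n
    show "(\<integral>\<^sup>+ x. Sn n (k x) \<partial>M) \<le> B"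
      unfolding Sn_def
    proof (rule HS_partition_le[OF k _ _ _ _ ub])
      show "emeasure M ({y. sig C n y = \<sigma>} \<inter> E) < \<infinity>" for \<sigma>
        using le_less_trans[OF emeasure_mono[of "{y. sig C n y = \<sigma>} \<inter> E" E M] Efin] by auto
    qed (auto simp: disjoint_family_on_def)
  qed
  finally show ?thesis .
qed

end

theorem HS_eq:
  assumes k: "L2bd k c"
  shows "(SUP F\<in>{F. finite F \<and> orthonormal_L2 M F}. ennreal (\<Sum>f\<in>F. L2_sqnorm M (kop k f))) =
    (\<integral>\<^sup>+ x. \<integral>\<^sup>+ y. (k x y)\<^sup>2 \<partial>M \<partial>M)"
proof (rule antisym)
  show "(SUP F\<in>{F. finite F \<and> orthonormal_L2 M F}. ennreal (\<Sum>f\<in>F. L2_sqnorm M (kop k f))) \<le> (\<integral>\<^sup>+ x. \<integral>\<^sup>+ y. (k x y)\<^sup>2 \<partial>M \<partial>M)"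
    by (intro SUP_least HS_upper[OF k]) auto
  define B where "B = (SUP F\<in>{F. finite F \<and> orthonormal_L2 M F}. ennreal (\<Sum>f\<in>F. L2_sqnorm M (kop k f)))"
  obtain E :: "nat \<Rightarrow> 'a set" where E: "range E \<subseteq> sets M" "(\<Union>i. E i) = space M" "\<And>i. emeasure M (E i) \<noteq> \<infinity>" "incseq E"
    using sigma_finite_incseq by blast
  have Ei[measurable]: "E i \<in> sets M" for i using E(1) by auto
  have km: "k x \<in> borel_measurable M" for x
    using kernel_slice[OF L2bd_measurable[OF k], of x] by (simp add: space_M')
  have km2: "(\<lambda>w. k (fst w) (snd w)) \<in> borel_measurable (M \<Otimes>\<^sub>M M)"
    using L2bd_measurable[OF k] by (simp add: case_prod_beta')
  have le: "(\<integral>\<^sup>+ x. \<integral>\<^sup>+ y. (k x y)\<^sup>2 * indicator (E i) y \<partial>M \<partial>M) \<le> B" for i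
  proof (rule HS_lower_on[OF Ei _ k])
    show "emeasure M (E i) < \<infinity>" using E(3)[of i] by (simp add: less_top)
    show "ennreal (\<Sum>f\<in>F. L2_sqnorm M (kop k f)) \<le> B" if "finite F" "orthonormal_L2 M F" for F
      unfolding B_def using that by (intro SUP_upper) auto
  qed
  have ind: "incseq (\<lambda>i. indicator (E i) y :: ennreal)" for y
    using E(4) by (auto simp: incseq_def indicator_def)
  have "(SUP i. indicator (E i) y :: ennreal) = 1" for y
  proof -
    obtain i where "y \<in> E i" using E(2) space_M' by auto
    then have "1 \<le> (SUP i. indicator (E i) y :: ennreal)" by (intro SUP_upper2[of i]) auto
    moreover have "(SUP i. indicator (E i) y :: ennreal) \<le> 1" by (intro SUP_least) (auto simp: indicator_def)
    ultimately show ?thesis by (rule antisym[rotated])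
  qed
  then have "(k x y)\<^sup>2 = (SUP i. (k x y)\<^sup>2 * indicator (E i) y)" for x y
    by (simp add: SUP_mult_left_ennreal[symmetric])
  then have "(\<integral>\<^sup>+ x. \<integral>\<^sup>+ y. (k x y)\<^sup>2 \<partial>M \<partial>M) = (\<integral>\<^sup>+ x. \<integral>\<^sup>+ y. (SUP i. (k x y)\<^sup>2 * indicator (E i) y) \<partial>M \<partial>M)" by simp
  also have "\<dots> = (\<integral>\<^sup>+ x. (SUP i. \<integral>\<^sup>+ y. (k x y)\<^sup>2 * indicator (E i) y \<partial>M) \<partial>M)"
    using ind km by (intro nn_integral_cong nn_integral_monotone_convergence_SUP)
      (auto simp: incseq_def le_fun_def intro!: mult_left_mono)
  also have "\<dots> = (SUP i. \<integral>\<^sup>+ x. \<integral>\<^sup>+ y. (k x y)\<^sup>2 * indicator (E i) y \<partial>M \<partial>M)"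
  proof (rule nn_integral_monotone_convergence_SUP)
    show "incseq (\<lambda>i x. \<integral>\<^sup>+ y. (k x y)\<^sup>2 * indicator (E i) y \<partial>M)"
      using ind by (auto simp: incseq_def le_fun_def intro!: nn_integral_mono mult_left_mono)
    show "(\<lambda>x. \<integral>\<^sup>+ y. (k x y)\<^sup>2 * indicator (E i) y \<partial>M) \<in> borel_measurable M" for i
      using km2 by (intro borel_measurable_nn_integral) (simp add: case_prod_beta')
  qed
  also have "\<dots> \<le> B" by (intro SUP_least le)
  finally show "(\<integral>\<^sup>+ x. \<integral>\<^sup>+ y. (k x y)\<^sup>2 \<partial>M \<partial>M) \<le> (SUP F\<in>{F. finite F \<and> orthonormal_L2 M F}. ennreal (\<Sum>f\<in>F. L2_sqnorm M (kop k f)))"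
    unfolding B_def .
qed

end

section \<open>The trace formula\<close>

text \<open>One-sided limits make \<open>w\<close> bounded along the path near each time, and
  Bolzano's principle turns this into a bound on the whole interval. So on a fixed path all
  sufficiently high truncations of \<open>w\<close> are inactive.\<close>

lemma cadlag_bounded:
  fixes w :: "'a::topological_space \<Rightarrow> real"
  assumes \<gamma>: "\<gamma> \<in> cadlag_paths t" and w: "continuous_on UNIV w" and t: "0 < t"
  shows "\<exists>B. \<forall>s\<in>{0..t}. \<bar>w (\<gamma> s)\<bar> \<le> B"
proof -
  define Q where "Q a b \<longleftrightarrow> (\<exists>B. \<forall>s\<in>{a..b} \<inter> {0..t}. \<bar>w (\<gamma> s)\<bar> \<le> B)" for a b
  have lim: "((\<lambda>s. w (\<gamma> s)) \<longlongrightarrow> w l) F" if "(\<gamma> \<longlongrightarrow> l) F" for l F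
    by (rule continuous_on_tendsto_compose[OF w that]) auto
  have bd: "\<forall>\<^sub>F s in F. \<bar>w (\<gamma> s)\<bar> \<le> \<bar>w l\<bar> + 1" if "(\<gamma> \<longlongrightarrow> l) F" for l F
  proof -
    have "\<forall>\<^sub>F s in F. \<bar>w (\<gamma> s)\<bar> < \<bar>w l\<bar> + 1"
      by (rule order_tendstoD(2)[OF tendsto_rabs[OF lim[OF that]]]) simp
    then show ?thesis by (auto elim: eventually_mono)
  qed
  have "Q 0 t"
  proof (rule Bolzano)
    show "0 \<le> t" using t by simp
    fix a b c assume "Q a b" "Q b c" "a \<le> b" "b \<le> c"
    then obtain B B' where B: "\<forall>s\<in>{a..b} \<inter> {0..t}. \<bar>w (\<gamma> s)\<bar> \<le> B" "\<forall>s\<in>{b..c} \<inter> {0..t}. \<bar>w (\<gamma> s)\<bar> \<le> B'"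
      unfolding Q_def by blast
    have "\<bar>w (\<gamma> s)\<bar> \<le> max B B'" if "s \<in> {a..c} \<inter> {0..t}" for s
    proof (cases "s \<le> b")
      case True
      then have "\<bar>w (\<gamma> s)\<bar> \<le> B" using B(1) that by auto
      then show ?thesis by simp
    next
      case False
      then have "\<bar>w (\<gamma> s)\<bar> \<le> B'" using B(2) that by auto
      then show ?thesis by simp
    qed
    then show "Q a c" unfolding Q_def by blast
  next
    fix x assume x: "0 \<le> x" "x \<le> t"
    obtain r R where r: "x < r" "\<And>s. x < s \<Longrightarrow> s < r \<Longrightarrow> s \<le> t \<Longrightarrow> \<bar>w (\<gamma> s)\<bar> \<le> R"
    proof (cases "x < t")
      case True
      then have "(\<gamma> \<longlongrightarrow> \<gamma> x) (at_right x)" using \<gamma> x by (auto simp: cadlag_paths_def)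
      from bd[OF this] show ?thesis unfolding eventually_at_right_field using that by blast
    next
      case False
      \<comment> \<open>To the right of \<open>x = t\<close> no times have to be controlled, so any
        neighbourhood and any bound will do.\<close>
      then show ?thesis using that[of "x + 1" 0] by simp
    qed
    obtain l L where l: "l < x" "\<And>s. l < s \<Longrightarrow> s < x \<Longrightarrow> 0 \<le> s \<Longrightarrow> \<bar>w (\<gamma> s)\<bar> \<le> L"
    proof (cases "0 < x")
      case True
      then have "x \<in> {0<..t}" using x by simp
      then obtain y where "(\<gamma> \<longlongrightarrow> y) (at_left x)" using \<gamma> unfolding cadlag_paths_def by blast
      from bd[OF this] show ?thesis unfolding eventually_at_left_field using that by blast
    next
      case False
      then show ?thesis using that[of "x - 1" 0] by simp
    qed
    define d where "d = min (r - x) (x - l)"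
    show "\<exists>d>0. \<forall>a b. a \<le> x \<and> x \<le> b \<and> b - a < d \<longrightarrow> Q a b"
    proof (intro exI[of _ d] conjI allI impI)
      show "0 < d" using r l by (simp add: d_def)
      fix a b assume ab: "a \<le> x \<and> x \<le> b \<and> b - a < d"
      have "\<bar>w (\<gamma> s)\<bar> \<le> max \<bar>w (\<gamma> x)\<bar> (max R L)" if s: "s \<in> {a..b} \<inter> {0..t}" for s
      proof -
        consider "s = x" | "x < s" | "s < x" by linarith
        then show ?thesis
        proof cases
          case 2
          then have "\<bar>w (\<gamma> s)\<bar> \<le> R" using s ab by (intro r(2)) (auto simp: d_def)
          then show ?thesis by simp
        next
          case 3
          then have "\<bar>w (\<gamma> s)\<bar> \<le> L" using s ab by (intro l(2)) (auto simp: d_def)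
          then show ?thesis by simp
        qed simp
      qed
      then show "Q a b" unfolding Q_def by blast
    qed
  qed
  then show ?thesis unfolding Q_def by simp
qed

section \<open>The diagonal of the limit kernel\<close>

locale schroedinger_bridge = schroedinger M P w C0 T + bridge M P t x W Pin
  for M :: "'a::{metric_space, second_countable_topology} measure" and P w C0 T t x W Pin +
  assumes w_cont: "continuous_on UNIV w"
begin

lemma wt_cont: "continuous_on UNIV (wt m n)"
  unfolding wt_def[abs_def] by (intro continuous_intros w_cont)

lemmas wt_FK = Feynman_Kac_bounded[OF wt_cont wt_le wt_ge]

definition ex :: "nat \<Rightarrow> nat \<Rightarrow> (real \<Rightarrow> 'a) \<Rightarrow> ennreal" where
  "ex m n \<gamma> = ennreal (exp (- integral {0..t} (\<lambda>s. wt m n (\<gamma> s))))"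

definition exm :: "nat \<Rightarrow> (real \<Rightarrow> 'a) \<Rightarrow> ennreal" where
  "exm m \<gamma> = ennreal (exp (- integral {0..t} (\<lambda>s. max (w (\<gamma> s)) (- real m))))"

text \<open>\<open>w\<close> is bounded along the path, so from a path-dependent index on the
  cut-off changes nothing and both sequences are eventually constant.\<close>

lemma exm_lim:
  assumes \<gamma>: "\<gamma> \<in> \<Omega>"
  shows "(\<lambda>n. ex m n \<gamma>) \<longlonglongrightarrow> exm m \<gamma>"
    and "(\<lambda>m. exm m \<gamma>) \<longlonglongrightarrow> ennreal (exp (- integral {0..t} (\<lambda>s. w (\<gamma> s))))"
proof -
  obtain B where B: "\<And>s. s \<in> {0..t} \<Longrightarrow> \<bar>w (\<gamma> s)\<bar> \<le> B" using cadlag_bounded[OF \<gamma> w_cont t] by blast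
  obtain N where N: "B \<le> real N" using real_arch_simple by blast
  have "ex m n \<gamma> = exm m \<gamma>" if "N \<le> n" for n
  proof -
    have "integral {0..t} (\<lambda>s. wt m n (\<gamma> s)) = integral {0..t} (\<lambda>s. max (w (\<gamma> s)) (- real m))"
    proof (rule integral_cong)
      fix s assume "s \<in> {0..t}"
      then have "\<bar>w (\<gamma> s)\<bar> \<le> real n" using B N that by (meson of_nat_le_iff order_trans)
      then show "wt m n (\<gamma> s) = max (w (\<gamma> s)) (- real m)" by (auto simp: wt_def)
    qed
    then show ?thesis by (simp add: ex_def exm_def)
  qed
  then show "(\<lambda>n. ex m n \<gamma>) \<longlonglongrightarrow> exm m \<gamma>"
    by (intro tendsto_eventually) (auto simp: eventually_sequentially)
  have "exm m \<gamma> = ennreal (exp (- integral {0..t} (\<lambda>s. w (\<gamma> s))))" if "N \<le> m" for m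
  proof -
    have "integral {0..t} (\<lambda>s. max (w (\<gamma> s)) (- real m)) = integral {0..t} (\<lambda>s. w (\<gamma> s))"
    proof (rule integral_cong)
      fix s assume "s \<in> {0..t}"
      then have "\<bar>w (\<gamma> s)\<bar> \<le> real m" using B N that by (meson of_nat_le_iff order_trans)
      then show "max (w (\<gamma> s)) (- real m) = w (\<gamma> s)" by auto
    qed
    then show ?thesis by (simp add: exm_def)
  qed
  then show "(\<lambda>m. exm m \<gamma>) \<longlonglongrightarrow> ennreal (exp (- integral {0..t} (\<lambda>s. w (\<gamma> s))))"
    by (intro tendsto_eventually) (auto simp: eventually_sequentially)
qed

lemma ex_measurable [measurable]: "ex m n \<in> borel_measurable Pin"
  unfolding ex_def[abs_def] by (rule wt_FK(3))

lemma exm_measurable [measurable]: "exm m \<in> borel_measurable Pin"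
  by (rule borel_measurable_LIMSEQ_order[OF exm_lim(1) ex_measurable]) (simp add: space_Pin)

lemma ex_le: "\<gamma> \<in> \<Omega> \<Longrightarrow> ex m n \<gamma> \<le> ennreal (exp (real m * t))"
proof -
  assume \<gamma>: "\<gamma> \<in> \<Omega>"
  have "integral {0..t} (\<lambda>s. - real m) \<le> integral {0..t} (\<lambda>s. wt m n (\<gamma> s))"
    by (rule integral_le) (use wt_FK(2)[OF \<gamma>] wt_ge in auto)
  then show ?thesis unfolding ex_def using t by (intro ennreal_leI) (simp add: mult.commute)
qed

text \<open>Integrability along paths has been shown for the two-sided truncations; the inequality
  is proven for these and inherited in the limit of \<open>n\<close>.\<close>

lemma exm_mono: "\<gamma> \<in> \<Omega> \<Longrightarrow> exm m \<gamma> \<le> exm (Suc m) \<gamma>"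
proof -
  assume \<gamma>: "\<gamma> \<in> \<Omega>"
  have "ex m n \<gamma> \<le> ex (Suc m) n \<gamma>" for n
  proof -
    have "integral {0..t} (\<lambda>s. wt (Suc m) n (\<gamma> s)) \<le> integral {0..t} (\<lambda>s. wt m n (\<gamma> s))"
      by (rule integral_le[OF wt_FK(2)[OF \<gamma>] wt_FK(2)[OF \<gamma>]]) (auto simp: wt_def)
    then show ?thesis unfolding ex_def by (intro ennreal_leI) simp
  qed
  then show ?thesis using LIMSEQ_le[OF exm_lim(1)[OF \<gamma>] exm_lim(1)[OF \<gamma>]] by blast
qed

lemma km_diagonal: "km m t x x = P t x x * (\<integral>\<^sup>+ \<gamma>. exm m \<gamma> \<partial>Pin)"
proof -
  have "(\<lambda>n. \<integral>\<^sup>+ \<gamma>. ex m n \<gamma> \<partial>Pin) \<longlonglongrightarrow> (\<integral>\<^sup>+ \<gamma>. exm m \<gamma> \<partial>Pin)"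
  proof (rule nn_integral_dominated_convergence[where w="\<lambda>_. ennreal (exp (real m * t))"])
    show "AE \<gamma> in Pin. ex m j \<gamma> \<le> ennreal (exp (real m * t))" for j
      using ex_le space_Pin by (intro AE_I2) simp
    show "AE \<gamma> in Pin. (\<lambda>i. ex m i \<gamma>) \<longlonglongrightarrow> exm m \<gamma>"
      using exm_lim(1) space_Pin by (intro AE_I2) simp
  qed (auto simp: Pin_1)
  then have "(\<lambda>n. P t x x * (\<integral>\<^sup>+ \<gamma>. ex m n \<gamma> \<partial>Pin)) \<longlonglongrightarrow> P t x x * (\<integral>\<^sup>+ \<gamma>. exm m \<gamma> \<partial>Pin)"
    by (rule ennreal_tendsto_cmult[rotated]) (use P_finite in simp)
  moreover have "P t x x * (\<integral>\<^sup>+ \<gamma>. ex m n \<gamma> \<partial>Pin) = Fmn m n t x x" for n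
    unfolding ex_def Fmn_def FK_def by (rule wt_FK(1))
  ultimately show ?thesis using LIMSEQ_unique[OF km_lim] by simp
qed

theorem kk_diagonal:
  "kk t x x = P t x x * (\<integral>\<^sup>+ \<gamma>. ennreal (exp (- integral {0..t} (\<lambda>s. w (\<gamma> s)))) \<partial>Pin)"
proof -
  have "(\<integral>\<^sup>+ \<gamma>. ennreal (exp (- integral {0..t} (\<lambda>s. w (\<gamma> s)))) \<partial>Pin) = (\<integral>\<^sup>+ \<gamma>. (SUP m. exm m \<gamma>) \<partial>Pin)"
  proof (rule nn_integral_cong)
    fix \<gamma> assume "\<gamma> \<in> space Pin"
    then have \<gamma>: "\<gamma> \<in> \<Omega>" by (simp add: space_Pin)
    have "incseq (\<lambda>m. exm m \<gamma>)" by (rule incseq_SucI) (rule exm_mono[OF \<gamma>])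
    from LIMSEQ_unique[OF exm_lim(2)[OF \<gamma>] LIMSEQ_SUP[OF this]]
    show "ennreal (exp (- integral {0..t} (\<lambda>s. w (\<gamma> s)))) = (SUP m. exm m \<gamma>)" .
  qed
  also have "\<dots> = (SUP m. \<integral>\<^sup>+ \<gamma>. exm m \<gamma> \<partial>Pin)"
    by (rule nn_integral_monotone_convergence_SUP_AE) (use exm_mono space_Pin in auto)
  finally show ?thesis unfolding kk_def km_diagonal by (simp add: SUP_mult_left_ennreal)
qed

end

lemma L2_sqnorm_eq_if_diff_zero:
  assumes f: "f \<in> L2 M" and g: "g \<in> L2 M" and z: "L2_sqnorm M (\<lambda>x. f x - g x) = 0"
  shows "L2_sqnorm M f = L2_sqnorm M g"
proof -
  note [measurable] = L2_measurable[OF f] L2_measurable[OF g]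
  have "integrable M (\<lambda>x. (cmod (f x - g x))\<^sup>2)" using L2_diff[OF f g] by (simp add: L2_def)
  then have "AE x in M. (cmod (f x - g x))\<^sup>2 = 0"
    using z unfolding L2_sqnorm_def by (subst integral_nonneg_eq_0_iff_AE[symmetric]) auto
  then have "AE x in M. (cmod (f x))\<^sup>2 = (cmod (g x))\<^sup>2" by eventually_elim simp
  then show ?thesis unfolding L2_sqnorm_def by (intro integral_cong_AE) auto
qed

section \<open>The trace\<close>

locale regular_schroedinger = schroedinger M P w C0 T + outer_regular M C
  for M :: "'a::second_countable_topology measure" and P w C0 T C
begin

text \<open>Symmetry and the semigroup law turn a diagonal coefficient at time \<open>t\<close> into
  a squared norm at time \<open>t/2\<close>. Such a norm does not see null sets, so
  \<open>T_eq_kop\<close> may replace \<open>T (t/2)\<close> by the kernel operator.\<close>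

theorem trace_eq_diagonal:
  assumes t: "0 < t" shows "pos_trace M (T t) = (\<integral>\<^sup>+ x. kk t x x \<partial>M)"
proof -
  have t2: "0 < t / 2" using t by simp
  obtain c where c: "L2bd (kk (t/2)) c" using kk_L2bd[OF t2] by blast
  have e: "Re (L2_inner M f (T t f)) = L2_sqnorm M (kop (kk (t/2)) f)" if f: "f \<in> L2 M" for f
  proof -
    have "ip M (T (t/2) f) (T (t/2) f) = ip M (T (t/2 + t/2) f) f"
      by (rule L2.sg_mult[OF T _ _ f f]) (use t in auto)
    also have "\<dots> = Re (L2_inner M f (T t f))" using L2_inner_cnj[of M "T t f" f] by (simp add: ip_def)
    finally have "Re (L2_inner M f (T t f)) = L2_sqnorm M (T (t/2) f)" by (simp add: ip_self)
    also have "\<dots> = L2_sqnorm M (kop (kk (t/2)) f)"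
      by (rule L2_sqnorm_eq_if_diff_zero[OF _ kop_L2(1)[OF c f] T_eq_kop[OF t2 f]])
        (use L2.sg_in[OF T, of "t/2" f] f t in simp)
    finally show ?thesis .
  qed
  have "pos_trace M (T t) = (SUP F\<in>{F. finite F \<and> orthonormal_L2 M F}. ennreal (\<Sum>f\<in>F. L2_sqnorm M (kop (kk (t/2)) f)))"
    unfolding pos_trace_def
    by (intro SUP_cong refl arg_cong[where f=ennreal] sum.cong) (auto simp: orthonormal_L2_def intro!: e)
  also have "\<dots> = (\<integral>\<^sup>+ x. \<integral>\<^sup>+ y. (kk (t/2) x y)\<^sup>2 \<partial>M \<partial>M)" by (rule HS_eq[OF c])
  also have "\<dots> = (\<integral>\<^sup>+ x. kk t x x \<partial>M)"
  proof (rule nn_integral_cong)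
    fix x
    have "(\<integral>\<^sup>+ y. (kk (t/2) x y)\<^sup>2 \<partial>M) = (\<integral>\<^sup>+ y. kk (t/2) x y * kk (t/2) y x \<partial>M)"
      unfolding power2_eq_square using kk_sym[of "t/2" x] by simp
    also have "\<dots> = kk t x x" using kk_CK[OF t2 t2, of x x] by simp
    finally show "(\<integral>\<^sup>+ y. (kk (t/2) x y)\<^sup>2 \<partial>M) = kk t x x" .
  qed
  finally show ?thesis .
qed

end

text \<open>Nothing is assumed about \<open>p\<close> at nonpositive times; the cut-off installs the
  convention of \<open>heat_kernel\<close>.\<close>

definition hk :: "(real \<Rightarrow> 'a \<Rightarrow> 'a \<Rightarrow> real) \<Rightarrow> real \<Rightarrow> 'a \<Rightarrow> 'a \<Rightarrow> ennreal" where
  "hk p s x y = (if 0 < s then ennreal (p s x y) else 0)"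

section \<open>Passage from the given data to the locales\<close>

context
  fixes M :: "'a::{metric_space, second_countable_topology} measure" and p
  assumes sets_M: "sets M = sets borel" and p: "pos_heat_kernel M p"
begin

lemma p_pos: "0 < s \<Longrightarrow> 0 < p s x y"
  using p[unfolded pos_heat_kernel_def, THEN conjunct2, THEN conjunct1] by simp

lemma hk_measurable: "(\<lambda>(s, x, y). hk p s x y) \<in> borel_measurable (borel \<Otimes>\<^sub>M M \<Otimes>\<^sub>M M)"
proof -
  let ?\<Omega> = "{0<..} \<times> UNIV :: (real \<times> 'a \<times> 'a) set"
  have o: "?\<Omega> \<inter> space borel \<in> sets borel" by (simp add: open_Times)
  have "(\<lambda>z. p (fst z) (fst (snd z)) (snd (snd z))) \<in> borel_measurable (restrict_space borel ?\<Omega>)"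
    using p unfolding pos_heat_kernel_def by blast
  then have "(\<lambda>z. ennreal (p (fst z) (fst (snd z)) (snd (snd z)))) \<in> borel_measurable (restrict_space borel ?\<Omega>)"
    by (rule measurable_compose[OF _ measurable_ennreal])
  then have "(\<lambda>z. ennreal (p (fst z) (fst (snd z)) (snd (snd z))) * indicator ?\<Omega> z) \<in> borel_measurable borel"
    unfolding borel_measurable_restrict_space_iff_ennreal[OF o] .
  also have "(\<lambda>z. ennreal (p (fst z) (fst (snd z)) (snd (snd z))) * indicator ?\<Omega> z) = (\<lambda>(s, x, y). hk p s x y)"
    by (auto simp: fun_eq_iff hk_def indicator_def)
  also have "borel_measurable (borel :: (real \<times> 'a \<times> 'a) measure) = borel_measurable (borel \<Otimes>\<^sub>M M \<Otimes>\<^sub>M M)"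
    by (rule measurable_cong_sets) (simp_all add: borel_prod[symmetric] sets_M cong: sets_pair_measure_cong)
  finally show ?thesis .
qed

lemma hk_heat_kernel: "heat_kernel M (hk p)"
proof -
  have sp: "space M = UNIV" using sets_eq_imp_space_eq[OF sets_M] by simp
  have ck: "ennreal (p (s + r) x y) = (\<integral>\<^sup>+ z. ennreal (p s x z * p r z y) \<partial>M)" if "0 < s" "0 < r" for s r x y
    using p that unfolding pos_heat_kernel_def by blast
  have sym: "p s x y = p s y x" if "0 < s" for s x y using p that unfolding pos_heat_kernel_def by blast
  have sub: "(\<integral>\<^sup>+ z. ennreal (p s x z) \<partial>M) \<le> 1" if "0 < s" for s x using p that unfolding pos_heat_kernel_def by blast
  fix x0 :: 'a
  have [measurable]: "(\<lambda>z. ennreal (p 1 x0 z)) \<in> borel_measurable M"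
  proof -
    have "(\<lambda>z. (1::real, x0, z)) \<in> measurable M (borel \<Otimes>\<^sub>M M \<Otimes>\<^sub>M M)"
      by (intro measurable_Pair measurable_const measurable_ident_sets) (auto simp: sp)
    from measurable_compose[OF this hk_measurable] show ?thesis by (simp add: hk_def)
  qed
  show ?thesis
  proof
    \<comment> \<open>Sigma-finiteness comes from the kernel itself: \<open>p 1 x0\<close> is
      positive with integral at most 1, so these superlevel sets cover the space and have measure at
      most \<open>n + 1\<close>.\<close>
    define A where "A n = {z \<in> space M. 1 \<le> of_nat (Suc n) * ennreal (p 1 x0 z)}" for n
    show "\<exists>A. countable A \<and> A \<subseteq> sets M \<and> \<Union> A = space M \<and> (\<forall>a\<in>A. emeasure M a \<noteq> \<infinity>)"
    proof (intro exI[of _ "range A"] conjI)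
      show "range A \<subseteq> sets M" unfolding A_def by auto
      have "\<exists>n. z \<in> A n" for z
      proof -
        obtain n where "1 / p 1 x0 z \<le> real n" using real_arch_simple by blast
        then have "1 \<le> real (Suc n) * p 1 x0 z" using p_pos[of 1 x0 z] by (simp add: field_simps add_increasing)
        then have "ennreal 1 \<le> ennreal (real (Suc n) * p 1 x0 z)" by (rule ennreal_leI)
        also have "\<dots> = of_nat (Suc n) * ennreal (p 1 x0 z)"
          using p_pos[of 1 x0 z] by (simp only: ennreal_mult[OF of_nat_0_le_iff less_imp_le] ennreal_of_nat_eq_real_of_nat)
        finally show ?thesis by (auto simp: A_def sp)
      qed
      then show "\<Union> (range A) = space M" using sp by auto
      show "\<forall>a\<in>range A. emeasure M a \<noteq> \<infinity>"
      proof safe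
        fix n assume inf: "emeasure M (A n) = \<infinity>"
        have "emeasure M (A n) \<le> of_nat (Suc n) * (\<integral>\<^sup>+ z. ennreal (p 1 x0 z) * indicator (space M) z \<partial>M)"
          unfolding A_def using nn_integral_Markov_inequality[of "\<lambda>z. ennreal (p 1 x0 z)" "space M" M "of_nat (Suc n)"] by simp
        also have "\<dots> \<le> of_nat (Suc n) * 1" using sub[of 1 x0] by (intro mult_left_mono) (auto simp: sp)
        also have "\<dots> < \<infinity>" by (simp add: ennreal_of_nat_eq_real_of_nat)
        finally show False using inf by simp
      qed
    qed simp
    show "space M = UNIV" by (rule sp)
    show "(\<lambda>(s, x, y). hk p s x y) \<in> borel_measurable (borel \<Otimes>\<^sub>M M \<Otimes>\<^sub>M M)" by (rule hk_measurable)
    show "hk p s x y = 0" if "s \<le> 0" for s x y using that by (simp add: hk_def)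
    show "(\<integral>\<^sup>+ z. hk p s x z * hk p r z y \<partial>M) = hk p (s + r) x y" if sr: "0 < s" "0 < r" for s r x y
    proof -
      have "ennreal (p s x z * p r z y) = ennreal (p s x z) * ennreal (p r z y)" for z
        using p_pos[OF sr(1), of x z] by (simp add: ennreal_mult' less_imp_le)
      then show ?thesis using ck[OF sr, of x y] sr by (simp add: hk_def)
    qed
    show "hk p s x y = hk p s y x" for s x y using sym[of s x y] by (simp add: hk_def)
    show "(\<integral>\<^sup>+ y. hk p s x y \<partial>M) \<le> 1" for s x using sub[of s x] by (cases "0 < s") (simp_all add: hk_def)
    show "hk p s x y < \<infinity>" for s x y by (simp add: hk_def)
  qed
qed

interpretation heat_kernel M "hk p" by (rule hk_heat_kernel)

lemma heat_op_eq_kop: "0 < s \<Longrightarrow> heat_op M p s f = kop (hk p s) f"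
proof -
  assume s: "0 < s"
  show ?thesis using s p_pos by (simp add: fun_eq_iff heat_op_def kop_def hk_def less_imp_le)
qed

lemma hk_heat_semigroup: "heat_semigroup M (hk p)"
proof
  fix f assume f: "f \<in> L2 M"
  have "((\<lambda>s. \<integral>\<^sup>+ x. ennreal ((cmod (heat_op M p s f x - f x))\<^sup>2) \<partial>M) \<longlongrightarrow> ennreal 0) (at_right 0)"
    using p f unfolding pos_heat_kernel_def by simp
  from tendsto_enn2real[OF this]
  have "((\<lambda>s. enn2real (\<integral>\<^sup>+ x. ennreal ((cmod (heat_op M p s f x - f x))\<^sup>2) \<partial>M)) \<longlongrightarrow> 0) (at_right 0)" by simp
  moreover have "\<forall>\<^sub>F s in at_right 0. enn2real (\<integral>\<^sup>+ x. ennreal ((cmod (heat_op M p s f x - f x))\<^sup>2) \<partial>M) =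
      L2_sqnorm M (\<lambda>x. kop (hk p s) f x - f x)"
    using eventually_at_right_less[of 0]
  proof eventually_elim
    case (elim s)
    have "(\<lambda>(x, y). hk p s x y) \<in> borel_measurable (M \<Otimes>\<^sub>M M)"
      using mkD[OF mk_P, of "\<lambda>_. s" "M \<Otimes>\<^sub>M M" fst snd] by (simp add: case_prod_beta')
    from kop_measurable[OF this L2_measurable[OF f]] have [measurable]: "kop (hk p s) f \<in> borel_measurable M" .
    note [measurable] = L2_measurable[OF f]
    show ?case unfolding heat_op_eq_kop[OF elim] L2_sqnorm_def
      by (rule integral_eq_nn_integral[symmetric]) auto
  qed
  ultimately show "((\<lambda>s. L2_sqnorm M (\<lambda>x. kop (hk p s) f x - f x)) \<longlongrightarrow> 0) (at_right 0)"
    by (rule Lim_transform_eventually)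
qed

interpretation heat_semigroup M "hk p" by (rule hk_heat_semigroup)

lemma semigroup_form_heat: "f \<in> L2 M \<Longrightarrow> semigroup_form M (heat_op M p) f = L2.frm (sgo (hk p)) f"
  by (rule semigroup_form_eq_frm) (auto simp: heat_op_eq_kop sgo_def intro: kop_L2(1)[OF P_L2bd])

lemma schroedinger_if_form_semigroup:
  assumes w: "continuous_on UNIV w" and Mp: "in_Mp M p (\<lambda>x. max (- w x) 0)"
    and T: "form_semigroup M (DomQw M p w) (Qw M p w) T"
  shows "\<exists>C0. schroedinger M (hk p) w C0 (\<lambda>s. if s = 0 then (\<lambda>f. f) else T s)"
proof -
  \<comment> \<open>The relative bound is taken with coefficient 1, which already keeps all the form
    sums bounded below.\<close>
  obtain C where C: "\<And>f. f \<in> DomQp M p \<Longrightarrow> (\<integral>\<^sup>+ x. ennreal (\<bar>max (- w x) 0\<bar> * (cmod (f x))\<^sup>2) \<partial>M) < \<infinity> \<and>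
      enn2real (\<integral>\<^sup>+ x. ennreal (\<bar>max (- w x) 0\<bar> * (cmod (f x))\<^sup>2) \<partial>M) \<le> 1 * Qp M p f + C * L2_sqnorm M f"
    using Mp[unfolded in_Mp_def, rule_format, of 1] by auto
  let ?T = "\<lambda>s. if s = 0 then (\<lambda>f. f) else T s"
  have Tin: "T s f \<in> L2 M" if "0 < s" "f \<in> L2 M" for s f
    by (rule T[unfolded form_semigroup_def, THEN conjunct1, rule_format, OF that])
  have Tbd: "\<exists>C. \<forall>f\<in>L2 M. L2_sqnorm M (T s f) \<le> C * L2_sqnorm M f" if "0 < s" for s
    using T that unfolding form_semigroup_def by blast
  have Tsym: "L2_inner M f (T s g) = L2_inner M (T s f) g" if "0 < s" "f \<in> L2 M" "g \<in> L2 M" for s f g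
    using T that unfolding form_semigroup_def by blast
  have Tadd: "AE x in M. T (s + r) f x = T s (T r f) x" if "0 < s" "0 < r" "f \<in> L2 M" for s r f
    using T that unfolding form_semigroup_def by blast
  have Tcont: "((\<lambda>s. L2_sqnorm M (\<lambda>x. T s f x - f x)) \<longlongrightarrow> 0) (at_right 0)" if "f \<in> L2 M" for f
    using T that unfolding form_semigroup_def by blast
  have Tform: "semigroup_form M T f = (if f \<in> DomQw M p w then ereal (Qw M p w f) else \<infinity>)" if "f \<in> L2 M" for f
    using T that unfolding form_semigroup_def by blast
  have sg: "L2.sg ?T"
    unfolding L2.sg_def
  proof (intro conjI allI impI ballI)
    fix f s assume f: "f \<in> L2 M"
    show "?T 0 f = f" by simp
    show "((\<lambda>s. L2.nd (?T s f) f) \<longlongrightarrow> 0) (at_right 0)"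
    proof (rule Lim_transform_eventually[OF Tcont[OF f]])
      show "\<forall>\<^sub>F s in at_right 0. L2_sqnorm M (\<lambda>x. T s f x - f x) = L2.nd (?T s f) f"
        using eventually_at_right_less[of 0] by eventually_elim (simp add: nd_L2 Tin f)
    qed
    fix s :: real assume s: "0 \<le> s"
    show "?T s f \<in> L2 M" using Tin[of s f] f s by auto
    fix g assume g: "g \<in> L2 M"
    show "ip M f (?T s g) = ip M (?T s f) g" using Tsym[of s f g] f g s by (auto simp: ip_def)
  next
    fix s :: real assume s: "0 \<le> s"
    show "\<exists>C. \<forall>f\<in>L2 M. ip M (?T s f) (?T s f) \<le> C * ip M f f"
    proof (cases "s = 0")
      case True
      then show ?thesis by (intro exI[of _ 1]) simp
    next
      case False
      then show ?thesis using Tbd[of s] s by (simp add: ip_self)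
    qed
  next
    fix s r :: real and f g assume sr: "0 \<le> s" "0 \<le> r" and f: "f \<in> L2 M" and g: "g \<in> L2 M"
    show "ip M (?T (s + r) f) g = ip M (?T s (?T r f)) g"
    proof (cases "s = 0 \<or> r = 0")
      case False
      then have sr': "0 < s" "0 < r" using sr by auto
      have "ip M (T (s + r) f) g = ip M (T s (T r f)) g"
        by (rule ip_cong_AE[OF Tadd[OF sr' f]]) (use sr' f g in \<open>auto intro!: L2_measurable Tin\<close>)
      then show ?thesis using sr' by simp
    qed auto
  qed
  have Dom: "f \<in> DomQp M p \<longleftrightarrow> L2.frm (sgo (hk p)) f < \<infinity>" if "f \<in> L2 M" for f
    using semigroup_form_heat[OF that] that by (simp add: DomQp_def)
  have Qp: "Qp M p f = real_of_ereal (L2.frm (sgo (hk p)) f)" if "f \<in> L2 M" for f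
    using semigroup_form_heat[OF that] by (simp add: Qp_def)
  \<comment> \<open>The constant of the relative bound may come out negative, while the growth
    estimates use a nonnegative one.\<close>
  have "schroedinger M (hk p) w (max C 0) ?T"
  proof
    show "w \<in> borel_measurable M"
      using borel_measurable_continuous_onI[OF w] measurable_cong_sets[OF sets_M refl] by blast
    show "0 \<le> max C 0" by simp
    show "L2.sg ?T" by (rule sg)
  next
    fix f q assume f: "f \<in> L2 M" and q: "L2.frm (sgo (hk p)) f = ereal q"
    let ?I = "\<integral>\<^sup>+ x. ennreal (max (- w x) 0 * (cmod (f x))\<^sup>2) \<partial>M"
    have "?I < \<infinity> \<and> enn2real ?I \<le> q + C * L2_sqnorm M f"
      using C[of f] f q by (simp add: Dom Qp)
    moreover have "C * L2_sqnorm M f \<le> max C 0 * L2_sqnorm M f"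
      by (intro mult_right_mono) (auto simp: L2_sqnorm_def)
    ultimately have "?I < \<infinity>" "enn2real ?I \<le> q + max C 0 * L2_sqnorm M f" by auto
    then show "?I \<le> ennreal (q + max C 0 * L2_sqnorm M f)" by (cases ?I) (auto intro: ennreal_leI)
  next
    fix f assume f: "f \<in> L2 M"
    have "L2.frm ?T f = semigroup_form M T f"
      by (rule semigroup_form_eq_frm[symmetric]) (use Tin f in auto)
    also have "\<dots> = (if f \<in> DomQw M p w then ereal (Qw M p w f) else \<infinity>)" by (rule Tform[OF f])
    also have "\<dots> = (if L2.frm (sgo (hk p)) f < \<infinity> \<and> (\<integral>\<^sup>+ x. ennreal (\<bar>w x\<bar> * (cmod (f x))\<^sup>2) \<partial>M) < \<infinity>
       then L2.frm (sgo (hk p)) f + ereal (\<integral>x. w x * (cmod (f x))\<^sup>2 \<partial>M) else \<infinity>)"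
    proof (cases "L2.frm (sgo (hk p)) f")
      case (real q)
      then show ?thesis using f by (simp add: DomQw_def Dom Qw_def Qp)
    next
      case MInf
      then show ?thesis using L2.frm_ne_minus_inf by blast
    qed (use f in \<open>simp add: DomQw_def Dom\<close>)
    finally show "L2.frm ?T f = (if L2.frm (sgo (hk p)) f < \<infinity> \<and> (\<integral>\<^sup>+ x. ennreal (\<bar>w x\<bar> * (cmod (f x))\<^sup>2) \<partial>M) < \<infinity>
       then L2.frm (sgo (hk p)) f + ereal (\<integral>x. w x * (cmod (f x))\<^sup>2 \<partial>M) else \<infinity>)" .
  qed
  then show ?thesis by blast
qed

lemma fidi_eq_path_fid:
  assumes "sorted_wrt (<) ts" "\<And>u. u \<in> set ts \<Longrightarrow> s < u \<and> u < t" "s < t"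
  shows "fidi M p s x (zip (ts @ [t]) (map A ts @ [UNIV])) =
    path_fid M (hk p) A s ts (\<lambda>r y. \<integral>\<^sup>+ z. hk p (t - r) y z \<partial>M) x"
  using assms
proof (induction ts arbitrary: s x)
  case Nil
  then show ?case by (simp add: hk_def)
next
  case (Cons u us)
  have "fidi M p u y (zip (us @ [t]) (map A us @ [UNIV])) =
    path_fid M (hk p) A u us (\<lambda>r y. \<integral>\<^sup>+ z. hk p (t - r) y z \<partial>M) y" for y
    using Cons.prems by (intro Cons.IH) auto
  moreover have "hk p (u - s) x y = ennreal (p (u - s) x y)" for y using Cons.prems by (simp add: hk_def)
  ultimately show ?case by simp
qed

lemma bridge_if_pinned:
  assumes t: "0 < t" and W: "wiener_measure M p t x W" and Pin: "pinned_wiener_measure M p t x x W Pin"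
  shows "bridge M (hk p) t x W Pin"
proof
  show "sets M = sets borel" by (rule sets_M)
  show "0 < t" by (rule t)
  show "0 < hk p s y z" if "0 < s" for s y z using p_pos[OF that] that by (simp add: hk_def)
  show "sets W = sets (path_filtration t t)" "emeasure W (space W) \<le> 1"
    using W by (auto simp: wiener_measure_def)
  show "sets Pin = sets (path_filtration_minus t)" "emeasure Pin (space Pin) = 1"
    using Pin by (auto simp: pinned_wiener_measure_def)
next
  fix ts and A :: "real \<Rightarrow> 'a set"
  assume ts: "sorted_wrt (<) ts" "\<And>u. u \<in> set ts \<Longrightarrow> 0 < u \<and> u < t" and A: "\<And>u. A u \<in> sets borel"
  \<comment> \<open>The prescribed distributions always include the terminal time; the set
    \<open>UNIV\<close> there imposes no condition, and its coordinate is integrated out.\<close>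
  let ?ts = "ts @ [t]" and ?As = "map A ts @ [UNIV]"
  have "emeasure W {\<gamma> \<in> cadlag_paths t. \<forall>i<length ?ts. \<gamma> (?ts ! i) \<in> ?As ! i} = fidi M p 0 x (zip ?ts ?As)"
  proof (rule W[unfolded wiener_measure_def, THEN conjunct2, THEN conjunct2, rule_format])
    have "0 < hd ?ts" using ts(2) t by (cases ts) auto
    then show "1 \<le> length ?ts \<and> length ?As = length ?ts \<and> sorted_wrt (<) ?ts \<and>
        0 < hd ?ts \<and> last ?ts = t \<and> (\<forall>A\<in>set ?As. A \<in> sets borel)"
      using ts A by (auto simp: sorted_wrt_append)
  qed
  moreover have "(\<forall>i<length ?ts. \<gamma> (?ts ! i) \<in> ?As ! i) \<longleftrightarrow> (\<forall>u\<in>set ts. \<gamma> u \<in> A u)" for \<gamma> :: "real \<Rightarrow> 'a"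
  proof -
    have "(\<forall>i<length ?ts. \<gamma> (?ts ! i) \<in> ?As ! i) \<longleftrightarrow> (\<forall>i<length ts. \<gamma> (ts ! i) \<in> A (ts ! i))"
      by (auto simp: nth_append less_Suc_eq)
    then show ?thesis by (simp add: all_set_conv_all_nth)
  qed
  moreover have "fidi M p 0 x (zip ?ts ?As) = path_fid M (hk p) A 0 ts (\<lambda>r y. \<integral>\<^sup>+ z. hk p (t - r) y z \<partial>M) x"
    by (rule fidi_eq_path_fid[OF ts t])
  ultimately show "emeasure W {\<gamma> \<in> cadlag_paths t. \<forall>u\<in>set ts. \<gamma> u \<in> A u} =
    path_fid M (hk p) A 0 ts (\<lambda>r y. \<integral>\<^sup>+ z. hk p (t - r) y z \<partial>M) x" by (simp only:)
next
  fix s and A :: "(real \<Rightarrow> 'a) set" assume s: "0 < s" "s < t" and A: "A \<in> sets (path_filtration t s)"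
  have pos: "0 < p t x x" by (rule p_pos[OF t])
  have e: "emeasure Pin A = ennreal (1 / p t x x) * (\<integral>\<^sup>+ \<gamma>\<in>A. ennreal (p (t - s) (\<gamma> s) x) \<partial>W)"
    using Pin s A unfolding pinned_wiener_measure_def by simp
  have "hk p t x x * ennreal (1 / p t x x) = 1"
    using pos t by (simp add: hk_def ennreal_mult'[symmetric])
  then have "hk p t x x * emeasure Pin A = (\<integral>\<^sup>+ \<gamma>\<in>A. ennreal (p (t - s) (\<gamma> s) x) \<partial>W)"
    unfolding e by (simp only: mult.assoc[symmetric] mult_1)
  then show "hk p t x x * emeasure Pin A = (\<integral>\<^sup>+ \<gamma>. hk p (t - s) (\<gamma> s) x * indicator A \<gamma> \<partial>W)"
    using s by (simp add: hk_def)
qed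

end

theorem theorem3p1:
  fixes M :: "'a::{metric_space, second_countable_topology} measure"
    and p :: "real \<Rightarrow> 'a \<Rightarrow> 'a \<Rightarrow> real"
    and w :: "'a \<Rightarrow> real"
    and t :: real
    and T :: "real \<Rightarrow> ('a \<Rightarrow> complex) \<Rightarrow> ('a \<Rightarrow> complex)"
    and W :: "'a \<Rightarrow> (real \<Rightarrow> 'a) measure"
    and Pin :: "'a \<Rightarrow> (real \<Rightarrow> 'a) measure"
  assumes "locally_compact_space (euclidean :: 'a topology)"
    and "radon_full_support M"
    and "pos_heat_kernel M p"
    and "regular_kernel M p"
    and "continuous_on UNIV w"
    and "in_Mp M p (\<lambda>x. max (- w x) 0)"
    and "t > 0"
    and "form_semigroup M (DomQw M p w) (Qw M p w) T"
    and "\<And>x. wiener_measure M p t x (W x)"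
    and "\<And>x. pinned_wiener_measure M p t x x (W x) (Pin x)"
  shows "pos_trace M (T t) =
    (\<integral>\<^sup>+ x. ennreal (p t x x) *
        (\<integral>\<^sup>+ \<gamma>. ennreal (exp (- integral {0..t} (\<lambda>s. w (\<gamma> s)))) \<partial>(Pin x)) \<partial>M)"
proof -
  have sets_M: "sets M = sets borel" using assms(2) by (simp add: radon_full_support_def)
  \<comment> \<open>\<open>form_semigroup\<close> leaves time 0 open, while \<open>sg\<close>
    requires the identity there.\<close>
  define T' where "T' = (\<lambda>s. if s = 0 then (\<lambda>f. f) else T s)"
  obtain C0 where S: "schroedinger M (hk p) w C0 T'"
    using schroedinger_if_form_semigroup[OF sets_M assms(3,5,6,8)] unfolding T'_def by blast
  interpret schroedinger M "hk p" w C0 T' by (rule S)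
  obtain \<B> :: "'a set set" where \<B>: "countable \<B>" "topological_basis \<B>" using ex_countable_basis by blast
  \<comment> \<open>The empty set is added to have an evidently nonempty countable family to
    enumerate; as an open set it does no harm to the unions.\<close>
  define C where "C i = from_nat_into (insert {} \<B>) i" for i :: nat
  have rC: "range C = insert {} \<B>"
    unfolding C_def[abs_def] by (rule range_from_nat_into) (use \<B> in auto)
  interpret regular_schroedinger M "hk p" w C0 T' C
  proof
    show "sets M = sets borel" by (rule sets_M)
    show "emeasure M A = (INF U\<in>{U. open U \<and> A \<subseteq> U}. emeasure M U)" if "A \<in> sets borel" for A
      using assms(2) that by (simp add: radon_full_support_def)
    show "open (C i)" for i
      using rC topological_basis_open[OF \<B>(2)] by (metis insert_iff open_empty rangeI)
    show "\<exists>I. U = (\<Union>i\<in>I. C i)" if U: "open U" for U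
    proof -
      obtain \<B>' where B': "\<B>' \<subseteq> \<B>" "\<Union>\<B>' = U" using \<B>(2)[unfolded topological_basis_def, THEN conjunct2, rule_format, OF U] by blast
      have "\<B>' = C ` (C -` \<B>')" using B'(1) rC by (subst image_vimage_eq) auto
      then show ?thesis using B'(2) by metis
    qed
  qed
  have "kk t x x = ennreal (p t x x) * (\<integral>\<^sup>+ \<gamma>. ennreal (exp (- integral {0..t} (\<lambda>s. w (\<gamma> s)))) \<partial>(Pin x))" for x
  proof -
    interpret b: bridge M "hk p" t x "W x" "Pin x"
      by (rule bridge_if_pinned[OF sets_M assms(3,7,9,10)])
    interpret schroedinger_bridge M "hk p" w C0 T' t x "W x" "Pin x" by standard (rule assms(5))
    show ?thesis using kk_diagonal assms(7) by (simp add: hk_def)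
  qed
  moreover have "T' t = T t" using assms(7) by (simp add: T'_def)
  ultimately show ?thesis using trace_eq_diagonal[OF assms(7)] by simp
qed

end
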